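(* Let $V(4)$ be the set of primes $p\equiv 1\pmod 4$ such that $16$ divides $h(-4p)=\#\mathrm{Cl}(\mathbb{Z}[\sqrt{-p}])$. Then $$V(4)=\left\{p\text{ prime}: p\equiv 1\pmod 8 \text{ and } \left(\frac{1+i}{p}\right)=\left(\frac{\alpha\delta_p}{\mathfrak{p}_p}\right)=1\right\},$$ where $K_1=\mathbb{Q}(\alpha)=\mathbb{Q}(\sqrt{1+i})$ with $\alpha^4-2\alpha^2+2=0$ and $i=\alpha^2-1$, $\delta_p\in K_1$ is an algebraic integer with $\mathrm{Norm}_{K_1/\mathbb{Q}(i)}(\delta_p)=p$, and $\mathfrak{p}_p$ is a prime of $K_1$ above $p$ with $\delta_p\notin\mathfrak{p}_p$.
   Context: For a prime $p\equiv 1\pmod 4$, $h(-4p)$ is the order of the ideal class group of $\mathbb{Z}[\sqrt{-p}]$, which is the ring of integers of $\mathbb{Q}(\sqrt{-p})$. For a prime ideal $\mathfrak{p}$ of the ring of integers $\mathcal{O}_K$ of a number field $K$ and $a\in\mathcal{O}_K$, $\left(\frac{a}{\mathfrak{p}}\right)\in\{0,\pm1\}$ is the quadratic character of the image of $a$ in $\mathcal{O}_K/\mathfrak{p}$ (equal to $0$ if $a\in\mathfrak{p}$). If $p\equiv 1\pmod 8$, then $\left(\frac{1+i}{p}\right)$ denotes the Legendre symbol modulo $p$ of $1+i$, where $i$ is interpreted as a square root of $-1$ in $\mathbb{F}_p$; the value does not depend on the choice of square root. The primes $p\equiv 1\pmod 8$ with $\left(\frac{1+i}{p}\right)=1$ are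 exactly the primes that split completely in $K_1$. For such $p$ one chooses $\delta_p$ and $\mathfrak{p}_p$ as in the claim, and the symbol $\left(\frac{\alpha\delta_p}{\mathfrak{p}_p}\right)$ does not depend on the choices of $\delta_p$ and $\mathfrak{p}_p$. The second symbol is considered only when the first equals $1$. *)

theory Defs
  imports
    "HOL-Algebra.Algebraic_Closure_Type"
    "HOL-Algebra.Generated_Fields"
    "HOL-Algebra.Ideal_Product"
    "HOL-Library.FuncSet"
    "HOL-Number_Theory.Number_Theory"
begin

text \<open>Number fields and their subrings are subsets of the complex numbers, with the
  operations of the ring \<open>\<C>\<close>.\<close>

abbreviation CC :: "complex ring" where
  "CC \<equiv> ring_of_type_algebra"

abbreviation CC_on :: "complex set \<Rightarrow> complex ring" where
  "CC_on A \<equiv> CC\<lparr>carrier := A\<rparr>"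

definition ring_of_integers :: "complex set \<Rightarrow> complex ring" where
  "ring_of_integers K = CC_on {x \<in> K. algebraic_int x}"

text \<open>In the following definitions \<open>A\<close> is a subring of the complex numbers. A fractional
  ideal is a subset of the fraction field of \<open>A\<close>, because it has a common denominator.\<close>

definition fractional_ideal :: "complex set \<Rightarrow> complex set \<Rightarrow> bool" where
  "fractional_ideal A I \<longleftrightarrow>
     subgroup I (add_monoid CC) \<and> I \<noteq> {0} \<and>
     (\<forall>r\<in>A. \<forall>x\<in>I. r * x \<in> I) \<and>
     (\<exists>d\<in>A. d \<noteq> 0 \<and> (\<forall>x\<in>I. d * x \<in> A))"

definition ideal_group :: "complex set \<Rightarrow> complex set monoid" where
  "ideal_group A =
     \<lparr>carrier = {I. fractional_ideal A I \<and>
                    (\<exists>J. fractional_ideal A J \<and> ideal_prod CC I J = A)},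
      monoid.mult = ideal_prod CC,
      one = A\<rparr>"

definition principal_ideals :: "complex set \<Rightarrow> complex set set" where
  "principal_ideals A = {(\<lambda>r. c * r) ` A | c. c \<in> generate_field CC A \<and> c \<noteq> 0}"

definition class_group :: "complex set \<Rightarrow> complex set set monoid" where
  "class_group A = ideal_group A Mod principal_ideals A"

text \<open>For primes \<open>p \<equiv> 1\<close> modulo \<open>4\<close> the ring \<open>\<int>[\<surd>-p]\<close> is
  the maximal order of discriminant \<open>-4p\<close>, and all its nonzero fractional ideals are invertible.\<close>

definition h_minus_4 :: "nat \<Rightarrow> nat" where
  "h_minus_4 p = Coset.order (class_group (generate_ring CC {csqrt (- of_nat p)}))"

definition V4 :: "nat set" where
  "V4 = {p. prime p \<and> [p = 1] (mod 4) \<and> 16 dvd h_minus_4 p}"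

text \<open>The embeddings of \<open>L\<close> into the complex numbers that fix \<open>K\<close> pointwise. They are made
  extensional so that each embedding is represented by exactly one function.\<close>

definition embeddings :: "complex set \<Rightarrow> complex set \<Rightarrow> (complex \<Rightarrow> complex) set" where
  "embeddings L K =
     {\<sigma> \<in> ring_hom (CC_on L) CC. \<sigma> \<in> extensional L \<and> (\<forall>x\<in>K. \<sigma> x = x)}"

definition field_norm :: "complex set \<Rightarrow> complex set \<Rightarrow> complex \<Rightarrow> complex" where
  "field_norm L K x = (\<Prod>\<sigma>\<in>embeddings L K. \<sigma> x)"

definition quadratic_character :: "('a, 'b) ring_scheme \<Rightarrow> 'a \<Rightarrow> 'a set \<Rightarrow> int" where
  "quadratic_character R a P =
     (if a \<in> P then 0
      else if \<exists>y \<in> carrier (R Quot P). y \<otimes>\<^bsub>R Quot P\<^esub> y = P +>\<^bsub>R\<^esub> a then 1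
      else - 1)"

text \<open>Here \<open>\<alpha>\<close> is any complex root of \<open>X\<^sup>4 - 2X\<^sup>2 + 2\<close>; then \<open>\<alpha>\<^sup>2 - 1\<close> is a square root
  of \<open>-1\<close>, possibly \<open>-\<i>\<close>.\<close>

abbreviation K1 :: "complex \<Rightarrow> complex set" where
  "K1 \<alpha> \<equiv> generate_field CC {\<alpha>}"

abbreviation Qi :: "complex \<Rightarrow> complex set" where
  "Qi \<alpha> \<equiv> generate_field CC {\<alpha>\<^sup>2 - 1}"

definition admissible :: "complex \<Rightarrow> nat \<Rightarrow> complex \<Rightarrow> complex set \<Rightarrow> bool" where
  "admissible \<alpha> p \<delta> P \<longleftrightarrow>
     \<delta> \<in> K1 \<alpha> \<and> algebraic_int \<delta> \<and> field_norm (K1 \<alpha>) (Qi \<alpha>) \<delta> = of_nat p \<and>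
     primeideal P (ring_of_integers (K1 \<alpha>)) \<and> of_nat p \<in> P \<and> \<delta> \<notin> P"

end

theory Submission
  imports Defs "HOL-Algebra.Sylow"
begin

text \<open>Let \<open>A = \<int>[\<surd>-p]\<close> for a prime \<open>p \<equiv> 1 (mod 4)\<close>, let \<open>G\<close> be its class group and \<open>t\<close> the class of
the prime ideal \<open>(2, 1 + \<surd>-p)\<close>. The proof is elementary: it compares ideal classes of \<open>A\<close> with Legendre
symbols, and then recognises the resulting symbol in \<open>K\<^sub>1\<close>.

\<^bold>\<open>The class group.\<close> A class of order two contains an ideal that is stable under complex conjugation,
and such an ideal is, up to a rational factor, one of four ideals of norm \<open>1\<close>, \<open>2\<close>, \<open>p\<close>, \<open>2p\<close>. So \<open>t\<close> is the
only involution of \<open>G\<close> (\<open>involution_class\<close>), and hence \<open>16\<close> divides the class number if and only if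
\<open>t\<close> is an eighth power (\<open>two_power_dvd_order_iff\<close>). The class of an ideal of norm \<open>n\<close> prime to \<open>p\<close> is
a square if and only if \<open>(n/p) = 1\<close>: the nontrivial direction solves the conic
\<open>U\<^sup>2 + pW\<^sup>2 = nZ\<^sup>2\<close> to reduce to fractional ideals of norm \<open>1\<close>, whose classes are squares (\<open>conic_solvable\<close>,
\<open>square_class_if_residue\<close>).

\<^bold>\<open>The bridge.\<close> If a Gaussian integer \<open>j\<close> satisfies \<open>\<bar>j\<bar>\<^sup>2 = u\<^sup>2 + pv\<^sup>2\<close> with \<open>u\<close>, \<open>v\<close> essentially coprime,
then its image under \<open>\<int>[i] \<rightarrow> \<int>/p\<close> is a square (\<open>Legendre_common_norm\<close>). Suppose \<open>t = g\<^sup>8\<close>. Then \<open>2\<close>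
is the norm of an ideal of square class, so \<open>(2/p) = 1\<close> and \<open>p \<equiv> 1 (mod 8)\<close>. For an ideal \<open>F\<close> of norm
\<open>f\<close> in the class of \<open>g\<^sup>-\<^sup>2\<close> the ideal \<open>(2, 1 + \<surd>-p) F\<^sup>4\<close> is principal, so
\<open>\<bar>(1 + i) f\<^sup>2\<bar>\<^sup>2 = 2f\<^sup>4\<close> has the form \<open>u\<^sup>2 + pv\<^sup>2\<close>, and the bridge gives \<open>((1 + i)/p) = 1\<close>
(\<open>eighth_power_imp_residues\<close>).

\<^bold>\<open>The last step.\<close> Write \<open>\<delta> = a + b\<alpha>\<close> with \<open>a\<close>, \<open>b\<close> in \<open>\<int>[i]\<close>; its norm being \<open>p\<close> means
\<open>a\<^sup>2 - (1 + i) b\<^sup>2 = p\<close>. Taking absolute values of \<open>a\<^sup>2 - p = (1 + i) b\<^sup>2\<close> gives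
\<open>(\<bar>a\<bar>\<^sup>2 - p)\<^sup>2 + p (2 Im a)\<^sup>2 = 2\<bar>b\<bar>\<^sup>4\<close>. After common factors are removed
(\<open>quartic_norm_reduction\<close>) this is \<open>x\<^sup>2 + py\<^sup>2 = 2n\<^sup>2\<close>, which exhibits an ideal \<open>N\<close> of norm \<open>n\<close> with
\<open>N\<^sup>2 (2, 1 + \<surd>-p)\<close> principal (\<open>class_of_norm_equation\<close>). Since \<open>n \<equiv> 1 (mod 4)\<close>, the class of \<open>N\<close> is a
square, say \<open>D\<^sup>-\<^sup>2\<close>, so that \<open>t = D\<^sup>4\<close>; thus \<open>t\<close> is an eighth power if and only if \<open>D\<close> is a square,
that is, if and only if \<open>(z/p) = 1\<close> for the norm \<open>z\<close> of an ideal in \<open>D\<close>. A generator of the product of \<open>N\<close>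
with the square of this ideal shows that \<open>\<bar>bz\<bar>\<^sup>2\<close> is, up to harmless factors, of the form
\<open>u\<^sup>2 + pv\<^sup>2\<close>, and the bridge turns \<open>(z/p)\<close> into \<open>(b/p)\<close> (\<open>sixteen_dvd_iff_Legendre\<close>).

\<^bold>\<open>The quartic field.\<close> The integers of \<open>K\<^sub>1\<close> are \<open>\<int>[i] + \<int>[i]\<alpha>\<close> (\<open>ring_of_integers_K1\<close>). Modulo a prime above
\<open>p\<close> they become \<open>\<int>/p\<close>, with \<open>i\<close> and \<open>\<alpha>\<close> mapping to \<open>\<iota>\<close> and \<open>s\<close>, where \<open>s\<^sup>2 = 1 + \<iota>\<close>.
If \<open>\<delta> = a + b\<alpha>\<close> has norm \<open>p\<close> and a nonzero image, then the image of its conjugate \<open>a - b\<alpha>\<close> is \<open>0\<close>, so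
\<open>a \<equiv> sb\<close>, and \<open>\<alpha>\<delta> \<equiv> s (a + sb) \<equiv> 2 (1 + \<iota>) b\<close>. As \<open>2\<close> and \<open>1 + \<iota>\<close> are squares modulo \<open>p\<close>,
the symbol of \<open>\<alpha>\<delta>\<close> is \<open>(b/p)\<close> (\<open>admissible_criterion\<close>). An element \<open>\<delta>\<close> exists because the box principle gives a
relative norm \<open>pm\<close> with a small \<open>m\<close> in \<open>\<int>[i]\<close>, and \<open>m\<close> can be divided away prime by prime
(\<open>scaled_norm_small_imp_one\<close>).\<close>

section \<open>Legendre symbols\<close>

lemma Legendre_eq_0_iff: "Legendre a p = 0 \<longleftrightarrow> p dvd a"
  by (auto simp: Legendre_def cong_0_iff)

lemma Legendre_cases: "Legendre a p = 0 \<or> Legendre a p = 1 \<or> Legendre a p = -1"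
  by (auto simp: Legendre_def)

lemma Legendre_cong:
  assumes "[a = b] (mod p)" shows "Legendre a p = Legendre b p"
proof -
  have "QuadRes p a = QuadRes p b"
    using assms unfolding QuadRes_def by (meson cong_sym cong_trans)
  moreover have "[a = 0] (mod p) \<longleftrightarrow> [b = 0] (mod p)"
    using assms by (meson cong_sym cong_trans)
  ultimately show ?thesis by (simp add: Legendre_def)
qed

lemma Legendre_eq_1I:
  assumes "[y\<^sup>2 = a] (mod p)" "\<not> p dvd a" shows "Legendre a p = 1"
  using assms by (auto simp: Legendre_def QuadRes_def cong_0_iff)

lemma Legendre_eq_1D:
  assumes "Legendre a p = 1" obtains y where "[y\<^sup>2 = a] (mod p)" "\<not> p dvd a"
  using assms by (auto simp: Legendre_def QuadRes_def cong_0_iff split: if_splits)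

locale odd_prime =
  fixes p :: nat
  assumes prime_p: "prime p" and gt2: "p > 2"
begin

lemma prime_int: "prime (int p)"
  using prime_p by simp

lemma Legendre_mult: "Legendre (a * b) p = Legendre a p * Legendre b p"
proof -
  have "[Legendre (a * b) p = (a * b) ^ ((p - 1) div 2)] (mod p)"
    by (rule euler_criterion[OF prime_p gt2])
  moreover have "[Legendre a p * Legendre b p = a ^ ((p - 1) div 2) * b ^ ((p - 1) div 2)] (mod p)"
    by (intro cong_mult euler_criterion prime_p gt2)
  ultimately have "[Legendre (a * b) p = Legendre a p * Legendre b p] (mod p)"
    by (metis cong_sym cong_trans power_mult_distrib)
  hence d: "int p dvd Legendre (a * b) p - Legendre a p * Legendre b p"
    by (simp add: cong_iff_dvd_diff)
  have "\<bar>Legendre (a * b) p - Legendre a p * Legendre b p\<bar> \<le> 2"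
    using Legendre_cases[of "a*b" p] Legendre_cases[of a p] Legendre_cases[of b p] by auto
  thus ?thesis using d gt2 zdvd_imp_le[of "int p" "\<bar>Legendre (a * b) p - Legendre a p * Legendre b p\<bar>"]
    by (cases "Legendre (a * b) p - Legendre a p * Legendre b p = 0") auto
qed

lemma Legendre_square: "\<not> int p dvd a \<Longrightarrow> Legendre (a\<^sup>2) p = 1"
  using prime_int by (intro Legendre_eq_1I[of a]) (auto simp: prime_dvd_power_iff)

lemma Legendre_minus_one: "Legendre (-1) p = (if p mod 4 = 1 then 1 else -1)"
proof -
  have "odd p" using prime_p gt2 prime_odd_nat by blast
  have "[Legendre (-1) p = (-1) ^ ((p - 1) div 2)] (mod p)"
    by (rule euler_criterion[OF prime_p gt2])
  moreover have "(-1::int) ^ ((p - 1) div 2) = (if p mod 4 = 1 then 1 else -1)"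
  proof (cases "p mod 4 = 1")
    case True
    hence "even ((p - 1) div 2)" by presburger
    thus ?thesis using True by simp
  next
    case False
    hence "odd ((p - 1) div 2)" using \<open>odd p\<close> gt2 by presburger
    thus ?thesis using False by simp
  qed
  ultimately have "int p dvd Legendre (-1) p - (if p mod 4 = 1 then 1 else -1)"
    by (simp add: cong_iff_dvd_diff)
  thus ?thesis using Legendre_cases[of "-1" p] gt2
      zdvd_imp_le[of "int p" 1] zdvd_imp_le[of "int p" 2]
    by (auto split: if_splits)
qed

end

locale prime_1_mod_4 = odd_prime +
  assumes mod4: "p mod 4 = 1"
begin

lemma Legendre_uminus: "Legendre (- a) p = Legendre a p"
  using Legendre_mult[of "-1" a] Legendre_minus_one mod4 by simp

lemma reciprocity:
  assumes "prime l" "odd l" "l \<noteq> p"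
  shows "Legendre (int l) p = Legendre p (int l)"
proof -
  have l2: "2 < l" using assms(1,2) prime_gt_1_nat[of l] by (cases "l = 2") auto
  have "even ((p - 1) div 2)" using mod4 by presburger
  hence "Legendre p l * Legendre l p = 1"
    using Quadratic_Reciprocity[OF prime_p gt2 assms(1) l2] assms(3) by simp
  thus ?thesis using Legendre_cases[of p l] Legendre_cases[of l p] by auto
qed

text \<open>With \<open>r\<^sup>2 = -1\<close> one has \<open>(1 + r)\<^sup>2 = 2r\<close>, so \<open>2\<close> and \<open>r\<close> have the same symbol, and Euler's criterion
evaluates that of \<open>r\<close>.\<close>

lemma Legendre_two: "Legendre 2 p = (if p mod 8 = 1 then 1 else -1)"
proof -
  have "Legendre (-1) p = 1" using Legendre_minus_one mod4 by simp
  then obtain r where r: "[r\<^sup>2 = -1] (mod int p)" using Legendre_eq_1D by metis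
  have nr: "\<not> int p dvd r"
  proof
    assume "int p dvd r"
    hence "int p dvd r\<^sup>2" by (simp add: power2_eq_square)
    hence "int p dvd -1" using cong_dvd_iff[OF r] by blast
    thus False using gt2 by simp
  qed
  have "[(1 + r)\<^sup>2 = 2 * r] (mod int p)"
    using cong_add[OF r cong_refl[of "1 + 2 * r"]] by (simp add: power2_eq_square algebra_simps)
  moreover have "\<not> int p dvd 2 * r"
    using nr prime_int gt2 by (auto simp: prime_dvd_mult_iff zdvd_not_zless)
  ultimately have "Legendre (2 * r) p = 1" by (rule Legendre_eq_1I)
  hence two: "Legendre 2 p = Legendre r p"
    using Legendre_mult[of 2 r] Legendre_cases[of 2 p] Legendre_cases[of r p] by auto
  obtain k where k: "p = 4 * k + 1" using mod4 by (metis mod_div_decomp mult.commute)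
  have "[Legendre r p = r ^ ((p - 1) div 2)] (mod p)"
    by (rule euler_criterion[OF prime_p gt2])
  also have "r ^ ((p - 1) div 2) = (r\<^sup>2) ^ k"
    by (simp add: k flip: power_mult)
  also have "[(r\<^sup>2) ^ k = (-1) ^ k] (mod p)"
    by (intro cong_pow r)
  finally have d: "int p dvd Legendre r p - (-1) ^ k"
    by (simp add: cong_iff_dvd_diff)
  have "\<bar>Legendre r p - (-1) ^ k\<bar> \<le> 2"
    using Legendre_cases[of r p] by (cases "even k") auto
  hence "Legendre r p = (-1) ^ k"
    using d gt2 zdvd_imp_le[of "int p" "\<bar>Legendre r p - (-1) ^ k\<bar>"]
    by (cases "Legendre r p - (-1) ^ k = 0") auto
  moreover have "p mod 8 = 1 \<longleftrightarrow> even k" unfolding k by presburger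
  ultimately show ?thesis using two by auto
qed

text \<open>The symbol is multiplicative, so only prime factors that occur to an odd power contribute.\<close>

lemma Legendre_eq_1_of_odd_multiplicity:
  assumes "Legendre 2 p = 1" "M \<noteq> 0" "\<not> int p dvd M"
    and "\<And>l. prime l \<Longrightarrow> odd l \<Longrightarrow> odd (multiplicity (int l) M) \<Longrightarrow> Legendre (int l) p = 1"
  shows "Legendre M p = 1"
  using assms(2-4)
proof (induction "nat \<bar>M\<bar>" arbitrary: M rule: less_induct)
  case less
  show ?case
  proof (cases "\<bar>M\<bar> = 1")
    case True
    hence "M = 1 \<or> M = -1" by auto
    moreover have "Legendre 1 p = 1" using gt2 by (intro Legendre_eq_1I[of 1]) auto
    ultimately show ?thesis using Legendre_uminus[of 1] by auto
  next
    case False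
    hence "nat \<bar>M\<bar> \<noteq> 1" by auto
    then obtain l where l: "prime l" "l dvd nat \<bar>M\<bar>" using prime_factor_nat by blast
    hence ldvd: "int l dvd M" by (metis int_dvd_int_iff int_nat_eq abs_ge_zero dvd_abs_iff)
    have pl: "prime (int l)" using l(1) by simp
    have l2: "l \<ge> 2" using prime_ge_2_nat l(1) by simp
    have smaller: "nat \<bar>N\<bar> < nat \<bar>M\<bar>" "N \<noteq> 0" "\<not> int p dvd N" if "M = c * N" "\<bar>c\<bar> > 1" for N c
    proof -
      show "N \<noteq> 0" using that less.prems by auto
      moreover have "\<bar>N\<bar> * 1 < \<bar>N\<bar> * \<bar>c\<bar>" using that(2) \<open>N \<noteq> 0\<close> by (intro mult_strict_left_mono) auto
      ultimately show "nat \<bar>N\<bar> < nat \<bar>M\<bar>" using that(1) by (simp add: abs_mult mult.commute)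
      show "\<not> int p dvd N" using less.prems that by auto
    qed
    have lp: "\<not> int p dvd int l"
      using ldvd less.prems(2) dvd_trans by blast
    consider "l = 2" | "odd l" "int l * int l dvd M" | "odd l" "\<not> int l * int l dvd M"
      using l(1) prime_odd_nat[of l] l2 by (cases "l = 2") auto
    thus ?thesis
    proof cases
      case 1
      then obtain N where N: "M = 2 * N" using ldvd by (auto elim: dvdE)
      have "Legendre N p = 1"
      proof (rule less.hyps)
        fix q :: nat assume q: "prime q" "odd q" "odd (multiplicity (int q) N)"
        have "multiplicity (int q) M = multiplicity (int q) (2::int) + multiplicity (int q) N"
          unfolding N using q smaller[of 2 N] N by (intro prime_elem_multiplicity_mult_distrib) auto
        moreover have "\<not> int q dvd 2"
          using q by (metis int_dvd_int_iff of_nat_numeral primes_dvd_imp_eq two_is_prime_nat dvd_refl)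
        hence "multiplicity (int q) (2::int) = 0" by (simp add: not_dvd_imp_multiplicity_0)
        ultimately show "Legendre (int q) p = 1" using q less.prems(3) by auto
      qed (use smaller[of 2 N] N in auto)
      thus ?thesis unfolding N using assms(1) Legendre_mult by simp
    next
      case 2
      then obtain N where N: "M = (int l * int l) * N" by (elim dvdE)
      have c: "\<bar>int l * int l\<bar> > 1" using l2 by (simp add: less_1_mult)
      have "Legendre N p = 1"
      proof (rule less.hyps)
        fix q :: nat assume q: "prime q" "odd q" "odd (multiplicity (int q) N)"
        have "multiplicity (int q) M = multiplicity (int q) (int l * int l) + multiplicity (int q) N"
          unfolding N using q smaller[OF N c] l2 by (intro prime_elem_multiplicity_mult_distrib) auto
        also have "multiplicity (int q) (int l * int l) = multiplicity (int q) (int l) + multiplicity (int q) (int l)"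
          using q l2 by (intro prime_elem_multiplicity_mult_distrib) auto
        finally show "Legendre (int q) p = 1" using q less.prems(3) by auto
      qed (use smaller[OF N c] in auto)
      thus ?thesis unfolding N
        using Legendre_mult[of "int l * int l" N] Legendre_square[OF lp] by (simp add: power2_eq_square)
    next
      case 3
      then obtain N where N: "M = int l * N" using ldvd by (auto elim: dvdE)
      have c: "\<bar>int l\<bar> > 1" using l2 by simp
      have nlN: "\<not> int l dvd N" using 3 N by auto
      hence mN: "multiplicity (int l) N = 0" by (simp add: not_dvd_imp_multiplicity_0)
      have mult: "multiplicity (int q) M = multiplicity (int q) (int l) + multiplicity (int q) N" if "prime q" for q
        unfolding N using that smaller[OF N c] l2 by (intro prime_elem_multiplicity_mult_distrib) auto
      have "Legendre N p = 1"
      proof (rule less.hyps)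
        fix q :: nat assume q: "prime q" "odd q" "odd (multiplicity (int q) N)"
        hence "q \<noteq> l" using mN by auto
        hence "\<not> int q dvd int l" using q l(1) primes_dvd_imp_eq by auto
        hence "multiplicity (int q) (int l) = 0" by (simp add: not_dvd_imp_multiplicity_0)
        thus "Legendre (int q) p = 1" using q mult[of q] less.prems(3) by auto
      qed (use smaller[OF N c] in auto)
      moreover have "Legendre (int l) p = 1"
      proof (rule less.prems(3))
        have "multiplicity (int l) (int l) = 1" using pl by (intro multiplicity_self) auto
        thus "odd (multiplicity (int l) M)" using mult[of l] l(1) mN by simp
      qed (use l 3 in auto)
      ultimately show ?thesis unfolding N using Legendre_mult by simp
    qed
  qed
qed

text \<open>Every prime factor \<open>l\<close> of \<open>n\<close> has \<open>-p\<close> as a square, so reciprocity gives \<open>(l/p) = (-1/l)\<close>;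
both sides of the claim are multiplicative in \<open>n\<close>.\<close>

lemma Legendre_divisor_of_norm:
  assumes "n > 0" "odd n" "int n dvd m\<^sup>2 + int p" "\<not> p dvd n"
  shows "Legendre (int n) p = (if n mod 4 = 1 then 1 else -1)"
  using assms
proof (induction n rule: less_induct)
  case (less n)
  show ?case
  proof (cases "n = 1")
    case True
    have "Legendre 1 p = 1" using gt2 by (intro Legendre_eq_1I[of 1]) auto
    thus ?thesis using True by simp
  next
    case False
    then obtain l where l: "prime l" "l dvd n" using prime_factor_nat by blast
    then obtain k where k: "n = l * k" by (elim dvdE)
    have ol: "odd l" and ok: "odd k" using less.prems k by auto
    have l2: "l > 2" using l(1) ol prime_gt_1_nat[of l] by (cases "l = 2") auto
    have lp: "\<not> p dvd l" "\<not> p dvd k" using less.prems k by auto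
    have k0: "k > 0" "k < n" using less.prems k l2 by auto
    have IH: "Legendre (int k) p = (if k mod 4 = 1 then 1 else -1)"
      using less.prems k by (intro less.IH k0 ok lp) (auto intro: dvd_trans)
    interpret L: odd_prime l by unfold_locales (use l l2 in auto)
    have ldvd: "int l dvd m\<^sup>2 + int p" using less.prems(3) k by (auto intro: dvd_trans)
    have "\<not> int l dvd int p"
      using lp(1) primes_dvd_imp_eq[OF l(1) prime_p] by auto
    hence "Legendre (- int p) l = 1"
      using ldvd by (intro Legendre_eq_1I[of m]) (auto simp: cong_iff_dvd_diff)
    hence "Legendre (-1) l * Legendre p l = 1" using L.Legendre_mult[of "-1" "int p"] by simp
    hence "Legendre p l = Legendre (-1) l"
      using Legendre_cases[of p l] Legendre_cases[of "-1" l] by auto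
    hence "Legendre l p = (if l mod 4 = 1 then 1 else -1)"
      using reciprocity[OF l(1) ol] lp(1) L.Legendre_minus_one by (cases "l = p") auto
    moreover have "n mod 4 = ((l mod 4) * (k mod 4)) mod 4" using k by (simp add: mod_mult_eq)
    moreover have "l mod 4 = 1 \<or> l mod 4 = 3" "k mod 4 = 1 \<or> k mod 4 = 3"
      using ol ok by presburger+
    ultimately show ?thesis using Legendre_mult[of "int l" "int k"] IH k by auto
  qed
qed

end

section \<open>Norms shared by two quadratic orders\<close>

context prime_1_mod_4
begin

lemma not_square: "k\<^sup>2 \<noteq> int p"
proof
  assume k: "k\<^sup>2 = int p"
  hence "int p dvd k\<^sup>2" by simp
  hence "int p dvd k" using prime_int by (simp add: prime_dvd_power_iff)
  hence "int p * int p dvd k\<^sup>2" unfolding power2_eq_square by (intro mult_dvd_mono)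
  hence "int p * int p \<le> int p" using k gt2 by (intro zdvd_imp_le) auto
  thus False using gt2 by auto
qed

lemma ex_floor_sqrt: "\<exists>k::int. k \<ge> 0 \<and> k\<^sup>2 \<le> int n \<and> int n < (k + 1)\<^sup>2"
proof (intro exI conjI)
  have "real_of_int \<lfloor>sqrt n\<rfloor> \<le> sqrt n" "sqrt n < real_of_int \<lfloor>sqrt n\<rfloor> + 1" by linarith+
  moreover show "\<lfloor>sqrt n\<rfloor> \<ge> 0" by simp
  ultimately have "(real_of_int \<lfloor>sqrt n\<rfloor>)\<^sup>2 \<le> (sqrt n)\<^sup>2" "(sqrt n)\<^sup>2 < (real_of_int \<lfloor>sqrt n\<rfloor> + 1)\<^sup>2"
    by (intro power_mono power_strict_mono; simp)+
  hence "(real_of_int \<lfloor>sqrt n\<rfloor>)\<^sup>2 \<le> real n" "real n < (real_of_int \<lfloor>sqrt n\<rfloor> + 1)\<^sup>2" by simp_all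
  hence "real_of_int (\<lfloor>sqrt n\<rfloor>\<^sup>2) \<le> real_of_int (int n)" "real_of_int (int n) < real_of_int ((\<lfloor>sqrt n\<rfloor> + 1)\<^sup>2)"
    by simp_all
  thus "\<lfloor>sqrt n\<rfloor>\<^sup>2 \<le> int n" "int n < (\<lfloor>sqrt n\<rfloor> + 1)\<^sup>2" by (simp_all only: of_int_le_iff of_int_less_iff)
qed

text \<open>Thue's argument; the congruence ties the representation to a chosen root \<open>\<iota>\<close> of \<open>-1\<close>.\<close>

lemma sum_two_squares:
  assumes "[\<iota>\<^sup>2 = -1] (mod int p)"
  obtains A B where "int p = A\<^sup>2 + B\<^sup>2" "int p dvd A + B * \<iota>"
proof -
  obtain k :: int where k: "k \<ge> 0" "k\<^sup>2 \<le> int p" "int p < (k + 1)\<^sup>2" using ex_floor_sqrt by blast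
  have kp: "k\<^sup>2 < int p" using k(2) not_square[of k] by simp
  define S where "S = {0..k} \<times> {0..k}"
  define f where "f = (\<lambda>(A, B). (A + B * \<iota>) mod int p)"
  have "card (f ` S) \<le> card {0..<int p}"
    using gt2 by (intro card_mono) (auto simp: f_def)
  moreover have "int p < int (card S)"
    using k by (simp add: S_def card_cartesian_product power2_eq_square)
  ultimately have "card (f ` S) < card S" by simp
  hence "\<not> inj_on f S" by (rule pigeonhole)
  then obtain x y where xy: "x \<in> S" "y \<in> S" "x \<noteq> y" "f x = f y" by (auto simp: inj_on_def)
  define A B where "A = fst x - fst y" and "B = snd x - snd y"
  have nz: "A \<noteq> 0 \<or> B \<noteq> 0" using xy(3) by (auto simp: A_def B_def prod_eq_iff)
  have "\<bar>A\<bar> \<le> k" "\<bar>B\<bar> \<le> k" using xy(1,2) by (auto simp: S_def A_def B_def)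
  hence "A\<^sup>2 \<le> k\<^sup>2" "B\<^sup>2 \<le> k\<^sup>2" using k(1) by (auto simp: abs_le_square_iff[symmetric])
  hence lt: "A\<^sup>2 + B\<^sup>2 < 2 * int p" using kp by linarith
  have dv: "int p dvd A + B * \<iota>"
    using xy(4) by (auto simp: f_def A_def B_def case_prod_unfold mod_eq_dvd_iff algebra_simps)
  have "A\<^sup>2 + B\<^sup>2 = (A + B * \<iota>) * (A - B * \<iota>) + B\<^sup>2 * (\<iota>\<^sup>2 - (-1))"
    by (simp add: power2_eq_square algebra_simps)
  moreover have "int p dvd \<iota>\<^sup>2 - (-1)" using assms by (simp add: cong_iff_dvd_diff)
  ultimately have "int p dvd A\<^sup>2 + B\<^sup>2" using dv by simp
  then obtain q where q: "A\<^sup>2 + B\<^sup>2 = int p * q" by (elim dvdE)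
  have "A\<^sup>2 + B\<^sup>2 > 0" using nz by (auto simp: sum_power2_gt_zero_iff)
  hence "q > 0" "q < 2" using q lt gt2 by (auto simp: zero_less_mult_iff mult.commute)
  hence "q = 1" by simp
  thus ?thesis using that[of A B] q dv by simp
qed

text \<open>Modulo \<open>l\<close> the prime \<open>p\<close> is congruent to \<open>B\<^sup>2\<close>; reciprocity swaps the two primes.\<close>

lemma Legendre_of_divisor_of_summand:
  assumes "prime l" "odd l" "int p = A\<^sup>2 + B\<^sup>2" "int l dvd A" "\<not> int p dvd A"
  shows "Legendre (int l) p = 1"
proof -
  have lp: "l \<noteq> p" using assms by auto
  have "[B\<^sup>2 = int p] (mod int l)" using assms(4) by (simp add: assms(3) cong_iff_dvd_diff power2_eq_square)
  moreover have "\<not> int l dvd int p" using lp assms(1) prime_p primes_dvd_imp_eq by auto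
  ultimately have "Legendre p l = 1" by (rule Legendre_eq_1I)
  thus ?thesis using reciprocity[OF assms(1,2) lp] by simp
qed

text \<open>A prime \<open>l\<close> with \<open>(p/l) = -1\<close> is inert in the field of \<open>\<surd>p\<close>: if it divides the norm \<open>K\<^sup>2 - pu\<^sup>2\<close>, it divides
\<open>K\<close> and \<open>u\<close>, and \<open>l\<^sup>2\<close> can be cancelled.\<close>

lemma even_multiplicity_of_nonresidue:
  fixes l :: nat
  assumes l: "prime l" and np: "Legendre p (int l) = -1"
    and nz: "K\<^sup>2 - int p * u\<^sup>2 \<noteq> 0"
  shows "even (multiplicity (int l) (K\<^sup>2 - int p * u\<^sup>2))"
  using nz
proof (induction "nat \<bar>K\<bar> + nat \<bar>u\<bar>" arbitrary: K u rule: less_induct)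
  case less
  have pl: "prime (int l)" and l2: "l \<ge> 2" using l prime_ge_2_nat by auto
  show ?case
  proof (cases "int l dvd K\<^sup>2 - int p * u\<^sup>2")
    case False
    thus ?thesis by (simp add: not_dvd_imp_multiplicity_0)
  next
    case True
    have lu: "int l dvd u"
    proof (rule ccontr)
      assume nu: "\<not> int l dvd u"
      hence "coprime u (int l)" using pl by (metis coprime_commute prime_imp_coprime)
      then obtain w where w: "[u * w = 1] (mod int l)" using cong_solve_coprime_int by blast
      have "[K\<^sup>2 = int p * u\<^sup>2] (mod int l)" using True by (simp add: cong_iff_dvd_diff)
      hence "[K\<^sup>2 * w\<^sup>2 = int p * u\<^sup>2 * w\<^sup>2] (mod int l)" by (intro cong_mult cong_refl)
      also have "int p * u\<^sup>2 * w\<^sup>2 = int p * (u * w)\<^sup>2" by (simp add: power_mult_distrib)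
      also have "[\<dots> = int p * 1\<^sup>2] (mod int l)" by (intro cong_mult cong_refl cong_pow w)
      finally have "[(K * w)\<^sup>2 = int p] (mod int l)" by (simp add: power_mult_distrib)
      hence "Legendre p l \<noteq> -1" by (auto simp: Legendre_def QuadRes_def)
      thus False using np by simp
    qed
    have "int l dvd int p * u\<^sup>2" using lu by (simp add: power2_eq_square)
    hence "int l dvd K\<^sup>2" using dvd_add[OF True] by (metis diff_add_cancel)
    hence lK: "int l dvd K" using pl by (simp add: prime_dvd_power_iff)
    from lu lK obtain K' u' where Ku: "K = int l * K'" "u = int l * u'" by (elim dvdE)
    have eq: "K\<^sup>2 - int p * u\<^sup>2 = (int l)\<^sup>2 * (K'\<^sup>2 - int p * u'\<^sup>2)"
      unfolding Ku by (simp add: power2_eq_square algebra_simps)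
    hence nz': "K'\<^sup>2 - int p * u'\<^sup>2 \<noteq> 0" using less.prems by auto
    have "nat \<bar>K'\<bar> \<le> nat \<bar>K\<bar>" "nat \<bar>u'\<bar> \<le> nat \<bar>u\<bar>"
      using l2 unfolding Ku by (auto simp: abs_mult nat_mult_distrib)
    moreover have "nat \<bar>K'\<bar> < nat \<bar>K\<bar> \<or> nat \<bar>u'\<bar> < nat \<bar>u\<bar>"
      using nz' l2 unfolding Ku by (cases "K' = 0") (auto simp: abs_mult nat_mult_distrib)
    ultimately have lt: "nat \<bar>K'\<bar> + nat \<bar>u'\<bar> < nat \<bar>K\<bar> + nat \<bar>u\<bar>" by (elim disjE) linarith+
    have "even (multiplicity (int l) (K'\<^sup>2 - int p * u'\<^sup>2))"
      by (rule less.hyps[OF lt nz'])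
    moreover have "multiplicity (int l) (K\<^sup>2 - int p * u\<^sup>2) = 2 + multiplicity (int l) (K'\<^sup>2 - int p * u'\<^sup>2)"
      unfolding eq using pl nz' l2
      by (subst prime_elem_multiplicity_mult_distrib) (auto simp: multiplicity_same_power)
    ultimately show ?thesis by simp
  qed
qed

text \<open>Write \<open>p = A\<^sup>2 + B\<^sup>2\<close> and multiply \<open>j = j1 + j2 i\<close> by a Gaussian prime of norm \<open>p\<close>: the product has
coordinates \<open>L\<close>, \<open>K\<close> with \<open>K\<^sup>2 + L\<^sup>2 = p (u\<^sup>2 + pv\<^sup>2)\<close>, which rearranges to
\<open>(pv - L) (pv + L) = K\<^sup>2 - pu\<^sup>2\<close>. The right-hand side is a norm from the field of \<open>\<surd>p\<close>, so a prime \<open>l\<close>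
with \<open>(p/l) = -1\<close> can divide \<open>pv + L\<close> to an odd power only if it divides both factors, and then it divides
both \<open>u\<close> and \<open>v\<close>. Hence \<open>(L/p) = ((pv + L)/p) = 1\<close>. Finally \<open>A j \<equiv> L\<close> under
\<open>i \<mapsto> \<iota>\<close>, and \<open>(A/p) = 1\<close>.\<close>

lemma Legendre_common_norm:
  assumes p8: "p mod 8 = 1" and iota: "[\<iota>\<^sup>2 = -1] (mod int p)"
    and norm: "j1\<^sup>2 + j2\<^sup>2 = u\<^sup>2 + int p * v\<^sup>2" and nj: "\<not> int p dvd j1\<^sup>2 + j2\<^sup>2"
    and prim: "\<And>l. prime l \<Longrightarrow> odd l \<Longrightarrow> int l dvd u \<Longrightarrow> int l dvd v \<Longrightarrow> Legendre (int l) p = 1"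
  shows "Legendre (j1 + j2 * \<iota>) p = 1"
proof -
  have two: "Legendre 2 p = 1" using Legendre_two p8 by simp
  obtain A B where AB: "int p = A\<^sup>2 + B\<^sup>2" "int p dvd A + B * \<iota>" using sum_two_squares[OF iota] .
  \<comment> \<open>If \<open>p\<close> divided \<open>A\<close>, then \<open>p\<^sup>2\<close> would divide \<open>p = A\<^sup>2 + B\<^sup>2\<close>.\<close>
  have nA: "\<not> int p dvd A"
  proof
    assume A: "int p dvd A"
    hence "int p dvd A\<^sup>2" by (simp add: power2_eq_square)
    hence "int p dvd B\<^sup>2" using AB(1) by (metis dvd_add_right_iff dvd_refl)
    hence "int p dvd B" using prime_int by (simp add: prime_dvd_power_iff)
    then obtain x y where "A = int p * x" "B = int p * y" using A by (elim dvdE)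
    hence "A\<^sup>2 + B\<^sup>2 = (int p * int p) * (x\<^sup>2 + y\<^sup>2)" by (simp add: power2_eq_square algebra_simps)
    hence "int p = (int p * int p) * (x\<^sup>2 + y\<^sup>2)" using AB(1) by simp
    hence "int p * 1 = int p * (int p * (x\<^sup>2 + y\<^sup>2))" by (simp add: mult.assoc)
    hence "1 = int p * (x\<^sup>2 + y\<^sup>2)" using gt2 by (subst (asm) mult_cancel_left) auto
    hence "int p dvd 1" by (metis dvd_triv_left)
    thus False using gt2 by simp
  qed
  have LA: "Legendre A p = 1"
  proof (rule Legendre_eq_1_of_odd_multiplicity[OF two])
    show "A \<noteq> 0" using nA by auto
    fix l :: nat assume l: "prime l" "odd l" "odd (multiplicity (int l) A)"
    hence "int l dvd A" by (metis even_zero not_dvd_imp_multiplicity_0)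
    thus "Legendre (int l) p = 1" using Legendre_of_divisor_of_summand[OF l(1,2) AB(1) _ nA] by simp
  qed (rule nA)
  define L K where "L = j1 * A + j2 * B" and "K = j2 * A - j1 * B"
  have KL: "K\<^sup>2 + L\<^sup>2 = int p * (u\<^sup>2 + int p * v\<^sup>2)"
  proof -
    have "K\<^sup>2 + L\<^sup>2 = (A\<^sup>2 + B\<^sup>2) * (j1\<^sup>2 + j2\<^sup>2)"
      by (simp add: K_def L_def power2_eq_square algebra_simps)
    thus ?thesis using AB(1) norm by simp
  qed
  have fac: "(int p * v - L) * (int p * v + L) = K\<^sup>2 - int p * u\<^sup>2"
    using KL by (simp add: power2_eq_square algebra_simps)
  have dA: "int p dvd A * (j1 + j2 * \<iota>) - L"
  proof -
    have "A * (j1 + j2 * \<iota>) - L = j2 * \<iota> * (A + B * \<iota>) - j2 * B * (\<iota>\<^sup>2 - (-1))"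
      by (simp add: L_def power2_eq_square algebra_simps)
    moreover have "int p dvd \<iota>\<^sup>2 - (-1)" using iota by (simp add: cong_iff_dvd_diff)
    ultimately show ?thesis using AB(2) by simp
  qed
  have nL: "\<not> int p dvd L"
  proof
    assume "int p dvd L"
    hence "int p dvd A * (j1 + j2 * \<iota>)" using dvd_add[OF dA] by (metis diff_add_cancel)
    hence j: "int p dvd j1 + j2 * \<iota>" using nA prime_int by (simp add: prime_dvd_mult_iff)
    have "j1\<^sup>2 + j2\<^sup>2 = (j1 + j2 * \<iota>) * (j1 - j2 * \<iota>) + j2\<^sup>2 * (\<iota>\<^sup>2 - (-1))"
      by (simp add: power2_eq_square algebra_simps)
    moreover have "int p dvd \<iota>\<^sup>2 - (-1)" using iota by (simp add: cong_iff_dvd_diff)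
    ultimately show False using j nj by simp
  qed
  have nM: "\<not> int p dvd int p * v + L" using nL by (simp add: dvd_add_right_iff)
  have nM': "\<not> int p dvd int p * v - L" using nL by (simp add: dvd_diff_right_iff)
  have nz: "int p * v + L \<noteq> 0" "int p * v - L \<noteq> 0" using nM nM' by (metis dvd_0_right)+
  \<comment> \<open>Only primes of odd multiplicity in \<open>pv + L\<close> matter; a bad one would divide \<open>u\<close> and \<open>v\<close>.\<close>
  have LM: "Legendre (int p * v + L) p = 1"
  proof (rule Legendre_eq_1_of_odd_multiplicity[OF two nz(1) nM])
    fix l :: nat assume l: "prime l" "odd l" "odd (multiplicity (int l) (int p * v + L))"
    have pl: "prime (int l)" using l(1) by simp
    have dl: "int l dvd int p * v + L" using l(3) not_dvd_imp_multiplicity_0 by fastforce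
    have lp: "l \<noteq> p" using dl nM by auto
    hence nlp: "\<not> int l dvd int p" using l(1) prime_p primes_dvd_imp_eq by auto
    show "Legendre (int l) p = 1"
    proof (rule ccontr)
      assume n1: "Legendre (int l) p \<noteq> 1"
      hence neg: "Legendre p l = -1"
        using reciprocity[OF l(1,2) lp] Legendre_cases[of p l] Legendre_eq_0_iff[of p l] nlp by auto
      have ev: "even (multiplicity (int l) ((int p * v - L) * (int p * v + L)))"
        unfolding fac by (rule even_multiplicity_of_nonresidue[OF l(1) neg]) (use nz fac in auto)
      have "multiplicity (int l) ((int p * v - L) * (int p * v + L)) =
            multiplicity (int l) (int p * v - L) + multiplicity (int l) (int p * v + L)"
        using pl nz by (intro prime_elem_multiplicity_mult_distrib) auto
      hence "odd (multiplicity (int l) (int p * v - L))" using ev l(3) by simp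
      hence dl': "int l dvd int p * v - L" by (metis even_zero not_dvd_imp_multiplicity_0)
      have n2: "\<not> int l dvd 2" using l(1,2)
        by (metis int_dvd_int_iff of_nat_numeral primes_dvd_imp_eq two_is_prime_nat dvd_refl)
      have "int l dvd 2 * (int p * v)" using dvd_add[OF dl dl'] by (simp add: algebra_simps)
      hence lv: "int l dvd v" using pl n2 nlp by (simp add: prime_dvd_mult_iff)
      have "int l * int l dvd K\<^sup>2 - int p * u\<^sup>2" unfolding fac[symmetric] using dl dl' by (intro mult_dvd_mono)
      hence d0: "int l dvd K\<^sup>2 - int p * u\<^sup>2" by (metis dvd_mult_left)
      have "int l dvd u"
      proof (rule ccontr)
        assume nu: "\<not> int l dvd u"
        hence "coprime u (int l)" using pl by (metis coprime_commute prime_imp_coprime)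
        then obtain w where w: "[u * w = 1] (mod int l)" using cong_solve_coprime_int by blast
        have "[K\<^sup>2 = int p * u\<^sup>2] (mod int l)" using d0 by (simp add: cong_iff_dvd_diff)
        hence "[K\<^sup>2 * w\<^sup>2 = int p * u\<^sup>2 * w\<^sup>2] (mod int l)" by (intro cong_mult cong_refl)
        also have "int p * u\<^sup>2 * w\<^sup>2 = int p * (u * w)\<^sup>2" by (simp add: power_mult_distrib)
        also have "[\<dots> = int p * 1\<^sup>2] (mod int l)" by (intro cong_mult cong_refl cong_pow w)
        finally have "[(K * w)\<^sup>2 = int p] (mod int l)" by (simp add: power_mult_distrib)
        hence "Legendre p l \<noteq> -1" by (auto simp: Legendre_def QuadRes_def)
        thus False using neg by simp
      qed
      thus False using prim[OF l(1,2) _ lv] n1 by simp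
    qed
  qed
  have "Legendre L p = 1" using LM Legendre_cong[of "int p * v + L" L p] by (simp add: cong_iff_dvd_diff)
  moreover have "Legendre (A * (j1 + j2 * \<iota>)) p = Legendre L p"
    using dA by (intro Legendre_cong) (simp add: cong_iff_dvd_diff)
  ultimately show ?thesis using LA Legendre_mult[of A "j1 + j2 * \<iota>"] by simp
qed

text \<open>The genus-theoretic core. By the box principle the two linear congruences \<open>U \<equiv> mW (mod n)\<close> and
\<open>U \<equiv> cZ (mod p)\<close>, where \<open>c\<^sup>2 \<equiv> n\<close>, have a solution so small that the form
\<open>U\<^sup>2 + pW\<^sup>2 - nZ\<^sup>2\<close>, a multiple of \<open>np\<close>, equals \<open>0\<close> or \<open>np\<close>. In the second case
\<open>U\<^sup>2 + pW\<^sup>2 = n (Z\<^sup>2 + p)\<close>, and multiplying \<open>U + W\<surd>-p\<close> by \<open>Z + \<surd>-p\<close> leads back to the first.\<close>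

lemma conic_solvable:
  assumes n: "n > 0" "\<not> p dvd n" and m: "int n dvd m\<^sup>2 + int p" and leg: "Legendre (int n) p = 1"
  obtains U W Z where "int n dvd U - m * W" "U\<^sup>2 + int p * W\<^sup>2 = int n * Z\<^sup>2" "Z \<noteq> 0"
proof -
  obtain c where c: "[c\<^sup>2 = int n] (mod int p)" using Legendre_eq_1D[OF leg] .
  obtain k1 k2 k3 :: int where k1: "k1 \<ge> 0" "k1\<^sup>2 \<le> int (n * p)" "int (n * p) < (k1 + 1)\<^sup>2"
    and k2: "k2 \<ge> 0" "k2\<^sup>2 \<le> int n" "int n < (k2 + 1)\<^sup>2"
    and k3: "k3 \<ge> 0" "k3\<^sup>2 \<le> int p" "int p < (k3 + 1)\<^sup>2"
    using ex_floor_sqrt by metis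
  define N where "N = int n * int p"
  have N0: "N > 0" using n gt2 by (simp add: N_def)
  define S where "S = {0..k1} \<times> {0..k2} \<times> {0..k3}"
  define f where "f = (\<lambda>(U, W, Z). ((U - m * W) mod int n, (U - c * Z) mod int p))"
  have "card (f ` S) \<le> card ({0..<int n} \<times> {0..<int p})"
    using n gt2 by (intro card_mono) (auto simp: f_def)
  also have "\<dots> = nat N" by (simp add: card_cartesian_product N_def nat_mult_distrib)
  also have "nat N < card S"
  proof -
    have "N\<^sup>2 = int (n * p) * int n * int p" by (simp add: N_def power2_eq_square)
    also have "\<dots> < (k1 + 1)\<^sup>2 * (k2 + 1)\<^sup>2 * (k3 + 1)\<^sup>2"
      using k1 k2 k3 by (intro mult_strict_mono) auto
    also have "\<dots> = ((k1 + 1) * (k2 + 1) * (k3 + 1))\<^sup>2" by (simp add: power_mult_distrib)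
    finally have "N < (k1 + 1) * (k2 + 1) * (k3 + 1)"
      by (rule power2_less_imp_less) (use k1(1) k2(1) k3(1) in simp)
    moreover have "int (card S) = (k1 + 1) * (k2 + 1) * (k3 + 1)"
      using k1(1) k2(1) k3(1) by (simp add: S_def card_cartesian_product)
    ultimately show ?thesis using N0 by linarith
  qed
  finally have "\<not> inj_on f S" by (rule pigeonhole)
  then obtain x y where xy: "x \<in> S" "y \<in> S" "x \<noteq> y" "f x = f y" unfolding inj_on_def by blast
  obtain x1 x2 x3 y1 y2 y3 where x: "x = (x1, x2, x3)" and y: "y = (y1, y2, y3)" by (metis prod_cases3)
  define U W Z where "U = x1 - y1" and "W = x2 - y2" and "Z = x3 - y3"
  have nzero: "U \<noteq> 0 \<or> W \<noteq> 0 \<or> Z \<noteq> 0" using xy(3) by (auto simp: U_def W_def Z_def x y)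
  have "\<bar>U\<bar> \<le> k1" "\<bar>W\<bar> \<le> k2" "\<bar>Z\<bar> \<le> k3"
    using xy(1,2) by (auto simp: S_def U_def W_def Z_def x y)
  hence sq: "U\<^sup>2 \<le> k1\<^sup>2" "W\<^sup>2 \<le> k2\<^sup>2" "Z\<^sup>2 \<le> k3\<^sup>2"
    using k1(1) k2(1) k3(1) by (auto simp: abs_le_square_iff[symmetric])
  have dn: "int n dvd U - m * W" and dp: "int p dvd U - c * Z"
    using xy(4) by (auto simp: f_def U_def W_def Z_def x y mod_eq_dvd_iff algebra_simps)
  define Q where "Q = U\<^sup>2 + int p * W\<^sup>2 - int n * Z\<^sup>2"
  have "Q = (U - m * W) * (U + m * W) + (m\<^sup>2 + int p) * W\<^sup>2 - int n * Z\<^sup>2"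
    by (simp add: Q_def power2_eq_square algebra_simps)
  hence "int n dvd Q" using dn m by simp
  moreover have "Q = (U - c * Z) * (U + c * Z) + (c\<^sup>2 - int n) * Z\<^sup>2 + int p * W\<^sup>2"
    by (simp add: Q_def power2_eq_square algebra_simps)
  hence "int p dvd Q" using dp c by (simp add: cong_iff_dvd_diff)
  moreover have cop: "coprime (int n) (int p)"
    using n prime_p by (metis coprime_commute coprime_int_iff prime_imp_coprime)
  ultimately have "N dvd Q" unfolding N_def by (intro divides_mult)
  then obtain q where q: "Q = N * q" by (elim dvdE)
  have "Z\<^sup>2 < int p" using sq(3) k3(2) not_square[of Z] by linarith
  hence "int n * Z\<^sup>2 < N" using n by (simp add: N_def)
  moreover have "U\<^sup>2 + int p * W\<^sup>2 \<ge> 0" by simp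
  ultimately have "Q > - N" unfolding Q_def by linarith
  hence "N * (q + 1) > 0" using q by (simp add: algebra_simps)
  hence q1: "q > -1" using N0 by (simp add: zero_less_mult_iff)
  \<comment> \<open>Strictness needs that \<open>np\<close> is not a square, as \<open>p\<close> does not divide \<open>n\<close>.\<close>
  have X1: "U\<^sup>2 < N"
  proof -
    have "U\<^sup>2 \<le> N" using sq(1) k1(2) by (simp add: N_def)
    moreover have "U\<^sup>2 \<noteq> N"
    proof
      assume XN: "U\<^sup>2 = N"
      hence "int p dvd U\<^sup>2" by (simp add: N_def)
      hence "int p dvd U" using prime_int by (simp add: prime_dvd_power_iff)
      hence "int p * int p dvd U\<^sup>2" unfolding power2_eq_square by (intro mult_dvd_mono)
      hence "int p dvd int n" unfolding XN N_def using gt2 by (simp add: mult.commute)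
      thus False using n by simp
    qed
    ultimately show ?thesis by simp
  qed
  have "W\<^sup>2 \<le> int n" using sq(2) k2(2) by linarith
  hence "int p * W\<^sup>2 \<le> N" using gt2 by (simp add: N_def mult.commute)
  moreover have "int n * Z\<^sup>2 \<ge> 0" by simp
  ultimately have "Q < 2 * N" using X1 unfolding Q_def by linarith
  hence "N * (2 - q) > 0" using q by (simp add: algebra_simps)
  hence q2: "q < 2" using N0 by (simp add: zero_less_mult_iff)
  consider "Q = 0" | "Q = N" using q q1 q2 by (cases "q = 0") auto
  thus ?thesis
  proof cases
    case 1
    have "Z \<noteq> 0"
    proof
      assume Z: "Z = 0"
      hence "U\<^sup>2 + int p * W\<^sup>2 = 0" using 1 by (simp add: Q_def)
      moreover have "int p * W\<^sup>2 \<ge> 0" "U\<^sup>2 \<ge> 0" by simp_all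
      ultimately have "U\<^sup>2 = 0" "int p * W\<^sup>2 = 0" by linarith+
      thus False using Z nzero gt2 by simp
    qed
    thus ?thesis using that[of U W Z] dn 1 by (simp add: Q_def)
  next
    case 2
    hence e: "U\<^sup>2 + int p * W\<^sup>2 = int n * (Z\<^sup>2 + int p)"
      by (simp add: Q_def N_def algebra_simps)
    show ?thesis
    proof (rule that[of "U * Z - int p * W" "U + W * Z" "Z\<^sup>2 + int p"])
      have "U * Z - int p * W - m * (U + W * Z) = (Z - m) * (U - m * W) - (m\<^sup>2 + int p) * W"
        by (simp add: power2_eq_square algebra_simps)
      thus "int n dvd U * Z - int p * W - m * (U + W * Z)" using dn m by simp
      have "(U * Z - int p * W)\<^sup>2 + int p * (U + W * Z)\<^sup>2 = (U\<^sup>2 + int p * W\<^sup>2) * (Z\<^sup>2 + int p)"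
        by (simp add: power2_eq_square algebra_simps)
      thus "(U * Z - int p * W)\<^sup>2 + int p * (U + W * Z)\<^sup>2 = int n * (Z\<^sup>2 + int p)\<^sup>2"
        unfolding e by (simp add: power2_eq_square)
      show "Z\<^sup>2 + int p \<noteq> 0" using gt2 zero_le_power2[of Z] by linarith
    qed
  qed
qed

end

section \<open>The relative norm equation over the integers\<close>

context prime_1_mod_4
begin

text \<open>Dividing \<open>b\<close> by \<open>1 + i\<close> as long as its norm is even does not change the symbol, because \<open>1 + \<iota>\<close> is a
square, and does not change the odd common divisors of the coordinates.\<close>

lemma gaussian_odd_part:
  assumes iota: "Legendre (1 + \<iota>) p = 1" "[\<iota>\<^sup>2 = -1] (mod int p)" and nz: "b1 \<noteq> 0 \<or> b2 \<noteq> (0::int)"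
  shows "\<exists>v c1 c2. odd (c1\<^sup>2 + c2\<^sup>2) \<and> b1\<^sup>2 + b2\<^sup>2 = 2 ^ v * (c1\<^sup>2 + c2\<^sup>2) \<and>
           Legendre (b1 + b2 * \<iota>) p = Legendre (c1 + c2 * \<iota>) p \<and>
           (\<forall>d. d dvd c1 \<and> d dvd c2 \<longrightarrow> d dvd b1 \<and> d dvd b2) \<and>
           (\<forall>d. odd d \<and> d dvd b1 \<and> d dvd b2 \<longrightarrow> d dvd c1 \<and> d dvd c2)"
  using nz
proof (induction "nat (b1\<^sup>2 + b2\<^sup>2)" arbitrary: b1 b2 rule: less_induct)
  case less
  show ?case
  proof (cases "odd (b1\<^sup>2 + b2\<^sup>2)")
    case True
    show ?thesis using True by (intro exI[of _ 0] exI[of _ b1] exI[of _ b2]) auto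
  next
    case False
    hence ev: "even (b1 + b2)" "even (b2 - b1)" by auto
    then obtain e1 e2 where e: "b1 + b2 = 2 * e1" "b2 - b1 = 2 * e2" unfolding dvd_def by blast
    have b: "b1 = e1 - e2" "b2 = e1 + e2" using e by auto
    have nrm: "b1\<^sup>2 + b2\<^sup>2 = 2 * (e1\<^sup>2 + e2\<^sup>2)" unfolding b by (simp add: power2_eq_square algebra_simps)
    have nz': "e1 \<noteq> 0 \<or> e2 \<noteq> 0" using less.prems b by auto
    hence pos: "e1\<^sup>2 + e2\<^sup>2 > 0" by (simp add: sum_power2_gt_zero_iff)
    have "e1\<^sup>2 + e2\<^sup>2 < b1\<^sup>2 + b2\<^sup>2" unfolding nrm using pos by simp
    moreover have "b1\<^sup>2 + b2\<^sup>2 > 0" unfolding nrm using pos by simp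
    ultimately have lt: "nat (e1\<^sup>2 + e2\<^sup>2) < nat (b1\<^sup>2 + b2\<^sup>2)" by (simp only: nat_mono_iff)
    obtain v c1 c2 where IH: "odd (c1\<^sup>2 + c2\<^sup>2)" "e1\<^sup>2 + e2\<^sup>2 = 2 ^ v * (c1\<^sup>2 + c2\<^sup>2)"
        "Legendre (e1 + e2 * \<iota>) p = Legendre (c1 + c2 * \<iota>) p"
        "\<forall>d. d dvd c1 \<and> d dvd c2 \<longrightarrow> d dvd e1 \<and> d dvd e2"
        "\<forall>d. odd d \<and> d dvd e1 \<and> d dvd e2 \<longrightarrow> d dvd c1 \<and> d dvd c2"
      using less.hyps[OF lt nz'] by blast
    have "(b1 + b2 * \<iota>) - (1 + \<iota>) * (e1 + e2 * \<iota>) = - e2 * (\<iota>\<^sup>2 - (-1))"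
      unfolding b by (simp add: power2_eq_square algebra_simps)
    moreover have "int p dvd \<iota>\<^sup>2 - (-1)" using iota(2) by (simp add: cong_iff_dvd_diff)
    ultimately have "[b1 + b2 * \<iota> = (1 + \<iota>) * (e1 + e2 * \<iota>)] (mod int p)"
      by (simp add: cong_iff_dvd_diff)
    hence "Legendre (b1 + b2 * \<iota>) p = Legendre ((1 + \<iota>) * (e1 + e2 * \<iota>)) p" by (rule Legendre_cong)
    hence "Legendre (b1 + b2 * \<iota>) p = Legendre (c1 + c2 * \<iota>) p" using iota(1) IH(3) Legendre_mult by simp
    moreover have "d dvd c1 \<and> d dvd c2" if d: "odd d" "d dvd b1" "d dvd b2" for d
    proof -
      have "d dvd 2 * e1" "d dvd 2 * e2" using d(2,3) e by (metis dvd_add, metis dvd_diff)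
      moreover have "coprime d 2" using d(1) by simp
      ultimately have "d dvd e1" "d dvd e2" by (simp_all add: coprime_dvd_mult_right_iff)
      thus ?thesis using IH(5) d(1) by blast
    qed
    moreover have "d dvd b1 \<and> d dvd b2" if "d dvd c1" "d dvd c2" for d
      using IH(4) that unfolding b by auto
    moreover have "b1\<^sup>2 + b2\<^sup>2 = 2 ^ Suc v * (c1\<^sup>2 + c2\<^sup>2)" using nrm IH(2) by simp
    ultimately show ?thesis using IH(1) by blast
  qed
qed

text \<open>For \<open>p \<equiv> 1 (mod 8)\<close> two odd numbers give \<open>x\<^sup>2 + py\<^sup>2 \<equiv> 2 (mod 8)\<close>.\<close>

lemma two_power_descent:
  assumes "p mod 8 = 1" "x\<^sup>2 + int p * y\<^sup>2 = 2 * 4 ^ v * (N::int)"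
  shows "\<exists>x0 y0. x = 2 ^ v * x0 \<and> y = 2 ^ v * y0 \<and> x0\<^sup>2 + int p * y0\<^sup>2 = 2 * N"
  using assms(2)
proof (induction v arbitrary: x y)
  case 0
  thus ?case by auto
next
  case (Suc v)
  obtain k where k: "int p = 8 * k + 1"
    using assms(1) by (metis div_mod_decomp_int mult.commute of_nat_1 of_nat_mod of_nat_numeral)
  have "even x \<and> even y"
  proof (rule ccontr)
    assume n: "\<not> (even x \<and> even y)"
    have ev: "x\<^sup>2 + int p * y\<^sup>2 = 8 * (4 ^ v * N)" using Suc.prems by simp
    hence "even (x\<^sup>2 + int p * y\<^sup>2)" by simp
    hence "even x \<longleftrightarrow> even y" using k by simp
    hence "odd x" "odd y" using n by auto
    then obtain a b where ab: "x = 2 * a + 1" "y = 2 * b + 1" by (auto elim!: oddE)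
    have "8 * (4 ^ v * N) = 4 * (a * a + a + b * b + b + 2 * k * y\<^sup>2) + 2"
      unfolding ev[symmetric] k by (simp add: ab power2_eq_square algebra_simps)
    thus False by presburger
  qed
  then obtain a b where ab: "x = 2 * a" "y = 2 * b" by (auto elim!: evenE)
  have "a\<^sup>2 + int p * b\<^sup>2 = 2 * 4 ^ v * N"
    using Suc.prems unfolding ab by (simp add: power_mult_distrib)
  from Suc.IH[OF this] show ?case unfolding ab by auto
qed

text \<open>The squared absolute value of \<open>a\<^sup>2 - p = (1 + i) b\<^sup>2\<close> reads
\<open>(\<bar>a\<bar>\<^sup>2 - p)\<^sup>2 + p (2 Im a)\<^sup>2 = 2\<bar>b\<bar>\<^sup>4\<close>. Let \<open>c\<close> be the part of \<open>b\<close> prime to \<open>1 + i\<close>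
and \<open>h\<close> the greatest rational integer dividing \<open>c\<close> and \<open>Im a\<close>. The equation shows that \<open>h\<^sup>2\<close> divides
\<open>Im a\<close>, so the powers of \<open>2\<close> and the factor \<open>h\<^sup>4\<close> can be cancelled; what remains is primitive. A prime divisor of
\<open>h\<close> sees \<open>p\<close> as the square of \<open>Re a\<close>.\<close>

lemma quartic_norm_reduction:
  fixes a1 a2 b1 b2 :: int
  assumes p8: "p mod 8 = 1" and iota: "Legendre (1 + \<iota>) p = 1" "[\<iota>\<^sup>2 = -1] (mod int p)"
    and re: "a1\<^sup>2 - a2\<^sup>2 - b1\<^sup>2 + b2\<^sup>2 + 2 * b1 * b2 = int p"
    and im: "2 * a1 * a2 - b1\<^sup>2 + b2\<^sup>2 - 2 * b1 * b2 = 0"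
  obtains c1 c2 h n :: int and x y where "Legendre (b1 + b2 * \<iota>) p = Legendre (c1 + c2 * \<iota>) p"
    "n > 0" "odd n" "odd h" "c1\<^sup>2 + c2\<^sup>2 = h\<^sup>2 * n" "x\<^sup>2 + int p * y\<^sup>2 = 2 * n\<^sup>2" "coprime y n"
    "\<And>l. prime l \<Longrightarrow> odd l \<Longrightarrow> int l dvd h \<Longrightarrow> Legendre (int l) p = 1"
proof -
  have nob: "\<not> (int p dvd a1 \<and> int p dvd a2 \<and> int p dvd b1 \<and> int p dvd b2)"
  proof
    assume *: "int p dvd a1 \<and> int p dvd a2 \<and> int p dvd b1 \<and> int p dvd b2"
    then obtain r1 r2 r3 r4 where r: "a1 = int p * r1" "a2 = int p * r2" "b1 = int p * r3" "b2 = int p * r4"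
      unfolding dvd_def by blast
    have "int p * 1 = int p * (int p * (r1\<^sup>2 - r2\<^sup>2 - r3\<^sup>2 + r4\<^sup>2 + 2 * r3 * r4))"
      using re unfolding r by (simp add: power2_eq_square algebra_simps)
    hence "1 = int p * (r1\<^sup>2 - r2\<^sup>2 - r3\<^sup>2 + r4\<^sup>2 + 2 * r3 * r4)"
      using gt2 by (subst (asm) mult_cancel_left) auto
    hence "int p dvd 1" by (metis dvd_triv_left)
    thus False using gt2 by simp
  qed
  have nzb: "b1 \<noteq> 0 \<or> b2 \<noteq> 0"
  proof (rule ccontr)
    assume "\<not> ?thesis"
    hence b: "b1 = 0" "b2 = 0" by auto
    hence "a1 = 0 \<or> a2 = 0" using im by auto
    moreover have "a1\<^sup>2 - a2\<^sup>2 = int p" using re b by simp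
    moreover have "- (a2\<^sup>2) \<noteq> int p" using gt2 zero_le_power2[of a2] by linarith
    ultimately show False using not_square[of a1] by auto
  qed
  obtain v c1 c2 where c: "odd (c1\<^sup>2 + c2\<^sup>2)" "b1\<^sup>2 + b2\<^sup>2 = 2 ^ v * (c1\<^sup>2 + c2\<^sup>2)"
    "Legendre (b1 + b2 * \<iota>) p = Legendre (c1 + c2 * \<iota>) p"
    "\<And>d. d dvd c1 \<Longrightarrow> d dvd c2 \<Longrightarrow> d dvd b1 \<and> d dvd b2"
    "\<And>d. odd d \<Longrightarrow> d dvd b1 \<Longrightarrow> d dvd b2 \<Longrightarrow> d dvd c1 \<and> d dvd c2"
    using gaussian_odd_part[OF iota nzb] by blast
  define n0 where "n0 = c1\<^sup>2 + c2\<^sup>2"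
  have n0: "n0 > 0" "odd n0" using c(1) unfolding n0_def
    by (auto simp: sum_power2_gt_zero_iff intro!: ccontr[of "c1\<^sup>2 + c2\<^sup>2 > 0"])
  have "(a1\<^sup>2 + a2\<^sup>2 - int p)\<^sup>2 + int p * (2 * a2)\<^sup>2 = (a1\<^sup>2 - a2\<^sup>2 - int p)\<^sup>2 + (2 * a1 * a2)\<^sup>2"
    by (simp add: power2_eq_square algebra_simps)
  also have "a1\<^sup>2 - a2\<^sup>2 - int p = b1\<^sup>2 - b2\<^sup>2 - 2 * b1 * b2" using re by linarith
  also have "2 * a1 * a2 = b1\<^sup>2 - b2\<^sup>2 + 2 * b1 * b2" using im by linarith
  also have "(b1\<^sup>2 - b2\<^sup>2 - 2 * b1 * b2)\<^sup>2 + (b1\<^sup>2 - b2\<^sup>2 + 2 * b1 * b2)\<^sup>2 = 2 * (b1\<^sup>2 + b2\<^sup>2)\<^sup>2"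
    by (simp add: power2_eq_square algebra_simps)
  also have "\<dots> = 2 * 4 ^ v * n0\<^sup>2"
  proof -
    have "(4::int) ^ v = (2 ^ v)\<^sup>2" by (simp add: power2_eq_square flip: power_mult_distrib)
    thus ?thesis unfolding c(2) n0_def by (simp add: power_mult_distrib)
  qed
  finally obtain x0 y0 where xy0: "a1\<^sup>2 + a2\<^sup>2 - int p = 2 ^ v * x0" "2 * a2 = 2 ^ v * y0"
    "x0\<^sup>2 + int p * y0\<^sup>2 = 2 * n0\<^sup>2"
    using two_power_descent[OF p8] by blast
  define h where "h = gcd a2 (gcd c1 c2)"
  have hc: "h dvd c1" "h dvd c2" "h dvd a2" unfolding h_def by (meson dvd_trans gcd_dvd1 gcd_dvd2)+
  hence hb: "h dvd b1" "h dvd b2" using c(4) by blast+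
  have h0: "h > 0"
    using n0(1) unfolding h_def n0_def by (intro gcd_pos_int[THEN iffD2]) (auto simp: sum_power2_gt_zero_iff)
  have oh: "odd h"
  proof
    assume "even h"
    hence "even c1" "even c2" using hc by (auto intro: dvd_trans)
    thus False using c(1) by simp
  qed
  have lh: "\<not> int l dvd a1 \<and> Legendre (int l) p = 1" if l: "prime l" "int l dvd h" for l
  proof -
    have ol: "odd l"
    proof
      assume "even l"
      hence "2 dvd int l" by simp
      hence "2 dvd h" using l(2) dvd_trans by blast
      thus False using oh by simp
    qed
    have d: "int l dvd a2" "int l dvd b1" "int l dvd b2" using l(2) hc hb dvd_trans by blast+
    have "int p - a1\<^sup>2 = - (a2 * a2) - b1 * b1 + b2 * b2 + 2 * b1 * b2"
      using re by (simp add: power2_eq_square)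
    hence d1: "int l dvd int p - a1\<^sup>2" using d by simp
    have na: "\<not> int l dvd a1"
    proof
      assume a: "int l dvd a1"
      hence "int l dvd (int p - a1\<^sup>2) + a1 * a1" using d1 by (intro dvd_add dvd_mult2)
      hence "int l dvd int p" by (simp add: power2_eq_square)
      hence "l = p" using l(1) prime_p primes_dvd_imp_eq by simp
      thus False using nob a d by blast
    qed
    have pl: "prime (int l)" using l(1) by simp
    have lp: "\<not> int l dvd int p"
    proof
      assume "int l dvd int p"
      hence "int l dvd a1\<^sup>2" using d1 by (simp add: dvd_diff_right_iff)
      thus False using na pl by (simp add: prime_dvd_power_iff)
    qed
    have "int l dvd a1\<^sup>2 - int p" using d1 by (simp add: dvd_diff_commute)
    hence "Legendre p l = 1" using lp by (intro Legendre_eq_1I[of a1]) (auto simp: cong_iff_dvd_diff)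
    moreover have "l \<noteq> p" using lp by auto
    ultimately show ?thesis using na reciprocity[OF l(1) ol] by simp
  qed
  have "coprime h a1"
  proof (rule ccontr)
    assume "\<not> coprime h a1"
    hence "gcd h a1 \<noteq> 1" by (simp add: coprime_iff_gcd_eq_1)
    then obtain q where q: "prime q" "q dvd nat (gcd h a1)"
      using prime_factor_nat[of "nat (gcd h a1)"] h0
      by (metis gcd_ge_0_int nat_eq_iff of_nat_1 )
    hence "int q dvd gcd h a1" by (metis gcd_ge_0_int int_dvd_int_iff int_nat_eq)
    thus False using lh[OF q(1)] by simp
  qed
  \<comment> \<open>Together with \<open>2 a1 a2 = h\<^sup>2 (...)\<close> this puts \<open>h\<^sup>2\<close>, rather than \<open>h\<close>, into \<open>a2\<close>.\<close>
  hence cop: "coprime (h\<^sup>2) (2 * a1)" using oh by (simp add: coprime_mult_right_iff)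
  obtain f1 f2 e1 e2 where f: "b1 = h * f1" "b2 = h * f2" and e: "c1 = h * e1" "c2 = h * e2"
    using hb hc unfolding dvd_def by blast
  have "2 * a1 * a2 = h\<^sup>2 * (f1\<^sup>2 - f2\<^sup>2 + 2 * f1 * f2)"
    using im unfolding f by (simp add: power2_eq_square algebra_simps)
  hence "h\<^sup>2 dvd 2 * a1 * a2" by simp
  hence "h\<^sup>2 dvd a2" using cop by (simp add: coprime_dvd_mult_right_iff)
  then obtain g where g: "a2 = h\<^sup>2 * g" by (auto elim: dvdE)
  have copv: "coprime (h\<^sup>2) (2 ^ v)" using oh by simp
  have "2 ^ v * x0 = h\<^sup>2 * (f1\<^sup>2 - f2\<^sup>2 - 2 * f1 * f2 + 2 * h\<^sup>2 * g\<^sup>2)"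
  proof -
    have "a1\<^sup>2 + a2\<^sup>2 - int p = b1\<^sup>2 - b2\<^sup>2 - 2 * b1 * b2 + 2 * a2\<^sup>2" using re by linarith
    thus ?thesis unfolding xy0(1)[symmetric] unfolding g f by (simp add: power2_eq_square algebra_simps)
  qed
  hence "h\<^sup>2 dvd 2 ^ v * x0" by simp
  hence "h\<^sup>2 dvd x0" using copv by (simp add: coprime_dvd_mult_right_iff)
  then obtain x where x: "x0 = h\<^sup>2 * x" by (auto elim: dvdE)
  have vy: "2 ^ v * y0 = h\<^sup>2 * (2 * g)" using xy0(2) g by simp
  hence "h\<^sup>2 dvd 2 ^ v * y0" by simp
  hence "h\<^sup>2 dvd y0" using copv by (simp add: coprime_dvd_mult_right_iff)
  then obtain y where y: "y0 = h\<^sup>2 * y" by (auto elim: dvdE)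
  have vg: "2 ^ v * y = 2 * g" using vy h0 unfolding y by simp
  define n where "n = e1\<^sup>2 + e2\<^sup>2"
  have n0h: "n0 = h\<^sup>2 * n" unfolding n0_def n_def e by (simp add: power2_eq_square algebra_simps)
  have np: "n > 0" "odd n" using n0 n0h h0 by (auto simp: zero_less_mult_iff)
  have "(h\<^sup>2)\<^sup>2 * (x\<^sup>2 + int p * y\<^sup>2) = (h\<^sup>2)\<^sup>2 * (2 * n\<^sup>2)"
    using xy0(3) unfolding x y n0h by (simp add: power_mult_distrib algebra_simps)
  hence main: "x\<^sup>2 + int p * y\<^sup>2 = 2 * n\<^sup>2" using h0 by simp
  \<comment> \<open>A common prime \<open>l\<close> of \<open>y\<close> and \<open>n\<close> would divide \<open>b/h\<close> and \<open>a2/h\<close>, against the choice of \<open>h\<close>.\<close>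
  have "coprime y n"
  proof (rule ccontr)
    assume "\<not> coprime y n"
    hence "gcd y n \<noteq> 1" by (simp add: coprime_iff_gcd_eq_1)
    then obtain l where l: "prime l" "l dvd nat (gcd y n)"
      using prime_factor_nat[of "nat (gcd y n)"]
      by (metis gcd_ge_0_int nat_eq_iff of_nat_1 )
    hence "int l dvd gcd y n" by (metis gcd_ge_0_int int_dvd_int_iff int_nat_eq)
    hence ly: "int l dvd y" and ln: "int l dvd n" by simp_all
    have pl: "prime (int l)" using l(1) by simp
    have ol: "odd (int l)"
    proof
      assume "even (int l)"
      hence "2 dvd n" using ln dvd_trans by blast
      thus False using np by simp
    qed
    have cl: "coprime (int l) 2" using ol by simp
    have n2: "\<not> int l dvd 2"
    proof
      assume "int l dvd 2"
      hence "int l dvd 1" using cl by (metis coprime_dvd_mult_right_iff mult_1_right)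
      thus False using pl by (simp add: not_prime_unit)
    qed
    have "int l dvd 2 * g" unfolding vg[symmetric] using ly by simp
    hence lg: "int l dvd g" using pl n2 by (simp add: prime_dvd_mult_iff)
    define w1 w2 where "w1 = f1\<^sup>2 - f2\<^sup>2 - 2 * f1 * f2" and "w2 = f1\<^sup>2 - f2\<^sup>2 + 2 * f1 * f2"
    have "h\<^sup>2 * w2 = h\<^sup>2 * (2 * a1 * g)"
      using im unfolding f g w2_def by (simp add: power2_eq_square algebra_simps)
    hence w2: "int l dvd w2" using lg h0 by simp
    have ff: "f1\<^sup>2 + f2\<^sup>2 = 2 ^ v * n"
    proof -
      have "h\<^sup>2 * (f1\<^sup>2 + f2\<^sup>2) = h\<^sup>2 * (2 ^ v * n)"
        using c(2) unfolding f n0_def[symmetric] n0h by (simp add: power2_eq_square algebra_simps)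
      thus ?thesis using h0 by simp
    qed
    have "w1\<^sup>2 + w2\<^sup>2 = 2 * (f1\<^sup>2 + f2\<^sup>2)\<^sup>2" by (simp add: w1_def w2_def power2_eq_square algebra_simps)
    hence "w1\<^sup>2 = 2 * (2 ^ v * n)\<^sup>2 - w2 * w2" unfolding ff by (simp add: power2_eq_square)
    moreover have "int l dvd 2 * (2 ^ v * n)\<^sup>2 - w2 * w2"
      using ln w2 by (simp add: power2_eq_square)
    ultimately have "int l dvd w1\<^sup>2" by simp
    hence w1: "int l dvd w1" using pl by (simp add: prime_dvd_power_iff)
    have "int l dvd w2 - w1" using w1 w2 by simp
    hence "int l dvd 2 * 2 * (f1 * f2)" by (simp add: w1_def w2_def)
    hence f12: "int l dvd f1 * f2" using pl n2 by (simp only: prime_dvd_mult_iff) blast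
    have "f1\<^sup>2 - f2\<^sup>2 = w2 - 2 * (f1 * f2)" by (simp add: w2_def)
    hence d12: "int l dvd f1\<^sup>2 - f2\<^sup>2" using w2 f12 by simp
    have lf: "int l dvd f1 \<and> int l dvd f2"
    proof (cases "int l dvd f1")
      case True
      hence "int l dvd f1\<^sup>2" by (simp add: power2_eq_square)
      hence "int l dvd f2\<^sup>2" using d12 by (simp add: dvd_diff_right_iff)
      thus ?thesis using True pl by (simp add: prime_dvd_power_iff)
    next
      case False
      hence f2: "int l dvd f2" using f12 pl by (simp add: prime_dvd_mult_iff)
      hence "int l dvd f2\<^sup>2" by (simp add: power2_eq_square)
      hence "int l dvd f1\<^sup>2" using d12 by (simp add: dvd_diff_left_iff)
      thus ?thesis using f2 pl by (simp add: prime_dvd_power_iff)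
    qed
    have o: "odd (h * int l)" using oh ol by simp
    have "h * int l dvd b1" "h * int l dvd b2" unfolding f using lf by (auto intro: mult_dvd_mono)
    hence "h * int l dvd c1" "h * int l dvd c2" using c(5)[OF o] by blast+
    moreover have "h * int l dvd a2" unfolding g power2_eq_square mult.assoc using lg
      by (intro mult_dvd_mono dvd_refl) (simp add: dvd_mult)
    ultimately have "h * int l dvd h" unfolding h_def by (metis gcd_greatest h_def)
    hence "h * int l \<le> h * 1" using h0 by (intro zdvd_imp_le) auto
    hence "int l \<le> 1" using h0 by (simp add: mult_le_cancel_left)
    thus False using prime_gt_1_nat[OF l(1)] by simp
  qed
  moreover have "c1\<^sup>2 + c2\<^sup>2 = h\<^sup>2 * n" using n0h n0_def by simp
  ultimately show ?thesis
    using that[of c1 c2 n h x y] c(3) np oh main lh by blast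
qed

end

section \<open>Powers of two dividing the order of an abelian group\<close>

lemma (in comm_group) pow_image_subgroup:
  "subgroup ((\<lambda>x. x [^] (n::nat)) ` carrier G) G"
proof (rule subgroupI)
  show "(\<lambda>x. x [^] n) ` carrier G \<subseteq> carrier G" by auto
  show "(\<lambda>x. x [^] n) ` carrier G \<noteq> {}" by auto
  show "inv a \<in> (\<lambda>x. x [^] n) ` carrier G" if "a \<in> (\<lambda>x. x [^] n) ` carrier G" for a
    using that by (auto simp: nat_pow_inv[symmetric] image_iff intro!: bexI[where x = "inv _"])
  show "a \<otimes> b \<in> (\<lambda>x. x [^] n) ` carrier G"
    if "a \<in> (\<lambda>x. x [^] n) ` carrier G" "b \<in> (\<lambda>x. x [^] n) ` carrier G" for a b
  proof -
    from that obtain x y where "x \<in> carrier G" "y \<in> carrier G" "a = x [^] n" "b = y [^] n" by blast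
    thus ?thesis by (auto simp: image_iff pow_mult_distrib m_comm intro!: bexI[of _ "x \<otimes> y"])
  qed
qed

text \<open>Cauchy's theorem for the prime two.\<close>

lemma (in group) even_subgroup_involution:
  assumes "finite (carrier G)" "subgroup H G" "even (card H)"
  obtains x where "x \<in> H" "x \<noteq> \<one>" "x \<otimes> x = \<one>"
proof -
  interpret H: group "G\<lparr>carrier := H\<rparr>" using subgroup_imp_group[OF assms(2)] .
  have fin: "finite H" using assms(1,2) finite_subset subgroup.subset by metis
  have "\<exists>K. subgroup K (G\<lparr>carrier := H\<rparr>) \<and> card K = 2 ^ 1"
    by (rule sylow_thm[of 2 _ 1 "card H div 2"]) (use fin assms(3) H.is_group in \<open>auto simp: Coset.order_def\<close>)
  then obtain K where K: "subgroup K (G\<lparr>carrier := H\<rparr>)" "card K = 2" by auto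
  have one: "\<one> \<in> K" using subgroup.one_closed[OF K(1)] by simp
  obtain x where x: "K = {\<one>, x}" "x \<noteq> \<one>"
    using K(2) one unfolding card_2_iff by (metis doubleton_eq_iff insertE singletonD)
  have xH: "x \<in> H" using subgroup.subset[OF K(1)] x by auto
  hence xG: "x \<in> carrier G" using assms(2) subgroup.mem_carrier by metis
  have "x \<otimes> x \<in> K" using subgroup.m_closed[OF K(1), of x x] x by simp
  hence "x \<otimes> x = \<one>" using x xG l_cancel_one by auto
  thus ?thesis using that xH x by blast
qed

text \<open>Let \<open>H\<^sub>k\<close> be the group of \<open>2\<^sup>k\<close>-th powers. As long as \<open>H\<^sub>k\<close> contains the only involution \<open>t\<close>, squaring
maps it two-to-one onto \<open>H\<^sub>k\<^sub>+\<^sub>1\<close>, so the order halves at each step; and \<open>H\<^sub>k\<^sub>+\<^sub>1\<close> contains \<open>t\<close> as soon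
as its order is even.\<close>

lemma (in comm_group) two_power_dvd_order_iff:
  assumes fin: "finite (carrier G)" and t: "t \<in> carrier G" "t \<noteq> \<one>"
    and inv: "\<And>x. x \<in> carrier G \<Longrightarrow> x \<otimes> x = \<one> \<longleftrightarrow> x = \<one> \<or> x = t"
  shows "2 ^ Suc k dvd Coset.order G \<longleftrightarrow> (\<exists>g\<in>carrier G. g [^] (2 ^ k :: nat) = t)"
proof
  assume "\<exists>g\<in>carrier G. g [^] (2 ^ k :: nat) = t"
  then obtain g where g: "g \<in> carrier G" "g [^] (2 ^ k :: nat) = t" by blast
  have "g [^] (2 ^ Suc k :: nat) = t \<otimes> t"
    using g by (simp add: mult_2 nat_pow_mult[symmetric])
  also have "\<dots> = \<one>" using inv t by blast
  finally have "ord g dvd 2 ^ Suc k" using pow_eq_id g by blast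
  then obtain i where i: "ord g = 2 ^ i" "i \<le> Suc k" using divides_primepow_nat[OF two_is_prime_nat] by blast
  moreover have "\<not> ord g dvd 2 ^ k" using pow_eq_id g t(2) by metis
  ultimately have "i = Suc k" using le_imp_power_dvd le_Suc_eq by metis
  thus "2 ^ Suc k dvd Coset.order G" using ord_dvd_group_order[OF g(1)] i by simp
next
  define H where "H = (\<lambda>k::nat. (\<lambda>x. x [^] (2 ^ k :: nat)) ` carrier G)"
  have sub: "subgroup (H k) G" for k unfolding H_def by (rule pow_image_subgroup)
  assume "2 ^ Suc k dvd Coset.order G"
  hence "t \<in> H k \<and> Coset.order G = 2 ^ k * card (H k)"
  proof (induction k)
    case 0
    have "H 0 = carrier G" by (auto simp: H_def image_iff)
    moreover have "Coset.order G = card (carrier G)" by (rule Coset.order_def)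
    ultimately show ?case using t by simp
  next
    case (Suc k)
    have "(2::nat) ^ Suc k dvd 2 ^ Suc (Suc k)" by (rule le_imp_power_dvd) simp
    hence "2 ^ Suc k dvd Coset.order G" using Suc.prems dvd_trans by blast
    hence IH: "t \<in> H k" "Coset.order G = 2 ^ k * card (H k)" using Suc.IH by auto
    have finH: "finite (H k)" for k using fin by (simp add: H_def)
    have HS: "H (Suc k) = (\<lambda>x. x \<otimes> x) ` H k"
      unfolding H_def image_image by (intro image_cong) (simp_all add: mult_2 nat_pow_mult)
    have fib: "{x \<in> H k. x \<otimes> x = z \<otimes> z} = {z, z \<otimes> t}" if z: "z \<in> H k" for z
    proof (intro equalityI subsetI)
      fix x assume x: "x \<in> {x \<in> H k. x \<otimes> x = z \<otimes> z}"
      have car: "x \<in> carrier G" "z \<in> carrier G" using x z sub subgroup.mem_carrier by fastforce+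
      have "(inv z \<otimes> x) \<otimes> (inv z \<otimes> x) = (inv z \<otimes> inv z) \<otimes> (x \<otimes> x)"
        using car by (simp add: m_ac)
      also have "\<dots> = (inv z \<otimes> inv z) \<otimes> (z \<otimes> z)" using x by simp
      also have "\<dots> = (inv z \<otimes> z) \<otimes> (inv z \<otimes> z)" using car by (simp only: m_ac inv_closed m_closed)
      also have "\<dots> = \<one>" using car by simp
      finally have "inv z \<otimes> x = \<one> \<or> inv z \<otimes> x = t" using inv[of "inv z \<otimes> x"] car by simp
      moreover have "x = z \<otimes> (inv z \<otimes> x)" using car by (simp add: m_assoc[symmetric])
      ultimately show "x \<in> {z, z \<otimes> t}" using car by auto
    next
      fix x assume x: "x \<in> {z, z \<otimes> t}"
      have car: "z \<in> carrier G" using z sub subgroup.mem_carrier by fastforce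
      have "(z \<otimes> t) \<otimes> (z \<otimes> t) = (z \<otimes> z) \<otimes> (t \<otimes> t)" using car t(1) by (simp add: m_ac)
      also have "\<dots> = z \<otimes> z" using inv[OF t(1)] car by simp
      finally show "x \<in> {x \<in> H k. x \<otimes> x = z \<otimes> z}"
        using x z IH(1) subgroup.m_closed[OF sub] by auto
    qed
    have fib2: "card {x \<in> H k. x \<otimes> x = y} = 2" if "y \<in> H (Suc k)" for y
    proof -
      obtain z where z: "z \<in> H k" "y = z \<otimes> z" using \<open>y \<in> H (Suc k)\<close> unfolding HS by auto
      have car: "z \<in> carrier G" using z sub subgroup.mem_carrier by fastforce
      hence "z \<noteq> z \<otimes> t" using t by (metis l_cancel r_one one_closed)
      thus ?thesis using fib[OF z(1)] z(2) by simp
    qed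
    have "card (H k) = (\<Sum>y\<in>(\<lambda>x. x \<otimes> x) ` H k. card {x \<in> H k. x \<otimes> x = y})"
      using sum.image_gen[OF finH[of k], of "\<lambda>_. 1::nat" "\<lambda>x. x \<otimes> x"] by simp
    also have "\<dots> = (\<Sum>y\<in>H (Suc k). 2)" unfolding HS[symmetric] by (intro sum.cong refl fib2)
    finally have half: "card (H k) = 2 * card (H (Suc k))" by simp
    hence ord: "Coset.order G = 2 ^ Suc k * card (H (Suc k))" using IH(2) by simp
    hence "even (card (H (Suc k)))" using Suc.prems by (simp add: mult.commute)
    then obtain x where x: "x \<in> H (Suc k)" "x \<noteq> \<one>" "x \<otimes> x = \<one>"
      using even_subgroup_involution[OF fin sub] by blast
    hence "x = t" using inv sub subgroup.mem_carrier by metis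
    thus ?case using x ord by simp
  qed
  thus "\<exists>g\<in>carrier G. g [^] (2 ^ k :: nat) = t" by (auto simp: H_def)
qed

section \<open>Ideal products in the complex numbers\<close>

lemma CC_simps [simp]:
  "carrier CC = UNIV" "x \<otimes>\<^bsub>CC\<^esub> y = x * y" "x \<oplus>\<^bsub>CC\<^esub> y = x + y" "\<one>\<^bsub>CC\<^esub> = 1" "\<zero>\<^bsub>CC\<^esub> = 0"
  by (simp_all add: ring_of_type_algebra_def)

lemma CC_a_inv [simp]: "\<ominus>\<^bsub>CC\<^esub> x = - x"
  by (rule abelian_group.minus_equality[OF ring.is_abelian_group[OF ring_from_type_algebra]]) auto

lemma CC_m_inv: "x \<noteq> 0 \<Longrightarrow> inv\<^bsub>CC\<^esub> x = inverse x"
  by (rule monoid.inv_char[OF ring.is_monoid[OF ring_from_type_algebra]]) auto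

lemma subgroup_CC_iff:
  "subgroup I (add_monoid CC) \<longleftrightarrow> 0 \<in> I \<and> (\<forall>x\<in>I. \<forall>y\<in>I. x + y \<in> I) \<and> (\<forall>x\<in>I. - x \<in> I)"
  using CC_a_inv by (auto simp: subgroup_def a_inv_def)

lemma ideal_prod_CC_I: "i \<in> I \<Longrightarrow> j \<in> J \<Longrightarrow> i * j \<in> ideal_prod CC I J"
  using ideal_prod.prod[of i I j J CC] by simp

lemma ideal_prod_CC_add:
  "x \<in> ideal_prod CC I J \<Longrightarrow> y \<in> ideal_prod CC I J \<Longrightarrow> x + y \<in> ideal_prod CC I J"
  using ideal_prod.sum[of x CC I J y] by simp

lemma ideal_prod_CC_induct [consumes 1, case_names prod sum]:
  assumes "x \<in> ideal_prod CC I J" "\<And>i j. i \<in> I \<Longrightarrow> j \<in> J \<Longrightarrow> Q (i * j)"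
    "\<And>x y. x \<in> ideal_prod CC I J \<Longrightarrow> y \<in> ideal_prod CC I J \<Longrightarrow> Q x \<Longrightarrow> Q y \<Longrightarrow> Q (x + y)"
  shows "Q x"
  using assms(1) by (induction rule: ideal_prod.induct) (use assms(2,3) in auto)

lemma ideal_prod_CC_least:
  assumes "\<And>i j. i \<in> I \<Longrightarrow> j \<in> J \<Longrightarrow> i * j \<in> L" "\<And>x y. x \<in> L \<Longrightarrow> y \<in> L \<Longrightarrow> x + y \<in> L"
  shows "ideal_prod CC I J \<subseteq> L"
proof
  fix x assume "x \<in> ideal_prod CC I J"
  thus "x \<in> L" by (induction rule: ideal_prod_CC_induct) (use assms in auto)
qed

lemma ideal_prod_CC_commute: "ideal_prod CC I J = ideal_prod CC J I"
proof -
  have "ideal_prod CC I J \<subseteq> ideal_prod CC J I" for I J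
  proof (rule ideal_prod_CC_least)
    show "i * j \<in> ideal_prod CC J I" if "i \<in> I" "j \<in> J" for i j
      using ideal_prod_CC_I[OF that(2,1)] by (simp add: mult.commute)
  qed (rule ideal_prod_CC_add)
  thus ?thesis by blast
qed

lemma ideal_prod_CC_assoc:
  "ideal_prod CC (ideal_prod CC I J) L = ideal_prod CC I (ideal_prod CC J L)"
proof -
  have *: "ideal_prod CC (ideal_prod CC I J) L \<subseteq> ideal_prod CC I (ideal_prod CC J L)" for I J L
  proof (rule ideal_prod_CC_least)
    fix s l assume s: "s \<in> ideal_prod CC I J" and l: "l \<in> L"
    show "s * l \<in> ideal_prod CC I (ideal_prod CC J L)" using s
    proof (induction rule: ideal_prod_CC_induct)
      case (prod i j)
      thus ?case using l by (simp add: mult.assoc ideal_prod_CC_I)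
    next
      case (sum x y)
      thus ?case by (simp add: distrib_right ideal_prod_CC_add)
    qed
  qed (rule ideal_prod_CC_add)
  show ?thesis using *[of I J L] *[of L J I] by (simp add: ideal_prod_CC_commute)
qed

lemma ideal_prod_CC_mono: "I \<subseteq> I' \<Longrightarrow> J \<subseteq> J' \<Longrightarrow> ideal_prod CC I J \<subseteq> ideal_prod CC I' J'"
  by (rule ideal_prod_CC_least) (auto intro: ideal_prod_CC_add ideal_prod_CC_I)

lemma ideal_prod_CC_scale: "ideal_prod CC ((*) c ` I) J = (*) c ` ideal_prod CC I J"
proof
  show "ideal_prod CC ((*) c ` I) J \<subseteq> (*) c ` ideal_prod CC I J"
  proof (rule ideal_prod_CC_least)
    fix i j assume "i \<in> (*) c ` I" "j \<in> J"
    then obtain i' where "i = c * i'" "i' \<in> I" by blast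
    thus "i * j \<in> (*) c ` ideal_prod CC I J" using \<open>j \<in> J\<close>
      by (auto simp: mult.assoc intro!: imageI ideal_prod_CC_I)
  next
    fix x y assume "x \<in> (*) c ` ideal_prod CC I J" "y \<in> (*) c ` ideal_prod CC I J"
    thus "x + y \<in> (*) c ` ideal_prod CC I J"
      by (auto simp: distrib_left[symmetric] intro!: imageI ideal_prod_CC_add)
  qed
  show "(*) c ` ideal_prod CC I J \<subseteq> ideal_prod CC ((*) c ` I) J"
  proof
    fix x assume "x \<in> (*) c ` ideal_prod CC I J"
    then obtain s where s: "x = c * s" "s \<in> ideal_prod CC I J" by blast
    from s(2) have "c * s \<in> ideal_prod CC ((*) c ` I) J"
    proof (induction rule: ideal_prod_CC_induct)
      case (prod i j)
      hence "c * i \<in> (*) c ` I" by blast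
      from ideal_prod_CC_I[OF this prod(2)] show ?case by (simp add: mult.assoc)
    next
      case (sum x y)
      thus ?case by (simp add: distrib_left ideal_prod_CC_add)
    qed
    thus "x \<in> ideal_prod CC ((*) c ` I) J" using s by simp
  qed
qed

lemma ideal_prod_CC_scale_right: "ideal_prod CC I ((*) c ` J) = (*) c ` ideal_prod CC I J"
  using ideal_prod_CC_scale[of c J I] by (simp add: ideal_prod_CC_commute)

lemma ideal_prod_CC_cnj: "cnj ` ideal_prod CC I J = ideal_prod CC (cnj ` I) (cnj ` J)"
proof
  have *: "cnj ` ideal_prod CC I J \<subseteq> ideal_prod CC (cnj ` I) (cnj ` J)" for I J
  proof
    fix x assume "x \<in> cnj ` ideal_prod CC I J"
    then obtain s where s: "x = cnj s" "s \<in> ideal_prod CC I J" by blast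
    from s(2) have "cnj s \<in> ideal_prod CC (cnj ` I) (cnj ` J)"
      by (induction rule: ideal_prod_CC_induct) (auto intro: ideal_prod_CC_I ideal_prod_CC_add)
    thus "x \<in> ideal_prod CC (cnj ` I) (cnj ` J)" using s by simp
  qed
  show "cnj ` ideal_prod CC I J \<subseteq> ideal_prod CC (cnj ` I) (cnj ` J)" by (rule *)
  have "cnj ` ideal_prod CC (cnj ` I) (cnj ` J) \<subseteq> ideal_prod CC (cnj ` cnj ` I) (cnj ` cnj ` J)" by (rule *)
  hence "cnj ` ideal_prod CC (cnj ` I) (cnj ` J) \<subseteq> ideal_prod CC I J" by (simp add: image_image)
  hence "cnj ` cnj ` ideal_prod CC (cnj ` I) (cnj ` J) \<subseteq> cnj ` ideal_prod CC I J" by (rule image_mono)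
  thus "ideal_prod CC (cnj ` I) (cnj ` J) \<subseteq> cnj ` ideal_prod CC I J" by (simp add: image_image)
qed

lemma scale_scale: "(*) (a::complex) ` (*) b ` I = (*) (a * b) ` I"
  by (simp add: image_image mult.assoc)

lemma scale_one: "(*) (1::complex) ` I = I"
  by simp

lemma cnj_scale: "cnj ` (*) c ` I = (*) (cnj c) ` cnj ` I"
  by (simp add: image_image)

text \<open>The least positive element generates.\<close>

lemma int_subgroup_principal:
  fixes S :: "int set"
  assumes "0 \<in> S" "\<And>x y. x \<in> S \<Longrightarrow> y \<in> S \<Longrightarrow> x + y \<in> S" "\<And>x. x \<in> S \<Longrightarrow> - x \<in> S" "s \<in> S" "s \<noteq> 0"
  obtains d where "d > 0" "S = {d * x | x. True}"
proof -
  have mul: "of_nat k * x \<in> S" if "x \<in> S" for k x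
    by (induction k) (use assms that in \<open>auto simp: distrib_right\<close>)
  have mulz: "k * x \<in> S" if "x \<in> S" for k x
    using mul[OF that, of "nat \<bar>k\<bar>"] assms(3)[of "\<bar>k\<bar> * x"] by (cases "k \<ge> 0") auto
  define P where "P = (\<lambda>n::nat. n > 0 \<and> int n \<in> S)"
  have "P (nat \<bar>s\<bar>)" using assms(3-5) by (auto simp: P_def abs_if)
  hence d: "P (LEAST n. P n)" by (rule LeastI)
  define d where "d = (LEAST n. P n)"
  have d0: "d > 0" "int d \<in> S" using d by (auto simp: d_def P_def)
  have "x \<in> {int d * x | x. True}" if x: "x \<in> S" for x
  proof -
    have "x mod int d = x + - (x div int d * int d)" by (simp add: minus_div_mult_eq_mod[symmetric])
    hence m: "x mod int d \<in> S" using assms(2)[OF x assms(3)[OF mulz[OF d0(2)]]] by simp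
    have "x mod int d = 0"
    proof (rule ccontr)
      assume "x mod int d \<noteq> 0"
      moreover have "0 \<le> x mod int d" "x mod int d < int d" using d0(1) by simp_all
      ultimately have pos: "0 < x mod int d" "x mod int d < int d" by linarith+
      hence "P (nat (x mod int d))" using m by (simp add: P_def)
      hence "d \<le> nat (x mod int d)" unfolding d_def by (rule Least_le)
      thus False using pos by linarith
    qed
    hence "x = int d * (x div int d)" by (metis add.right_neutral mult_div_mod_eq)
    thus ?thesis by blast
  qed
  moreover have "int d * x \<in> S" for x using mulz[OF d0(2), of x] by (simp add: mult.commute)
  ultimately have "S = {int d * x | x. True}" by auto
  thus ?thesis using that[of "int d"] d0 by simp
qed

section \<open>The quadratic order and its fractional ideals\<close>

context prime_1_mod_4
begin

definition om :: complex where "om = csqrt (- of_nat p)"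

definition A :: "complex set" where "A = {of_int x + of_int y * om | x y. True}"

definition K :: "complex set" where "K = {a / of_int d | a d. a \<in> A \<and> d \<noteq> 0}"

text \<open>For \<open>n\<close> dividing \<open>m\<^sup>2 + p\<close> this is the ideal \<open>(n, m + \<surd>-p)\<close>, whose quotient ring is \<open>\<int>/n\<close>; every
fractional ideal is a rational multiple of one of these.\<close>

definition idl :: "int \<Rightarrow> int \<Rightarrow> complex set" where
  "idl n m = {of_int n * of_int x + (of_int m + om) * of_int y | x y. True}"

lemma om_eq: "om = \<i> * complex_of_real (sqrt p)"
  by (simp add: om_def csqrt_of_real_nonpos)

lemma om_sq: "om * om = - of_nat p"
  by (simp add: om_eq power2_eq_square[symmetric] power_mult_distrib flip: of_real_power)

lemma om_sq': "om * (om * z) = - of_nat p * z"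
  by (simp add: om_sq mult.assoc[symmetric])

lemma cnj_om [simp]: "cnj om = - om"
  by (simp add: om_eq)

lemma sqrt_p_pos: "sqrt (real p) > 0"
  using gt2 by simp

lemma lin_eq_iff [simp]:
  "of_int x + of_int y * om = of_int x' + of_int y' * om \<longleftrightarrow> x = x' \<and> y = y'"
  using sqrt_p_pos by (auto simp: om_eq complex_eq_iff)

lemma lin_eq_0_iff: "of_int x + of_int y * om = 0 \<longleftrightarrow> x = 0 \<and> y = 0"
  using lin_eq_iff[of x y 0 0] by simp

lemma AI [intro]: "of_int x + of_int y * om \<in> A"
  by (auto simp: A_def)

lemma AE:
  assumes "a \<in> A" obtains x y where "a = of_int x + of_int y * om"
  using assms by (auto simp: A_def)

lemma A_add: "a \<in> A \<Longrightarrow> b \<in> A \<Longrightarrow> a + b \<in> A"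
proof -
  assume "a \<in> A" "b \<in> A"
  then obtain x y x' y' where *: "a = of_int x + of_int y * om" "b = of_int x' + of_int y' * om" by (elim AE)
  have "a + b = of_int (x + x') + of_int (y + y') * om" by (simp add: * algebra_simps)
  thus ?thesis by (simp only: AI)
qed

lemma A_minus: "a \<in> A \<Longrightarrow> - a \<in> A"
proof -
  assume "a \<in> A"
  then obtain x y where *: "a = of_int x + of_int y * om" by (elim AE)
  have "- a = of_int (- x) + of_int (- y) * om" by (simp add: *)
  thus ?thesis by (simp only: AI)
qed

lemma A_diff: "a \<in> A \<Longrightarrow> b \<in> A \<Longrightarrow> a - b \<in> A"
  using A_add[of a "- b"] A_minus[of b] by simp

lemma lin_mult:
  "(of_int x + of_int y * om) * (of_int x' + of_int y' * om) =
   of_int (x * x' - int p * y * y') + of_int (x * y' + y * x') * om"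
  by (simp add: algebra_simps om_sq om_sq')

lemma A_mult: "a \<in> A \<Longrightarrow> b \<in> A \<Longrightarrow> a * b \<in> A"
  by (elim AE) (simp only: lin_mult AI)

lemma A_of_int [intro, simp]: "of_int x \<in> A"
  using AI[of x 0] by simp

lemma A_0 [simp]: "0 \<in> A" and A_1 [simp]: "1 \<in> A" and A_om [simp]: "om \<in> A"
  using AI[of 0 0] AI[of 1 0] AI[of 0 1] by auto

lemma A_cnj: "a \<in> A \<Longrightarrow> cnj a \<in> A"
proof -
  assume "a \<in> A"
  then obtain x y where *: "a = of_int x + of_int y * om" by (elim AE)
  have "cnj a = of_int x + of_int (- y) * om" by (simp add: *)
  thus ?thesis by (simp only: AI)
qed

lemma norm_lin:
  "(of_int x + of_int y * om) * cnj (of_int x + of_int y * om) = of_int (x\<^sup>2 + int p * y\<^sup>2)"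
  by (simp add: algebra_simps om_sq om_sq' power2_eq_square)

lemma generate_ring_A: "generate_ring CC {om} = A"
proof
  show "generate_ring CC {om} \<subseteq> A"
  proof
    fix x assume "x \<in> generate_ring CC {om}"
    thus "x \<in> A" by (induction rule: generate_ring.induct) (auto simp: A_add A_mult A_minus)
  qed
  have one: "1 \<in> generate_ring CC {om}" using generate_ring.one[of CC] by simp
  have neg: "- x \<in> generate_ring CC {om}" if "x \<in> generate_ring CC {om}" for x
    using generate_ring.a_inv[OF that] by simp
  have add: "x + y \<in> generate_ring CC {om}" if "x \<in> generate_ring CC {om}" "y \<in> generate_ring CC {om}" for x y
    using generate_ring.eng_add[OF that] by simp
  have mult: "x * y \<in> generate_ring CC {om}" if "x \<in> generate_ring CC {om}" "y \<in> generate_ring CC {om}" for x y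
    using generate_ring.eng_mult[OF that] by simp
  have zero: "0 \<in> generate_ring CC {om}" using add[OF one neg[OF one]] by simp
  have nat: "of_nat n \<in> generate_ring CC {om}" for n
    by (induction n) (auto intro: zero add one)
  have int: "of_int n \<in> generate_ring CC {om}" for n
    using nat[of "nat \<bar>n\<bar>"] neg[OF nat[of "nat \<bar>n\<bar>"]] by (cases "n \<ge> 0") auto
  have "om \<in> generate_ring CC {om}" by (rule generate_ring.incl) simp
  thus "A \<subseteq> generate_ring CC {om}" by (auto elim!: AE intro!: add mult int)
qed

lemma KI: "a \<in> A \<Longrightarrow> d \<noteq> 0 \<Longrightarrow> a / of_int d \<in> K"
  by (auto simp: K_def)

lemma K_of_A: "a \<in> A \<Longrightarrow> a \<in> K"
  unfolding K_def by (intro CollectI exI[of _ a] exI[of _ 1]) auto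

lemma K_add: "a \<in> K \<Longrightarrow> b \<in> K \<Longrightarrow> a + b \<in> K"
proof -
  assume "a \<in> K" "b \<in> K"
  then obtain x d y e where *: "a = x / of_int d" "b = y / of_int e" "x \<in> A" "y \<in> A" "d \<noteq> 0" "e \<noteq> 0"
    unfolding K_def by blast
  have "a + b = (x * of_int e + y * of_int d) / of_int (d * e)" using * by (simp add: field_simps)
  moreover have "x * of_int e + y * of_int d \<in> A" using * by (intro A_add A_mult) auto
  moreover have "d * e \<noteq> 0" using * by simp
  ultimately show ?thesis by (metis KI)
qed

lemma K_minus: "a \<in> K \<Longrightarrow> - a \<in> K"
proof -
  assume "a \<in> K"
  then obtain x d where *: "a = x / of_int d" "x \<in> A" "d \<noteq> 0" unfolding K_def by blast
  have "- a = (- x) / of_int d" using * by simp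
  thus ?thesis unfolding K_def using * A_minus by blast
qed

lemma K_mult: "a \<in> K \<Longrightarrow> b \<in> K \<Longrightarrow> a * b \<in> K"
proof -
  assume "a \<in> K" "b \<in> K"
  then obtain x d y e where *: "a = x / of_int d" "b = y / of_int e" "x \<in> A" "y \<in> A" "d \<noteq> 0" "e \<noteq> 0"
    unfolding K_def by blast
  have "a * b = (x * y) / of_int (d * e)" using * by (simp add: field_simps)
  moreover have "x * y \<in> A" using * by (intro A_mult) auto
  moreover have "d * e \<noteq> 0" using * by simp
  ultimately show ?thesis by (metis KI)
qed

lemma norm_A_pos:
  assumes "a \<in> A" "a \<noteq> 0"
  obtains N :: int where "N > 0" "a * cnj a = of_int N"
proof -
  obtain x y where a: "a = of_int x + of_int y * om" using assms(1) by (elim AE)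
  have "x \<noteq> 0 \<or> y \<noteq> 0" using assms(2) a by auto
  hence "x\<^sup>2 + int p * y\<^sup>2 > 0" using gt2
    by (cases "y = 0") (auto intro!: add_nonneg_pos mult_pos_pos)
  thus ?thesis using that norm_lin[of x y] a by blast
qed

lemma K_inverse: "a \<in> K \<Longrightarrow> inverse a \<in> K"
proof (cases "a = 0")
  case True
  thus "a \<in> K \<Longrightarrow> ?thesis" by simp
next
  case False
  assume "a \<in> K"
  then obtain x d where *: "a = x / of_int d" "x \<in> A" "d \<noteq> 0" unfolding K_def by blast
  hence "x \<noteq> 0" using False by auto
  then obtain N :: int where N: "N > 0" "x * cnj x = of_int N" using norm_A_pos * by blast
  have "inverse a = of_int d / x" using * by simp
  also have "\<dots> = (of_int d * cnj x) / (x * cnj x)" using \<open>x \<noteq> 0\<close> by simp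
  finally have "inverse a = (of_int d * cnj x) / of_int N" unfolding N(2) .
  moreover have "of_int d * cnj x \<in> A" using * by (intro A_mult A_cnj) auto
  moreover have "N \<noteq> 0" using N by simp
  ultimately show ?thesis by (metis KI)
qed

text \<open>Quotients of elements of \<open>A\<close> have rational denominators, because the norm of the denominator is an integer.\<close>

lemma generate_field_A: "generate_field CC A = K"
proof
  show "generate_field CC A \<subseteq> K"
  proof
    fix x assume "x \<in> generate_field CC A"
    thus "x \<in> K"
      by (induction rule: generate_field.induct)
         (auto simp: K_add K_mult K_minus K_of_A CC_m_inv K_inverse)
  qed
  show "K \<subseteq> generate_field CC A"
  proof
    fix x assume "x \<in> K"
    then obtain a d where *: "x = a / of_int d" "a \<in> A" "d \<noteq> 0" unfolding K_def by blast
    have "of_int d \<in> generate_field CC A" by (rule generate_field.incl) simp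
    hence "inverse (of_int d) \<in> generate_field CC A"
      using generate_field.m_inv[of "of_int d" CC A] *(3) by (simp add: CC_m_inv)
    moreover have "a \<in> generate_field CC A" using * by (intro generate_field.incl)
    ultimately show "x \<in> generate_field CC A"
      using generate_field.eng_mult[of a CC A "inverse (of_int d)"] * by (simp add: divide_inverse)
  qed
qed

lemma K_of_int [simp]: "of_int x \<in> K" by (simp add: K_of_A)

lemma K_divide: "a \<in> K \<Longrightarrow> b \<in> K \<Longrightarrow> a / b \<in> K"
  by (simp add: divide_inverse K_mult K_inverse)

abbreviation fi :: "complex set \<Rightarrow> bool" where "fi \<equiv> fractional_ideal A"

lemma fi_iff:
  "fi I \<longleftrightarrow> 0 \<in> I \<and> (\<forall>x\<in>I. \<forall>y\<in>I. x + y \<in> I) \<and> (\<forall>x\<in>I. - x \<in> I) \<and> I \<noteq> {0} \<and>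
     (\<forall>r\<in>A. \<forall>x\<in>I. r * x \<in> I) \<and> (\<exists>d\<in>A. d \<noteq> 0 \<and> (\<forall>x\<in>I. d * x \<in> A))"
  unfolding fractional_ideal_def subgroup_CC_iff by blast

lemma fi_0: "fi I \<Longrightarrow> 0 \<in> I" and fi_add: "fi I \<Longrightarrow> x \<in> I \<Longrightarrow> y \<in> I \<Longrightarrow> x + y \<in> I"
  and fi_minus: "fi I \<Longrightarrow> x \<in> I \<Longrightarrow> - x \<in> I" and fi_smult: "fi I \<Longrightarrow> r \<in> A \<Longrightarrow> x \<in> I \<Longrightarrow> r * x \<in> I"
  unfolding fi_iff by blast+

lemma fi_diff: "fi I \<Longrightarrow> x \<in> I \<Longrightarrow> y \<in> I \<Longrightarrow> x - y \<in> I"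
  using fi_add[of I x "- y"] fi_minus[of I y] by simp

lemma fi_nonzero: assumes "fi I" obtains x where "x \<in> I" "x \<noteq> 0"
  using assms unfolding fi_iff by blast

lemma fi_A: "fi A"
proof -
  have "A \<noteq> {0}" using A_1 by (metis singletonD zero_neq_one)
  thus ?thesis unfolding fi_iff by (auto simp: A_add A_minus A_mult intro!: bexI[of _ 1])
qed

lemma fi_scale:
  assumes "fi I" "c \<in> K" "c \<noteq> 0" shows "fi ((*) c ` I)"
proof -
  obtain a d where c: "c = a / of_int d" "a \<in> A" "d \<noteq> 0" using assms(2) unfolding K_def by blast
  obtain e where e: "e \<in> A" "e \<noteq> 0" "\<forall>x\<in>I. e * x \<in> A" using assms(1) unfolding fi_iff by blast
  obtain x where x: "x \<in> I" "x \<noteq> 0" using fi_nonzero[OF assms(1)] .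
  have "c * x \<in> (*) c ` I" "c * x \<noteq> 0" using x assms by auto
  moreover have "\<exists>d\<in>A. d \<noteq> 0 \<and> (\<forall>x\<in>(*) c ` I. d * x \<in> A)"
  proof (intro bexI conjI ballI)
    show "of_int d * e \<noteq> 0" "of_int d * e \<in> A" using c e by (auto intro: A_mult)
    fix y assume "y \<in> (*) c ` I"
    then obtain z where z: "y = c * z" "z \<in> I" by blast
    hence "of_int d * e * y = a * (e * z)" using c by simp
    with c(2) e(3) z(2) show "of_int d * e * y \<in> A" by (metis A_mult)
  qed
  moreover have "0 \<in> (*) c ` I" using fi_0[OF assms(1)] by (auto simp: image_iff intro!: bexI[of _ 0])
  moreover have "u + v \<in> (*) c ` I" if "u \<in> (*) c ` I" "v \<in> (*) c ` I" for u v
    using that fi_add[OF assms(1)] by (auto simp: distrib_left[symmetric])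
  moreover have "- u \<in> (*) c ` I" if "u \<in> (*) c ` I" for u
    using that fi_minus[OF assms(1)] by (auto simp: image_iff intro: bexI[of _ "- _"])
  moreover have "r * u \<in> (*) c ` I" if "r \<in> A" "u \<in> (*) c ` I" for r u
    using that fi_smult[OF assms(1)] by (auto simp: image_iff mult.left_commute intro: bexI[of _ "r * _"])
  ultimately show ?thesis unfolding fi_iff by blast
qed

lemma fi_cnj:
  assumes "fi I" shows "fi (cnj ` I)"
proof -
  obtain e where e: "e \<in> A" "e \<noteq> 0" "\<forall>x\<in>I. e * x \<in> A" using assms unfolding fi_iff by blast
  obtain x where x: "x \<in> I" "x \<noteq> 0" using fi_nonzero[OF assms] .
  have "cnj x \<in> cnj ` I" "cnj x \<noteq> 0" using x by auto
  moreover have "\<exists>d\<in>A. d \<noteq> 0 \<and> (\<forall>x\<in>cnj ` I. d * x \<in> A)"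
  proof (intro bexI conjI ballI)
    show "cnj e \<noteq> 0" "cnj e \<in> A" using e by (auto intro: A_cnj)
    fix y assume "y \<in> cnj ` I"
    then obtain z where z: "y = cnj z" "z \<in> I" by blast
    hence "cnj e * y = cnj (e * z)" by simp
    thus "cnj e * y \<in> A" using e z A_cnj by metis
  qed
  moreover have "0 \<in> cnj ` I" using fi_0[OF assms] by (auto simp: image_iff intro!: bexI[of _ 0])
  moreover have "u + v \<in> cnj ` I" if "u \<in> cnj ` I" "v \<in> cnj ` I" for u v
    using that fi_add[OF assms] by (auto simp: complex_cnj_add[symmetric] simp del: complex_cnj_add)
  moreover have "- u \<in> cnj ` I" if "u \<in> cnj ` I" for u
    using that fi_minus[OF assms] by (auto simp: complex_cnj_minus[symmetric] simp del: complex_cnj_minus)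
  moreover have "r * u \<in> cnj ` I" if r: "r \<in> A" "u \<in> cnj ` I" for r u
  proof -
    obtain z where z: "u = cnj z" "z \<in> I" using r by blast
    have "r * u = cnj (cnj r * z)" using z by simp
    thus ?thesis using fi_smult[OF assms A_cnj[OF r(1)] z(2)] by blast
  qed
  ultimately show ?thesis unfolding fi_iff by blast
qed

lemma fi_prod:
  assumes I: "fi I" and J: "fi J" shows "fi (ideal_prod CC I J)"
proof -
  obtain e where e: "e \<in> A" "e \<noteq> 0" "\<forall>x\<in>I. e * x \<in> A" using I unfolding fi_iff by blast
  obtain f where f: "f \<in> A" "f \<noteq> 0" "\<forall>x\<in>J. f * x \<in> A" using J unfolding fi_iff by blast
  obtain x where x: "x \<in> I" "x \<noteq> 0" using fi_nonzero[OF I] .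
  obtain y where y: "y \<in> J" "y \<noteq> 0" using fi_nonzero[OF J] .
  have "x * y \<in> ideal_prod CC I J" "x * y \<noteq> 0" using x y by (auto intro: ideal_prod_CC_I)
  moreover have "\<exists>d\<in>A. d \<noteq> 0 \<and> (\<forall>x\<in>ideal_prod CC I J. d * x \<in> A)"
  proof (intro bexI conjI ballI)
    show "e * f \<noteq> 0" "e * f \<in> A" using e f by (auto intro: A_mult)
    fix s assume "s \<in> ideal_prod CC I J"
    thus "e * f * s \<in> A"
    proof (induction rule: ideal_prod_CC_induct)
      case (prod i j)
      have "e * f * (i * j) = (e * i) * (f * j)" by simp
      thus ?case using prod e f A_mult by metis
    next
      case (sum u v)
      thus ?case by (simp add: distrib_left A_add)
    qed
  qed
  moreover have "0 \<in> ideal_prod CC I J" using ideal_prod_CC_I[OF fi_0[OF I] fi_0[OF J]] by simp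
  moreover have "r * s \<in> ideal_prod CC I J" if r: "r \<in> A" and s: "s \<in> ideal_prod CC I J" for r s
    using s
  proof (induction rule: ideal_prod_CC_induct)
    case (prod i j)
    thus ?case using ideal_prod_CC_I[OF fi_smult[OF I r prod(1)] prod(2)] by (simp add: mult.assoc)
  next
    case (sum u v)
    thus ?case by (simp add: distrib_left ideal_prod_CC_add)
  qed
  moreover from this[of "-1"] have "- s \<in> ideal_prod CC I J" if "s \<in> ideal_prod CC I J" for s
    using A_minus[OF A_1] that by simp
  ultimately show ?thesis unfolding fi_iff using ideal_prod_CC_add by blast
qed

lemma ideal_prod_A: assumes "fi I" shows "ideal_prod CC I A = I"
proof
  show "ideal_prod CC I A \<subseteq> I"
  proof (rule ideal_prod_CC_least)
    show "i * j \<in> I" if "i \<in> I" "j \<in> A" for i j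
      using fi_smult[OF assms that(2,1)] by (simp add: mult.commute)
  qed (rule fi_add[OF assms])
  show "I \<subseteq> ideal_prod CC I A"
    using ideal_prod_CC_I[of _ I 1 A] by auto
qed

lemma idlI: "of_int n * of_int x + (of_int m + om) * of_int y \<in> idl n m"
  by (auto simp: idl_def)

lemma idlE:
  assumes "z \<in> idl n m"
  obtains x y where "z = of_int n * of_int x + (of_int m + om) * of_int y"
  using assms by (auto simp: idl_def)

lemma idl_n: "of_int n \<in> idl n m"
  using idlI[of n 1 m 0] by simp

lemma idl_m: "of_int m + om \<in> idl n m"
  using idlI[of n 0 m 1] by simp

lemma fi_idl:
  assumes n: "n > 0" and dv: "n dvd m\<^sup>2 + int p" shows "fi (idl n m)"
proof -
  obtain l where l: "m\<^sup>2 + int p = n * l" using dv by (elim dvdE)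
  have om_idl: "om * z \<in> idl n m" if "z \<in> idl n m" for z
  proof -
    obtain x y where z: "z = of_int n * of_int x + (of_int m + om) * of_int y" using \<open>z \<in> idl n m\<close> by (rule idlE)
    have "(of_int (m\<^sup>2 + int p) :: complex) = of_int (n * l)" using l by simp
    hence l': "(of_nat p :: complex) = of_int n * of_int l - (of_int m)\<^sup>2" by (simp add: algebra_simps)
    have "om * z = of_int n * of_int (- m * x - l * y) + (of_int m + om) * of_int (n * x + m * y)"
      unfolding z by (simp add: algebra_simps om_sq om_sq' l' power2_eq_square)
    thus ?thesis using idlI by metis
  qed
  have add: "u + v \<in> idl n m" if "u \<in> idl n m" "v \<in> idl n m" for u v
  proof -
    obtain x y x' y' where z: "u = of_int n * of_int x + (of_int m + om) * of_int y"
      "v = of_int n * of_int x' + (of_int m + om) * of_int y'"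
      using \<open>u \<in> idl n m\<close> \<open>v \<in> idl n m\<close> by (elim idlE)
    have "u + v = of_int n * of_int (x + x') + (of_int m + om) * of_int (y + y')"
      unfolding z by (simp add: algebra_simps)
    thus ?thesis using idlI by metis
  qed
  have scale: "of_int k * u \<in> idl n m" if "u \<in> idl n m" for u k
  proof -
    obtain x y where z: "u = of_int n * of_int x + (of_int m + om) * of_int y"
      using \<open>u \<in> idl n m\<close> by (rule idlE)
    have "of_int k * u = of_int n * of_int (k * x) + (of_int m + om) * of_int (k * y)"
      unfolding z by (simp add: algebra_simps)
    thus ?thesis using idlI by metis
  qed
  have sm: "r * u \<in> idl n m" if "r \<in> A" "u \<in> idl n m" for r u
  proof -
    obtain x y where r: "r = of_int x + of_int y * om" using \<open>r \<in> A\<close> by (rule AE)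
    have "r * u = of_int x * u + of_int y * (om * u)" by (simp add: r algebra_simps)
    thus ?thesis using add scale om_idl that(2) by metis
  qed
  have sub: "1 * u \<in> A" if "u \<in> idl n m" for u
  proof -
    obtain x y where z: "u = of_int n * of_int x + (of_int m + om) * of_int y"
      using \<open>u \<in> idl n m\<close> by (rule idlE)
    have "u = of_int (n * x + m * y) + of_int y * om" unfolding z by (simp add: algebra_simps)
    thus ?thesis by (simp only: AI mult_1)
  qed
  have "of_int n \<noteq> (0::complex)" using n by simp
  hence "idl n m \<noteq> {0}" using idl_n[of n m] by auto
  moreover have "0 \<in> idl n m" using idlI[of n 0 m 0] by simp
  moreover have "- u \<in> idl n m" if "u \<in> idl n m" for u using scale[of u "-1"] that by simp
  ultimately show ?thesis unfolding fi_iff using add sm sub A_1 by (metis zero_neq_one)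
qed

lemma idl_subset_A: "idl n m \<subseteq> A"
proof
  fix u assume "u \<in> idl n m"
  then obtain x y where z: "u = of_int n * of_int x + (of_int m + om) * of_int y" by (auto simp: idl_def)
  have "u = of_int (n * x + m * y) + of_int y * om" unfolding z by (simp add: algebra_simps)
  thus "u \<in> A" by (simp only: AI)
qed

text \<open>Hermite normal form of an ideal: \<open>k\<close> generates the second coordinates of its elements. Multiplication by
\<open>\<surd>-p\<close> shows that \<open>k\<close> also divides the rational integers and the first coordinates that occur.\<close>

lemma integral_ideal_eq_idl:
  assumes J: "fi J" "J \<subseteq> A"
  obtains k n m where "k > 0" "n > 0" "n dvd m\<^sup>2 + int p" "J = (*) (of_int k) ` idl n m"
proof -
  obtain g where g: "g \<in> J" "g \<noteq> 0" using fi_nonzero[OF J(1)] .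
  obtain N :: int where N: "N > 0" "g * cnj g = of_int N" using norm_A_pos g J(2) by blast
  have NJ: "of_int N \<in> J"
    using fi_smult[OF J(1) A_cnj[of g] g(1)] g J(2) N by (simp add: mult.commute subset_iff)
  define S1 where "S1 = {x. of_int x \<in> J}"
  define S2 where "S2 = {y. \<exists>x. of_int x + of_int y * om \<in> J}"
  obtain n1 where n1: "n1 > 0" "S1 = {n1 * x | x. True}"
  proof (rule int_subgroup_principal[of S1 N])
    show "0 \<in> S1" using fi_0[OF J(1)] by (simp add: S1_def)
    show "x + y \<in> S1" if "x \<in> S1" "y \<in> S1" for x y using that fi_add[OF J(1)] by (simp add: S1_def)
    show "- x \<in> S1" if "x \<in> S1" for x using that fi_minus[OF J(1), of "of_int x"] by (simp add: S1_def)
    show "N \<in> S1" "N \<noteq> 0" using N NJ by (auto simp: S1_def)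
  qed (use that in auto)
  have NS2: "x \<in> S2" if "x \<in> S1" for x
    using that fi_smult[OF J(1) A_om, of "of_int x"] unfolding S1_def S2_def
    by (auto simp: mult.commute intro!: exI[of _ 0])
  obtain k where k: "k > 0" "S2 = {k * x | x. True}"
  proof (rule int_subgroup_principal[of S2 N])
    show "0 \<in> S2" using fi_0[OF J(1)] by (auto simp: S2_def intro!: exI[of _ 0])
    show "N \<in> S2" "N \<noteq> 0" using N NS2 NJ by (auto simp: S1_def)
    show "x + y \<in> S2" if xy: "x \<in> S2" "y \<in> S2" for x y
    proof -
      obtain u v where uv: "of_int u + of_int x * om \<in> J" "of_int v + of_int y * om \<in> J" using xy by (auto simp: S2_def)
      have "(of_int u + of_int x * om) + (of_int v + of_int y * om) = of_int (u + v) + of_int (x + y) * om"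
        by (simp add: algebra_simps)
      hence "of_int (u + v) + of_int (x + y) * om \<in> J" using fi_add[OF J(1) uv] by (simp only:)
      thus ?thesis unfolding S2_def by blast
    qed
    show "- x \<in> S2" if xy: "x \<in> S2" for x
    proof -
      obtain u where uv: "of_int u + of_int x * om \<in> J" using xy by (auto simp: S2_def)
      have "- (of_int u + of_int x * om) = of_int (- u) + of_int (- x) * om"
        by (simp add: algebra_simps)
      hence "of_int (- u) + of_int (- x) * om \<in> J" using fi_minus[OF J(1) uv] by (simp only:)
      thus ?thesis unfolding S2_def by blast
    qed
  qed (use that in auto)
  have "k \<in> S2" unfolding k(2) by (auto intro: exI[of _ 1])
  then obtain x0 where h: "of_int x0 + of_int k * om \<in> J" by (auto simp: S2_def)
  have "n1 \<in> S1" unfolding n1(2) by (auto intro: exI[of _ 1])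
  hence n1J: "of_int n1 \<in> J" and "n1 \<in> S2" using NS2 by (auto simp: S1_def)
  then obtain n where n: "n1 = k * n" unfolding k(2) by blast
  have "om * (of_int x0 + of_int k * om) = of_int (- int p * k) + of_int x0 * om"
    by (simp add: algebra_simps om_sq om_sq')
  hence "of_int (- int p * k) + of_int x0 * om \<in> J" using fi_smult[OF J(1) A_om h] by metis
  hence "x0 \<in> S2" unfolding S2_def by blast
  then obtain m where m: "x0 = k * m" unfolding k(2) by blast
  have n0: "n > 0" using n n1(1) k(1) by (simp add: zero_less_mult_iff)
  have hk: "of_int x0 + of_int k * om = of_int k * (of_int m + om)" by (simp add: m algebra_simps)
  have "(of_int m - om) * (of_int k * (of_int m + om)) = of_int (k * (m\<^sup>2 + int p))"
    by (simp add: algebra_simps om_sq om_sq' power2_eq_square)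
  moreover have "of_int m - om \<in> A" by (intro A_diff) auto
  ultimately have "of_int (k * (m\<^sup>2 + int p)) \<in> J" using fi_smult[OF J(1)] h unfolding hk by metis
  hence "k * (m\<^sup>2 + int p) \<in> S1" by (simp add: S1_def)
  then obtain w where "k * (m\<^sup>2 + int p) = k * (n * w)" unfolding n1(2) n by (auto simp: mult.assoc)
  hence "m\<^sup>2 + int p = n * w" using k(1) by simp
  hence dv: "n dvd m\<^sup>2 + int p" by simp
  have "J = (*) (of_int k) ` idl n m"
  proof
    show "(*) (of_int k) ` idl n m \<subseteq> J"
    proof
      fix u assume "u \<in> (*) (of_int k) ` idl n m"
      then obtain x y where u: "u = of_int k * (of_int n * of_int x + (of_int m + om) * of_int y)" by (auto simp: idl_def)
      have "u = of_int x * of_int n1 + of_int y * (of_int x0 + of_int k * om)"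
        unfolding u hk n by (simp add: algebra_simps)
      thus "u \<in> J" using fi_add[OF J(1) fi_smult[OF J(1) A_of_int n1J] fi_smult[OF J(1) A_of_int h]] by metis
    qed
    show "J \<subseteq> (*) (of_int k) ` idl n m"
    proof
      fix u assume u: "u \<in> J"
      hence "u \<in> A" using J(2) by blast
      then obtain x y where xy: "u = of_int x + of_int y * om" by (rule AE)
      hence "y \<in> S2" using u by (auto simp: S2_def)
      then obtain y' where y': "y = k * y'" unfolding k(2) by blast
      have "u - of_int y' * (of_int x0 + of_int k * om) \<in> J"
        by (intro fi_diff[OF J(1)] u fi_smult[OF J(1)] h A_of_int)
      moreover have "u - of_int y' * (of_int x0 + of_int k * om) = of_int (x - y' * x0)"
        by (simp add: xy y' algebra_simps)
      ultimately have "x - y' * x0 \<in> S1" by (simp add: S1_def)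
      then obtain x' where x': "x - y' * x0 = n1 * x'" unfolding n1(2) by blast
      hence "x = k * n * x' + y' * (k * m)" using n m by (simp add: algebra_simps)
      hence "u = of_int k * (of_int n * of_int x' + (of_int m + om) * of_int y')"
        unfolding xy y' by (simp add: algebra_simps)
      thus "u \<in> (*) (of_int k) ` idl n m" using idlI by blast
    qed
  qed
  thus ?thesis using that k(1) n0 dv by blast
qed

lemma fractional_ideal_eq_idl:
  assumes I: "fi I"
  obtains k N n m where "k > 0" "N > 0" "n > 0" "n dvd m\<^sup>2 + int p" "I = (*) (of_int k / of_int N) ` idl n m"
proof -
  obtain d where d: "d \<in> A" "d \<noteq> 0" "\<forall>x\<in>I. d * x \<in> A" using I unfolding fi_iff by blast
  obtain N :: int where N: "N > 0" "d * cnj d = of_int N" using norm_A_pos d by blast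
  have fJ: "fi ((*) (of_int N) ` I)" using N by (intro fi_scale I) auto
  have "of_int N * x \<in> A" if "x \<in> I" for x
  proof -
    have "of_int N * x = cnj d * (d * x)" unfolding N(2)[symmetric] by simp
    thus ?thesis using d that A_cnj A_mult by metis
  qed
  hence "(*) (of_int N) ` I \<subseteq> A" by blast
  then obtain k n m where kn: "k > 0" "n > 0" "n dvd m\<^sup>2 + int p" "(*) (of_int N) ` I = (*) (of_int k) ` idl n m"
    using integral_ideal_eq_idl[OF fJ] by metis
  have "I = (*) (1 / of_int N) ` (*) (of_int N) ` I" unfolding scale_scale using N by simp
  also have "\<dots> = (*) (of_int k / of_int N) ` idl n m" unfolding kn(4) scale_scale by simp
  finally show ?thesis using that kn N by blast
qed

end

section \<open>The class group of the quadratic order\<close>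

context prime_1_mod_4
begin

lemma prime_divisor_of_gcd:
  assumes "\<not> coprime (a::int) b"
  obtains q :: nat where "prime q" "int q dvd a" "int q dvd b"
proof -
  have "nat (gcd a b) \<noteq> 1" using assms by (metis coprime_iff_gcd_eq_1 gcd_ge_0_int int_nat_eq of_nat_1)
  then obtain q where q: "prime q" "q dvd nat (gcd a b)" using prime_factor_nat by blast
  hence "int q dvd gcd a b" by (metis gcd_ge_0_int int_dvd_int_iff int_nat_eq)
  thus ?thesis using that q(1) by simp
qed

text \<open>The binary quadratic form \<open>nx\<^sup>2 + 2mxy + ly\<^sup>2\<close> is primitive, also in its middle coefficient \<open>2m\<close>. This
is where \<open>p \<equiv> 1 (mod 4)\<close> enters: at the prime \<open>2\<close> it makes \<open>m\<^sup>2 + p \<equiv> 0 (mod 4)\<close> impossible.\<close>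

lemma idl_bezout:
  assumes n: "n > 0" and l: "m\<^sup>2 + int p = n * l"
  obtains a b c where "a * n + b * (2 * m) + c * l = 1"
proof -
  have "coprime (gcd n (2 * m)) l"
  proof (rule ccontr)
    assume "\<not> coprime (gcd n (2 * m)) l"
    then obtain q where q: "prime q" "int q dvd gcd n (2 * m)" "int q dvd l" by (rule prime_divisor_of_gcd)
    have qd: "int q dvd n" "int q dvd 2 * m" using q(2) by simp_all
    have pq: "prime (int q)" using q(1) by simp
    have qq: "int q * int q dvd m\<^sup>2 + int p" unfolding l using qd(1) q(3) by (rule mult_dvd_mono)
    show False
    proof (cases "q = 2")
      case True
      hence "4 dvd m\<^sup>2 + int p" using qq by simp
      moreover have "int p mod 4 = 1" using mod4 by (metis of_nat_1 of_nat_mod of_nat_numeral)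
      ultimately have "m\<^sup>2 mod 4 = 3" by presburger
      moreover have "m\<^sup>2 mod 4 = (m mod 4)\<^sup>2 mod 4" by (simp add: power_mod)
      moreover have "m mod 4 \<in> {0, 1, 2, 3}" by auto
      ultimately show False by auto
    next
      case False
      hence "\<not> int q dvd 2" using q(1)
        by (metis int_dvd_int_iff of_nat_numeral primes_dvd_imp_eq two_is_prime_nat)
      hence qm: "int q dvd m" using qd(2) pq by (simp add: prime_dvd_mult_iff)
      hence qm2: "int q * int q dvd m\<^sup>2" unfolding power2_eq_square by (intro mult_dvd_mono)
      hence qp: "int q * int q dvd int p" using qq by (simp add: dvd_add_right_iff)
      hence "int q dvd int p" by (metis dvd_mult_left)
      hence "q = p" using q(1) prime_p primes_dvd_imp_eq by simp
      hence "int p * int p dvd int p * 1" using qp by simp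
      hence "int p dvd 1" using gt2 by (subst (asm) dvd_times_left_cancel_iff) auto
      thus False using gt2 by simp
    qed
  qed
  then obtain x y where xy: "x * gcd n (2 * m) + y * l = 1" using bezout_int[of "gcd n (2 * m)" l] by auto
  obtain u v where "u * n + v * (2 * m) = gcd n (2 * m)" using bezout_int by blast
  hence "x * (u * n + v * (2 * m)) + y * l = 1" using xy by simp
  hence "(x * u) * n + (x * v) * (2 * m) + y * l = 1" by (simp add: algebra_simps)
  thus ?thesis using that by blast
qed

text \<open>The product of \<open>(n, m + \<surd>-p)\<close> with its conjugate is generated by \<open>n\<^sup>2\<close>, \<open>2mn\<close> and \<open>nl\<close>, together with
elements of \<open>nA\<close>; by primitivity the three integers have greatest common divisor \<open>n\<close>.\<close>

lemma idl_times_cnj: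
  assumes n: "n > 0" and dv: "n dvd m\<^sup>2 + int p"
  shows "ideal_prod CC (idl n m) (cnj ` idl n m) = (*) (of_int n) ` A"
proof
  obtain l where l: "m\<^sup>2 + int p = n * l" using dv by (elim dvdE)
  hence "(of_int (m\<^sup>2 + int p) :: complex) = of_int (n * l)" by simp
  hence l': "(of_nat p :: complex) = of_int n * of_int l - (of_int m)\<^sup>2" by (simp add: algebra_simps)
  show "ideal_prod CC (idl n m) (cnj ` idl n m) \<subseteq> (*) (of_int n) ` A"
  proof (rule ideal_prod_CC_least)
    fix i j assume i: "i \<in> idl n m" and "j \<in> cnj ` idl n m"
    then obtain j' where j': "j = cnj j'" "j' \<in> idl n m" by blast
    obtain x y where x: "i = of_int n * of_int x + (of_int m + om) * of_int y" using i by (rule idlE)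
    obtain u v where u: "j' = of_int n * of_int u + (of_int m + om) * of_int v" using j'(2) by (rule idlE)
    have "i * j = of_int n * (of_int (n * x * u + m * x * v + m * u * y + l * y * v) + of_int (u * y - x * v) * om)"
      unfolding j'(1) x u by (simp add: algebra_simps om_sq om_sq' l' power2_eq_square)
    thus "i * j \<in> (*) (of_int n) ` A" using AI by blast
  next
    fix x y assume "x \<in> (*) (of_int n) ` A" "y \<in> (*) (of_int n) ` A"
    thus "x + y \<in> (*) (of_int n) ` A" by (auto simp: distrib_left[symmetric] intro!: imageI A_add)
  qed
  let ?S = "ideal_prod CC (idl n m) (cnj ` idl n m)"
  have fS: "fi ?S" using fi_prod fi_cnj fi_idl[OF n dv] by blast
  obtain a b c where abc: "a * n + b * (2 * m) + c * l = 1" using idl_bezout[OF n l] .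
  have "cnj (of_int n) \<in> cnj ` idl n m" "cnj (of_int m + om) \<in> cnj ` idl n m" using idl_n idl_m by blast+
  hence nc: "of_int n \<in> cnj ` idl n m" "of_int m - om \<in> cnj ` idl n m" by simp_all
  have 1: "of_int n * of_int n \<in> ?S" by (intro ideal_prod_CC_I idl_n nc)
  have "of_int n * (of_int m - om) + (of_int m + om) * of_int n \<in> ?S"
    by (intro ideal_prod_CC_add ideal_prod_CC_I idl_n idl_m nc)
  hence 2: "of_int n * (2 * of_int m) \<in> ?S" by (simp add: algebra_simps)
  have "(of_int m + om) * (of_int m - om) \<in> ?S" by (intro ideal_prod_CC_I idl_m nc)
  hence 3: "of_int n * of_int l \<in> ?S" by (simp add: algebra_simps om_sq l' power2_eq_square)
  have "of_int a * (of_int n * of_int n) + of_int b * (of_int n * (2 * of_int m)) + of_int c * (of_int n * of_int l) \<in> ?S"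
    by (intro fi_add[OF fS] fi_smult[OF fS] 1 2 3 A_of_int)
  also have "of_int a * (of_int n * of_int n) + of_int b * (of_int n * (2 * of_int m)) + of_int c * (of_int n * of_int l) =
      of_int n * (of_int (a * n + b * (2 * m) + c * l) :: complex)"
    by (simp add: algebra_simps)
  finally have nS: "of_int n \<in> ?S" unfolding abc by simp
  show "(*) (of_int n) ` A \<subseteq> ?S"
  proof
    fix z assume "z \<in> (*) (of_int n) ` A"
    then obtain a where "z = of_int n * a" "a \<in> A" by blast
    thus "z \<in> ?S" using fi_smult[OF fS _ nS, of a] by (simp add: mult.commute)
  qed
qed

text \<open>Invertibility is explicit: the inverse of an ideal is a rational multiple of its conjugate.\<close>

lemma fi_invertible:
  assumes "fi I"
  obtains c where "c \<in> K" "c \<noteq> 0" "ideal_prod CC I ((*) c ` cnj ` I) = A"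
proof -
  obtain k N n m where *: "k > 0" "N > 0" "n > 0" "n dvd m\<^sup>2 + int p" "I = (*) (of_int k / of_int N) ` idl n m"
    using fractional_ideal_eq_idl[OF assms] .
  let ?r = "of_int k / of_int N :: complex"
  have r: "?r \<noteq> 0" "cnj ?r = ?r" using * by auto
  have "ideal_prod CC I (cnj ` I) = (*) (?r * ?r * of_int n) ` A"
    unfolding *(5) cnj_scale ideal_prod_CC_scale ideal_prod_CC_scale_right idl_times_cnj[OF *(3,4)] scale_scale
    by (simp add: mult.assoc)
  moreover have "(1 / (?r * ?r * of_int n)) * (?r * ?r * of_int n) = 1" using * by simp
  ultimately have "ideal_prod CC I ((*) (1 / (?r * ?r * of_int n)) ` cnj ` I) = A"
    by (simp only: ideal_prod_CC_scale_right scale_scale scale_one)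
  moreover have "1 / (?r * ?r * of_int n) \<in> K"
    by (intro K_divide K_mult K_of_int) (use K_of_A in auto)
  moreover have "1 / (?r * ?r * of_int n) \<noteq> 0" using r * by auto
  ultimately show ?thesis using that by blast
qed

abbreviation "IG \<equiv> ideal_group A"
abbreviation "G \<equiv> class_group A"

lemma carrier_IG: "carrier IG = {I. fi I}"
proof -
  have "\<exists>J. fi J \<and> ideal_prod CC I J = A" if I: "fi I" for I
  proof -
    obtain c where "c \<in> K" "c \<noteq> 0" "ideal_prod CC I ((*) c ` cnj ` I) = A" using fi_invertible[OF I] .
    thus ?thesis using fi_scale[OF fi_cnj[OF I]] by blast
  qed
  thus ?thesis by (auto simp: ideal_group_def)
qed

lemma IG_simps [simp]: "I \<otimes>\<^bsub>IG\<^esub> J = ideal_prod CC I J" "\<one>\<^bsub>IG\<^esub> = A"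
  by (simp_all add: ideal_group_def)

lemma comm_group_IG: "comm_group IG"
proof (rule comm_groupI)
  show "\<exists>y\<in>carrier IG. y \<otimes>\<^bsub>IG\<^esub> x = \<one>\<^bsub>IG\<^esub>" if "x \<in> carrier IG" for x
  proof -
    have x: "fi x" using that by (simp add: carrier_IG)
    obtain c where "c \<in> K" "c \<noteq> 0" "ideal_prod CC x ((*) c ` cnj ` x) = A" using fi_invertible[OF x] .
    thus ?thesis using fi_scale[OF fi_cnj[OF x]] carrier_IG by (auto simp: ideal_prod_CC_commute[of _ x])
  qed
  show "\<one>\<^bsub>IG\<^esub> \<otimes>\<^bsub>IG\<^esub> x = x" if "x \<in> carrier IG" for x
    using that by (simp add: carrier_IG ideal_prod_CC_commute[of A] ideal_prod_A)
  show "x \<otimes>\<^bsub>IG\<^esub> y = y \<otimes>\<^bsub>IG\<^esub> x" for x y by (simp add: ideal_prod_CC_commute[of x])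
qed (auto simp: carrier_IG fi_prod fi_A ideal_prod_CC_assoc)

lemma principal_ideals_A: "principal_ideals A = {(*) c ` A | c. c \<in> K \<and> c \<noteq> 0}"
  unfolding principal_ideals_def generate_field_A ..

lemma principal_subgroup: "subgroup (principal_ideals A) IG"
proof (rule group.subgroupI)
  show "Group.group IG" using comm_group_IG by (rule comm_group.axioms)
  show "principal_ideals A \<subseteq> carrier IG"
    using fi_scale[OF fi_A] by (auto simp: principal_ideals_A carrier_IG)
  have "(*) 1 ` A \<in> principal_ideals A" unfolding principal_ideals_A
    by (intro CollectI exI[of _ 1] conjI refl K_of_A A_1) simp
  thus "principal_ideals A \<noteq> {}" by blast
  show "inv\<^bsub>IG\<^esub> a \<in> principal_ideals A" if a: "a \<in> principal_ideals A" for a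
  proof -
    obtain c where c: "a = (*) c ` A" "c \<in> K" "c \<noteq> 0" using a unfolding principal_ideals_A by blast
    have f: "fi ((*) (inverse c) ` A)" "fi a" using fi_scale[OF fi_A] c K_inverse by auto
    have "ideal_prod CC ((*) (inverse c) ` A) a = A"
      unfolding c(1) ideal_prod_CC_scale ideal_prod_CC_scale_right ideal_prod_A[OF fi_A] scale_scale using c by simp
    hence "inv\<^bsub>IG\<^esub> a = (*) (inverse c) ` A"
      using f by (intro group.inv_equality) (auto simp: carrier_IG comm_group.axioms[OF comm_group_IG])
    thus ?thesis unfolding principal_ideals_A using c K_inverse by auto
  qed
  show "a \<otimes>\<^bsub>IG\<^esub> b \<in> principal_ideals A" if ab: "a \<in> principal_ideals A" "b \<in> principal_ideals A" for a b
  proof -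
    obtain c where c: "a = (*) c ` A" "c \<in> K" "c \<noteq> 0" using ab unfolding principal_ideals_A by blast
    obtain d where d: "b = (*) d ` A" "d \<in> K" "d \<noteq> 0" using ab unfolding principal_ideals_A by blast
    have "a \<otimes>\<^bsub>IG\<^esub> b = (*) (c * d) ` A"
      unfolding c(1) d(1) IG_simps ideal_prod_CC_scale ideal_prod_CC_scale_right ideal_prod_A[OF fi_A] scale_scale
      by (simp only: mult.commute)
    thus ?thesis unfolding principal_ideals_A using c d K_mult by auto
  qed
qed

lemma comm_group_G: "comm_group G"
  unfolding class_group_def by (rule comm_group.abelian_FactGroup[OF comm_group_IG principal_subgroup])

text \<open>The coset of \<open>I\<close> modulo the principal ideals, described without reference to the group operation.\<close>

definition cls :: "complex set \<Rightarrow> complex set set" where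
  "cls I = {(*) c ` I | c. c \<in> K \<and> c \<noteq> 0}"

lemma r_coset_eq_cls:
  assumes "fi I" shows "principal_ideals A #>\<^bsub>IG\<^esub> I = cls I"
proof -
  have "ideal_prod CC ((*) c ` A) I = (*) c ` I" for c
    unfolding ideal_prod_CC_scale ideal_prod_CC_commute[of A] ideal_prod_A[OF assms] ..
  thus ?thesis unfolding r_coset_def cls_def principal_ideals_A by auto
qed

lemma cls_eq_iff:
  assumes "fi I" "fi J"
  shows "cls I = cls J \<longleftrightarrow> (\<exists>c\<in>K. c \<noteq> 0 \<and> J = (*) c ` I)"
proof
  assume *: "cls I = cls J"
  have "(*) 1 ` J \<in> cls J" unfolding cls_def by (intro CollectI exI[of _ 1] conjI refl K_of_A A_1) simp
  hence "J \<in> cls I" using * by simp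
  thus "\<exists>c\<in>K. c \<noteq> 0 \<and> J = (*) c ` I" unfolding cls_def by blast
next
  assume "\<exists>c\<in>K. c \<noteq> 0 \<and> J = (*) c ` I"
  then obtain c where c: "c \<in> K" "c \<noteq> 0" "J = (*) c ` I" by blast
  show "cls I = cls J"
  proof
    show "cls J \<subseteq> cls I"
    proof
      fix L assume "L \<in> cls J"
      then obtain d where "L = (*) d ` J" "d \<in> K" "d \<noteq> 0" unfolding cls_def by blast
      hence "L = (*) (d * c) ` I" "d * c \<in> K" "d * c \<noteq> 0" using c K_mult by (auto simp: scale_scale)
      thus "L \<in> cls I" unfolding cls_def by blast
    qed
    show "cls I \<subseteq> cls J"
    proof
      fix L assume "L \<in> cls I"
      then obtain d where d: "L = (*) d ` I" "d \<in> K" "d \<noteq> 0" unfolding cls_def by blast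
      have "L = (*) (d / c * c) ` I" using d(1) c(2) by simp
      hence "L = (*) (d / c) ` J" unfolding c(3) scale_scale .
      moreover have "d / c \<in> K" "d / c \<noteq> 0" using c d K_divide by auto
      ultimately show "L \<in> cls J" unfolding cls_def by blast
    qed
  qed
qed

lemma cls_scale: "fi I \<Longrightarrow> c \<in> K \<Longrightarrow> c \<noteq> 0 \<Longrightarrow> cls ((*) c ` I) = cls I"
  using cls_eq_iff[of I "(*) c ` I"] fi_scale by blast

lemma carrier_G: "carrier G = cls ` {I. fi I}"
  unfolding class_group_def carrier_FactGroup carrier_IG by (intro image_cong refl) (simp add: r_coset_eq_cls)

lemma cls_carrier: "fi I \<Longrightarrow> cls I \<in> carrier G"
  unfolding carrier_G by blast

lemma cls_mult:
  assumes "fi I" "fi J" shows "cls I \<otimes>\<^bsub>G\<^esub> cls J = cls (ideal_prod CC I J)"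
proof -
  interpret IG: comm_group IG by (rule comm_group_IG)
  have N: "normal (principal_ideals A) IG" using principal_subgroup IG.normal_iff_subgroup by blast
  have "(principal_ideals A #>\<^bsub>IG\<^esub> I) <#>\<^bsub>IG\<^esub> (principal_ideals A #>\<^bsub>IG\<^esub> J) = principal_ideals A #>\<^bsub>IG\<^esub> (I \<otimes>\<^bsub>IG\<^esub> J)"
    using assms by (intro normal.rcos_sum[OF N]) (simp_all add: carrier_IG)
  thus ?thesis unfolding class_group_def mult_FactGroup
    using assms fi_prod by (simp add: r_coset_eq_cls)
qed

lemma cls_one: "\<one>\<^bsub>G\<^esub> = cls A"
  unfolding class_group_def one_FactGroup cls_def principal_ideals_A ..

lemma cls_eq_one_iff: "fi I \<Longrightarrow> cls I = \<one>\<^bsub>G\<^esub> \<longleftrightarrow> (\<exists>c\<in>K. c \<noteq> 0 \<and> I = (*) c ` A)"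
  unfolding cls_one using cls_eq_iff[OF fi_A, of I] by auto

lemma cls_cnj: "fi I \<Longrightarrow> cls I \<otimes>\<^bsub>G\<^esub> cls (cnj ` I) = \<one>\<^bsub>G\<^esub>"
proof -
  assume I: "fi I"
  obtain c where "c \<in> K" "c \<noteq> 0" "ideal_prod CC I ((*) c ` cnj ` I) = A" using fi_invertible[OF I] .
  thus ?thesis using cls_mult[OF I fi_scale[OF fi_cnj[OF I]]] cls_scale[OF fi_cnj[OF I]] by (metis cls_one)
qed

text \<open>A positive integer generating an ideal is unique, which makes ideal norms well defined.\<close>

lemma real_scale_A_eq:
  assumes "(*) (of_int a) ` A = (*) (of_int b) ` A" "a > 0" "b > 0" shows "a = b"
proof -
  have *: "b dvd a" if "(*) (of_int a) ` A = (*) (of_int b) ` A" for a b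
  proof -
    have "of_int a * 1 \<in> (*) (of_int a) ` A" by (intro imageI) simp
    hence "of_int a \<in> (*) (of_int b) ` A" using that by simp
    then obtain z where z: "of_int a = of_int b * z" "z \<in> A" by blast
    obtain x y where "z = of_int x + of_int y * om" using z(2) by (rule AE)
    hence "of_int a + of_int 0 * om = of_int (b * x) + of_int (b * y) * om" using z(1) by (simp add: algebra_simps)
    hence "a = b * x" by (simp only: lin_eq_iff)
    thus ?thesis by simp
  qed
  show ?thesis using *[OF assms(1)] *[OF assms(1)[symmetric]] assms(2,3) by (intro zdvd_antisym_nonneg) auto
qed

end

section \<open>Representatives, finiteness and square classes\<close>

context prime_1_mod_4
begin

abbreviation cl :: "int \<Rightarrow> int \<Rightarrow> complex set set" where "cl n m \<equiv> cls (idl n m)"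

text \<open>The norm of \<open>I\<close> is characterised by \<open>I\<close> times its conjugate, which also covers fractional ideals.\<close>

definition has_norm :: "complex set \<Rightarrow> int \<Rightarrow> bool" where
  "has_norm I a \<longleftrightarrow> fi I \<and> a > 0 \<and> ideal_prod CC I (cnj ` I) = (*) (of_int a) ` A"

lemma has_norm_idl: "n > 0 \<Longrightarrow> n dvd m\<^sup>2 + int p \<Longrightarrow> has_norm (idl n m) n"
  by (simp add: has_norm_def fi_idl idl_times_cnj)

lemma has_norm_prod:
  assumes "has_norm I a" "has_norm J b" shows "has_norm (ideal_prod CC I J) (a * b)"
proof -
  have "ideal_prod CC (ideal_prod CC I J) (cnj ` ideal_prod CC I J) =
        ideal_prod CC (ideal_prod CC I J) (ideal_prod CC (cnj ` I) (cnj ` J))"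
    by (simp only: ideal_prod_CC_cnj)
  also have "\<dots> = ideal_prod CC I (ideal_prod CC (ideal_prod CC J (cnj ` J)) (cnj ` I))"
    by (metis ideal_prod_CC_assoc ideal_prod_CC_commute)
  also have "\<dots> = ideal_prod CC I ((*) (of_int b) ` cnj ` I)"
    using assms fi_cnj unfolding has_norm_def
    by (simp add: ideal_prod_CC_scale ideal_prod_CC_commute[of A] ideal_prod_A)
  also have "\<dots> = (*) (of_int b) ` (*) (of_int a) ` A"
    using assms unfolding has_norm_def ideal_prod_CC_scale_right by simp
  also have "\<dots> = (*) (of_int (a * b)) ` A" unfolding scale_scale by (simp add: mult.commute)
  finally show ?thesis using assms fi_prod by (simp add: has_norm_def)
qed

lemma scale_norm:
  assumes "has_norm J b"
  shows "ideal_prod CC ((*) c ` J) (cnj ` (*) c ` J) = (*) (c * cnj c * of_int b) ` A"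
proof -
  have "ideal_prod CC J (cnj ` J) = (*) (of_int b) ` A" using assms by (simp add: has_norm_def)
  thus ?thesis
    by (simp only: cnj_scale ideal_prod_CC_scale ideal_prod_CC_scale_right scale_scale) (simp only: mult_ac)
qed

text \<open>Norms of equivalent ideals differ by the norm of the quotient; with the denominator cleared this is an
equation of integers.\<close>

lemma has_norm_scale_eq:
  assumes "has_norm I a" "has_norm J b" "I = (*) ((of_int u + of_int v * om) / of_int d) ` J" "d \<noteq> 0"
  shows "a * d\<^sup>2 = (u\<^sup>2 + int p * v\<^sup>2) * b"
proof -
  let ?g = "of_int u + of_int v * om" and ?c = "(of_int u + of_int v * om) / of_int d"
  have cc: "?c * cnj ?c * (of_int d)\<^sup>2 = of_int (u\<^sup>2 + int p * v\<^sup>2)"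
    using assms(4) norm_lin[of u v] by (simp add: power2_eq_square del: complex_cnj_add complex_cnj_mult)
  have "?g \<noteq> 0"
  proof
    assume "?g = 0"
    hence "I \<subseteq> {0}" using assms(3) by auto
    thus False using assms(1) fi_nonzero unfolding has_norm_def by blast
  qed
  then obtain N where N: "N > 0" "?g * cnj ?g = of_int N" using norm_A_pos[OF AI] by blast
  hence pos: "u\<^sup>2 + int p * v\<^sup>2 > 0" using norm_lin[of u v] by (metis of_int_eq_iff)
  have "(*) (of_int a) ` A = (*) (?c * cnj ?c * of_int b) ` A"
    using scale_norm[OF assms(2), of ?c] assms(1) unfolding has_norm_def assms(3) by blast
  hence "(*) ((of_int d)\<^sup>2) ` (*) (of_int a) ` A = (*) ((of_int d)\<^sup>2) ` (*) (?c * cnj ?c * of_int b) ` A" by simp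
  moreover have "(of_int d)\<^sup>2 * of_int a = (of_int (a * d\<^sup>2) :: complex)" by simp
  moreover have "(of_int d)\<^sup>2 * (?c * cnj ?c * of_int b) = (?c * cnj ?c * (of_int d)\<^sup>2) * of_int b"
    by (simp only: mult_ac)
  moreover have "\<dots> = of_int ((u\<^sup>2 + int p * v\<^sup>2) * b)" unfolding cc by simp
  ultimately have "(*) (of_int (a * d\<^sup>2)) ` A = (*) (of_int ((u\<^sup>2 + int p * v\<^sup>2) * b)) ` A"
    unfolding scale_scale by metis
  thus ?thesis
    by (rule real_scale_A_eq) (use assms pos in \<open>auto simp: has_norm_def\<close>)
qed

lemma K_cases:
  assumes "c \<in> K"
  obtains u v d where "c = (of_int u + of_int v * om) / of_int d" "d \<noteq> 0"
proof -
  obtain a d where a: "c = a / of_int d" "a \<in> A" "d \<noteq> 0" using assms unfolding K_def by blast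
  obtain u v where "a = of_int u + of_int v * om" using a(2) by (rule AE)
  thus ?thesis using that a by blast
qed

text \<open>If \<open>I \<subseteq> J\<close> then \<open>aJ = J I cnj I \<subseteq> J cnj J I = aI\<close>.\<close>

lemma has_norm_subset_eq:
  assumes "has_norm I a" "has_norm J a" "I \<subseteq> J" shows "I = J"
proof
  have f: "fi I" "fi J" and a0: "of_int a \<noteq> (0::complex)" using assms by (auto simp: has_norm_def)
  have "(*) (of_int a) ` J = ideal_prod CC J (ideal_prod CC I (cnj ` I))"
    using assms(1) f by (simp add: has_norm_def ideal_prod_CC_scale_right ideal_prod_A)
  also have "\<dots> = ideal_prod CC (ideal_prod CC J (cnj ` I)) I"
    by (metis ideal_prod_CC_assoc ideal_prod_CC_commute)
  also have "\<dots> \<subseteq> ideal_prod CC (ideal_prod CC J (cnj ` J)) I"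
    using assms(3) by (intro ideal_prod_CC_mono) auto
  also have "\<dots> = (*) (of_int a) ` I"
    using assms(2) f by (simp add: has_norm_def ideal_prod_CC_scale ideal_prod_CC_commute[of A] ideal_prod_A)
  finally have *: "(*) (of_int a) ` J \<subseteq> (*) (of_int a) ` I" .
  show "J \<subseteq> I"
  proof
    fix x assume "x \<in> J"
    hence "of_int a * x \<in> (*) (of_int a) ` I" using * by blast
    then obtain y where "of_int a * x = of_int a * y" "y \<in> I" by blast
    thus "x \<in> I" using a0 by simp
  qed
qed (rule assms(3))

lemma class_rep:
  assumes "x \<in> carrier G"
  obtains n m where "n > 0" "n dvd m\<^sup>2 + int p" "x = cl n m"
proof -
  obtain I where I: "fi I" "x = cls I" using assms unfolding carrier_G by blast
  obtain k N n m where *: "k > 0" "N > 0" "n > 0" "n dvd m\<^sup>2 + int p" "I = (*) (of_int k / of_int N) ` idl n m"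
    using fractional_ideal_eq_idl[OF I(1)] .
  have "x = cl n m" unfolding I(2) *(5) using * by (intro cls_scale fi_idl K_divide K_of_int) auto
  thus ?thesis using that * by blast
qed

lemma idl_shift: "idl n (m + n * k) = idl n m"
proof -
  have *: "idl n (m + n * k) \<subseteq> idl n m" for m k
  proof
    fix z assume "z \<in> idl n (m + n * k)"
    then obtain x y where "z = of_int n * of_int x + (of_int (m + n * k) + om) * of_int y" by (rule idlE)
    hence "z = of_int n * of_int (x + k * y) + (of_int m + om) * of_int y" by (simp add: algebra_simps)
    thus "z \<in> idl n m" using idlI by metis
  qed
  show ?thesis using *[of m k] *[of "m + n * k" "- k"] by simp
qed

lemma cnj_idl: "cnj ` idl n m = idl n (- m)"
proof -
  have *: "cnj ` idl n m \<subseteq> idl n (- m)" for m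
  proof
    fix z assume "z \<in> cnj ` idl n m"
    then obtain w where w: "z = cnj w" "w \<in> idl n m" by blast
    obtain x y where "w = of_int n * of_int x + (of_int m + om) * of_int y" using w(2) by (rule idlE)
    hence "z = of_int n * of_int x + (of_int (- m) + om) * of_int (- y)" using w by (simp add: algebra_simps)
    thus "z \<in> idl n (- m)" using idlI by metis
  qed
  have "cnj ` cnj ` idl n (- m) \<subseteq> cnj ` idl n m" using *[of "- m"] by (intro image_mono) simp
  thus ?thesis using *[of m] by (auto simp: image_image)
qed

lemma cl_cnj:
  assumes "n > 0" "n dvd m\<^sup>2 + int p" shows "inv\<^bsub>G\<^esub> (cl n m) = cls (cnj ` idl n m)"
proof -
  interpret G: comm_group G by (rule comm_group_G)
  have f: "fi (idl n m)" using assms by (rule fi_idl)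
  show ?thesis using cls_cnj[OF f] f fi_cnj[OF f] cls_carrier
    by (intro G.inv_equality) (auto simp: G.m_comm)
qed

text \<open>One step of form reduction: multiplication by \<open>m - \<surd>-p\<close> carries \<open>(n, m + \<surd>-p)\<close> to \<open>n\<close> times
\<open>(l, -m + \<surd>-p)\<close>.\<close>

lemma cl_swap:
  assumes "n > 0" "l > 0" "m\<^sup>2 + int p = n * l" shows "cl n m = cl l (- m)"
proof -
  have "(of_int (m\<^sup>2 + int p) :: complex) = of_int (n * l)" using assms by simp
  hence l': "(of_nat p :: complex) = of_int n * of_int l - (of_int m)\<^sup>2" by (simp add: algebra_simps)
  have eq: "(of_int m - om) * (of_int n * of_int x + (of_int m + om) * of_int y) =
        of_int n * (of_int l * of_int y + (of_int (- m) + om) * of_int (- x))" for x y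
    by (simp add: algebra_simps om_sq om_sq' l' power2_eq_square)
  have "(*) (of_int m - om) ` idl n m = (*) (of_int n) ` idl l (- m)"
  proof
    show "(*) (of_int m - om) ` idl n m \<subseteq> (*) (of_int n) ` idl l (- m)"
    proof
      fix z assume "z \<in> (*) (of_int m - om) ` idl n m"
      then obtain w where w: "z = (of_int m - om) * w" "w \<in> idl n m" by blast
      obtain x y where "w = of_int n * of_int x + (of_int m + om) * of_int y" using w(2) by (rule idlE)
      hence "z = of_int n * (of_int l * of_int y + (of_int (- m) + om) * of_int (- x))" using w(1) eq by simp
      thus "z \<in> (*) (of_int n) ` idl l (- m)" using idlI by blast
    qed
    show "(*) (of_int n) ` idl l (- m) \<subseteq> (*) (of_int m - om) ` idl n m"
    proof
      fix z assume "z \<in> (*) (of_int n) ` idl l (- m)"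
      then obtain w where w: "z = of_int n * w" "w \<in> idl l (- m)" by blast
      obtain x y where "w = of_int l * of_int x + (of_int (- m) + om) * of_int y" using w(2) by (rule idlE)
      hence "z = (of_int m - om) * (of_int n * of_int (- y) + (of_int m + om) * of_int x)"
        using w(1) eq[of "- y" x] by simp
      thus "z \<in> (*) (of_int m - om) ` idl n m" using idlI by blast
    qed
  qed
  moreover have "of_int m - om \<noteq> 0" using lin_eq_0_iff[of m "-1"] by simp
  moreover have "of_int m - om \<in> K" by (intro K_of_A A_diff) auto
  moreover have f: "fi (idl n m)" "fi (idl l (- m))" using assms by (auto intro!: fi_idl)
  ultimately show ?thesis using cls_scale[of "idl n m" "of_int m - om"] cls_scale[of "idl l (- m)" "of_int n"] assms(1)
    by simp
qed

text \<open>With \<open>\<bar>m\<bar> \<le> n/2\<close> the cofactor \<open>l = (m\<^sup>2 + p)/n\<close> is smaller than \<open>n\<close> whenever \<open>n > p\<close>, so swapping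
terminates. The weak bound \<open>p\<close> suffices for finiteness.\<close>

lemma class_rep_reduced:
  assumes "n > 0" "n dvd m\<^sup>2 + int p"
  shows "\<exists>n' m'. 0 < n' \<and> n' \<le> int p \<and> 0 \<le> m' \<and> m' < n' \<and> cl n m = cl n' m'"
  using assms
proof (induction "nat n" arbitrary: n m rule: less_induct)
  case less
  show ?case
  proof (cases "n \<le> int p")
    case True
    have "idl n m = idl n (m mod n)" using idl_shift[of n "m mod n" "m div n"] by (simp add: algebra_simps)
    thus ?thesis using True less.prems
      by (intro exI[of _ n] exI[of _ "m mod n"]) auto
  next
    case False
    \<comment> \<open>The representative of \<open>m\<close> modulo \<open>n\<close> of least absolute value.\<close>
    define m0 where "m0 = (m + n div 2) mod n - n div 2"
    have "m0 = m + n * (- ((m + n div 2) div n))"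
      using mult_div_mod_eq[of n "m + n div 2"] unfolding m0_def by linarith
    hence sh: "idl n m = idl n m0" and md: "n dvd m0 - m"
      using idl_shift[of n m "- ((m + n div 2) div n)"] by simp_all
    have centred: "2 * \<bar>r - h\<bar> \<le> k" if "2 * h \<le> k" "k \<le> 2 * h + 1" "0 \<le> r" "r < k" for r h k :: int
      using that by presburger
    have "2 * (n div 2) \<le> n" "n \<le> 2 * (n div 2) + 1" by presburger+
    hence "2 * \<bar>m0\<bar> \<le> n" unfolding m0_def
      by (rule centred) (use less.prems(1) in simp_all)
    hence "(2 * \<bar>m0\<bar>)\<^sup>2 \<le> n\<^sup>2" by (intro power_mono) auto
    hence m04: "4 * m0\<^sup>2 \<le> n\<^sup>2" by (simp add: power_mult_distrib)
    have "m0\<^sup>2 + int p = (m0 - m) * (m0 + m) + (m\<^sup>2 + int p)" by (simp add: power2_eq_square algebra_simps)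
    moreover have "n dvd (m0 - m) * (m0 + m) + (m\<^sup>2 + int p)" by (intro dvd_add dvd_mult2 md less.prems(2))
    ultimately have "n dvd m0\<^sup>2 + int p" by (simp only:)
    then obtain l where l: "m0\<^sup>2 + int p = n * l" by (elim dvdE)
    have "n * l > 0" unfolding l[symmetric] using gt2 zero_le_power2[of m0] by linarith
    hence l0: "l > 0" using less.prems(1) by (simp add: zero_less_mult_iff)
    have "4 * n \<le> n * n" using False gt2 mod4 less.prems(1) by (intro mult_right_mono) auto
    moreover have "4 * m0\<^sup>2 \<le> n * n" using m04 by (simp add: power2_eq_square)
    ultimately have "m0\<^sup>2 + int p < n * n" using False less.prems(1) by linarith
    hence "n * l < n * n" unfolding l .
    hence "l < n" using less.prems(1) by simp
    hence "\<exists>n' m'. 0 < n' \<and> n' \<le> int p \<and> 0 \<le> m' \<and> m' < n' \<and> cl l (- m0) = cl n' m'"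
      using l0 l by (intro less.hyps) auto
    thus ?thesis unfolding sh cl_swap[OF less.prems(1) l0 l] .
  qed
qed

lemma finite_G: "finite (carrier G)"
proof (rule finite_subset)
  show "carrier G \<subseteq> (\<lambda>(n, m). cl n m) ` ({0..int p} \<times> {0..int p})"
  proof
    fix x assume "x \<in> carrier G"
    then obtain n m where "n > 0" "n dvd m\<^sup>2 + int p" "x = cl n m" by (rule class_rep)
    then obtain n' m' where "0 < n'" "n' \<le> int p" "0 \<le> m'" "m' < n'" "x = cl n' m'"
      using class_rep_reduced by metis
    thus "x \<in> (\<lambda>(n, m). cl n m) ` ({0..int p} \<times> {0..int p})"
      by (intro image_eqI[of _ _ "(n', m')"]) auto
  qed
qed auto

text \<open>For each prime divisor of \<open>M\<close> a residue class of \<open>(x, y)\<close> among \<open>(1, 0)\<close>, \<open>(0, 1)\<close> and \<open>(1, 1)\<close>, up to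
units, avoids divisibility; taking for \<open>x\<close> and \<open>y\<close> products of primes prescribes which of the
two coordinates vanishes.\<close>

lemma primitive_form_coprime_value:
  fixes n m l M :: int
  assumes bez: "a * n + b * (2 * m) + c * l = 1" and M: "M > 0"
  obtains x y where "x \<noteq> 0" "coprime (n * x\<^sup>2 + 2 * m * x * y + l * y\<^sup>2) M"
proof -
  define PF where "PF = {q::nat. prime q \<and> int q dvd M}"
  have "PF \<subseteq> {..nat M}" using M by (auto simp: PF_def dest: zdvd_imp_le)
  hence fin: "finite PF" by (rule finite_subset) simp
  \<comment> \<open>Primes in \<open>Q1\<close> will divide \<open>x\<close> but not \<open>y\<close>, those in \<open>Q2\<close> will divide \<open>y\<close> but not \<open>x\<close>, the remaining ones neither.\<close>
  define Q1 Q2 where "Q1 = {q\<in>PF. int q dvd n \<and> \<not> int q dvd l}" and "Q2 = {q\<in>PF. \<not> int q dvd n}"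
  have finQ: "finite Q1" "finite Q2" using fin by (auto simp: Q1_def Q2_def)
  define x y where "x = int (\<Prod>Q1)" and "y = int (\<Prod>Q2)"
  have dvd: "int q dvd int (\<Prod>Q) \<longleftrightarrow> q \<in> Q" if q: "prime q" and Q: "finite Q" "Q \<subseteq> PF" for q Q
  proof
    assume "int q dvd int (\<Prod>Q)"
    hence "q dvd \<Prod>Q" by (simp only: int_dvd_int_iff)
    then obtain r where "r \<in> Q" "q dvd r" using prime_dvd_prod_iff[OF Q(1) q, of "\<lambda>x. x"] by auto
    thus "q \<in> Q" using q Q primes_dvd_imp_eq[of q r] by (auto simp: PF_def)
  next
    assume "q \<in> Q"
    hence "q dvd \<Prod>Q" using dvd_prodI[OF Q(1), of q "\<lambda>x. x"] by simp
    thus "int q dvd int (\<Prod>Q)" by (simp only: int_dvd_int_iff)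
  qed
  have x: "int q dvd x \<longleftrightarrow> q \<in> Q1" and y: "int q dvd y \<longleftrightarrow> q \<in> Q2" if "prime q" for q
    unfolding x_def y_def using dvd[OF that] finQ by (auto simp: Q1_def Q2_def)
  have "x \<noteq> 0" unfolding x_def using finQ by (auto simp: Q1_def PF_def)
  moreover have "coprime (n * x\<^sup>2 + 2 * m * x * y + l * y\<^sup>2) M"
  proof (rule ccontr)
    assume "\<not> ?thesis"
    then obtain q where q: "prime q" "int q dvd n * x\<^sup>2 + 2 * m * x * y + l * y\<^sup>2" "int q dvd M"
      by (rule prime_divisor_of_gcd)
    have pq: "prime (int q)" and qPF: "q \<in> PF" using q by (auto simp: PF_def)
    consider "\<not> int q dvd n" | "int q dvd n" "\<not> int q dvd l" | "int q dvd n" "int q dvd l" by blast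
    thus False
    proof cases
      case 1
      hence "int q dvd y" "\<not> int q dvd x" using x[OF q(1)] y[OF q(1)] qPF by (auto simp: Q1_def Q2_def)
      moreover have "n * x\<^sup>2 = (n * x\<^sup>2 + 2 * m * x * y + l * y\<^sup>2) - y * (2 * m * x + l * y)"
        by (simp add: power2_eq_square algebra_simps)
      ultimately have "int q dvd n * x\<^sup>2" using q(2) by (metis dvd_diff dvd_mult2)
      thus False using 1 \<open>\<not> int q dvd x\<close> pq by (simp add: prime_dvd_mult_iff prime_dvd_power_iff)
    next
      case 2
      hence "int q dvd x" "\<not> int q dvd y" using x[OF q(1)] y[OF q(1)] qPF by (auto simp: Q1_def Q2_def)
      moreover have "l * y\<^sup>2 = (n * x\<^sup>2 + 2 * m * x * y + l * y\<^sup>2) - x * (n * x + 2 * m * y)"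
        by (simp add: power2_eq_square algebra_simps)
      ultimately have "int q dvd l * y\<^sup>2" using q(2) by (metis dvd_diff dvd_mult2)
      thus False using 2 \<open>\<not> int q dvd y\<close> pq by (simp add: prime_dvd_mult_iff prime_dvd_power_iff)
    next
      case 3
      hence n: "\<not> int q dvd x" "\<not> int q dvd y" using x[OF q(1)] y[OF q(1)] qPF by (auto simp: Q1_def Q2_def)
      have "2 * m * x * y = (n * x\<^sup>2 + 2 * m * x * y + l * y\<^sup>2) - (n * x\<^sup>2 + l * y\<^sup>2)" by simp
      hence "int q dvd 2 * m * x * y" using q(2) 3 by (metis dvd_add dvd_diff dvd_mult2)
      hence "int q dvd 2 * m" using n pq by (simp add: prime_dvd_mult_iff)
      hence "int q dvd a * n + b * (2 * m) + c * l" using 3 by simp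
      thus False unfolding bez using pq by (simp add: not_prime_unit)
    qed
  qed
  ultimately show ?thesis using that by blast
qed

text \<open>A value \<open>f\<close> of the norm form of \<open>C\<^sup>-\<^sup>1\<close> is the norm of an integral ideal in \<open>C\<close>; removing the rational content
of that ideal only removes a square from \<open>f\<close>.\<close>

lemma class_rep_coprime:
  assumes C: "C \<in> carrier G" and M: "M > 0"
  obtains n m where "n > 0" "n dvd m\<^sup>2 + int p" "coprime n M" "C = cl n m"
proof -
  interpret G: comm_group G by (rule comm_group_G)
  obtain n m where nm: "n > 0" "n dvd m\<^sup>2 + int p" "inv\<^bsub>G\<^esub> C = cl n m" using class_rep[of "inv\<^bsub>G\<^esub> C"] C by auto
  obtain l where l: "m\<^sup>2 + int p = n * l" using nm(2) by (elim dvdE)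
  obtain a b c where abc: "a * n + b * (2 * m) + c * l = 1" using idl_bezout[OF nm(1) l] .
  obtain x y where xy: "x \<noteq> 0" "coprime (n * x\<^sup>2 + 2 * m * x * y + l * y\<^sup>2) M"
    using primitive_form_coprime_value[OF abc M] .
  define f where "f = n * x\<^sup>2 + 2 * m * x * y + l * y\<^sup>2"
  define g where "g = of_int n * of_int x + (of_int m + om) * of_int y"
  have g: "g \<in> idl n m" unfolding g_def by (rule idlI)
  have g': "g = of_int (n * x + m * y) + of_int y * om" by (simp add: g_def algebra_simps)
  have "(n * x + m * y)\<^sup>2 + int p * y\<^sup>2 = n * (n * x\<^sup>2 + 2 * m * x * y) + (m\<^sup>2 + int p) * y\<^sup>2"
    by (simp add: power2_eq_square algebra_simps)
  hence nf: "(n * x + m * y)\<^sup>2 + int p * y\<^sup>2 = n * f" unfolding l f_def by (simp add: algebra_simps)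
  have gA: "g \<in> A" unfolding g' by (rule AI)
  have gg: "g * cnj g = of_int n * of_int f" unfolding g' norm_lin nf by simp
  have "n * x + m * y \<noteq> 0 \<or> y \<noteq> 0" using xy(1) nm(1) by auto
  hence "(n * x + m * y)\<^sup>2 + int p * y\<^sup>2 > 0" using gt2
    by (cases "y = 0") (auto intro!: add_nonneg_pos mult_pos_pos)
  hence f0: "f > 0" unfolding nf using nm(1) by (simp add: zero_less_mult_iff)
  have gn0: "g \<noteq> 0" using gg f0 nm(1) by auto
  have fI: "fi (idl n m)" using nm by (intro fi_idl)
  define J where "J = (*) (g / of_int n) ` cnj ` idl n m"
  have c: "g / of_int n \<in> K" "g / of_int n \<noteq> 0"
    using gn0 nm(1) K_divide[OF K_of_A[OF gA] K_of_int] by auto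
  have fJ: "fi J" unfolding J_def by (intro fi_scale fi_cnj fI c)
  have "J \<subseteq> A"
  proof
    fix z assume "z \<in> J"
    then obtain w where w: "w \<in> idl n m" "z = g / of_int n * cnj w" unfolding J_def by blast
    have "g * cnj w \<in> ideal_prod CC (idl n m) (cnj ` idl n m)" using g w by (intro ideal_prod_CC_I imageI)
    hence "g * cnj w \<in> (*) (of_int n) ` A" unfolding idl_times_cnj[OF nm(1,2)] .
    then obtain a where "g * cnj w = of_int n * a" "a \<in> A" by blast
    thus "z \<in> A" using w(2) nm(1) by simp
  qed
  then obtain k n' m' where J: "k > 0" "n' > 0" "n' dvd m'\<^sup>2 + int p" "J = (*) (of_int k) ` idl n' m'"
    using integral_ideal_eq_idl[OF fJ] by metis
  have "cnj ` idl n m = idl n (- m)" by (rule cnj_idl)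
  hence "has_norm (cnj ` idl n m) n" using has_norm_idl[of n "- m"] nm by simp
  hence "ideal_prod CC J (cnj ` J) = (*) (g / of_int n * cnj (g / of_int n) * of_int n) ` A"
    unfolding J_def by (rule scale_norm)
  moreover have "g / of_int n * cnj (g / of_int n) * of_int n = of_int f"
    using gg nm(1) by (simp add: field_simps)
  ultimately have hJ: "has_norm J f" unfolding has_norm_def using fJ f0 by simp
  have "J = (*) ((of_int k + of_int 0 * om) / of_int 1) ` idl n' m'" using J(4) by simp
  from has_norm_scale_eq[OF hJ has_norm_idl[OF J(2,3)] this] have "f = k\<^sup>2 * n'" by simp
  hence "coprime n' M" using xy(2) unfolding f_def[symmetric] by simp
  moreover have "C = cl n' m'"
  proof -
    have "cl n' m' = cls J" unfolding J(4) using J by (intro cls_scale[symmetric] fi_idl) auto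
    also have "\<dots> = cls (cnj ` idl n m)" unfolding J_def by (intro cls_scale fi_cnj fI c)
    also have "\<dots> = inv\<^bsub>G\<^esub> (cl n m)" by (rule cl_cnj[OF nm(1,2), symmetric])
    also have "\<dots> = C" unfolding nm(3)[symmetric] using C by simp
    finally show ?thesis by simp
  qed
  ultimately show ?thesis using that J by blast
qed

definition sup_A :: "complex set \<Rightarrow> complex set" where
  "sup_A I = {z. \<exists>a\<in>A. \<exists>x\<in>I. z = a + x}"

lemma sup_AI: "a \<in> A \<Longrightarrow> x \<in> I \<Longrightarrow> a + x \<in> sup_A I"
  by (auto simp: sup_A_def)

lemma sup_AE:
  assumes "z \<in> sup_A I" obtains a x where "a \<in> A" "x \<in> I" "z = a + x"
  using assms by (auto simp: sup_A_def)

lemma fi_sup_A: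
  assumes I: "fi I" shows "fi (sup_A I)"
proof -
  obtain d where d: "d \<in> A" "d \<noteq> 0" "\<forall>x\<in>I. d * x \<in> A" using I unfolding fi_iff by blast
  have one: "1 \<in> sup_A I" and zero: "0 \<in> sup_A I"
    using sup_AI[OF A_1 fi_0[OF I]] sup_AI[OF A_0 fi_0[OF I]] by simp_all
  have ne: "sup_A I \<noteq> {0}" using one by (metis singletonD zero_neq_one)
  have add: "u + v \<in> sup_A I" if "u \<in> sup_A I" "v \<in> sup_A I" for u v
  proof -
    obtain a x where u: "a \<in> A" "x \<in> I" "u = a + x" using \<open>u \<in> sup_A I\<close> by (rule sup_AE)
    obtain b y where v: "b \<in> A" "y \<in> I" "v = b + y" using \<open>v \<in> sup_A I\<close> by (rule sup_AE)
    have "u + v = (a + b) + (x + y)" using u v by simp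
    thus ?thesis using sup_AI[OF A_add[OF u(1) v(1)] fi_add[OF I u(2) v(2)]] by simp
  qed
  have smult: "r * u \<in> sup_A I" if r: "r \<in> A" and "u \<in> sup_A I" for r u
  proof -
    obtain a x where u: "a \<in> A" "x \<in> I" "u = a + x" using \<open>u \<in> sup_A I\<close> by (rule sup_AE)
    show ?thesis using sup_AI[OF A_mult[OF r u(1)] fi_smult[OF I r u(2)]] u(3) by (simp add: distrib_left)
  qed
  have minus: "- u \<in> sup_A I" if "u \<in> sup_A I" for u using smult[OF A_minus[OF A_1] that] by simp
  have den: "d * u \<in> A" if "u \<in> sup_A I" for u
  proof -
    obtain a x where u: "a \<in> A" "x \<in> I" "u = a + x" using \<open>u \<in> sup_A I\<close> by (rule sup_AE)
    show ?thesis using A_add[OF A_mult[OF d(1) u(1)], of "d * x"] d(3) u by (simp add: distrib_left)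
  qed
  show ?thesis unfolding fi_iff
    by (intro conjI ballI bexI[of _ d] ne zero add smult minus den d(1,2))
qed

text \<open>Hilbert's Theorem 90 for ideals: if \<open>I\<close> times its conjugate is \<open>A\<close>, then \<open>M = A + I\<close> satisfies
\<open>I cnj M = I + I cnj I = M\<close>, so \<open>I\<close> is equivalent to \<open>M\<close> times the inverse class of \<open>cnj M\<close>, which is
the class of \<open>M\<close> itself.\<close>

lemma norm_one_ideal_square_class:
  assumes I: "fi I" and n1: "ideal_prod CC I (cnj ` I) = A"
  obtains Y where "Y \<in> carrier G" "cls I = Y \<otimes>\<^bsub>G\<^esub> Y"
proof -
  interpret G: comm_group G by (rule comm_group_G)
  define M where "M = sup_A I"
  have fM: "fi M" unfolding M_def by (rule fi_sup_A[OF I])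
  have IM: "I \<subseteq> M" "1 \<in> M"
    using sup_AI[OF A_0, of _ I] sup_AI[OF A_1 fi_0[OF I]] unfolding M_def by auto
  have "ideal_prod CC I (cnj ` M) = M"
  proof
    show "ideal_prod CC I (cnj ` M) \<subseteq> M"
    proof (rule ideal_prod_CC_least)
      fix i j assume ij: "i \<in> I" "j \<in> cnj ` M"
      then obtain w where w: "j = cnj w" "w \<in> sup_A I" unfolding M_def by blast
      obtain a x where "a \<in> A" "x \<in> I" "w = a + x" using w(2) by (rule sup_AE)
      hence ax: "j = cnj (a + x)" "a \<in> A" "x \<in> I" using w(1) by simp_all
      have "i * j = i * cnj x + cnj a * i" using ax by (simp add: algebra_simps)
      moreover have "i * cnj x \<in> A" using ideal_prod_CC_I[of i I "cnj x" "cnj ` I"] ij ax n1 by simp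
      moreover have "cnj a * i \<in> I" using fi_smult[OF I A_cnj] ij ax by simp
      ultimately show "i * j \<in> M" unfolding M_def using sup_AI by simp
    qed (rule fi_add[OF fM])
    have "cnj 1 \<in> cnj ` M" using IM(2) by blast
    hence 1: "x \<in> ideal_prod CC I (cnj ` M)" if "x \<in> I" for x
      using ideal_prod_CC_I[OF that, of 1 "cnj ` M"] by simp
    have "ideal_prod CC I (cnj ` I) \<subseteq> ideal_prod CC I (cnj ` M)"
      using IM by (intro ideal_prod_CC_mono) auto
    hence 2: "A \<subseteq> ideal_prod CC I (cnj ` M)" unfolding n1 .
    show "M \<subseteq> ideal_prod CC I (cnj ` M)"
    proof
      fix z assume "z \<in> M"
      then obtain a x where "a \<in> A" "x \<in> I" "z = a + x" unfolding M_def by (rule sup_AE)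
      thus "z \<in> ideal_prod CC I (cnj ` M)" using 1 2 ideal_prod_CC_add by blast
    qed
  qed
  hence "cls I \<otimes>\<^bsub>G\<^esub> cls (cnj ` M) = cls M" using cls_mult[OF I fi_cnj[OF fM]] by simp
  hence "cls I \<otimes>\<^bsub>G\<^esub> cls (cnj ` M) \<otimes>\<^bsub>G\<^esub> cls M = cls M \<otimes>\<^bsub>G\<^esub> cls M" by simp
  moreover have car: "cls I \<in> carrier G" "cls M \<in> carrier G" "cls (cnj ` M) \<in> carrier G"
    using cls_carrier I fM fi_cnj by auto
  hence "cls I \<otimes>\<^bsub>G\<^esub> cls (cnj ` M) \<otimes>\<^bsub>G\<^esub> cls M = cls I \<otimes>\<^bsub>G\<^esub> (cls M \<otimes>\<^bsub>G\<^esub> cls (cnj ` M))"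
    by (simp add: G.m_assoc G.m_comm[of "cls (cnj ` M)" "cls M"])
  hence "cls I \<otimes>\<^bsub>G\<^esub> cls (cnj ` M) \<otimes>\<^bsub>G\<^esub> cls M = cls I" using cls_cnj[OF fM] car by simp
  ultimately show ?thesis using that car by metis
qed

text \<open>A solution of the conic gives an element \<open>g = U + W\<surd>-p\<close> of the ideal with norm \<open>nZ\<^sup>2\<close>; dividing the conjugate ideal by a
suitable multiple of \<open>g\<close> produces an ideal of norm \<open>1\<close>.\<close>

lemma square_class_if_residue:
  assumes n: "n > 0" "n dvd m\<^sup>2 + int p" and leg: "Legendre n p = 1"
  obtains Y where "Y \<in> carrier G" "cl n m = Y \<otimes>\<^bsub>G\<^esub> Y"
proof -
  interpret G: comm_group G by (rule comm_group_G)
  have "\<not> int p dvd n" using leg Legendre_eq_0_iff[of n p] by auto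
  hence "\<not> p dvd nat n" using n(1) by (metis int_dvd_int_iff int_nat_eq less_imp_le)
  then obtain U W Z where uwz: "n dvd U - m * W" "U\<^sup>2 + int p * W\<^sup>2 = n * Z\<^sup>2" "Z \<noteq> 0"
    using conic_solvable[of "nat n" m] n leg by auto
  define g where "g = of_int U + of_int W * om"
  obtain t where t: "U - m * W = n * t" using uwz(1) by (elim dvdE)
  have "U = n * t + m * W" using t by simp
  hence "g = of_int n * of_int t + (of_int m + om) * of_int W" unfolding g_def by (simp add: algebra_simps)
  hence g: "g \<in> idl n m" using idlI by metis
  have gg: "g * cnj g = of_int n * (of_int Z)\<^sup>2" unfolding g_def norm_lin uwz(2) by simp
  have g0: "g \<noteq> 0" using gg uwz(3) n(1) by auto
  have gA: "g \<in> A" unfolding g_def by (rule AI)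
  define c where "c = g / of_int (n * Z)"
  have c: "c \<in> K" "c \<noteq> 0"
    using g0 n(1) uwz(3) K_divide[OF K_of_A[OF gA] K_of_int] unfolding c_def by (auto simp del: of_int_mult)
  have fI: "fi (cnj ` idl n m)" using n by (intro fi_cnj fi_idl)
  define J where "J = (*) c ` cnj ` idl n m"
  have fJ: "fi J" unfolding J_def by (intro fi_scale fI c)
  have "has_norm (cnj ` idl n m) n" unfolding cnj_idl using has_norm_idl[of n "- m"] n by simp
  hence "ideal_prod CC J (cnj ` J) = (*) (c * cnj c * of_int n) ` A"
    unfolding J_def by (rule scale_norm)
  moreover have "c * cnj c * of_int n = 1"
  proof -
    have "c * cnj c * of_int n = (g * cnj g) * of_int n / (of_int n * of_int Z)\<^sup>2"
      by (simp add: c_def power2_eq_square)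
    also have "\<dots> = 1" unfolding gg using n(1) uwz(3) by (simp add: power2_eq_square)
    finally show ?thesis .
  qed
  ultimately have "ideal_prod CC J (cnj ` J) = A" by simp
  then obtain Y where Y: "Y \<in> carrier G" "cls J = Y \<otimes>\<^bsub>G\<^esub> Y" using norm_one_ideal_square_class[OF fJ] by blast
  have "cls J = inv\<^bsub>G\<^esub> (cl n m)" unfolding cl_cnj[OF n] J_def by (intro cls_scale fI c)
  hence "inv\<^bsub>G\<^esub> (inv\<^bsub>G\<^esub> (cl n m)) = inv\<^bsub>G\<^esub> (Y \<otimes>\<^bsub>G\<^esub> Y)" using Y by simp
  hence e: "cl n m = inv\<^bsub>G\<^esub> Y \<otimes>\<^bsub>G\<^esub> inv\<^bsub>G\<^esub> Y"
    using Y(1) cls_carrier[OF fi_idl[OF n]] by (simp add: G.inv_mult_group)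
  show ?thesis by (rule that[OF G.inv_closed[OF Y(1)] e])
qed

text \<open>Reduce modulo \<open>p\<close>; if \<open>p\<close> divides \<open>w\<close>, it divides \<open>u\<close> and \<open>v\<close> too, and all three can be divided by \<open>p\<close>.\<close>

lemma Legendre_of_square_form:
  assumes "n * w\<^sup>2 = f\<^sup>2 * (u\<^sup>2 + int p * v\<^sup>2)" "w \<noteq> 0" "\<not> int p dvd n" "\<not> int p dvd f"
  shows "Legendre n p = 1"
  using assms(1,2)
proof (induction "nat \<bar>w\<bar>" arbitrary: u v w rule: less_induct)
  case less
  show ?case
  proof (cases "int p dvd w")
    case False
    have "Legendre (n * w\<^sup>2) p = Legendre ((f * u)\<^sup>2) p"
      unfolding less.prems(1) by (intro Legendre_cong) (simp add: cong_iff_dvd_diff power2_eq_square algebra_simps)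
    moreover have "Legendre (n * w\<^sup>2) p = Legendre n p" using Legendre_mult Legendre_square[OF False] by simp
    ultimately have *: "Legendre n p = Legendre ((f * u)\<^sup>2) p" by simp
    have "\<not> int p dvd f * u"
    proof
      assume "int p dvd f * u"
      hence "int p dvd (f * u)\<^sup>2" by (simp add: power2_eq_square)
      hence "Legendre n p = 0" using * Legendre_eq_0_iff by metis
      thus False using assms(3) Legendre_eq_0_iff by metis
    qed
    thus ?thesis using * Legendre_square by simp
  next
    case True
    then obtain w' where w': "w = int p * w'" by (elim dvdE)
    have "int p dvd f\<^sup>2 * u\<^sup>2 + int p * (f\<^sup>2 * v\<^sup>2)"
      using less.prems(1) unfolding w' by (metis (no_types, lifting) distrib_left dvd_mult dvd_mult2 dvd_refl mult.left_commute power2_eq_square)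
    hence "int p dvd f\<^sup>2 * u\<^sup>2" by (simp add: dvd_add_left_iff)
    hence "int p dvd u" using assms(4) prime_int by (simp add: prime_dvd_mult_iff prime_dvd_power_iff)
    then obtain u' where u': "u = int p * u'" by (elim dvdE)
    have "int p * (n * int p * w'\<^sup>2) = int p * (f\<^sup>2 * (int p * u'\<^sup>2 + v\<^sup>2))"
      using less.prems(1) unfolding w' u' by (simp add: power2_eq_square algebra_simps)
    hence e: "n * int p * w'\<^sup>2 = f\<^sup>2 * (int p * u'\<^sup>2 + v\<^sup>2)" using gt2 by (subst (asm) mult_cancel_left) auto
    have "f\<^sup>2 * v\<^sup>2 = int p * (n * w'\<^sup>2 - f\<^sup>2 * u'\<^sup>2)" using e by (simp add: algebra_simps)
    hence "int p dvd f\<^sup>2 * v\<^sup>2" by simp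
    hence "int p dvd v" using assms(4) prime_int by (simp add: prime_dvd_mult_iff prime_dvd_power_iff)
    then obtain v' where v': "v = int p * v'" by (elim dvdE)
    have "int p * (n * w'\<^sup>2) = int p * (f\<^sup>2 * (u'\<^sup>2 + int p * v'\<^sup>2))"
      using e unfolding v' by (simp add: power2_eq_square algebra_simps)
    hence e': "n * w'\<^sup>2 = f\<^sup>2 * (u'\<^sup>2 + int p * v'\<^sup>2)" using gt2 by (subst (asm) mult_cancel_left) auto
    have "w' \<noteq> 0" using less.prems w' by auto
    moreover have "nat \<bar>w'\<bar> < nat \<bar>w\<bar>" using \<open>w' \<noteq> 0\<close> gt2 unfolding w' by (simp add: abs_mult nat_mult_distrib)
    ultimately show ?thesis using less.hyps e' by blast
  qed
qed

text \<open>An ideal equivalent to the square of an ideal of norm \<open>f\<close> prime to \<open>p\<close> has norm \<open>f\<^sup>2\<close> times the norm of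
a field element.\<close>

lemma residue_if_square_class:
  assumes n: "n > 0" "n dvd m\<^sup>2 + int p" "\<not> int p dvd n" and Y: "Y \<in> carrier G" "cl n m = Y \<otimes>\<^bsub>G\<^esub> Y"
  shows "Legendre n p = 1"
proof -
  obtain f m' where f: "f > 0" "f dvd m'\<^sup>2 + int p" "coprime f (int p)" "Y = cl f m'"
    using class_rep_coprime[OF Y(1), of "int p"] gt2 by auto
  have fI: "fi (idl n m)" "fi (idl f m')" using n f by (auto intro: fi_idl)
  have "cls (ideal_prod CC (idl f m') (idl f m')) = cl n m" using Y(2) f(4) cls_mult fI by simp
  then obtain c where c: "c \<in> K" "idl n m = (*) c ` ideal_prod CC (idl f m') (idl f m')"
    using cls_eq_iff fI fi_prod by blast
  obtain u v d where d: "c = (of_int u + of_int v * om) / of_int d" "d \<noteq> 0" using K_cases[OF c(1)] .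
  have "n * d\<^sup>2 = (u\<^sup>2 + int p * v\<^sup>2) * (f * f)"
    using has_norm_scale_eq[OF has_norm_idl[OF n(1,2)] has_norm_prod[OF has_norm_idl[OF f(1,2)] has_norm_idl[OF f(1,2)]] _ d(2)]
      c(2) d(1) by simp
  hence "n * d\<^sup>2 = f\<^sup>2 * (u\<^sup>2 + int p * v\<^sup>2)" by (simp add: power2_eq_square mult.commute)
  moreover have "\<not> int p dvd f" using f(3) prime_int by (metis coprime_commute coprime_absorb_left not_prime_unit)
  ultimately show ?thesis using Legendre_of_square_form d(2) n(3) by blast
qed

end

section \<open>Divisibility of the class number by sixteen\<close>

context prime_1_mod_4
begin

abbreviation t2 :: "complex set set" where "t2 \<equiv> cl 2 1"

lemma two_dvd: "(2::int) dvd 1\<^sup>2 + int p"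
proof -
  have "odd p" using mod4 by presburger
  thus ?thesis by simp
qed

lemma idl_1: "idl 1 m = A"
proof
  show "A \<subseteq> idl 1 m"
  proof
    fix z assume "z \<in> A"
    then obtain x y where "z = of_int x + of_int y * om" by (rule AE)
    hence "z = of_int 1 * of_int (x - m * y) + (of_int m + om) * of_int y" by (simp add: algebra_simps)
    thus "z \<in> idl 1 m" using idlI by metis
  qed
qed (rule idl_subset_A)

text \<open>The ideal \<open>(p, \<surd>-p)\<close> is generated by \<open>\<surd>-p\<close>.\<close>

lemma cl_p: "cl (int p) 0 = \<one>\<^bsub>G\<^esub>"
proof -
  have eq: "om * (of_int x + of_int y * om) = of_int (int p) * of_int (- y) + (of_int 0 + om) * of_int x" for x y
    by (simp add: algebra_simps om_sq om_sq')
  have "(*) om ` A = idl (int p) 0"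
  proof
    show "(*) om ` A \<subseteq> idl (int p) 0"
    proof
      fix z assume "z \<in> (*) om ` A"
      then obtain a where a: "z = om * a" "a \<in> A" by blast
      obtain x y where "a = of_int x + of_int y * om" using a(2) by (rule AE)
      thus "z \<in> idl (int p) 0" using a(1) eq idlI by metis
    qed
    show "idl (int p) 0 \<subseteq> (*) om ` A"
    proof
      fix z assume "z \<in> idl (int p) 0"
      then obtain x y where "z = of_int (int p) * of_int x + (of_int 0 + om) * of_int y" by (rule idlE)
      hence "z = om * (of_int y + of_int (- x) * om)" using eq[of y "- x"] by simp
      thus "z \<in> (*) om ` A" using AI by blast
    qed
  qed
  moreover have "om \<noteq> 0" using lin_eq_0_iff[of 0 1] by simp
  ultimately show ?thesis using cls_scale[OF fi_A K_of_A[OF A_om]] by (simp add: cls_one)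
qed

text \<open>The ideal of norm \<open>2p\<close> is \<open>\<surd>-p\<close> times the one of norm \<open>2\<close>.\<close>

lemma cl_2p: "cl (2 * int p) (int p) = t2"
proof -
  have eq: "om * (of_int 2 * of_int x + (of_int 1 + om) * of_int y) =
        of_int (2 * int p) * of_int (- x - y) + (of_int (int p) + om) * of_int (2 * x + y)" for x y
    by (simp add: algebra_simps om_sq om_sq')
  have "(*) om ` idl 2 1 = idl (2 * int p) (int p)"
  proof
    show "(*) om ` idl 2 1 \<subseteq> idl (2 * int p) (int p)"
    proof
      fix z assume "z \<in> (*) om ` idl 2 1"
      then obtain a where a: "z = om * a" "a \<in> idl 2 1" by blast
      obtain x y where "a = of_int 2 * of_int x + (of_int 1 + om) * of_int y" using a(2) by (rule idlE)
      thus "z \<in> idl (2 * int p) (int p)" using a(1) eq idlI by metis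
    qed
    show "idl (2 * int p) (int p) \<subseteq> (*) om ` idl 2 1"
    proof
      fix z assume "z \<in> idl (2 * int p) (int p)"
      then obtain x y where z: "z = of_int (2 * int p) * of_int x + (of_int (int p) + om) * of_int y" by (rule idlE)
      have "- (x + y) - (- 2 * x - y) = x" "2 * (x + y) + (- 2 * x - y) = y" by simp_all
      hence "z = om * (of_int 2 * of_int (x + y) + (of_int 1 + om) * of_int (- 2 * x - y))"
        unfolding z eq by (simp only:)
      thus "z \<in> (*) om ` idl 2 1" using idlI by blast
    qed
  qed
  moreover have "om \<noteq> 0" using lin_eq_0_iff[of 0 1] by simp
  ultimately show ?thesis using cls_scale[OF fi_idl[OF _ two_dvd] K_of_A[OF A_om]] by simp
qed

lemma t2_carrier: "t2 \<in> carrier G"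
  by (intro cls_carrier fi_idl two_dvd) simp

lemma t2_square: "t2 \<otimes>\<^bsub>G\<^esub> t2 = \<one>\<^bsub>G\<^esub>"
proof -
  have "cnj ` idl 2 1 = idl 2 1" using idl_shift[of 2 1 "-1"] by (simp add: cnj_idl)
  thus ?thesis using cls_cnj[OF fi_idl[OF _ two_dvd]] by simp
qed

text \<open>The equation \<open>u\<^sup>2 + pv\<^sup>2 = 2\<close> has no solution.\<close>

lemma t2_neq_one: "t2 \<noteq> \<one>\<^bsub>G\<^esub>"
proof
  assume "t2 = \<one>\<^bsub>G\<^esub>"
  then obtain c where c: "c \<in> K" "idl 2 1 = (*) c ` A"
    using cls_eq_one_iff[OF fi_idl[OF _ two_dvd]] by auto
  have "c * 1 \<in> (*) c ` A" by (intro imageI A_1)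
  hence "c \<in> A" using c(2) idl_subset_A by auto
  then obtain u v where uv: "c = of_int u + of_int v * om" by (rule AE)
  have "has_norm A 1" using has_norm_idl[of 1 0] by (simp add: idl_1)
  moreover have "has_norm (idl 2 1) 2" by (intro has_norm_idl two_dvd) simp
  moreover have "idl 2 1 = (*) ((of_int u + of_int v * om) / of_int 1) ` A" using c(2) uv by simp
  ultimately have e: "2 * 1\<^sup>2 = (u\<^sup>2 + int p * v\<^sup>2) * 1" by (intro has_norm_scale_eq) auto
  have "v = 0"
  proof (rule ccontr)
    assume "v \<noteq> 0"
    hence "v\<^sup>2 > 0" by simp
    hence "v\<^sup>2 \<ge> 1" by linarith
    hence "int p * v\<^sup>2 \<ge> int p * 1" by (intro mult_left_mono) auto
    moreover have "u\<^sup>2 \<ge> 0" "u\<^sup>2 + int p * v\<^sup>2 = 2" using e by simp_all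
    ultimately show False using gt2 by linarith
  qed
  hence "u\<^sup>2 = 2" using e by simp
  moreover have "u\<^sup>2 mod 4 = (u mod 4)\<^sup>2 mod 4" by (simp add: power_mod)
  moreover have "u mod 4 = 0 \<or> u mod 4 = 1 \<or> u mod 4 = 2 \<or> u mod 4 = 3" by presburger
  ultimately show False by auto
qed

text \<open>If the class of \<open>I\<close> is its own inverse, then \<open>cnj I = \<gamma> I\<close> with \<open>\<gamma>\<close> of norm \<open>1\<close>. By Hilbert's Theorem 90
\<open>\<gamma> = \<beta> / cnj \<beta>\<close>, so \<open>\<beta>I\<close> is stable under conjugation. Its primitive part \<open>(n, m + \<surd>-p)\<close> then has
\<open>n\<close> dividing \<open>2m\<close>, hence \<open>2p\<close>, and the four possible values of \<open>n\<close> give only the classes \<open>1\<close> and \<open>t\<close>.\<close>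

lemma involution_class:
  assumes x: "x \<in> carrier G" "x \<otimes>\<^bsub>G\<^esub> x = \<one>\<^bsub>G\<^esub>"
  shows "x = \<one>\<^bsub>G\<^esub> \<or> x = t2"
proof -
  interpret G: comm_group G by (rule comm_group_G)
  obtain n m where nm: "n > 0" "n dvd m\<^sup>2 + int p" "x = cl n m" using class_rep[OF x(1)] .
  have fI: "fi (idl n m)" using nm by (intro fi_idl)
  have "cls (idl n m) = cls (cnj ` idl n m)"
    using cl_cnj[OF nm(1,2)] x nm(3) G.inv_equality by metis
  then obtain \<gamma> where \<gamma>: "\<gamma> \<in> K" "\<gamma> \<noteq> 0" "cnj ` idl n m = (*) \<gamma> ` idl n m"
    using cls_eq_iff[OF fI fi_cnj[OF fI]] by blast
  obtain u v d where d: "\<gamma> = (of_int u + of_int v * om) / of_int d" "d \<noteq> 0" using K_cases[OF \<gamma>(1)] .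
  have "has_norm (cnj ` idl n m) n" unfolding cnj_idl using has_norm_idl[of n "- m"] nm by simp
  from has_norm_scale_eq[OF this has_norm_idl[OF nm(1,2)] \<gamma>(3)[unfolded d(1)] d(2)]
  have "d\<^sup>2 = u\<^sup>2 + int p * v\<^sup>2" using nm(1) by simp
  hence "(of_int u + of_int v * om) * cnj (of_int u + of_int v * om) = (of_int d)\<^sup>2"
    unfolding norm_lin by (simp only: of_int_power[symmetric])
  hence g1: "\<gamma> * cnj \<gamma> = 1" unfolding d(1) using d(2)
    by (simp add: power2_eq_square del: complex_cnj_add complex_cnj_mult)
  \<comment> \<open>The usual witness \<open>1 + \<gamma>\<close> vanishes for \<open>\<gamma> = -1\<close>, where \<open>\<surd>-p\<close> does the job.\<close>
  define \<beta> where "\<beta> = (if \<gamma> = -1 then om else 1 + \<gamma>)"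
  have om0: "om \<noteq> 0" using lin_eq_0_iff[of 0 1] by simp
  have \<beta>: "\<beta> \<in> K" "\<beta> \<noteq> 0" "cnj \<beta> * \<gamma> = \<beta>"
  proof -
    show "\<beta> \<in> K" using \<gamma>(1) K_add[OF K_of_A[OF A_1]] K_of_A[OF A_om] by (simp add: \<beta>_def)
    show "\<beta> \<noteq> 0" using om0 add_eq_0_iff[of 1 \<gamma>] by (simp add: \<beta>_def)
    show "cnj \<beta> * \<gamma> = \<beta>"
    proof (cases "\<gamma> = -1")
      case True
      thus ?thesis by (simp add: \<beta>_def)
    next
      case False
      hence "cnj \<beta> * \<gamma> = \<gamma> + \<gamma> * cnj \<gamma>" by (simp add: \<beta>_def algebra_simps)
      thus ?thesis using False g1 by (simp add: \<beta>_def)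
    qed
  qed
  define L where "L = (*) \<beta> ` idl n m"
  have fL: "fi L" unfolding L_def by (intro fi_scale fI \<beta>)
  have Lc: "cnj ` L = L" unfolding L_def cnj_scale \<gamma>(3) scale_scale \<beta>(3) ..
  obtain k N n' m' where *: "k > 0" "N > 0" "n' > 0" "n' dvd m'\<^sup>2 + int p" "L = (*) (of_int k / of_int N) ` idl n' m'"
    using fractional_ideal_eq_idl[OF fL] .
  let ?r = "of_int k / of_int N :: complex"
  have "(*) ?r ` idl n' (- m') = (*) ?r ` idl n' m'"
    using Lc unfolding *(5) cnj_scale cnj_idl by simp
  hence "(*) (1 / ?r) ` (*) ?r ` idl n' (- m') = (*) (1 / ?r) ` (*) ?r ` idl n' m'" by simp
  moreover have "1 / ?r * ?r = 1" using * by simp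
  ultimately have st: "idl n' (- m') = idl n' m'" unfolding scale_scale by simp
  have "of_int (- m') + om \<in> idl n' m'" using idl_m[of "- m'" n'] st by simp
  then obtain a b where "of_int (- m') + om = of_int n' * of_int a + (of_int m' + om) * of_int b" by (rule idlE)
  hence "of_int (- m') + of_int 1 * om = of_int (n' * a + m' * b) + of_int b * om" by (simp add: algebra_simps)
  hence "- m' = n' * a + m' * b" "b = 1" by (simp_all only: lin_eq_iff)
  hence "2 * m' = n' * (- a)" by simp
  hence n2m: "n' dvd 2 * m'" by (metis dvd_triv_left)
  have "2 * int p = 2 * (m'\<^sup>2 + int p) - m' * (2 * m')" by (simp add: power2_eq_square)
  hence n2p: "n' dvd 2 * int p" using *(4) n2m by (metis dvd_diff dvd_mult)
  have x': "x = cl n' m'"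
  proof -
    have "cls L = x" unfolding L_def nm(3) by (intro cls_scale fI \<beta>)
    moreover have "cls L = cl n' m'" unfolding *(5) using * by (intro cls_scale fi_idl K_divide K_of_int) auto
    ultimately show ?thesis by simp
  qed
  have oddp: "odd (int p)" using mod4 by presburger
  have par: "odd m'" if "even n'"
  proof
    assume "even m'"
    hence "odd (m'\<^sup>2 + int p)" using oddp by simp
    thus False using that *(4) dvd_trans by blast
  qed
  show ?thesis
  proof (cases "int p dvd n'")
    case False
    hence "coprime n' (int p)" using prime_int by (metis coprime_commute prime_imp_coprime)
    hence "n' dvd 2" using n2p by (simp add: coprime_dvd_mult_left_iff)
    hence "n' \<le> 2" by (intro zdvd_imp_le) auto
    hence "n' = 1 \<or> n' = 2" using *(3) by auto
    thus ?thesis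
    proof
      assume "n' = 1"
      thus ?thesis using x' by (simp add: idl_1 cls_one)
    next
      assume n': "n' = 2"
      then obtain k where "m' = 2 * k + 1" using par by (auto elim: oddE)
      thus ?thesis using x' n' idl_shift[of 2 1 k] by (simp add: add.commute)
    qed
  next
    case True
    then obtain e where e: "n' = int p * e" by (elim dvdE)
    have "int p * e dvd int p * 2" using n2p unfolding e by (simp add: mult.commute)
    hence "e dvd 2" using gt2 by (subst (asm) dvd_times_left_cancel_iff) auto
    hence "e \<le> 2" by (intro zdvd_imp_le) auto
    moreover have "e > 0" using *(3) e gt2 by (simp add: zero_less_mult_iff)
    ultimately have e12: "e = 1 \<or> e = 2" by auto
    have "int p dvd 2 * m'" using True n2m dvd_trans by blast
    moreover have "\<not> int p dvd 2" using gt2 by (auto dest: zdvd_imp_le)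
    ultimately have "int p dvd m'" using prime_int by (simp add: prime_dvd_mult_iff)
    then obtain k where k: "m' = int p * k" by (elim dvdE)
    from e12 show ?thesis
    proof
      assume "e = 1"
      hence "idl n' m' = idl (int p) 0" using idl_shift[of "int p" 0 k] e k by simp
      thus ?thesis using x' cl_p by simp
    next
      assume e2: "e = 2"
      hence "odd m'" using par e by simp
      then obtain k' where "k = 2 * k' + 1" using k by (auto elim: oddE)
      hence "m' = int p + (2 * int p) * k'" using k by (simp add: algebra_simps)
      hence "idl n' m' = idl (2 * int p) (int p)" using idl_shift[of "2 * int p" "int p" k'] e e2 by (simp add: mult.commute)
      thus ?thesis using x' cl_2p by simp
    qed
  qed
qed

lemma involution_iff: "x \<in> carrier G \<Longrightarrow> x \<otimes>\<^bsub>G\<^esub> x = \<one>\<^bsub>G\<^esub> \<longleftrightarrow> x = \<one>\<^bsub>G\<^esub> \<or> x = t2"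
proof -
  interpret G: comm_group G by (rule comm_group_G)
  show "x \<in> carrier G \<Longrightarrow> x \<otimes>\<^bsub>G\<^esub> x = \<one>\<^bsub>G\<^esub> \<longleftrightarrow> x = \<one>\<^bsub>G\<^esub> \<or> x = t2"
    using involution_class t2_square by auto
qed

lemma sixteen_dvd_class_number_iff:
  "16 dvd Coset.order G \<longleftrightarrow> (\<exists>g\<in>carrier G. g [^]\<^bsub>G\<^esub> (8::nat) = t2)"
  using comm_group.two_power_dvd_order_iff[OF comm_group_G finite_G t2_carrier t2_neq_one involution_iff, of 3] by simp

lemma principal_product_norm:
  assumes I: "has_norm I a" "I \<subseteq> A" and one: "cls I = \<one>\<^bsub>G\<^esub>"
  obtains u v where "I = (*) (of_int u + of_int v * om) ` A" "a = u\<^sup>2 + int p * v\<^sup>2"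
proof -
  have f: "fi I" using I by (simp add: has_norm_def)
  then obtain c where c: "c \<in> K" "I = (*) c ` A" using cls_eq_one_iff one by blast
  have "c * 1 \<in> (*) c ` A" by (intro imageI A_1)
  hence "c \<in> A" using c(2) I(2) by auto
  then obtain u v where uv: "c = of_int u + of_int v * om" by (rule AE)
  have "has_norm A 1" using has_norm_idl[of 1 0] by (simp add: idl_1)
  moreover have "I = (*) ((of_int u + of_int v * om) / of_int 1) ` A" using c(2) uv by simp
  ultimately have "a * 1\<^sup>2 = (u\<^sup>2 + int p * v\<^sup>2) * 1" using I(1) by (intro has_norm_scale_eq) auto
  thus ?thesis using that c(2) uv by simp
qed

lemma ideal_prod_subset_A: "I \<subseteq> A \<Longrightarrow> J \<subseteq> A \<Longrightarrow> ideal_prod CC I J \<subseteq> A"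
  by (rule ideal_prod_CC_least) (auto intro: A_mult A_add)

text \<open>Rational integers dividing an element of \<open>A\<close> divide all its multiples.\<close>

lemma dvd_coeffs:
  assumes "of_int x + of_int y * om = (of_int u + of_int v * om) * a" "a \<in> A" "l dvd u" "l dvd v"
  shows "l dvd x" "l dvd y"
proof -
  obtain r s where "a = of_int r + of_int s * om" using assms(2) by (rule AE)
  hence "of_int x + of_int y * om = of_int (u * r - int p * v * s) + of_int (u * s + v * r) * om"
    using assms(1) lin_mult by simp
  hence "x = u * r - int p * v * s" "y = u * s + v * r" by (simp_all only: lin_eq_iff)
  thus "l dvd x" "l dvd y" using assms(3,4) by simp_all
qed

lemma odd_prime_not_dvd_two: "prime l \<Longrightarrow> odd l \<Longrightarrow> \<not> int l dvd 2"
  by (metis int_dvd_int_iff of_nat_numeral primes_dvd_imp_eq two_is_prime_nat dvd_refl)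

text \<open>Let \<open>N = (n, m + \<surd>-p)\<close> and \<open>Z = (z, m' + \<surd>-p)\<close>. An odd prime \<open>l\<close> dividing both coordinates of a generator of
\<open>N Z\<^sup>2\<close> divides all elements of this ideal. Testing suitable products of the generators of \<open>N\<close> and \<open>Z\<close> shows that \<open>l\<close> divides \<open>z\<close> and \<open>m'\<close>, hence \<open>p\<close>.\<close>

lemma primitive_norm_square_times:
  assumes n: "n > 0" "n dvd m\<^sup>2 + int p" and z: "z > 0" "z dvd m'\<^sup>2 + int p"
    and cop: "coprime n z" "\<not> int p dvd z"
    and one: "cl n m \<otimes>\<^bsub>G\<^esub> cl z m' \<otimes>\<^bsub>G\<^esub> cl z m' = \<one>\<^bsub>G\<^esub>"
  obtains u v where "n * z\<^sup>2 = u\<^sup>2 + int p * v\<^sup>2"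
    "\<And>l. prime l \<Longrightarrow> odd l \<Longrightarrow> \<not> (int l dvd u \<and> int l dvd v)"
proof -
  define I where "I = ideal_prod CC (ideal_prod CC (idl n m) (idl z m')) (idl z m')"
  have f: "fi (idl n m)" "fi (idl z m')" using n z by (auto intro: fi_idl)
  have hI: "has_norm I (n * z * z)" unfolding I_def using n z by (intro has_norm_prod has_norm_idl)
  have IA: "I \<subseteq> A" unfolding I_def by (intro ideal_prod_subset_A idl_subset_A)
  have "cls I = \<one>\<^bsub>G\<^esub>" using one f unfolding I_def by (simp add: cls_mult fi_prod)
  then obtain u v where uv: "I = (*) (of_int u + of_int v * om) ` A" "n * z * z = u\<^sup>2 + int p * v\<^sup>2"
    using principal_product_norm[OF hI IA] by metis
  have mem: "\<exists>a\<in>A. i * j * k = (of_int u + of_int v * om) * a"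
    if "i \<in> idl n m" "j \<in> idl z m'" "k \<in> idl z m'" for i j k
  proof -
    have "i * j * k \<in> I" unfolding I_def using that by (intro ideal_prod_CC_I)
    thus ?thesis unfolding uv(1) by blast
  qed
  have "\<not> (int l dvd u \<and> int l dvd v)" if l: "prime l" "odd l" for l
  proof
    assume d: "int l dvd u \<and> int l dvd v"
    have pl: "prime (int l)" using l by simp
    obtain a where a: "a \<in> A" "(of_int m + om) * of_int z * of_int z = (of_int u + of_int v * om) * a"
      using mem[OF idl_m idl_n idl_n] by blast
    have "of_int (m * z * z) + of_int (z * z) * om = (of_int u + of_int v * om) * a"
      using a(2) by (simp add: algebra_simps)
    hence "int l dvd z * z" using dvd_coeffs(2) a(1) d by blast
    hence lz: "int l dvd z" using pl by (simp add: prime_dvd_mult_iff)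
    hence ln: "\<not> int l dvd n" using cop(1) pl by (metis coprime_common_divisor not_prime_unit)
    obtain b where b: "b \<in> A" "of_int n * (of_int m' + om) * (of_int m' + om) = (of_int u + of_int v * om) * b"
      using mem[OF idl_n idl_m idl_m] by blast
    have "of_int (n * (m'\<^sup>2 - int p)) + of_int (n * (2 * m')) * om = (of_int u + of_int v * om) * b"
      unfolding b(2)[symmetric] by (simp add: algebra_simps om_sq om_sq' power2_eq_square)
    hence "int l dvd n * (2 * m')" using dvd_coeffs(2) b(1) d by blast
    hence lm: "int l dvd m'" using ln odd_prime_not_dvd_two[OF l] pl by (simp add: prime_dvd_mult_iff)
    have "int l dvd m'\<^sup>2 + int p" using lz z(2) dvd_trans by blast
    moreover have "int l dvd m'\<^sup>2" using lm by (simp add: power2_eq_square)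
    ultimately have "int l dvd int p" by (simp add: dvd_add_right_iff)
    hence "l = p" using l(1) prime_p primes_dvd_imp_eq by simp
    thus False using lz cop(2) by simp
  qed
  thus ?thesis using that uv(2) by (simp add: power2_eq_square mult.assoc)
qed

text \<open>The same primitivity argument for a generator of \<open>(2, 1 + \<surd>-p) F\<^sup>4\<close>, where \<open>F = (f, m + \<surd>-p)\<close>.\<close>

lemma primitive_norm_two_fourth_power:
  assumes f: "f > 0" "f dvd m\<^sup>2 + int p" "\<not> int p dvd f"
    and one: "t2 \<otimes>\<^bsub>G\<^esub> ((cl f m \<otimes>\<^bsub>G\<^esub> cl f m) \<otimes>\<^bsub>G\<^esub> (cl f m \<otimes>\<^bsub>G\<^esub> cl f m)) = \<one>\<^bsub>G\<^esub>"
  obtains u v where "2 * (f\<^sup>2)\<^sup>2 = u\<^sup>2 + int p * v\<^sup>2"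
    "\<And>l. prime l \<Longrightarrow> odd l \<Longrightarrow> \<not> (int l dvd u \<and> int l dvd v)"
proof -
  define F where "F = ideal_prod CC (idl f m) (idl f m)"
  define I where "I = ideal_prod CC (idl 2 1) (ideal_prod CC F F)"
  have fi: "fi (idl f m)" "fi (idl 2 1)" using f two_dvd by (auto intro: fi_idl)
  have "has_norm I (2 * ((f * f) * (f * f)))" unfolding I_def F_def
    using f two_dvd by (intro has_norm_prod has_norm_idl) auto
  moreover have "2 * ((f * f) * (f * f)) = 2 * (f\<^sup>2)\<^sup>2" by (simp add: power2_eq_square)
  ultimately have hI: "has_norm I (2 * (f\<^sup>2)\<^sup>2)" by (simp only:)
  have IA: "I \<subseteq> A" unfolding I_def F_def by (intro ideal_prod_subset_A idl_subset_A)
  have "cls I = \<one>\<^bsub>G\<^esub>" using one fi unfolding I_def F_def by (simp add: cls_mult fi_prod)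
  then obtain u v where uv: "I = (*) (of_int u + of_int v * om) ` A" "2 * (f\<^sup>2)\<^sup>2 = u\<^sup>2 + int p * v\<^sup>2"
    using principal_product_norm[OF hI IA] by metis
  have mem: "\<exists>a\<in>A. i * ((j * j) * (j * j)) = (of_int u + of_int v * om) * a"
    if "i \<in> idl 2 1" "j \<in> idl f m" for i j
  proof -
    have "i * ((j * j) * (j * j)) \<in> I" unfolding I_def F_def using that by (intro ideal_prod_CC_I)
    thus ?thesis unfolding uv(1) by blast
  qed
  have "\<not> (int l dvd u \<and> int l dvd v)" if l: "prime l" "odd l" for l
  proof
    assume d: "int l dvd u \<and> int l dvd v"
    have pl: "prime (int l)" using l by simp
    have l2: "\<not> int l dvd 2" using odd_prime_not_dvd_two[OF l] .
    obtain a where a: "a \<in> A" "of_int 2 * ((of_int f * of_int f) * (of_int f * of_int f)) = (of_int u + of_int v * om) * a"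
      using mem[OF idl_n idl_n] by blast
    have "of_int (2 * (f * f * (f * f))) + of_int 0 * om = (of_int u + of_int v * om) * a"
      using a(2) by simp
    hence "int l dvd 2 * (f * f * (f * f))" using dvd_coeffs(1) a(1) d by blast
    hence lf: "int l dvd f" using pl l2 by (simp add: prime_dvd_mult_iff)
    have lmp: "int l dvd m\<^sup>2 + int p" using lf f(2) dvd_trans by blast
    let ?mu = "of_int m + om"
    obtain b where b: "b \<in> A" "of_int 2 * ((?mu * ?mu) * (?mu * ?mu)) = (of_int u + of_int v * om) * b"
      using mem[OF idl_n idl_m] by blast
    have "of_int (2 * ((m\<^sup>2 - int p)\<^sup>2 - 4 * m\<^sup>2 * int p)) + of_int (8 * m * (m\<^sup>2 - int p)) * om = (of_int u + of_int v * om) * b"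
      unfolding b(2)[symmetric] by (simp add: algebra_simps om_sq om_sq' power2_eq_square)
    hence "int l dvd 8 * m * (m\<^sup>2 - int p)" using dvd_coeffs(2) b(1) d by blast
    moreover have "8 * m * (m\<^sup>2 - int p) = 2 * (2 * (2 * (2 * (m * (m * m))))) - 8 * m * (m\<^sup>2 + int p)"
      by (simp add: power2_eq_square algebra_simps)
    moreover have "int l dvd 8 * m * (m\<^sup>2 + int p)" using lmp by simp
    ultimately have "int l dvd 2 * (2 * (2 * (2 * (m * (m * m)))))" by (metis dvd_add diff_add_cancel)
    hence lm: "int l dvd m" using l2 pl by (simp only: prime_dvd_mult_iff) blast
    moreover have "int l dvd m\<^sup>2" using lm by (simp add: power2_eq_square)
    ultimately have "int l dvd int p" using lmp by (simp add: dvd_add_right_iff)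
    hence "l = p" using l(1) prime_p primes_dvd_imp_eq by simp
    thus False using lf f(3) by simp
  qed
  thus ?thesis using that uv(2) by blast
qed

text \<open>The element \<open>g = x + y\<surd>-p\<close> generates the ideal \<open>N\<^sup>2 (2, 1 + \<surd>-p)\<close>, where \<open>N = (n, m + \<surd>-p)\<close> and
\<open>m \<equiv> x/y\<close> modulo \<open>n\<^sup>2\<close>. It suffices to see that \<open>g\<close> divides this product, because both ideals have norm
\<open>2n\<^sup>2\<close>. Divisibility follows from the explicit cofactors \<open>\<beta>\<close>, \<open>\<gamma>1\<close> and \<open>\<gamma>2\<close> of the generators; the last two
are integral because \<open>1 + \<surd>-p\<close> times an element of even norm is divisible by \<open>2\<close>.\<close>

lemma class_of_norm_equation:
  assumes n: "n > 0" "odd n" and eq: "x\<^sup>2 + int p * y\<^sup>2 = 2 * n\<^sup>2" and cop: "coprime y n"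
  obtains m where "n dvd m\<^sup>2 + int p" "cl n m \<otimes>\<^bsub>G\<^esub> cl n m \<otimes>\<^bsub>G\<^esub> t2 = \<one>\<^bsub>G\<^esub>"
proof -
  have "coprime y (n\<^sup>2)" using cop by simp
  then obtain m0 where "[y * m0 = 1] (mod n\<^sup>2)" using cong_solve_coprime_int by blast
  hence "[y * m0 * x = 1 * x] (mod n\<^sup>2)" by (intro cong_mult cong_refl)
  hence "[x = m0 * x * y] (mod n\<^sup>2)" by (simp add: cong_sym_eq mult.commute mult.left_commute)
  then obtain m where m: "n\<^sup>2 dvd x - m * y" by (auto simp: cong_iff_dvd_diff)
  have "y\<^sup>2 * (m\<^sup>2 + int p) = (x\<^sup>2 + int p * y\<^sup>2) - (x - m * y) * (x + m * y)"
    by (simp add: power2_eq_square algebra_simps)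
  moreover have "n\<^sup>2 dvd (x\<^sup>2 + int p * y\<^sup>2) - (x - m * y) * (x + m * y)" unfolding eq using m by simp
  ultimately have "n\<^sup>2 dvd y\<^sup>2 * (m\<^sup>2 + int p)" by simp
  moreover have "coprime (n\<^sup>2) (y\<^sup>2)" using cop by (simp add: coprime_commute)
  ultimately have nm2: "n\<^sup>2 dvd m\<^sup>2 + int p" by (simp add: coprime_dvd_mult_right_iff)
  hence nm: "n dvd m\<^sup>2 + int p" by (metis dvd_mult_left power2_eq_square)
  have oddp: "odd (int p)" using mod4 by presburger
  have odd_xy: "odd x" "odd y"
  proof -
    have "even (x\<^sup>2 + int p * y\<^sup>2)" using eq by simp
    hence xy: "even x \<longleftrightarrow> even y" using oddp by simp
    show "odd x"
    proof
      assume "even x"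
      then obtain a b where "x = 2 * a" "y = 2 * b" using xy by (metis evenE)
      hence "2 * (2 * (a\<^sup>2 + int p * b\<^sup>2)) = 2 * n\<^sup>2" using eq by (simp add: power_mult_distrib)
      hence "n\<^sup>2 = 2 * (a\<^sup>2 + int p * b\<^sup>2)" by linarith
      hence "even (n\<^sup>2)" by simp
      thus False using n(2) by simp
    qed
    thus "odd y" using xy by simp
  qed
  define g where "g = of_int x + of_int y * om"
  define gb where "gb = of_int x + of_int (- y) * om"
  have gg: "g * gb = 2 * (of_int n)\<^sup>2"
  proof -
    have "g * gb = of_int (x\<^sup>2 + int p * y\<^sup>2)" unfolding g_def gb_def lin_mult by (simp add: power2_eq_square)
    thus ?thesis unfolding eq by simp
  qed
  have n0: "of_int n \<noteq> (0::complex)" using n by simp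
  have "n\<^sup>2 dvd m * (x - m * y) + (m\<^sup>2 + int p) * y" using m nm2 by simp
  moreover have "m * (x - m * y) + (m\<^sup>2 + int p) * y = m * x + int p * y"
    by (simp add: power2_eq_square algebra_simps)
  ultimately obtain b1 where b1: "m * x + int p * y = n\<^sup>2 * b1" by (metis dvdE)
  obtain b2 where b2: "x - m * y = n\<^sup>2 * b2" using m by (elim dvdE)
  define \<beta> where "\<beta> = of_int b1 + of_int b2 * om"
  have "(of_int m + om) * gb = of_int (m * x + int p * y) + of_int (x - m * y) * om"
    unfolding gb_def by (simp add: algebra_simps om_sq om_sq')
  hence mg: "(of_int m + om) * gb = (of_int n)\<^sup>2 * \<beta>"
    unfolding b1 b2 \<beta>_def by (simp add: algebra_simps)
  have "(of_int n)\<^sup>2 * (2 * (of_int m + om)) = (g * gb) * (of_int m + om)" unfolding gg by simp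
  also have "\<dots> = g * ((of_int m + om) * gb)" by (simp only: mult_ac)
  also have "\<dots> = (of_int n)\<^sup>2 * (g * \<beta>)" unfolding mg by (simp only: mult_ac)
  finally have h1: "2 * (of_int m + om) = g * \<beta>" using n0 by simp
  have half: "\<exists>c\<in>A. (1 + om) * (of_int a + of_int b * om) = 2 * c" if "even (a + b)" for a b
  proof -
    obtain s where s: "a + b = 2 * s" using \<open>even (a + b)\<close> by (rule evenE)
    have "even (a - int p * b)" using \<open>even (a + b)\<close> oddp by simp
    then obtain r where r: "a - int p * b = 2 * r" by (elim evenE)
    have "(1 + om) * (of_int a + of_int b * om) = of_int (a - int p * b) + of_int (a + b) * om"
      using lin_mult[of 1 1 a b] by (simp add: add.commute)
    hence "(1 + om) * (of_int a + of_int b * om) = 2 * (of_int r + of_int s * om)"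
      unfolding r s by (simp add: algebra_simps)
    thus ?thesis using AI by blast
  qed
  have "(n\<^sup>2)\<^sup>2 * (b1\<^sup>2 + int p * b2\<^sup>2) = (m\<^sup>2 + int p) * (x\<^sup>2 + int p * y\<^sup>2)"
  proof -
    have "(n\<^sup>2)\<^sup>2 * (b1\<^sup>2 + int p * b2\<^sup>2) = (n\<^sup>2 * b1)\<^sup>2 + int p * (n\<^sup>2 * b2)\<^sup>2"
      by (simp add: power2_eq_square algebra_simps)
    also have "\<dots> = (m\<^sup>2 + int p) * (x\<^sup>2 + int p * y\<^sup>2)"
      unfolding b1[symmetric] b2[symmetric] by (simp add: power2_eq_square algebra_simps)
    finally show ?thesis .
  qed
  hence "even ((n\<^sup>2)\<^sup>2 * (b1\<^sup>2 + int p * b2\<^sup>2))" unfolding eq by simp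
  hence "even (b1\<^sup>2 + int p * b2\<^sup>2)" using n(2) by simp
  hence evb: "even (b1 + b2)" using oddp by simp
  obtain \<gamma>1 where c1: "\<gamma>1 \<in> A" "(1 + om) * \<beta> = 2 * \<gamma>1" using half[OF evb] unfolding \<beta>_def by blast
  have "even (x + - y)" using odd_xy by simp
  then obtain \<gamma>2 where c2: "\<gamma>2 \<in> A" "(1 + om) * gb = 2 * \<gamma>2" using half unfolding gb_def by blast
  have "2 * ((1 + om) * (of_int m + om)) = g * ((1 + om) * \<beta>)" using h1 by (metis mult.left_commute)
  hence h2: "(1 + om) * (of_int m + om) = g * \<gamma>1" unfolding c1(2) by simp
  have "2 * ((1 + om) * (of_int n)\<^sup>2) = g * ((1 + om) * gb)" using gg by (metis mult.left_commute)
  hence h3: "(1 + om) * (of_int n)\<^sup>2 = g * \<gamma>2" unfolding c2(2) by simp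
  have bA: "\<beta> \<in> A" "gb \<in> A" "g \<in> A" "of_int m + om \<in> A"
    unfolding \<beta>_def gb_def g_def by (rule AI, rule AI, rule AI, intro A_add A_of_int A_om)
  define I where "I = ideal_prod CC (ideal_prod CC (idl n m) (idl n m)) (idl 2 1)"
  have sub: "i * j * s \<in> (*) g ` A" if ijs: "i \<in> idl n m" "j \<in> idl n m" "s \<in> idl 2 1" for i j s
  proof -
    let ?mu = "of_int m + om"
    obtain x1 y1 where i: "i = of_int n * of_int x1 + ?mu * of_int y1" using ijs(1) by (rule idlE)
    obtain x2 y2 where j: "j = of_int n * of_int x2 + ?mu * of_int y2" using ijs(2) by (rule idlE)
    obtain x3 y3 where "s = of_int 2 * of_int x3 + (of_int 1 + om) * of_int y3" using ijs(3) by (rule idlE)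
    hence s: "s = 2 * of_int x3 + (1 + om) * of_int y3" by simp
    define w where "w = of_int n * (of_int x1 * of_int y2 + of_int x2 * of_int y1) + ?mu * of_int y1 * of_int y2"
    have wA: "w \<in> A" unfolding w_def by (intro A_add A_mult bA A_of_int)
    have "i * j = (of_int n)\<^sup>2 * (of_int x1 * of_int x2) + ?mu * w"
      unfolding i j w_def by (simp add: power2_eq_square algebra_simps)
    hence "i * j * s = (of_int x1 * of_int x2) * (of_int x3 * (2 * (of_int n)\<^sup>2) + of_int y3 * ((1 + om) * (of_int n)\<^sup>2)) +
        w * (of_int x3 * (2 * ?mu) + of_int y3 * ((1 + om) * ?mu))"
      unfolding s by (simp add: algebra_simps)
    also have "\<dots> = g * ((of_int x1 * of_int x2) * (of_int x3 * gb + of_int y3 * \<gamma>2) + w * (of_int x3 * \<beta> + of_int y3 * \<gamma>1))"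
      unfolding h1 h2 h3 gg[symmetric] by (simp add: algebra_simps)
    finally show ?thesis
      by (simp only:) (intro imageI A_add A_mult bA wA c1(1) c2(1) A_of_int)
  qed
  have gA: "fi ((*) g ` A)"
    using lin_eq_0_iff[of x y] odd_xy bA K_of_A by (intro fi_scale fi_A) (auto simp: g_def)
  have "I \<subseteq> (*) g ` A" unfolding I_def
  proof (rule ideal_prod_CC_least)
    fix e s assume e: "e \<in> ideal_prod CC (idl n m) (idl n m)" and s: "s \<in> idl 2 1"
    from e show "e * s \<in> (*) g ` A"
    proof (induction rule: ideal_prod_CC_induct)
      case (prod i j)
      thus ?case using sub s by blast
    next
      case (sum u v)
      thus ?case using fi_add[OF gA] by (simp add: distrib_right)
    qed
  qed (rule fi_add[OF gA])
  moreover have hI: "has_norm I (n * n * 2)" unfolding I_def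
    using n nm two_dvd by (intro has_norm_prod has_norm_idl) auto
  moreover have "has_norm ((*) g ` A) (n * n * 2)"
  proof -
    have hA: "has_norm A 1" using has_norm_idl[of 1 0] by (simp add: idl_1)
    have "cnj g = gb" by (simp add: g_def gb_def)
    hence "g * cnj g * of_int 1 = of_int (n * n * 2)" using gg by (simp add: power2_eq_square)
    thus ?thesis unfolding has_norm_def using scale_norm[OF hA, of g] gA n(1) by (simp del: of_int_mult)
  qed
  ultimately have "I = (*) g ` A" using has_norm_subset_eq by blast
  hence "cls I = \<one>\<^bsub>G\<^esub>" using gA bA(3) K_of_A cls_eq_one_iff[of I] odd_xy lin_eq_0_iff[of x y]
    by (auto simp: g_def)
  moreover have "cls I = cl n m \<otimes>\<^bsub>G\<^esub> cl n m \<otimes>\<^bsub>G\<^esub> t2"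
    unfolding I_def using n nm two_dvd by (simp add: cls_mult fi_prod fi_idl)
  ultimately show ?thesis using that nm by metis
qed

text \<open>From \<open>t = g\<^sup>8\<close>: the class \<open>t\<close> is a square and contains an ideal of norm \<open>2\<close>, whence \<open>(2/p) = 1\<close>. With \<open>F\<close> of norm \<open>f\<close> in the class
of \<open>g\<^sup>-\<^sup>2\<close>, the number \<open>2f\<^sup>4 = \<bar>f\<^sup>2 + f\<^sup>2 i\<bar>\<^sup>2\<close> is primitively of the form \<open>u\<^sup>2 + pv\<^sup>2\<close>,
and \<open>Legendre_common_norm\<close> applies to \<open>f\<^sup>2 (1 + i)\<close>.\<close>

lemma eighth_power_imp_residues:
  assumes "16 dvd Coset.order G"
  shows "p mod 8 = 1" "[\<iota>\<^sup>2 = -1] (mod int p) \<Longrightarrow> Legendre (1 + \<iota>) p = 1"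
proof -
  interpret G: comm_group G by (rule comm_group_G)
  obtain g where g: "g \<in> carrier G" "g [^]\<^bsub>G\<^esub> (8::nat) = t2"
    using assms sixteen_dvd_class_number_iff by blast
  have n2: "\<not> int p dvd 2" using gt2 by (auto dest: zdvd_imp_le)
  have "g [^]\<^bsub>G\<^esub> (8::nat) = g [^]\<^bsub>G\<^esub> (4::nat) \<otimes>\<^bsub>G\<^esub> g [^]\<^bsub>G\<^esub> (4::nat)"
    using g(1) by (simp add: G.nat_pow_mult)
  hence "Legendre 2 p = 1"
    using g residue_if_square_class[OF _ two_dvd n2, of "g [^]\<^bsub>G\<^esub> (4::nat)"] by simp
  thus p8: "p mod 8 = 1" using Legendre_two by (auto split: if_splits)
  assume iota: "[\<iota>\<^sup>2 = -1] (mod int p)"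
  define h where "h = inv\<^bsub>G\<^esub> (g [^]\<^bsub>G\<^esub> (2::nat))"
  have h: "h \<in> carrier G" using g by (simp add: h_def)
  obtain f m where f: "f > 0" "f dvd m\<^sup>2 + int p" "coprime f (int p)" "h = cl f m"
    using class_rep_coprime[OF h, of "int p"] gt2 by auto
  have npf: "\<not> int p dvd f" using f(3) prime_int by (metis coprime_commute coprime_absorb_left not_prime_unit)
  have "(h \<otimes>\<^bsub>G\<^esub> h) \<otimes>\<^bsub>G\<^esub> (h \<otimes>\<^bsub>G\<^esub> h) = inv\<^bsub>G\<^esub> (g [^]\<^bsub>G\<^esub> (8::nat))"
    unfolding h_def using g(1) by (simp add: G.inv_mult_group[symmetric] G.nat_pow_mult)
  hence "t2 \<otimes>\<^bsub>G\<^esub> ((h \<otimes>\<^bsub>G\<^esub> h) \<otimes>\<^bsub>G\<^esub> (h \<otimes>\<^bsub>G\<^esub> h)) = \<one>\<^bsub>G\<^esub>" using g(2) t2_carrier by simp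
  then obtain u v where uv: "2 * (f\<^sup>2)\<^sup>2 = u\<^sup>2 + int p * v\<^sup>2"
    "\<And>l. prime l \<Longrightarrow> odd l \<Longrightarrow> \<not> (int l dvd u \<and> int l dvd v)"
    using primitive_norm_two_fourth_power[OF f(1,2) npf] f(4) by metis
  have "(f\<^sup>2)\<^sup>2 + (f\<^sup>2)\<^sup>2 = u\<^sup>2 + int p * v\<^sup>2" using uv(1) by simp
  moreover have "\<not> int p dvd (f\<^sup>2)\<^sup>2 + (f\<^sup>2)\<^sup>2"
  proof
    assume "int p dvd (f\<^sup>2)\<^sup>2 + (f\<^sup>2)\<^sup>2"
    hence "int p dvd 2 * (f\<^sup>2)\<^sup>2" by simp
    hence "int p dvd (f\<^sup>2)\<^sup>2" using n2 prime_int by (simp only: prime_dvd_mult_iff) blast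
    thus False using npf prime_int prime_dvd_power by blast
  qed
  ultimately have "Legendre (f\<^sup>2 + f\<^sup>2 * \<iota>) p = 1"
    using Legendre_common_norm[OF p8 iota] uv(2) by blast
  hence "Legendre (f\<^sup>2 * (1 + \<iota>)) p = 1" by (simp add: algebra_simps)
  thus "Legendre (1 + \<iota>) p = 1" using Legendre_mult Legendre_square[OF npf] by simp
qed

text \<open>The norm equation produces an ideal \<open>N\<close> of norm \<open>n \<equiv> 1 (mod 4)\<close> with \<open>N\<^sup>2 (2, 1 + \<surd>-p)\<close> principal. By
\<open>Legendre_divisor_of_norm\<close> its class is a square \<open>D\<^sup>-\<^sup>2\<close>, so \<open>t = D\<^sup>4\<close>. If also \<open>t = g\<^sup>8\<close>, then \<open>D\<close>
differs from \<open>g\<^sup>2\<close> by an element of order dividing \<open>4\<close>, and these are squares because \<open>t\<close> is a fourth power;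
so \<open>16\<close> divides the class number if and only if \<open>D\<close> is a square. For an ideal \<open>Z\<close> of norm \<open>z\<close> in \<open>D\<close> this means
\<open>(z/p) = 1\<close>, and since \<open>N Z\<^sup>2\<close> is principal, \<open>Legendre_common_norm\<close> applied to \<open>z\<close> times the odd part of
\<open>b\<close> identifies \<open>(z/p)\<close> with \<open>(b/p)\<close>.\<close>

theorem sixteen_dvd_iff_Legendre:
  assumes p8: "p mod 8 = 1" and iota: "Legendre (1 + \<iota>) p = 1" "[\<iota>\<^sup>2 = -1] (mod int p)"
    and re: "a1\<^sup>2 - a2\<^sup>2 - b1\<^sup>2 + b2\<^sup>2 + 2 * b1 * b2 = int p"
    and im: "2 * a1 * a2 - b1\<^sup>2 + b2\<^sup>2 - 2 * b1 * b2 = 0"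
  shows "16 dvd Coset.order G \<longleftrightarrow> Legendre (b1 + b2 * \<iota>) p = 1"
proof -
  interpret G: comm_group G by (rule comm_group_G)
  obtain c1 c2 h n x y where *: "Legendre (b1 + b2 * \<iota>) p = Legendre (c1 + c2 * \<iota>) p"
    "n > 0" "odd n" "odd h" "c1\<^sup>2 + c2\<^sup>2 = h\<^sup>2 * n" "x\<^sup>2 + int p * y\<^sup>2 = 2 * n\<^sup>2" "coprime y n"
    and hl: "\<And>l. prime l \<Longrightarrow> odd l \<Longrightarrow> int l dvd h \<Longrightarrow> Legendre (int l) p = 1"
    using quartic_norm_reduction[OF p8 iota re im] by metis
  obtain m where m: "n dvd m\<^sup>2 + int p" "cl n m \<otimes>\<^bsub>G\<^esub> cl n m \<otimes>\<^bsub>G\<^esub> t2 = \<one>\<^bsub>G\<^esub>"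
    using class_of_norm_equation[OF *(2,3,6,7)] .
  have npn: "\<not> int p dvd n"
  proof
    assume pn: "int p dvd n"
    hence "int p * int p dvd n\<^sup>2" unfolding power2_eq_square by (intro mult_dvd_mono)
    hence pp: "int p * int p dvd x\<^sup>2 + int p * y\<^sup>2" unfolding *(6) by simp
    hence "int p dvd x\<^sup>2 + int p * y\<^sup>2" by (metis dvd_mult_left)
    hence "int p dvd x\<^sup>2" by (simp add: dvd_add_left_iff)
    hence "int p dvd x" using prime_int by (simp add: prime_dvd_power_iff)
    hence "int p * int p dvd x\<^sup>2" unfolding power2_eq_square by (intro mult_dvd_mono)
    hence "int p * int p dvd int p * y\<^sup>2" using pp by (simp add: dvd_add_right_iff)
    hence "int p dvd y\<^sup>2" using gt2 by (subst (asm) dvd_times_left_cancel_iff) auto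
    hence "int p dvd y" using prime_int by (simp add: prime_dvd_power_iff)
    thus False using pn *(7) prime_int by (metis coprime_common_divisor not_prime_unit)
  qed
  have hp: "\<not> int p dvd h"
  proof
    assume ph: "int p dvd h"
    have "odd p" using p8 by presburger
    hence "Legendre (int p) p = 1" using hl[OF prime_p _ ph] by simp
    thus False using Legendre_eq_0_iff[of "int p" "int p"] by simp
  qed
  \<comment> \<open>An odd sum of two squares, divided by the odd square \<open>h\<^sup>2\<close>.\<close>
  have n4: "nat n mod 4 = 1"
  proof -
    have mods: "e\<^sup>2 mod 4 = 0 \<or> e\<^sup>2 mod 4 = 1" for e :: int
    proof -
      have "e\<^sup>2 mod 4 = (e mod 4)\<^sup>2 mod 4" by (simp add: power_mod)
      moreover have "e mod 4 = 0 \<or> e mod 4 = 1 \<or> e mod 4 = 2 \<or> e mod 4 = 3" by presburger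
      ultimately show ?thesis by auto
    qed
    have "h mod 4 = 1 \<or> h mod 4 = 3" using *(4) by presburger
    moreover have "h\<^sup>2 mod 4 = (h mod 4)\<^sup>2 mod 4" by (simp add: power_mod)
    ultimately have h1: "h\<^sup>2 mod 4 = 1" by auto
    have "(c1\<^sup>2 + c2\<^sup>2) mod 4 = ((h\<^sup>2 mod 4) * (n mod 4)) mod 4" unfolding *(5) by (simp add: mod_mult_eq)
    hence "(c1\<^sup>2 + c2\<^sup>2) mod 4 = n mod 4" using h1 by simp
    hence "n mod 4 = 1" using mods[of c1] mods[of c2] *(3) by presburger
    thus ?thesis using *(2) by (simp add: nat_mod_as_int)
  qed
  have "Legendre (int (nat n)) p = 1"
    using Legendre_divisor_of_norm[of "nat n" m] *(2,3) m(1) npn n4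
    by (auto simp: even_nat_iff int_dvd_int_iff[symmetric] simp del: int_dvd_int_iff)
  hence "Legendre n p = 1" using *(2) by simp
  then obtain Y where Y: "Y \<in> carrier G" "cl n m = Y \<otimes>\<^bsub>G\<^esub> Y"
    using square_class_if_residue[OF *(2) m(1)] by blast
  define D where "D = inv\<^bsub>G\<^esub> Y"
  have D: "D \<in> carrier G" using Y(1) by (simp add: D_def)
  have "2 * int p * n > 0" using *(2) gt2 by simp
  then obtain z m' where z: "z > 0" "z dvd m'\<^sup>2 + int p" "coprime z (2 * int p * n)" "D = cl z m'"
    using class_rep_coprime[OF D] by metis
  have copz: "coprime n z" "coprime z (int p)" using z(3) by (auto simp: coprime_commute)
  have npz: "\<not> int p dvd z" using copz(2) prime_int by (metis coprime_commute coprime_absorb_left not_prime_unit)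
  have YD: "Y \<otimes>\<^bsub>G\<^esub> D = \<one>\<^bsub>G\<^esub>" using Y(1) by (simp add: D_def)
  have "cl n m \<otimes>\<^bsub>G\<^esub> D \<otimes>\<^bsub>G\<^esub> D = (Y \<otimes>\<^bsub>G\<^esub> D) \<otimes>\<^bsub>G\<^esub> (Y \<otimes>\<^bsub>G\<^esub> D)"
    using Y D by (simp add: G.m_ac)
  hence one: "cl n m \<otimes>\<^bsub>G\<^esub> cl z m' \<otimes>\<^bsub>G\<^esub> cl z m' = \<one>\<^bsub>G\<^esub>" using YD z(4) by simp
  obtain u v where uv: "n * z\<^sup>2 = u\<^sup>2 + int p * v\<^sup>2"
    "\<And>l. prime l \<Longrightarrow> odd l \<Longrightarrow> \<not> (int l dvd u \<and> int l dvd v)"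
    using primitive_norm_square_times[OF *(2) m(1) z(1,2) copz(1) npz one] by blast
  have "(c1 * z)\<^sup>2 + (c2 * z)\<^sup>2 = h\<^sup>2 * (n * z\<^sup>2)"
    using *(5) by (simp add: power_mult_distrib distrib_right[symmetric])
  hence nrm: "(c1 * z)\<^sup>2 + (c2 * z)\<^sup>2 = (h * u)\<^sup>2 + int p * (h * v)\<^sup>2"
    and nrm': "(c1 * z)\<^sup>2 + (c2 * z)\<^sup>2 = h\<^sup>2 * (n * z\<^sup>2)"
    unfolding uv(1) by (simp_all add: power_mult_distrib algebra_simps)
  have "Legendre (c1 * z + c2 * z * \<iota>) p = 1"
  proof (rule Legendre_common_norm[OF p8 iota(2) nrm])
    show "\<not> int p dvd (c1 * z)\<^sup>2 + (c2 * z)\<^sup>2"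
      unfolding nrm' using hp npn npz prime_int by (simp add: prime_dvd_mult_iff prime_dvd_power_iff)
    fix l assume l: "prime l" "odd l" "int l dvd h * u" "int l dvd h * v"
    hence "int l dvd h" using uv(2)[OF l(1,2)] by (auto simp: prime_dvd_mult_iff)
    thus "Legendre (int l) p = 1" using hl l by blast
  qed
  hence "Legendre (z * (c1 + c2 * \<iota>)) p = 1" by (simp add: algebra_simps)
  hence "Legendre z p * Legendre (c1 + c2 * \<iota>) p = 1" by (simp add: Legendre_mult)
  hence zb: "Legendre z p = 1 \<longleftrightarrow> Legendre (b1 + b2 * \<iota>) p = 1"
    unfolding *(1) using Legendre_cases[of z p] Legendre_cases[of "c1 + c2 * \<iota>" p] by auto
  have t2D: "t2 = D [^]\<^bsub>G\<^esub> (4::nat)"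
  proof -
    have pw: "D [^]\<^bsub>G\<^esub> (4::nat) = (D \<otimes>\<^bsub>G\<^esub> D) \<otimes>\<^bsub>G\<^esub> (D \<otimes>\<^bsub>G\<^esub> D)"
      using D by (simp add: numeral_eq_Suc G.m_assoc)
    have "(Y \<otimes>\<^bsub>G\<^esub> Y) \<otimes>\<^bsub>G\<^esub> (Y \<otimes>\<^bsub>G\<^esub> Y) \<otimes>\<^bsub>G\<^esub> t2 = \<one>\<^bsub>G\<^esub>" using m(2) Y(2) by simp
    hence "((D \<otimes>\<^bsub>G\<^esub> D) \<otimes>\<^bsub>G\<^esub> (D \<otimes>\<^bsub>G\<^esub> D)) \<otimes>\<^bsub>G\<^esub> ((Y \<otimes>\<^bsub>G\<^esub> Y) \<otimes>\<^bsub>G\<^esub> (Y \<otimes>\<^bsub>G\<^esub> Y) \<otimes>\<^bsub>G\<^esub> t2) = (D \<otimes>\<^bsub>G\<^esub> D) \<otimes>\<^bsub>G\<^esub> (D \<otimes>\<^bsub>G\<^esub> D)"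
      using D by simp
    moreover have "((D \<otimes>\<^bsub>G\<^esub> D) \<otimes>\<^bsub>G\<^esub> (D \<otimes>\<^bsub>G\<^esub> D)) \<otimes>\<^bsub>G\<^esub> ((Y \<otimes>\<^bsub>G\<^esub> Y) \<otimes>\<^bsub>G\<^esub> (Y \<otimes>\<^bsub>G\<^esub> Y) \<otimes>\<^bsub>G\<^esub> t2) =
        (Y \<otimes>\<^bsub>G\<^esub> D) \<otimes>\<^bsub>G\<^esub> (Y \<otimes>\<^bsub>G\<^esub> D) \<otimes>\<^bsub>G\<^esub> (Y \<otimes>\<^bsub>G\<^esub> D) \<otimes>\<^bsub>G\<^esub> (Y \<otimes>\<^bsub>G\<^esub> D) \<otimes>\<^bsub>G\<^esub> t2"
      using D Y(1) t2_carrier by (simp add: G.m_ac)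
    ultimately show ?thesis using YD t2_carrier pw by simp
  qed
  have "16 dvd Coset.order G \<longleftrightarrow> (\<exists>w\<in>carrier G. D = w \<otimes>\<^bsub>G\<^esub> w)"
  proof
    assume "\<exists>w\<in>carrier G. D = w \<otimes>\<^bsub>G\<^esub> w"
    then obtain w where w: "w \<in> carrier G" "D = w \<otimes>\<^bsub>G\<^esub> w" by blast
    have "D = w [^]\<^bsub>G\<^esub> (2::nat)" using w by (simp add: numeral_eq_Suc)
    hence "w [^]\<^bsub>G\<^esub> (8::nat) = t2" unfolding t2D using w(1) by (simp add: G.nat_pow_pow)
    thus "16 dvd Coset.order G" using w(1) sixteen_dvd_class_number_iff by blast
  next
    assume "16 dvd Coset.order G"
    then obtain g where g: "g \<in> carrier G" "g [^]\<^bsub>G\<^esub> (8::nat) = t2"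
      using sixteen_dvd_class_number_iff by blast
    define sq where "sq = (\<lambda>x. \<exists>w\<in>carrier G. x = w \<otimes>\<^bsub>G\<^esub> w)"
    have sq_mult: "sq (x \<otimes>\<^bsub>G\<^esub> y)" if "sq x" "sq y" for x y
    proof -
      obtain w w' where "w \<in> carrier G" "w' \<in> carrier G" "x = w \<otimes>\<^bsub>G\<^esub> w" "y = w' \<otimes>\<^bsub>G\<^esub> w'"
        using \<open>sq x\<close> \<open>sq y\<close> unfolding sq_def by blast
      hence "x \<otimes>\<^bsub>G\<^esub> y = (w \<otimes>\<^bsub>G\<^esub> w') \<otimes>\<^bsub>G\<^esub> (w \<otimes>\<^bsub>G\<^esub> w')" "w \<otimes>\<^bsub>G\<^esub> w' \<in> carrier G" by (simp_all add: G.m_ac)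
      thus ?thesis unfolding sq_def by blast
    qed
    have sq_one: "sq \<one>\<^bsub>G\<^esub>" unfolding sq_def by (intro bexI[of _ "\<one>\<^bsub>G\<^esub>"]) auto
    have sq_even: "sq (x [^]\<^bsub>G\<^esub> (2 * k :: nat))" if "x \<in> carrier G" for x k
      unfolding sq_def using that by (intro bexI[of _ "x [^]\<^bsub>G\<^esub> k"]) (auto simp: G.nat_pow_mult mult_2)
    have sq_t2: "sq t2" unfolding g(2)[symmetric] using sq_even[OF g(1), of 4] by simp
    have inv2: "sq x" if "x \<in> carrier G" "x \<otimes>\<^bsub>G\<^esub> x = \<one>\<^bsub>G\<^esub>" for x
      using involution_class[OF that] sq_one sq_t2 by auto
    \<comment> \<open>The quotient of \<open>D\<close> and \<open>g\<^sup>2\<close> has order dividing \<open>4\<close>, since both have fourth power \<open>t\<close>.\<close>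
    define y where "y = D \<otimes>\<^bsub>G\<^esub> inv\<^bsub>G\<^esub> (g [^]\<^bsub>G\<^esub> (2::nat))"
    have y: "y \<in> carrier G" using D g(1) by (simp add: y_def)
    have "y [^]\<^bsub>G\<^esub> (4::nat) = D [^]\<^bsub>G\<^esub> (4::nat) \<otimes>\<^bsub>G\<^esub> inv\<^bsub>G\<^esub> (g [^]\<^bsub>G\<^esub> (8::nat))"
      unfolding y_def using D g(1) by (simp add: G.pow_mult_distrib G.m_comm G.nat_pow_inv G.nat_pow_pow)
    hence y4: "y [^]\<^bsub>G\<^esub> (4::nat) = \<one>\<^bsub>G\<^esub>" using g(2) t2D t2_carrier by simp
    have "(y \<otimes>\<^bsub>G\<^esub> y) \<otimes>\<^bsub>G\<^esub> (y \<otimes>\<^bsub>G\<^esub> y) = \<one>\<^bsub>G\<^esub>" using y4 y by (simp add: numeral_eq_Suc G.m_assoc)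
    hence "y \<otimes>\<^bsub>G\<^esub> y = \<one>\<^bsub>G\<^esub> \<or> y \<otimes>\<^bsub>G\<^esub> y = t2" using involution_class y by simp
    hence "sq y"
    proof
      assume "y \<otimes>\<^bsub>G\<^esub> y = \<one>\<^bsub>G\<^esub>"
      thus ?thesis using inv2 y by blast
    next
      assume yt: "y \<otimes>\<^bsub>G\<^esub> y = t2"
      define k where "k = g [^]\<^bsub>G\<^esub> (4::nat)"
      have k: "k \<in> carrier G" "k \<otimes>\<^bsub>G\<^esub> k = t2" using g by (auto simp: k_def G.nat_pow_mult)
      have "(y \<otimes>\<^bsub>G\<^esub> inv\<^bsub>G\<^esub> k) \<otimes>\<^bsub>G\<^esub> (y \<otimes>\<^bsub>G\<^esub> inv\<^bsub>G\<^esub> k) = (y \<otimes>\<^bsub>G\<^esub> y) \<otimes>\<^bsub>G\<^esub> inv\<^bsub>G\<^esub> (k \<otimes>\<^bsub>G\<^esub> k)"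
        using y k(1) by (simp add: G.m_ac G.inv_mult_group)
      hence "sq (y \<otimes>\<^bsub>G\<^esub> inv\<^bsub>G\<^esub> k)" using yt k t2_carrier y by (intro inv2) auto
      moreover have "sq k" using sq_even[OF g(1), of 2] by (simp add: k_def)
      ultimately have "sq ((y \<otimes>\<^bsub>G\<^esub> inv\<^bsub>G\<^esub> k) \<otimes>\<^bsub>G\<^esub> k)" by (rule sq_mult)
      thus ?thesis using y k(1) by (simp add: G.m_assoc)
    qed
    moreover have "sq (g [^]\<^bsub>G\<^esub> (2::nat))" using sq_even[OF g(1), of 1] by simp
    ultimately have "sq (y \<otimes>\<^bsub>G\<^esub> g [^]\<^bsub>G\<^esub> (2::nat))" by (rule sq_mult)
    moreover have "y \<otimes>\<^bsub>G\<^esub> g [^]\<^bsub>G\<^esub> (2::nat) = D" unfolding y_def using D g(1) by (simp add: G.m_assoc)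
    ultimately show "\<exists>w\<in>carrier G. D = w \<otimes>\<^bsub>G\<^esub> w" unfolding sq_def by simp
  qed
  also have "\<dots> \<longleftrightarrow> Legendre z p = 1"
  proof
    assume "\<exists>w\<in>carrier G. D = w \<otimes>\<^bsub>G\<^esub> w"
    thus "Legendre z p = 1" using residue_if_square_class[OF z(1,2) npz] z(4) by auto
  next
    assume "Legendre z p = 1"
    thus "\<exists>w\<in>carrier G. D = w \<otimes>\<^bsub>G\<^esub> w" using square_class_if_residue[OF z(1,2)] z(4) by metis
  qed
  finally show ?thesis using zb by simp
qed

end

section \<open>The quartic field and its embeddings\<close>

text \<open>The element \<open>j = \<alpha>\<^sup>2 - 1\<close> below is \<open>\<i>\<close> or \<open>-\<i>\<close>, depending on the root \<open>\<alpha>\<close>.\<close>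

locale quartic_field =
  fixes \<alpha> :: complex
  assumes root: "\<alpha> ^ 4 - 2 * \<alpha>\<^sup>2 + 2 = 0"
begin

definition j :: complex where "j = \<alpha>\<^sup>2 - 1"

lemma alpha_sq: "\<alpha> * \<alpha> = 1 + j"
  by (simp add: j_def power2_eq_square)

lemma j_sq: "j * j = -1"
proof -
  have "j * j = (\<alpha> ^ 4 - 2 * \<alpha>\<^sup>2 + 2) - 1"
    by (simp add: j_def power4_eq_xxxx power2_eq_square algebra_simps)
  thus ?thesis using root by simp
qed

lemma alpha_sq': "\<alpha> * (\<alpha> * z) = (1 + j) * z"
  by (simp add: alpha_sq mult.assoc[symmetric])

lemma j_sq': "j * (j * z) = - z"
  by (simp add: j_sq mult.assoc[symmetric])

lemma j_cases: "j = \<i> \<or> j = - \<i>"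
proof -
  have "(j - \<i>) * (j + \<i>) = 0" by (simp add: algebra_simps j_sq)
  hence "j - \<i> = 0 \<or> j + \<i> = 0" by simp
  thus ?thesis by (simp add: eq_neg_iff_add_eq_0)
qed

lemma of_rat_complex: "(of_rat r :: complex) = of_real (of_rat r)"
proof -
  obtain m n where "r = of_int m / of_int n" by (metis quotient_of_div surj_pair)
  thus ?thesis by (simp add: of_rat_divide)
qed

lemma cnj_j: "cnj j = - j"
  using j_cases by auto

definition Qj :: "complex set" where "Qj = {of_rat a + of_rat b * j | a b. True}"
definition Zj :: "complex set" where "Zj = {of_int a + of_int b * j | a b. True}"
definition M :: "complex set" where "M = {a + b * \<alpha> | a b. a \<in> Zj \<and> b \<in> Zj}"
definition L :: "complex set" where "L = {u + v * \<alpha> | u v. u \<in> Qj \<and> v \<in> Qj}"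

lemma QjI: "of_rat a + of_rat b * j \<in> Qj" by (auto simp: Qj_def)
lemma QjE: assumes "z \<in> Qj" obtains a b where "z = of_rat a + of_rat b * j"
  using assms by (auto simp: Qj_def)
lemma ZjI: "of_int a + of_int b * j \<in> Zj" by (auto simp: Zj_def)
lemma ZjE: assumes "z \<in> Zj" obtains a b where "z = of_int a + of_int b * j"
  using assms by (auto simp: Zj_def)
lemma MI: "a \<in> Zj \<Longrightarrow> b \<in> Zj \<Longrightarrow> a + b * \<alpha> \<in> M" by (auto simp: M_def)
lemma ME: assumes "z \<in> M" obtains a b where "a \<in> Zj" "b \<in> Zj" "z = a + b * \<alpha>"
  using assms by (auto simp: M_def)
lemma LI: "a \<in> Qj \<Longrightarrow> b \<in> Qj \<Longrightarrow> a + b * \<alpha> \<in> L" by (auto simp: L_def)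
lemma LE: assumes "z \<in> L" obtains a b where "a \<in> Qj" "b \<in> Qj" "z = a + b * \<alpha>"
  using assms by (auto simp: L_def)

lemma Qj_add: "x \<in> Qj \<Longrightarrow> y \<in> Qj \<Longrightarrow> x + y \<in> Qj"
proof (elim QjE)
  fix a b c d assume "x = of_rat a + of_rat b * j" "y = of_rat c + of_rat d * j"
  hence "x + y = of_rat (a + c) + of_rat (b + d) * j" by (simp add: of_rat_add algebra_simps)
  thus ?thesis by (simp only: QjI)
qed

lemma Qj_minus: "x \<in> Qj \<Longrightarrow> - x \<in> Qj"
proof (elim QjE)
  fix a b assume "x = of_rat a + of_rat b * j"
  hence "- x = of_rat (- a) + of_rat (- b) * j" by (simp add: of_rat_minus algebra_simps)
  thus ?thesis by (simp only: QjI)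
qed

lemma Qj_mult: "x \<in> Qj \<Longrightarrow> y \<in> Qj \<Longrightarrow> x * y \<in> Qj"
proof (elim QjE)
  fix a b c d assume "x = of_rat a + of_rat b * j" "y = of_rat c + of_rat d * j"
  hence "x * y = of_rat (a * c - b * d) + of_rat (a * d + b * c) * j"
    by (simp add: of_rat_add of_rat_mult of_rat_diff algebra_simps j_sq j_sq')
  thus ?thesis by (simp only: QjI)
qed

lemma Qj_of_rat [simp]: "of_rat a \<in> Qj" using QjI[of a 0] by simp
lemma Qj_0 [simp]: "0 \<in> Qj" and Qj_1 [simp]: "1 \<in> Qj" and Qj_j [simp]: "j \<in> Qj"
  using QjI[of 0 0] QjI[of 1 0] QjI[of 0 1] by simp_all
lemma Qj_of_int [simp]: "of_int a \<in> Qj" using Qj_of_rat[of "of_int a"] by simp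

lemma Qj_diff: "x \<in> Qj \<Longrightarrow> y \<in> Qj \<Longrightarrow> x - y \<in> Qj"
  using Qj_add[of x "- y"] Qj_minus by simp

text \<open>Inverses are computed with the conjugate \<open>a - bj\<close>.\<close>

lemma Qj_inverse: "x \<in> Qj \<Longrightarrow> inverse x \<in> Qj"
proof (cases "x = 0")
  case False
  assume "x \<in> Qj"
  then obtain a b where x: "x = of_rat a + of_rat b * j" by (rule QjE)
  have e: "x * (of_rat a - of_rat b * j) = of_rat (a\<^sup>2 + b\<^sup>2)"
    by (simp add: x of_rat_add of_rat_mult power2_eq_square algebra_simps j_sq j_sq')
  have "a \<noteq> 0 \<or> b \<noteq> 0" using False x by auto
  hence nz: "a\<^sup>2 + b\<^sup>2 \<noteq> 0" by (simp add: sum_power2_eq_zero_iff)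
  have "inverse x = (of_rat a + of_rat (- b) * j) * of_rat (inverse (a\<^sup>2 + b\<^sup>2))"
  proof (rule inverse_unique)
    have "x * ((of_rat a + of_rat (- b) * j) * of_rat (inverse (a\<^sup>2 + b\<^sup>2))) = of_rat (a\<^sup>2 + b\<^sup>2) * of_rat (inverse (a\<^sup>2 + b\<^sup>2))"
      unfolding e[symmetric] by (simp add: of_rat_minus)
    also have "\<dots> = 1" unfolding of_rat_mult[symmetric] using nz by simp
    finally show "x * ((of_rat a + of_rat (- b) * j) * of_rat (inverse (a\<^sup>2 + b\<^sup>2))) = 1" .
  qed
  thus ?thesis using Qj_mult[OF QjI Qj_of_rat] by simp
qed simp

lemma Qj_eq_iff [simp]: "of_rat a + of_rat b * j = of_rat c + of_rat d * j \<longleftrightarrow> a = c \<and> b = d"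
proof
  assume *: "of_rat a + of_rat b * j = of_rat c + of_rat d * j"
  have re: "Re (of_rat r) = of_rat r" "Im (of_rat r) = 0" for r
    by (simp_all add: of_rat_complex)
  show "a = c \<and> b = d"
    using arg_cong[OF *, of Re] arg_cong[OF *, of Im] j_cases re by (auto simp: re)
qed auto

lemma Zj_subset_Qj: "Zj \<subseteq> Qj"
proof
  fix z assume "z \<in> Zj"
  then obtain a b where "z = of_int a + of_int b * j" by (rule ZjE)
  thus "z \<in> Qj" using QjI[of "of_int a" "of_int b"] by simp
qed

lemma Zj_eq_iff [simp]: "of_int a + of_int b * j = of_int c + of_int d * j \<longleftrightarrow> a = c \<and> b = d"
  using Qj_eq_iff[of "of_int a" "of_int b" "of_int c" "of_int d"] by simp

lemma Zj_add: "x \<in> Zj \<Longrightarrow> y \<in> Zj \<Longrightarrow> x + y \<in> Zj"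
proof (elim ZjE)
  fix a b c d assume "x = of_int a + of_int b * j" "y = of_int c + of_int d * j"
  hence "x + y = of_int (a + c) + of_int (b + d) * j" by (simp add: algebra_simps)
  thus ?thesis by (simp only: ZjI)
qed

lemma Zj_mult: "x \<in> Zj \<Longrightarrow> y \<in> Zj \<Longrightarrow> x * y \<in> Zj"
proof (elim ZjE)
  fix a b c d assume "x = of_int a + of_int b * j" "y = of_int c + of_int d * j"
  hence "x * y = of_int (a * c - b * d) + of_int (a * d + b * c) * j"
    by (simp add: algebra_simps j_sq j_sq')
  thus ?thesis by (simp only: ZjI)
qed

lemma Zj_of_int [simp]: "of_int a \<in> Zj" using ZjI[of a 0] by simp
lemma Zj_0 [simp]: "0 \<in> Zj" and Zj_1 [simp]: "1 \<in> Zj" and Zj_j [simp]: "j \<in> Zj"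
  using ZjI[of 0 0] ZjI[of 1 0] ZjI[of 0 1] by simp_all
lemma Zj_minus: "x \<in> Zj \<Longrightarrow> - x \<in> Zj"
  using Zj_mult[OF Zj_of_int[of "-1"], of x] by simp
lemma Zj_diff: "x \<in> Zj \<Longrightarrow> y \<in> Zj \<Longrightarrow> x - y \<in> Zj"
  using Zj_add[of x "- y"] Zj_minus by simp

lemma M_add: "x \<in> M \<Longrightarrow> y \<in> M \<Longrightarrow> x + y \<in> M"
proof (elim ME)
  fix a b c d assume *: "a \<in> Zj" "b \<in> Zj" "c \<in> Zj" "d \<in> Zj" "x = a + b * \<alpha>" "y = c + d * \<alpha>"
  hence "x + y = (a + c) + (b + d) * \<alpha>" by (simp add: algebra_simps)
  thus ?thesis using * by (simp only: MI Zj_add)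
qed

lemma M_mult: "x \<in> M \<Longrightarrow> y \<in> M \<Longrightarrow> x * y \<in> M"
proof (elim ME)
  fix a b c d assume *: "a \<in> Zj" "b \<in> Zj" "c \<in> Zj" "d \<in> Zj" "x = a + b * \<alpha>" "y = c + d * \<alpha>"
  hence "x * y = (a * c + (1 + j) * (b * d)) + (a * d + b * c) * \<alpha>"
    by (simp add: algebra_simps alpha_sq alpha_sq')
  thus ?thesis using * by (simp only: MI Zj_add Zj_mult Zj_1 Zj_j)
qed

lemma Zj_subset_M: "Zj \<subseteq> M"
proof
  fix z assume "z \<in> Zj"
  thus "z \<in> M" using MI[of z 0] by simp
qed

lemma M_of_int [simp]: "of_int a \<in> M" using Zj_subset_M by auto
lemma M_0 [simp]: "0 \<in> M" and M_1 [simp]: "1 \<in> M" and M_j [simp]: "j \<in> M" using Zj_subset_M by auto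
lemma M_alpha [simp]: "\<alpha> \<in> M" using MI[of 0 1] by simp
lemma M_minus: "x \<in> M \<Longrightarrow> - x \<in> M" using M_mult[OF M_of_int[of "-1"], of x] by simp
lemma M_diff: "x \<in> M \<Longrightarrow> y \<in> M \<Longrightarrow> x - y \<in> M" using M_add[of x "- y"] M_minus by simp

lemma L_add: "x \<in> L \<Longrightarrow> y \<in> L \<Longrightarrow> x + y \<in> L"
proof (elim LE)
  fix a b c d assume *: "a \<in> Qj" "b \<in> Qj" "c \<in> Qj" "d \<in> Qj" "x = a + b * \<alpha>" "y = c + d * \<alpha>"
  hence "x + y = (a + c) + (b + d) * \<alpha>" by (simp add: algebra_simps)
  thus ?thesis using * by (simp only: LI Qj_add)
qed

lemma L_mult_eq:
  "(a + b * \<alpha>) * (c + d * \<alpha>) = (a * c + (1 + j) * (b * d)) + (a * d + b * c) * \<alpha>"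
  by (simp add: algebra_simps alpha_sq alpha_sq')

lemma L_mult: "x \<in> L \<Longrightarrow> y \<in> L \<Longrightarrow> x * y \<in> L"
proof (elim LE)
  fix a b c d assume *: "a \<in> Qj" "b \<in> Qj" "c \<in> Qj" "d \<in> Qj" "x = a + b * \<alpha>" "y = c + d * \<alpha>"
  hence "x * y = (a * c + (1 + j) * (b * d)) + (a * d + b * c) * \<alpha>" using L_mult_eq by simp
  thus ?thesis using * by (simp only: LI Qj_add Qj_mult Qj_1 Qj_j)
qed

lemma Qj_subset_L: "Qj \<subseteq> L"
proof
  fix z assume "z \<in> Qj"
  thus "z \<in> L" using LI[of z 0] by simp
qed

lemma L_of_Qj: "z \<in> Qj \<Longrightarrow> z \<in> L" using Qj_subset_L by blast

lemma L_alpha [simp]: "\<alpha> \<in> L" using LI[of 0 1] by simp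

text \<open>The norm of \<open>1 + j\<close> is \<open>2\<close>, which is not the square of a rational number. Hence \<open>1\<close> and \<open>\<alpha>\<close> are independent over
\<open>\<rat>(j)\<close>.\<close>

lemma one_plus_j_nonsquare:
  assumes "w \<in> Qj" shows "w * w \<noteq> 1 + j"
proof
  assume *: "w * w = 1 + j"
  obtain a b where w: "w = of_rat a + of_rat b * j" using assms by (rule QjE)
  have c: "cnj (of_rat r) = of_rat r" for r by (simp add: of_rat_complex)
  have "(w * cnj w) * (w * cnj w) = (w * w) * cnj (w * w)" by simp
  also have "\<dots> = (1 + j) * (1 - j)" unfolding * by (simp add: cnj_j)
  also have "\<dots> = 2" by (simp add: algebra_simps j_sq)
  finally have 2: "(w * cnj w) * (w * cnj w) = 2" .
  have "w * cnj w = of_rat (a\<^sup>2 + b\<^sup>2)"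
    by (simp add: w c cnj_j of_rat_add of_rat_mult power2_eq_square algebra_simps j_sq j_sq')
  hence "of_rat ((a\<^sup>2 + b\<^sup>2)\<^sup>2) = (of_rat 2 :: complex)" using 2 by (simp add: of_rat_mult power2_eq_square)
  hence sq: "(a\<^sup>2 + b\<^sup>2)\<^sup>2 = 2" by (simp only: of_rat_eq_iff)
  define s where "s = a\<^sup>2 + b\<^sup>2"
  obtain m n where mn: "s = of_int m / of_int n" "n > 0" "coprime m n"
    by (metis quotient_of_div quotient_of_coprime quotient_of_denom_pos surj_pair)
  have "of_int (m\<^sup>2) = (of_int (2 * n\<^sup>2) :: rat)"
    using sq mn(2) unfolding s_def[symmetric] mn(1) by (simp add: field_simps power2_eq_square)
  hence e: "m\<^sup>2 = 2 * n\<^sup>2" by (simp only: of_int_eq_iff)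
  hence "even (m\<^sup>2)" by simp
  hence "even m" by simp
  then obtain k where k: "m = 2 * k" by (elim evenE)
  have "n\<^sup>2 = 2 * k\<^sup>2" using e unfolding k by (simp add: power_mult_distrib)
  hence "even (n\<^sup>2)" by simp
  hence "even n" by simp
  with \<open>even m\<close> mn(3) show False using coprime_common_divisor[of m n 2] by simp
qed

lemma L_eq_0: "u \<in> Qj \<Longrightarrow> v \<in> Qj \<Longrightarrow> u + v * \<alpha> = 0 \<Longrightarrow> u = 0 \<and> v = 0"
proof (cases "v = 0")
  case False
  assume uv: "u \<in> Qj" "v \<in> Qj" "u + v * \<alpha> = 0"
  have "\<alpha> = - u * inverse v" using uv(3) False by (simp add: field_simps add_eq_0_iff)
  hence "\<alpha> \<in> Qj" using Qj_mult[OF Qj_minus[OF uv(1)] Qj_inverse[OF uv(2)]] by simp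
  thus ?thesis using one_plus_j_nonsquare alpha_sq by blast
qed simp

lemma L_eq_iff:
  assumes "u \<in> Qj" "v \<in> Qj" "u' \<in> Qj" "v' \<in> Qj"
  shows "u + v * \<alpha> = u' + v' * \<alpha> \<longleftrightarrow> u = u' \<and> v = v'"
  using L_eq_0[of "u - u'" "v - v'"] assms Qj_diff by (auto simp: algebra_simps)

lemma norm_nonzero:
  assumes "u \<in> Qj" "v \<in> Qj" "u + v * \<alpha> \<noteq> 0" shows "u * u - (1 + j) * (v * v) \<noteq> 0"
proof
  assume *: "u * u - (1 + j) * (v * v) = 0"
  show False
  proof (cases "v = 0")
    case True
    thus False using * assms by simp
  next
    case False
    hence "(u * inverse v) * (u * inverse v) = 1 + j" using * by (simp add: field_simps)
    thus False using one_plus_j_nonsquare Qj_mult[OF assms(1) Qj_inverse[OF assms(2)]] by blast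
  qed
qed

lemma L_inverse: "x \<in> L \<Longrightarrow> inverse x \<in> L"
proof (cases "x = 0")
  case True
  thus "x \<in> L \<Longrightarrow> ?thesis" by simp
next
  case False
  assume "x \<in> L"
  then obtain u v where uv: "u \<in> Qj" "v \<in> Qj" "x = u + v * \<alpha>" by (rule LE)
  define N where "N = u * u - (1 + j) * (v * v)"
  have N: "N \<noteq> 0" "N \<in> Qj" unfolding N_def
    using norm_nonzero[OF uv(1,2)] uv(3) False
    by (simp, intro Qj_diff Qj_mult Qj_add Qj_1 Qj_j uv(1,2))
  have "x * (u + (- v) * \<alpha>) = N" unfolding uv(3) L_mult_eq N_def by (simp add: algebra_simps)
  hence "inverse x = (u + (- v) * \<alpha>) * inverse N" using N
    by (intro inverse_unique) (simp add: mult.assoc[symmetric])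
  thus ?thesis using L_mult[OF LI[OF uv(1) Qj_minus[OF uv(2)]] L_of_Qj[OF Qj_inverse[OF N(2)]]] by simp
qed

lemma generate_field_closed:
  assumes "\<And>x y. x \<in> S \<Longrightarrow> y \<in> S \<Longrightarrow> x + y \<in> S" "\<And>x y. x \<in> S \<Longrightarrow> y \<in> S \<Longrightarrow> x * y \<in> S"
    "\<And>x. x \<in> S \<Longrightarrow> - x \<in> S" "\<And>x. x \<in> S \<Longrightarrow> inverse x \<in> S" "1 \<in> S" "z \<in> S"
  shows "generate_field CC {z} \<subseteq> S"
proof
  fix x assume "x \<in> generate_field CC {z}"
  thus "x \<in> S" by (induction rule: generate_field.induct) (use assms in \<open>auto simp: CC_m_inv\<close>)
qed

lemma gf_add: "x \<in> generate_field CC H \<Longrightarrow> y \<in> generate_field CC H \<Longrightarrow> x + y \<in> generate_field CC H"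
  using generate_field.eng_add[of x CC H y] by simp
lemma gf_mult: "x \<in> generate_field CC H \<Longrightarrow> y \<in> generate_field CC H \<Longrightarrow> x * y \<in> generate_field CC H"
  using generate_field.eng_mult[of x CC H y] by simp
lemma gf_minus: "x \<in> generate_field CC H \<Longrightarrow> - x \<in> generate_field CC H"
  using generate_field.a_inv[of x CC H] by simp
lemma gf_one: "1 \<in> generate_field CC H" using generate_field.one[of CC H] by simp
lemma gf_zero: "0 \<in> generate_field CC H" using gf_add[OF gf_one gf_minus[OF gf_one]] by simp
lemma gf_inverse: "x \<in> generate_field CC H \<Longrightarrow> inverse x \<in> generate_field CC H"
  using generate_field.m_inv[of x CC H] gf_zero by (cases "x = 0") (simp_all add: CC_m_inv)
lemma gf_of_nat: "of_nat n \<in> generate_field CC H"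
  by (induction n) (auto intro: gf_zero gf_add gf_one)
lemma gf_of_int: "of_int n \<in> generate_field CC H"
  using gf_of_nat[of "nat \<bar>n\<bar>" H] gf_minus[OF gf_of_nat[of "nat \<bar>n\<bar>" H]] by (cases "n \<ge> 0") auto
lemma gf_of_rat: "of_rat r \<in> generate_field CC H"
proof -
  obtain m n where "r = of_int m / of_int n" by (metis quotient_of_div surj_pair)
  hence "of_rat r = (of_int m / of_int n :: complex)" by (simp add: of_rat_divide)
  hence "of_rat r = of_int m * inverse (of_int n :: complex)" by (simp only: divide_inverse)
  thus ?thesis using gf_mult[OF gf_of_int gf_inverse[OF gf_of_int]] by simp
qed
lemma gf_incl: "z \<in> generate_field CC {z}" by (rule generate_field.incl) simp

lemma Qi_eq: "Qi \<alpha> = Qj"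
proof
  show "Qi \<alpha> \<subseteq> Qj" unfolding j_def[symmetric]
    by (rule generate_field_closed) (auto intro: Qj_add Qj_mult Qj_minus Qj_inverse)
  show "Qj \<subseteq> Qi \<alpha>" unfolding j_def[symmetric]
    by (auto elim!: QjE intro!: gf_add gf_mult gf_of_rat gf_incl)
qed

lemma L_minus: "x \<in> L \<Longrightarrow> - x \<in> L"
  using L_mult[of "-1" x] L_of_Qj[OF Qj_minus[OF Qj_1]] by simp

lemma K1_eq: "K1 \<alpha> = L"
proof
  show "K1 \<alpha> \<subseteq> L"
    by (rule generate_field_closed) (auto intro: L_add L_mult L_minus L_inverse L_of_Qj)
  have "j \<in> K1 \<alpha>" unfolding j_def using gf_add[OF gf_mult[OF gf_incl gf_incl] gf_minus[OF gf_one], of \<alpha>]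
    by (simp add: power2_eq_square)
  thus "L \<subseteq> K1 \<alpha>"
    by (auto elim!: LE QjE intro!: gf_add gf_mult gf_of_rat gf_incl)
qed

text \<open>The nontrivial automorphism \<open>\<alpha> \<mapsto> -\<alpha>\<close> over \<open>\<rat>(j)\<close>.\<close>

definition sg :: "complex \<Rightarrow> complex" where
  "sg x = (THE y. \<exists>u\<in>Qj. \<exists>v\<in>Qj. x = u + v * \<alpha> \<and> y = u - v * \<alpha>)"

lemma sg_eq: "u \<in> Qj \<Longrightarrow> v \<in> Qj \<Longrightarrow> sg (u + v * \<alpha>) = u - v * \<alpha>"
  unfolding sg_def by (rule the_equality) (use L_eq_iff in blast)+

lemma sg_add: "x \<in> L \<Longrightarrow> y \<in> L \<Longrightarrow> sg (x + y) = sg x + sg y"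
proof (elim LE)
  fix a b c d assume *: "a \<in> Qj" "b \<in> Qj" "c \<in> Qj" "d \<in> Qj" "x = a + b * \<alpha>" "y = c + d * \<alpha>"
  hence "x + y = (a + c) + (b + d) * \<alpha>" by (simp add: algebra_simps)
  hence sum: "sg (x + y) = (a + c) - (b + d) * \<alpha>" using sg_eq[OF Qj_add Qj_add] * by (simp only:)
  have "sg x = a - b * \<alpha>" "sg y = c - d * \<alpha>" using * sg_eq by (simp_all only:)
  thus ?thesis unfolding sum by (simp add: algebra_simps)
qed

lemma sg_mult: "x \<in> L \<Longrightarrow> y \<in> L \<Longrightarrow> sg (x * y) = sg x * sg y"
proof (elim LE)
  fix a b c d assume *: "a \<in> Qj" "b \<in> Qj" "c \<in> Qj" "d \<in> Qj" "x = a + b * \<alpha>" "y = c + d * \<alpha>"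
  have in_Q: "a * c + (1 + j) * (b * d) \<in> Qj" "a * d + b * c \<in> Qj" using * by (auto intro!: Qj_add Qj_mult)
  have "sg (x * y) = (a * c + (1 + j) * (b * d)) - (a * d + b * c) * \<alpha>"
    unfolding *(5,6) L_mult_eq using in_Q by (rule sg_eq)
  also have "\<dots> = (a - b * \<alpha>) * (c - d * \<alpha>)" by (simp add: algebra_simps alpha_sq alpha_sq')
  finally show ?thesis using * sg_eq by simp
qed

lemma sg_Qj: "u \<in> Qj \<Longrightarrow> sg u = u" using sg_eq[of u 0] by simp

text \<open>An embedding over \<open>\<rat>(j)\<close> is determined by the image of \<open>\<alpha>\<close>, which is a square root of \<open>1 + j\<close>.\<close>

lemma embeddings_eq: "embeddings (K1 \<alpha>) (Qi \<alpha>) = {restrict (\<lambda>x. x) L, restrict sg L}"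
proof
  have hom: "f \<in> ring_hom (CC_on L) CC \<longleftrightarrow>
      (\<forall>x\<in>L. \<forall>y\<in>L. f (x * y) = f x * f y \<and> f (x + y) = f x + f y) \<and> f 1 = 1" for f
    unfolding ring_hom_def by (auto simp: ring_of_type_algebra_def)
  have L1: "1 \<in> L" using L_of_Qj by simp
  show "{restrict (\<lambda>x. x) L, restrict sg L} \<subseteq> embeddings (K1 \<alpha>) (Qi \<alpha>)"
    unfolding embeddings_def K1_eq Qi_eq hom
    using L_add L_mult L1 L_of_Qj sg_add sg_mult sg_Qj by auto
  show "embeddings (K1 \<alpha>) (Qi \<alpha>) \<subseteq> {restrict (\<lambda>x. x) L, restrict sg L}"
  proof
    fix f assume "f \<in> embeddings (K1 \<alpha>) (Qi \<alpha>)"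
    hence f: "f \<in> extensional L" "\<forall>x\<in>Qj. f x = x" "f 1 = 1"
      "\<And>x y. x \<in> L \<Longrightarrow> y \<in> L \<Longrightarrow> f (x * y) = f x * f y" "\<And>x y. x \<in> L \<Longrightarrow> y \<in> L \<Longrightarrow> f (x + y) = f x + f y"
      unfolding embeddings_def K1_eq Qi_eq hom by auto
    have "f \<alpha> * f \<alpha> = 1 + j" using f(4)[OF L_alpha L_alpha] f(2) Qj_add by (simp add: alpha_sq)
    hence "(f \<alpha> - \<alpha>) * (f \<alpha> + \<alpha>) = 0" by (simp add: algebra_simps alpha_sq)
    hence fa: "f \<alpha> = \<alpha> \<or> f \<alpha> = - \<alpha>" by (auto simp: add_eq_0_iff2)
    have val: "f (u + v * \<alpha>) = u + v * f \<alpha>" if "u \<in> Qj" "v \<in> Qj" for u v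
      using that f L_of_Qj L_mult by simp
    from fa show "f \<in> {restrict (\<lambda>x. x) L, restrict sg L}"
    proof
      assume "f \<alpha> = \<alpha>"
      hence "f = restrict (\<lambda>x. x) L" using val f(1) by (intro extensionalityI[of _ L]) (auto elim!: LE)
      thus ?thesis by simp
    next
      assume "f \<alpha> = - \<alpha>"
      hence "f = restrict sg L" using val f(1) by (intro extensionalityI[of _ L]) (auto elim!: LE simp: sg_eq)
      thus ?thesis by simp
    qed
  qed
qed

lemma field_norm_eq:
  assumes "u \<in> Qj" "v \<in> Qj"
  shows "field_norm (K1 \<alpha>) (Qi \<alpha>) (u + v * \<alpha>) = u * u - (1 + j) * (v * v)"
proof -
  have "\<alpha> \<noteq> 0" using root by auto
  hence "sg \<alpha> \<noteq> \<alpha>" using sg_eq[of 0 1] by simp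
  hence "restrict (\<lambda>x. x) L \<noteq> restrict sg L" using L_alpha by (metis restrict_apply')
  moreover have "u + v * \<alpha> \<in> L" using assms by (rule LI)
  ultimately have "field_norm (K1 \<alpha>) (Qi \<alpha>) (u + v * \<alpha>) = (u + v * \<alpha>) * (u - v * \<alpha>)"
    unfolding field_norm_def embeddings_eq using sg_eq[OF assms] by simp
  also have "\<dots> = u * u - (1 + j) * (v * v)" by (simp add: algebra_simps alpha_sq alpha_sq')
  finally show ?thesis .
qed

text \<open>All powers of \<open>x\<close> have a common denominator. For elements of \<open>L\<close> this is equivalent to being an algebraic integer, but closure under
addition and multiplication follows at once from the binomial theorem.\<close>

definition almost_integral :: "complex \<Rightarrow> bool" where
  "almost_integral x \<longleftrightarrow> (\<exists>d::int. d \<noteq> 0 \<and> (\<forall>k. of_int d * x ^ k \<in> M))"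

lemma almost_integral_M: "x \<in> M \<Longrightarrow> almost_integral x"
proof -
  assume x: "x \<in> M"
  have "x ^ k \<in> M" for k by (induction k) (auto intro: M_mult x)
  thus ?thesis unfolding almost_integral_def by (intro exI[of _ 1]) auto
qed

lemma M_sum: "finite S \<Longrightarrow> (\<And>i. i \<in> S \<Longrightarrow> f i \<in> M) \<Longrightarrow> (\<Sum>i\<in>S. f i) \<in> M"
  by (induction S rule: finite_induct) (auto intro: M_add)

lemma almost_integral_mult:
  assumes "almost_integral x" "almost_integral y" shows "almost_integral (x * y)"
proof -
  obtain d e where d: "d \<noteq> 0" "\<And>k. of_int d * x ^ k \<in> M" and e: "e \<noteq> 0" "\<And>k. of_int e * y ^ k \<in> M"
    using assms unfolding almost_integral_def by blast
  have "of_int (d * e) * (x * y) ^ k \<in> M" for k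
  proof -
    have "of_int (d * e) * (x * y) ^ k = (of_int d * x ^ k) * (of_int e * y ^ k)"
      by (simp add: power_mult_distrib)
    thus ?thesis using M_mult[OF d(2) e(2)] by (simp only:)
  qed
  thus ?thesis unfolding almost_integral_def using d(1) e(1) by (intro exI[of _ "d * e"]) simp
qed

lemma almost_integral_add:
  assumes "almost_integral x" "almost_integral y" shows "almost_integral (x + y)"
proof -
  obtain d e where d: "d \<noteq> 0" "\<And>k. of_int d * x ^ k \<in> M" and e: "e \<noteq> 0" "\<And>k. of_int e * y ^ k \<in> M"
    using assms unfolding almost_integral_def by blast
  have "of_int (d * e) * (x + y) ^ k \<in> M" for k
  proof -
    have "of_int (d * e) * (x + y) ^ k =
        (\<Sum>i\<le>k. of_int (int (k choose i)) * ((of_int d * x ^ i) * (of_int e * y ^ (k - i))))"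
      unfolding binomial_ring sum_distrib_left by (intro sum.cong refl) simp
    also have "\<dots> \<in> M" by (intro M_sum M_mult d e M_of_int) auto
    finally show ?thesis .
  qed
  thus ?thesis unfolding almost_integral_def using d(1) e(1) by (intro exI[of _ "d * e"]) simp
qed

lemma L_denominator: "x \<in> L \<Longrightarrow> \<exists>d::int. d \<noteq> 0 \<and> of_int d * x \<in> M"
proof -
  have rat: "\<exists>d::int. d \<noteq> 0 \<and> (\<exists>n. of_int d * (of_rat r :: complex) = of_int n)" for r
  proof -
    obtain m n where "r = of_int m / of_int n" "n > 0" by (metis quotient_of_div quotient_of_denom_pos surj_pair)
    hence "of_int n * (of_rat r :: complex) = of_int m" by (simp add: of_rat_divide)
    thus ?thesis using \<open>n > 0\<close> by (intro exI[of _ n]) auto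
  qed
  have Q: "\<exists>d::int. d \<noteq> 0 \<and> of_int d * u \<in> Zj" if "u \<in> Qj" for u
  proof -
    obtain a b where u: "u = of_rat a + of_rat b * j" using \<open>u \<in> Qj\<close> by (rule QjE)
    obtain d m where d: "d \<noteq> 0" "of_int d * (of_rat a :: complex) = of_int m" using rat by blast
    obtain e n where e: "e \<noteq> 0" "of_int e * (of_rat b :: complex) = of_int n" using rat by blast
    have "of_int (d * e) * u = of_int e * (of_int d * of_rat a) + of_int d * (of_int e * of_rat b) * j"
      by (simp add: u algebra_simps)
    also have "\<dots> = of_int (e * m) + of_int (d * n) * j" unfolding d e by simp
    finally have "of_int (d * e) * u \<in> Zj" by (simp only: ZjI)
    thus ?thesis using d e by (intro exI[of _ "d * e"]) simp
  qed
  assume "x \<in> L"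
  then obtain u v where uv: "u \<in> Qj" "v \<in> Qj" "x = u + v * \<alpha>" by (rule LE)
  obtain d where d: "d \<noteq> 0" "of_int d * u \<in> Zj" using Q uv by blast
  obtain e where e: "e \<noteq> 0" "of_int e * v \<in> Zj" using Q uv by blast
  have "of_int (d * e) * x = of_int e * (of_int d * u) + of_int d * (of_int e * v) * \<alpha>"
    by (simp add: uv algebra_simps)
  hence "of_int (d * e) * x \<in> M" using MI[OF Zj_mult[OF Zj_of_int d(2)] Zj_mult[OF Zj_of_int e(2)]] by simp
  thus ?thesis using d e by (intro exI[of _ "d * e"]) simp
qed

text \<open>A denominator that works for the powers below the degree works for all powers, by the monic equation.\<close>

lemma algebraic_int_almost_integral:
  assumes x: "x \<in> L" "algebraic_int x" shows "almost_integral x"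
proof -
  obtain q :: "complex poly" where q: "lead_coeff q = 1" "\<forall>i. coeff q i \<in> \<int>" "poly q x = 0"
    using x(2) by (auto elim: algebraic_int.cases)
  define n where "n = degree q"
  have pw: "x ^ k \<in> L" for k by (induction k) (auto intro: L_mult x L_of_Qj)
  have "\<exists>d. \<forall>k. d k \<noteq> (0::int) \<and> of_int (d k) * x ^ k \<in> M" using L_denominator[OF pw] by metis
  then obtain d :: "nat \<Rightarrow> int" where d: "\<And>k. d k \<noteq> 0" "\<And>k. of_int (d k) * x ^ k \<in> M" by blast
  define D where "D = (\<Prod>k<n. d k)"
  have D0: "D \<noteq> 0" unfolding D_def using d(1) by simp
  have small: "of_int D * x ^ k \<in> M" if "k < n" for k
  proof -
    have "D = d k * (\<Prod>i\<in>{..<n} - {k}. d i)" unfolding D_def using that by (intro prod.remove) auto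
    hence "of_int D * x ^ k = of_int (\<Prod>i\<in>{..<n} - {k}. d i) * (of_int (d k) * x ^ k)" by (simp add: mult.commute mult.left_commute)
    thus ?thesis using M_mult[OF M_of_int d(2)] by (simp only:)
  qed
  have "0 = (\<Sum>i\<le>n. coeff q i * x ^ i)" using q(3) by (simp add: poly_altdef n_def)
  also have "\<dots> = (\<Sum>i<n. coeff q i * x ^ i) + x ^ n"
    using q(1) by (simp add: n_def lessThan_Suc_atMost[symmetric])
  finally have xn: "x ^ n = - (\<Sum>i<n. coeff q i * x ^ i)" by (metis add.commute add_eq_0_iff)
  have "of_int D * x ^ k \<in> M" for k
  proof (induction k rule: less_induct)
    case (less k)
    show ?case
    proof (cases "k < n")
      case True
      thus ?thesis by (rule small)
    next
      case False
      then obtain i where k: "k = n + i" using le_Suc_ex by (metis not_less)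
      have "of_int D * x ^ k = - (\<Sum>m<n. coeff q m * (of_int D * x ^ (m + i)))"
        unfolding k power_add xn by (simp add: sum_distrib_left sum_distrib_right mult_ac power_add)
      moreover have "coeff q m * (of_int D * x ^ (m + i)) \<in> M" if "m < n" for m
      proof -
        obtain z where "coeff q m = of_int z" using q(2) by (metis Ints_cases)
        thus ?thesis using less[of "m + i"] that k M_mult[OF M_of_int] by simp
      qed
      ultimately show ?thesis using M_minus M_sum[of "{..<n}"] by simp
    qed
  qed
  thus ?thesis unfolding almost_integral_def using D0 by blast
qed

end

section \<open>The ring of integers of the quartic field\<close>

context quartic_field
begin

lemma M_Qj_Zj: "x \<in> M \<Longrightarrow> x \<in> Qj \<Longrightarrow> x \<in> Zj"
proof (elim ME)
  fix a b assume *: "x \<in> Qj" "a \<in> Zj" "b \<in> Zj" "x = a + b * \<alpha>"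
  have "x + 0 * \<alpha> = a + b * \<alpha>" using *(4) by simp
  hence "x = a" using L_eq_iff[of x 0 a b] * Zj_subset_Qj Qj_0 by blast
  thus ?thesis using *(2) by simp
qed

lemma of_rat_mem_Zj: "of_rat r \<in> Zj \<Longrightarrow> \<exists>n. r = of_int n"
proof (elim ZjE)
  fix a b assume "of_rat r = of_int a + of_int b * j"
  hence "of_rat r + of_rat 0 * j = of_rat (of_int a) + of_rat (of_int b) * j" by simp
  hence "r = of_int a" by (simp only: Qj_eq_iff)
  thus ?thesis by blast
qed

text \<open>If \<open>n\<close> is the reduced denominator of \<open>r\<close>, then every power of \<open>n\<close> divides the common denominator.\<close>

lemma almost_integral_of_rat:
  assumes "almost_integral (of_rat r)" shows "\<exists>n. r = of_int n"
proof -
  obtain d where d: "d \<noteq> 0" "\<And>k. of_int d * of_rat r ^ k \<in> M"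
    using assms unfolding almost_integral_def by blast
  obtain m n where mn: "r = of_int m / of_int n" "n > 0" "coprime m n"
    by (metis quotient_of_div quotient_of_coprime quotient_of_denom_pos surj_pair)
  have dvd: "n ^ k dvd d" for k
  proof -
    have eq: "of_int d * of_rat r ^ k = (of_rat (of_int d * r ^ k) :: complex)"
      by (simp add: of_rat_mult of_rat_power)
    have "of_rat (of_int d * r ^ k) \<in> Zj" using M_Qj_Zj[OF d(2)[of k]] unfolding eq by simp
    then obtain c where c: "of_int d * r ^ k = of_int c" using of_rat_mem_Zj by blast
    have "of_int (d * m ^ k) = (of_int (c * n ^ k) :: rat)"
      using c mn(2) unfolding mn(1) by (simp add: power_divide field_simps)
    hence "d * m ^ k = c * n ^ k" by (simp only: of_int_eq_iff)
    hence "n ^ k dvd d * m ^ k" by simp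
    moreover have "coprime (n ^ k) (m ^ k)" using mn(3) by (simp add: coprime_commute)
    ultimately show ?thesis by (simp add: coprime_dvd_mult_left_iff)
  qed
  have "n = 1"
  proof (rule ccontr)
    assume "n \<noteq> 1"
    define e where "e = nat \<bar>d\<bar>"
    have "n ^ e \<le> \<bar>d\<bar>" using dvd[of e] d(1) by (metis abs_dvd_iff dvd_abs_iff zdvd_imp_le zero_less_abs_iff)
    moreover have "(2::int) ^ e \<le> n ^ e" using \<open>n \<noteq> 1\<close> mn(2) by (intro power_mono) auto
    moreover have "int e < 2 ^ e" using of_nat_less_two_power[of e, where 'a = int] .
    ultimately show False unfolding e_def by simp
  qed
  thus ?thesis using mn(1) by auto
qed

lemma cnj_Zj: "x \<in> Zj \<Longrightarrow> cnj x \<in> Zj"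
proof (elim ZjE)
  fix a b assume "x = of_int a + of_int b * j"
  hence "cnj x = of_int a + of_int (- b) * j" by (simp add: cnj_j)
  thus ?thesis by (simp only: ZjI)
qed

lemma Qj_power: "q \<in> Qj \<Longrightarrow> q ^ k \<in> Qj"
  by (induction k) (auto intro: Qj_mult)

lemma almost_integral_cnj:
  assumes "q \<in> Qj" "almost_integral q" shows "almost_integral (cnj q)"
proof -
  obtain d where d: "d \<noteq> 0" "\<And>k. of_int d * q ^ k \<in> M"
    using assms(2) unfolding almost_integral_def by blast
  have "of_int d * cnj q ^ k \<in> M" for k
  proof -
    have "of_int d * q ^ k \<in> Zj" by (intro M_Qj_Zj d Qj_mult Qj_of_int Qj_power assms)
    hence "cnj (of_int d * q ^ k) \<in> M" using cnj_Zj Zj_subset_M by blast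
    thus ?thesis by simp
  qed
  thus ?thesis unfolding almost_integral_def using d(1) by blast
qed

lemma almost_integral_minus: "almost_integral x \<Longrightarrow> almost_integral (- x)"
  using almost_integral_mult[OF almost_integral_M[OF M_of_int[of "-1"]], of x] by simp

text \<open>The trace \<open>2a\<close>, the norm \<open>a\<^sup>2 + b\<^sup>2\<close> and, up to sign, the trace \<open>2b\<close> of \<open>qj\<close> are rational and almost integral,
hence integers. Since \<open>(2a)\<^sup>2 + (2b)\<^sup>2 \<equiv> 0 (mod 4)\<close>, both \<open>2a\<close> and \<open>2b\<close> are even.\<close>

lemma almost_integral_Qj:
  assumes q: "q \<in> Qj" "almost_integral q" shows "q \<in> Zj"
proof -
  obtain a b where ab: "q = of_rat a + of_rat b * j" using q(1) by (rule QjE)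
  have c: "cnj q = of_rat a - of_rat b * j" by (simp add: ab of_rat_complex cnj_j)
  have ac: "almost_integral (cnj q)" by (rule almost_integral_cnj[OF q])
  have "q + cnj q = of_rat (2 * a)" unfolding c by (simp add: ab of_rat_mult)
  hence "almost_integral (of_rat (2 * a))" using almost_integral_add[OF q(2) ac] by simp
  then obtain A where A: "2 * a = of_int A" using almost_integral_of_rat by blast
  have "j * - (q + - cnj q) = of_rat (2 * b)" unfolding c by (simp add: ab of_rat_mult algebra_simps j_sq j_sq')
  hence "almost_integral (of_rat (2 * b))"
    using almost_integral_mult[OF almost_integral_M[OF M_j] almost_integral_minus[OF
        almost_integral_add[OF q(2) almost_integral_minus[OF ac]]]] by simp
  then obtain B where B: "2 * b = of_int B" using almost_integral_of_rat by blast
  have "q * cnj q = of_rat (a\<^sup>2 + b\<^sup>2)" unfolding c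
    by (simp add: ab of_rat_add of_rat_mult power2_eq_square algebra_simps j_sq j_sq')
  hence "almost_integral (of_rat (a\<^sup>2 + b\<^sup>2))" using almost_integral_mult[OF q(2) ac] by simp
  then obtain N where N: "a\<^sup>2 + b\<^sup>2 = of_int N" using almost_integral_of_rat by blast
  have "of_int (A\<^sup>2 + B\<^sup>2) = (2 * a)\<^sup>2 + (2 * b)\<^sup>2" unfolding A B by simp
  also have "\<dots> = 4 * (a\<^sup>2 + b\<^sup>2)" by (simp add: power2_eq_square algebra_simps)
  also have "\<dots> = of_int (4 * N)" unfolding N by simp
  finally have e: "A\<^sup>2 + B\<^sup>2 = 4 * N" by (simp only: of_int_eq_iff)
  have "even (A\<^sup>2 + B\<^sup>2)" unfolding e by simp
  hence par: "even A \<longleftrightarrow> even B" by simp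
  have "even A"
  proof (rule ccontr)
    assume "odd A"
    hence "odd B" using par by simp
    obtain x y where "A = 2 * x + 1" "B = 2 * y + 1" using \<open>odd A\<close> \<open>odd B\<close> by (elim oddE)
    hence "4 * (x\<^sup>2 + x + y\<^sup>2 + y) + 2 = 4 * N" using e by (simp add: power2_eq_square algebra_simps)
    thus False by presburger
  qed
  then obtain x y where xy: "A = 2 * x" "B = 2 * y" using par by (elim evenE) auto
  have "a = of_int x" "b = of_int y" using A B unfolding xy by simp_all
  thus ?thesis unfolding ab using ZjI[of x y] by simp
qed

lemma sg_M: "x \<in> M \<Longrightarrow> sg x \<in> M"
proof (elim ME)
  fix u v assume *: "u \<in> Zj" "v \<in> Zj" "x = u + v * \<alpha>"
  have "u \<in> Qj" "v \<in> Qj" using * Zj_subset_Qj by auto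
  hence "sg x = u + (- v) * \<alpha>" using sg_eq *(3) by simp
  thus ?thesis using MI[OF *(1) Zj_minus[OF *(2)]] by (simp only:)
qed

lemma L_power: "x \<in> L \<Longrightarrow> x ^ k \<in> L"
  by (induction k) (auto intro: L_mult L_of_Qj)

lemma sg_power: "x \<in> L \<Longrightarrow> sg (x ^ k) = sg x ^ k"
  by (induction k) (auto simp: sg_mult L_power sg_Qj)

lemma almost_integral_sg:
  assumes "x \<in> L" "almost_integral x" shows "almost_integral (sg x)"
proof -
  obtain d where d: "d \<noteq> 0" "\<And>k. of_int d * x ^ k \<in> M"
    using assms(2) unfolding almost_integral_def by blast
  have "of_int d * sg x ^ k \<in> M" for k
  proof -
    have "sg (of_int d * x ^ k) = of_int d * sg x ^ k"
      using assms(1) by (simp add: sg_mult sg_power L_power L_of_Qj sg_Qj)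
    thus ?thesis using sg_M[OF d(2)[of k]] by simp
  qed
  thus ?thesis unfolding almost_integral_def using d(1) by blast
qed

end

text \<open>The hypotheses are the coordinates of \<open>s\<^sup>2 = (1 + i) (r\<^sup>2 - 4n)\<close> in \<open>\<int>[i]\<close>; the conclusion says that \<open>2\<close> divides \<open>r\<close> and
\<open>2 (1 + i)\<close> divides \<open>s\<close>, divisibility by \<open>1 + i\<close> being expressed by an even coordinate sum.\<close>

lemma quartic_order_maximal_coordinates:
  fixes r1 r2 s1 s2 n1 n2 :: int
  assumes re: "s1\<^sup>2 - s2\<^sup>2 = r1\<^sup>2 - r2\<^sup>2 - 4 * n1 - 2 * r1 * r2 + 4 * n2"
    and im: "2 * s1 * s2 = r1\<^sup>2 - r2\<^sup>2 - 4 * n1 + 2 * r1 * r2 - 4 * n2"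
  shows "even r1 \<and> even r2 \<and> even s1 \<and> even s2 \<and> even (s1 div 2 + s2 div 2)"
proof -
  have "even (r1\<^sup>2 - r2\<^sup>2 - 4 * n1 + 2 * r1 * r2 - 4 * n2)" unfolding im[symmetric] by simp
  hence pr: "even r1 \<longleftrightarrow> even r2" by simp
  have "even (s1\<^sup>2 - s2\<^sup>2)" unfolding re using pr by simp
  hence ps: "even s1 \<longleftrightarrow> even s2" by simp
  have half: "even x" if "2 * x = 4 * y" for x y :: int using that by presburger
  have four: "\<exists>k. x\<^sup>2 - y\<^sup>2 = 4 * k" if xy: "even x \<longleftrightarrow> even y" for x y :: int
  proof -
    have "even (x - y)" "even (x + y)" using xy by auto
    then obtain u v where "x - y = 2 * u" "x + y = 2 * v" by (elim evenE)
    hence "(x + y) * (x - y) = 4 * (u * v)" by simp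
    hence "x\<^sup>2 - y\<^sup>2 = 4 * (u * v)" by (simp add: power2_eq_square algebra_simps)
    thus ?thesis by blast
  qed
  obtain k1 where k1: "s1\<^sup>2 - s2\<^sup>2 = 4 * k1" using four[OF ps] by blast
  obtain k2 where k2: "r1\<^sup>2 - r2\<^sup>2 = 4 * k2" using four[OF pr] by blast
  have "2 * (r1 * r2) = 4 * (k2 - n1 + n2 - k1)" using re k1 k2 by (simp add: algebra_simps)
  hence "even (r1 * r2)" by (rule half)
  hence er: "even r1" "even r2" using pr by auto
  then obtain x y where xy: "r1 = 2 * x" "r2 = 2 * y" by (elim evenE)
  have "2 * (s1 * s2) = 4 * (k2 - n1 + 2 * (x * y) - n2)" using im k2 unfolding xy by (simp add: algebra_simps)
  hence "even (s1 * s2)" by (rule half)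
  hence es: "even s1" "even s2" using ps by auto
  then obtain z w where zw: "s1 = 2 * z" "s2 = 2 * w" by (elim evenE)
  have "z\<^sup>2 - w\<^sup>2 = x\<^sup>2 - y\<^sup>2 - n1 - 2 * (x * y) + n2"
    using re unfolding xy zw by (simp add: power_mult_distrib)
  moreover have "2 * (z * w) = x\<^sup>2 - y\<^sup>2 - n1 + 2 * (x * y) - n2"
    using im unfolding xy zw by (simp add: power_mult_distrib)
  ultimately have "z\<^sup>2 - w\<^sup>2 = 2 * (z * w) + 2 * (n2 - 2 * (x * y))" by simp
  hence "even (z\<^sup>2 - w\<^sup>2)" by simp
  hence "even (z + w)" by simp
  thus ?thesis using er es unfolding zw by simp
qed

context quartic_field
begin

text \<open>For \<open>x = u + v\<alpha>\<close> the trace \<open>r = 2u\<close>, the norm \<open>n\<close> and the trace \<open>s = 2v (1 + j)\<close> of \<open>\<alpha>x\<close> are integral over \<open>\<int>[j]\<close>,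
and they satisfy \<open>s\<^sup>2 = (1 + j) (r\<^sup>2 - 4n)\<close>.\<close>

lemma almost_integral_imp_M:
  assumes x: "x \<in> L" "almost_integral x" shows "x \<in> M"
proof -
  obtain u v where uv: "u \<in> Qj" "v \<in> Qj" "x = u + v * \<alpha>" using x(1) by (rule LE)
  have sx: "sg (u + v * \<alpha>) = u - v * \<alpha>" by (rule sg_eq[OF uv(1,2)])
  have ai: "almost_integral (sg x)" by (rule almost_integral_sg[OF x])
  have Q: "2 * u \<in> Qj" "u * u - (1 + j) * (v * v) \<in> Qj" "(1 + j) * (2 * v) \<in> Qj"
    using Qj_of_int[of 2] by (auto intro!: Qj_mult Qj_diff Qj_add uv(1,2))
  have "x + sg x = 2 * u" unfolding uv(3) sx by simp
  hence "almost_integral (2 * u)" using almost_integral_add[OF x(2) ai] by simp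
  hence "2 * u \<in> Zj" using almost_integral_Qj Q(1) by blast
  then obtain r1 r2 where r: "2 * u = of_int r1 + of_int r2 * j" by (rule ZjE)
  have "x * sg x = u * u - (1 + j) * (v * v)" unfolding uv(3) sx by (simp add: algebra_simps alpha_sq alpha_sq')
  hence "almost_integral (u * u - (1 + j) * (v * v))" using almost_integral_mult[OF x(2) ai] by simp
  hence "u * u - (1 + j) * (v * v) \<in> Zj" using almost_integral_Qj Q(2) by blast
  then obtain n1 n2 where n: "u * u - (1 + j) * (v * v) = of_int n1 + of_int n2 * j" by (rule ZjE)
  have "\<alpha> * (x + - sg x) = (1 + j) * (2 * v)" unfolding uv(3) sx by (simp add: algebra_simps alpha_sq alpha_sq')
  hence "almost_integral ((1 + j) * (2 * v))"
    using almost_integral_mult[OF almost_integral_M[OF M_alpha] almost_integral_add[OF x(2) almost_integral_minus[OF ai]]]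
    by simp
  hence "(1 + j) * (2 * v) \<in> Zj" using almost_integral_Qj Q(3) by blast
  then obtain s1 s2 where s: "(1 + j) * (2 * v) = of_int s1 + of_int s2 * j" by (rule ZjE)
  \<comment> \<open>Comparing coordinates brings the problem into \<open>\<int>\<close>.\<close>
  have "((1 + j) * (2 * v)) * ((1 + j) * (2 * v)) =
      (1 + j) * ((2 * u) * (2 * u) - 4 * (u * u - (1 + j) * (v * v)))" by (simp add: algebra_simps)
  hence "of_int (s1\<^sup>2 - s2\<^sup>2) + of_int (2 * s1 * s2) * j =
      of_int (r1\<^sup>2 - r2\<^sup>2 - 4 * n1 - 2 * r1 * r2 + 4 * n2) + of_int (r1\<^sup>2 - r2\<^sup>2 - 4 * n1 + 2 * r1 * r2 - 4 * n2) * j"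
    unfolding r n s by (simp add: algebra_simps power2_eq_square j_sq j_sq')
  hence eqs: "s1\<^sup>2 - s2\<^sup>2 = r1\<^sup>2 - r2\<^sup>2 - 4 * n1 - 2 * r1 * r2 + 4 * n2"
    "2 * s1 * s2 = r1\<^sup>2 - r2\<^sup>2 - 4 * n1 + 2 * r1 * r2 - 4 * n2" by (simp_all only: Zj_eq_iff)
  note even = quartic_order_maximal_coordinates[OF eqs]
  then obtain x1 x2 z1 z2 where e: "r1 = 2 * x1" "r2 = 2 * x2" "s1 = 2 * z1" "s2 = 2 * z2" by (elim conjE evenE)
  have "even (z1 + z2)" using even unfolding e by simp
  then obtain w where w: "z1 + z2 = 2 * w" by (elim evenE)
  have cancel: "x = y" if "2 * x = 2 * y" for x y :: complex using that by simp
  have "2 * u = 2 * (of_int x1 + of_int x2 * j)" using r unfolding e by (simp add: algebra_simps)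
  hence "u = of_int x1 + of_int x2 * j" by (rule cancel)
  hence uZ: "u \<in> Zj" by (simp only: ZjI)
  have "2 * ((1 + j) * v) = 2 * (of_int z1 + of_int z2 * j)" using s unfolding e by (simp add: algebra_simps)
  hence "(1 + j) * v = of_int z1 + of_int z2 * j" by (rule cancel)
  hence "(1 - j) * ((1 + j) * v) = (1 - j) * (of_int z1 + of_int z2 * j)" by simp
  hence "2 * v = of_int (z1 + z2) + of_int (z2 - z1) * j" by (simp add: algebra_simps j_sq j_sq')
  moreover have "z2 - z1 = 2 * (w - z1)" using w by simp
  ultimately have "2 * v = 2 * (of_int w + of_int (w - z1) * j)" unfolding w by (simp add: algebra_simps)
  hence "v = of_int w + of_int (w - z1) * j" by (rule cancel)
  hence "v \<in> Zj" by (simp only: ZjI)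
  thus ?thesis unfolding uv(3) using uZ by (rule MI[rotated])
qed

text \<open>With trace \<open>t1 + t2 j\<close> and norm \<open>n1 + n2 j\<close> over \<open>\<rat>(j)\<close>, the quadratic equation of \<open>x\<close> multiplied by its conjugate is the
monic integral quartic \<open>(x\<^sup>2 - t1 x + n1)\<^sup>2 + (t2 x - n2)\<^sup>2 = 0\<close>.\<close>

lemma M_algebraic_int:
  assumes "x \<in> M" shows "algebraic_int x"
proof -
  obtain a b where ab: "a \<in> Zj" "b \<in> Zj" "x = a + b * \<alpha>" using assms by (rule ME)
  have "2 * a \<in> Zj" using Zj_mult[OF Zj_of_int[of 2] ab(1)] by simp
  then obtain t1 t2 where t: "2 * a = of_int t1 + of_int t2 * j" by (rule ZjE)
  have "a * a - (1 + j) * (b * b) \<in> Zj" by (intro Zj_diff Zj_mult Zj_add ab(1,2) Zj_1 Zj_j)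
  then obtain n1 n2 where n: "a * a - (1 + j) * (b * b) = of_int n1 + of_int n2 * j" by (rule ZjE)
  have "x * x - (2 * a) * x + (a * a - (1 + j) * (b * b)) = 0"
    unfolding ab(3) by (simp add: algebra_simps alpha_sq alpha_sq')
  hence "x * x - of_int t1 * x + of_int n1 = (of_int t2 * x - of_int n2) * j"
    unfolding t n by (simp add: algebra_simps)
  hence "(x * x - of_int t1 * x + of_int n1) * (x * x - of_int t1 * x + of_int n1) =
      ((of_int t2 * x - of_int n2) * j) * ((of_int t2 * x - of_int n2) * j)" by simp
  also have "\<dots> = - ((of_int t2 * x - of_int n2) * (of_int t2 * x - of_int n2))"
    by (simp add: algebra_simps j_sq j_sq')
  finally have eq: "(x * x - of_int t1 * x + of_int n1) * (x * x - of_int t1 * x + of_int n1) +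
      (of_int t2 * x - of_int n2) * (of_int t2 * x - of_int n2) = 0" by simp
  define q :: "complex poly" where "q = map_poly of_int
    [:n1\<^sup>2 + n2\<^sup>2, - 2 * t1 * n1 - 2 * t2 * n2, t1\<^sup>2 + 2 * n1 + t2\<^sup>2, - 2 * t1, 1:]"
  have "poly q x = 0" unfolding eq[symmetric] q_def
    by (simp add: map_poly_pCons algebra_simps power2_eq_square)
  moreover have "lead_coeff q = 1" unfolding q_def by (simp add: map_poly_pCons)
  moreover have "\<forall>i. coeff q i \<in> \<int>" unfolding q_def by (simp add: coeff_map_poly)
  ultimately show ?thesis by (intro algebraic_int.intros[of q])
qed

lemma M_subset_L: "M \<subseteq> L"
  using Zj_subset_Qj by (auto elim!: ME intro!: LI)

lemma ring_of_integers_K1: "ring_of_integers (K1 \<alpha>) = CC_on M"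
proof -
  have "{x \<in> K1 \<alpha>. algebraic_int x} = M"
    unfolding K1_eq using M_subset_L M_algebraic_int almost_integral_imp_M algebraic_int_almost_integral by blast
  thus ?thesis unfolding ring_of_integers_def by simp
qed

definition elt :: "int \<Rightarrow> int \<Rightarrow> int \<Rightarrow> int \<Rightarrow> complex" where
  "elt a1 a2 b1 b2 = (of_int a1 + of_int a2 * j) + (of_int b1 + of_int b2 * j) * \<alpha>"

lemma elt_M: "elt a1 a2 b1 b2 \<in> M"
  unfolding elt_def by (intro MI ZjI)

lemma M_eltE: assumes "x \<in> M" obtains a1 a2 b1 b2 where "x = elt a1 a2 b1 b2"
proof -
  obtain a b where ab: "a \<in> Zj" "b \<in> Zj" "x = a + b * \<alpha>" using assms by (rule ME)
  obtain a1 a2 where a: "a = of_int a1 + of_int a2 * j" using ab(1) by (rule ZjE)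
  obtain b1 b2 where b: "b = of_int b1 + of_int b2 * j" using ab(2) by (rule ZjE)
  show ?thesis using that[of a1 a2 b1 b2] ab(3) unfolding a b elt_def .
qed

lemma elt_eq_iff: "elt a1 a2 b1 b2 = elt c1 c2 d1 d2 \<longleftrightarrow> a1 = c1 \<and> a2 = c2 \<and> b1 = d1 \<and> b2 = d2"
proof -
  have "of_int x + of_int y * j \<in> Qj" for x y using ZjI Zj_subset_Qj by blast
  thus ?thesis unfolding elt_def using L_eq_iff Zj_eq_iff by metis
qed

lemma elt_add: "elt a1 a2 b1 b2 + elt c1 c2 d1 d2 = elt (a1 + c1) (a2 + c2) (b1 + d1) (b2 + d2)"
  by (simp add: elt_def algebra_simps)

lemma elt_mult: "elt a1 a2 b1 b2 * elt c1 c2 d1 d2 =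
  elt (a1 * c1 - a2 * c2 + (b1 * d1 - b2 * d2) - (b1 * d2 + b2 * d1))
      (a1 * c2 + a2 * c1 + (b1 * d1 - b2 * d2) + (b1 * d2 + b2 * d1))
      (a1 * d1 - a2 * d2 + b1 * c1 - b2 * c2)
      (a1 * d2 + a2 * d1 + b1 * c2 + b2 * c1)"
  by (simp add: elt_def algebra_simps alpha_sq alpha_sq' j_sq j_sq')

lemma elt_of_int: "of_int n = elt n 0 0 0" and elt_alpha: "\<alpha> = elt 0 0 1 0" and elt_j: "j = elt 0 1 0 0"
  by (simp_all add: elt_def)

lemma field_norm_elt:
  "field_norm (K1 \<alpha>) (Qi \<alpha>) (elt a1 a2 b1 b2) = of_nat n \<longleftrightarrow>
   a1\<^sup>2 - a2\<^sup>2 - b1\<^sup>2 + b2\<^sup>2 + 2 * b1 * b2 = int n \<and> 2 * a1 * a2 - b1\<^sup>2 + b2\<^sup>2 - 2 * b1 * b2 = 0"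
proof -
  have Q: "of_int x + of_int y * j \<in> Qj" for x y using ZjI Zj_subset_Qj by blast
  have "field_norm (K1 \<alpha>) (Qi \<alpha>) (elt a1 a2 b1 b2) =
    of_int (a1\<^sup>2 - a2\<^sup>2 - b1\<^sup>2 + b2\<^sup>2 + 2 * b1 * b2) + of_int (2 * a1 * a2 - b1\<^sup>2 + b2\<^sup>2 - 2 * b1 * b2) * j"
    unfolding elt_def field_norm_eq[OF Q Q] by (simp add: algebra_simps power2_eq_square j_sq j_sq')
  moreover have "of_nat n = of_int (int n) + of_int 0 * j" by simp
  ultimately show ?thesis by (simp only: Zj_eq_iff)
qed

end

section \<open>Prime ideals above p and the quadratic character\<close>

text \<open>The norm \<open>a\<^sup>2 - (1 + i) b\<^sup>2\<close> of \<open>a + b\<alpha>\<close>, evaluated at an integer \<open>k\<close> in place of \<open>i\<close>. Modulo a divisor of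
\<open>k\<^sup>2 + 1\<close> this evaluation is a ring homomorphism on \<open>\<int>[i]\<close>.\<close>

lemma relative_norm_identity:
  fixes a1 a2 b1 b2 k :: int
  shows "(a1\<^sup>2 - a2\<^sup>2 - b1\<^sup>2 + b2\<^sup>2 + 2 * b1 * b2) + (2 * a1 * a2 - b1\<^sup>2 + b2\<^sup>2 - 2 * b1 * b2) * k =
    (a1 + a2 * k)\<^sup>2 - (1 + k) * (b1 + b2 * k)\<^sup>2 - (k\<^sup>2 + 1) * (a2\<^sup>2 - (1 + k) * b2\<^sup>2 - 2 * b1 * b2)"
  by (simp add: power2_eq_square algebra_simps)

lemma minus_one_root_dvd: "[k\<^sup>2 = -1] (mod m) \<longleftrightarrow> m dvd k\<^sup>2 + 1" for k m :: int
  by (simp add: cong_iff_dvd_diff)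

text \<open>One step of Hensel lifting.\<close>

lemma lift_sqrt_minus_one:
  fixes k q :: int
  assumes q: "prime q" "odd q" and k: "[k\<^sup>2 = -1] (mod q)"
  obtains k' where "[k' = k] (mod q)" "q\<^sup>2 dvd k'\<^sup>2 + 1"
proof -
  obtain c where c: "k\<^sup>2 + 1 = q * c" using k unfolding minus_one_root_dvd by (elim dvdE)
  have "\<not> q dvd k"
  proof
    assume "q dvd k"
    hence "q dvd k\<^sup>2" by (simp add: power2_eq_square)
    hence "q dvd (k\<^sup>2 + 1) - k\<^sup>2" using c by (intro dvd_diff) auto
    thus False using q(1) not_prime_unit by auto
  qed
  moreover have "\<not> q dvd 2"
  proof
    assume "q dvd 2"
    hence "q \<le> 2" by (intro zdvd_imp_le) auto
    thus False using q prime_ge_2_int[of q] by auto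
  qed
  ultimately have "\<not> q dvd 2 * k" using q(1) prime_dvd_multD by blast
  hence "coprime q (2 * k)" by (rule prime_imp_coprime[OF q(1)])
  hence "coprime (2 * k) q" by (rule coprime_commute[THEN iffD1])
  then obtain e where e: "[2 * k * e = 1] (mod q)" using cong_solve_coprime_int by blast
  then obtain f where f: "2 * k * e = 1 + q * f" by (metis cong_iff_lin cong_sym)
  define k' where "k' = k - q * (c * e)"
  have "k'\<^sup>2 + 1 = (k\<^sup>2 + 1) - q * c * (2 * k * e) + q\<^sup>2 * (c * e)\<^sup>2"
    unfolding k'_def by (simp add: power2_eq_square algebra_simps)
  also have "\<dots> = q\<^sup>2 * ((c * e)\<^sup>2 - c * f)" unfolding c f by (simp add: power2_eq_square algebra_simps)
  finally have "q\<^sup>2 dvd k'\<^sup>2 + 1" by simp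
  moreover have "[k' = k] (mod q)" unfolding k'_def by (simp add: cong_iff_dvd_diff)
  ultimately show ?thesis using that by blast
qed

text \<open>If the Gaussian prime belonging to \<open>q\<close> and \<open>k\<close> divides \<open>a\<close> and \<open>b\<close>, its square divides the norm of
\<open>a + b\<alpha>\<close>; the root \<open>k'\<close> modulo \<open>q\<^sup>2\<close> detects divisibility by that square.\<close>

lemma relative_norm_primitive:
  fixes a1 a2 b1 b2 k q :: int
  assumes q: "prime q" "odd q" and k: "[k\<^sup>2 = -1] (mod q)"
    and dvd: "q dvd a1 + a2 * k" "q dvd b1 + b2 * k"
  obtains k' where "[k' = k] (mod q)" "q\<^sup>2 dvd k'\<^sup>2 + 1"
    "q\<^sup>2 dvd (a1\<^sup>2 - a2\<^sup>2 - b1\<^sup>2 + b2\<^sup>2 + 2 * b1 * b2) + (2 * a1 * a2 - b1\<^sup>2 + b2\<^sup>2 - 2 * b1 * b2) * k'"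
proof -
  obtain k' where k': "[k' = k] (mod q)" "q\<^sup>2 dvd k'\<^sup>2 + 1" using lift_sqrt_minus_one[OF q k] .
  have "q dvd k' - k" using k'(1) by (simp add: cong_iff_dvd_diff)
  have d: "q dvd (x + y * k) + y * (k' - k)" if "q dvd x + y * k" for x y :: int
    by (rule dvd_add[OF that dvd_mult[OF \<open>q dvd k' - k\<close>]])
  have shift: "(x + y * k) + y * (k' - k) = x + y * k'" for x y :: int by (simp add: algebra_simps)
  hence "q dvd a1 + a2 * k'" "q dvd b1 + b2 * k'" using d[OF dvd(1)] d[OF dvd(2)] by (simp_all only: shift)
  hence sq: "q\<^sup>2 dvd (a1 + a2 * k')\<^sup>2" "q\<^sup>2 dvd (b1 + b2 * k')\<^sup>2" by (simp_all add: dvd_power_same)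
  have "q\<^sup>2 dvd (a1 + a2 * k')\<^sup>2 - (1 + k') * (b1 + b2 * k')\<^sup>2 - (k'\<^sup>2 + 1) * (a2\<^sup>2 - (1 + k') * b2\<^sup>2 - 2 * b1 * b2)"
    by (rule dvd_diff[OF dvd_diff[OF sq(1) dvd_mult[OF sq(2)]] dvd_mult2[OF k'(2)]])
  hence "q\<^sup>2 dvd (a1\<^sup>2 - a2\<^sup>2 - b1\<^sup>2 + b2\<^sup>2 + 2 * b1 * b2) + (2 * a1 * a2 - b1\<^sup>2 + b2\<^sup>2 - 2 * b1 * b2) * k'"
    by (simp only: relative_norm_identity)
  thus ?thesis using that k' by blast
qed

context quartic_field
begin

lemma cring_M: "cring (CC_on M)"
proof (intro cringI abelian_groupI comm_monoidI)
  show "\<exists>y\<in>carrier (CC_on M). y \<oplus>\<^bsub>CC_on M\<^esub> x = \<zero>\<^bsub>CC_on M\<^esub>" if "x \<in> carrier (CC_on M)" for x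
    using that M_minus by (intro bexI[of _ "- x"]) auto
qed (auto simp: M_add M_mult algebra_simps)

lemma minus_M: "a \<in> M \<Longrightarrow> b \<in> M \<Longrightarrow> a \<ominus>\<^bsub>CC_on M\<^esub> b = a - b"
proof -
  assume ab: "a \<in> M" "b \<in> M"
  interpret cring "CC_on M" by (rule cring_M)
  have "\<ominus>\<^bsub>CC_on M\<^esub> b = - b" by (rule minus_equality) (use ab M_minus in auto)
  thus ?thesis by (simp add: a_minus_def)
qed

text \<open>The reduction \<open>j \<mapsto> k\<close>, \<open>\<alpha> \<mapsto> s\<close>, as an integer that has a meaning only modulo divisors of \<open>k\<^sup>2 + 1\<close> and
\<open>s\<^sup>2 - (1 + k)\<close>.\<close>

definition ev :: "int \<Rightarrow> int \<Rightarrow> complex \<Rightarrow> int" where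
  "ev k s x = (THE n. \<exists>a1 a2 b1 b2. x = elt a1 a2 b1 b2 \<and> n = (a1 + a2 * k) + (b1 + b2 * k) * s)"

lemma ev_elt: "ev k s (elt a1 a2 b1 b2) = (a1 + a2 * k) + (b1 + b2 * k) * s"
  unfolding ev_def by (rule the_equality) (auto simp: elt_eq_iff)

lemma ev_of_int [simp]: "ev k s (of_int n) = n"
  by (simp add: elt_of_int ev_elt)

lemma ev_add: "x \<in> M \<Longrightarrow> y \<in> M \<Longrightarrow> ev k s (x + y) = ev k s x + ev k s y"
  by (auto elim!: M_eltE simp: elt_add ev_elt algebra_simps)

lemma ev_uminus: "x \<in> M \<Longrightarrow> ev k s (- x) = - ev k s x"
  using ev_add[of x "- x" k s] M_minus[of x] ev_of_int[of k s 0] by simp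

lemma ev_mult:
  assumes "[k\<^sup>2 = -1] (mod m)" "[s\<^sup>2 = 1 + k] (mod m)" "x \<in> M" "y \<in> M"
  shows "[ev k s (x * y) = ev k s x * ev k s y] (mod m)"
proof -
  obtain a1 a2 b1 b2 where x: "x = elt a1 a2 b1 b2" using assms(3) by (rule M_eltE)
  obtain c1 c2 d1 d2 where y: "y = elt c1 c2 d1 d2" using assms(4) by (rule M_eltE)
  have "ev k s x * ev k s y - ev k s (x * y) =
     (k\<^sup>2 + 1) * (a2 * c2 + b2 * d2 * (1 + k) + (b1 * d2 + b2 * d1) + (a2 * d2 + b2 * c2) * s) +
     (s\<^sup>2 - (1 + k)) * ((b1 + b2 * k) * (d1 + d2 * k))"
    unfolding x y elt_mult ev_elt by (simp add: algebra_simps power2_eq_square)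
  moreover have "m dvd k\<^sup>2 + 1" "m dvd s\<^sup>2 - (1 + k)" using assms(1,2) by (simp_all add: cong_iff_dvd_diff)
  ultimately have "m dvd ev k s x * ev k s y - ev k s (x * y)" by simp
  thus ?thesis by (simp add: cong_iff_dvd_diff dvd_diff_commute)
qed

lemma primeideal_ev:
  assumes p: "prime p" and k: "[k\<^sup>2 = -1] (mod int p)" and s: "[s\<^sup>2 = 1 + k] (mod int p)"
  shows "primeideal {x \<in> M. int p dvd ev k s x} (CC_on M)" (is "primeideal ?P _")
proof (rule primeidealI2)
  have dvd_mult: "int p dvd ev k s (x * y) \<longleftrightarrow> int p dvd ev k s x * ev k s y" if "x \<in> M" "y \<in> M" for x y
    using cong_dvd_iff[OF ev_mult[OF k s that]] .
  have pp: "prime (int p)" using p by simp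
  show "cring (CC_on M)" by (rule cring_M)
  show "additive_subgroup ?P (CC_on M)"
  proof (intro additive_subgroup.intro group.subgroupI)
    show "group (add_monoid (CC_on M))"
      using cring_M by (meson abelian_group.a_group cring.axioms(1) ring.is_abelian_group)
    show "inv\<^bsub>add_monoid (CC_on M)\<^esub> x \<in> ?P" if "x \<in> ?P" for x
    proof -
      have "\<ominus>\<^bsub>CC_on M\<^esub> x = - x"
        by (rule abelian_group.minus_equality[OF ring.is_abelian_group[OF cring.axioms(1)[OF cring_M]]])
          (use that M_minus in auto)
      thus ?thesis using that by (auto simp: a_inv_def M_minus ev_uminus)
    qed
    have "ev k s 0 = 0" using ev_of_int[of k s 0] by simp
    hence "0 \<in> ?P" by simp
    thus "?P \<noteq> {}" by blast
  qed (auto simp: M_add ev_add)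
  show "x \<otimes>\<^bsub>CC_on M\<^esub> a \<in> ?P" if "a \<in> ?P" "x \<in> carrier (CC_on M)" for a x
    using that dvd_mult[of x a] by (simp add: M_mult)
  show "a \<otimes>\<^bsub>CC_on M\<^esub> x \<in> ?P" if "a \<in> ?P" "x \<in> carrier (CC_on M)" for a x
    using that dvd_mult[of a x] by (simp add: M_mult)
  have "ev k s 1 = 1" using ev_of_int[of k s 1] by simp
  hence not1: "1 \<notin> ?P" using pp by (auto simp: not_prime_unit)
  show "carrier (CC_on M) \<noteq> ?P"
  proof
    assume eq: "carrier (CC_on M) = ?P"
    have "1 \<in> carrier (CC_on M)" by simp
    thus False using not1 unfolding eq by contradiction
  qed
  show "a \<in> ?P \<or> b \<in> ?P"
    if "a \<in> carrier (CC_on M)" "b \<in> carrier (CC_on M)" "a \<otimes>\<^bsub>CC_on M\<^esub> b \<in> ?P" for a b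
    using that dvd_mult[of a b] prime_dvd_mult_iff[OF pp] by simp
qed

lemma primeideal_M:
  assumes "primeideal P (CC_on M)"
  shows "P \<subseteq> M" "\<And>x y. x \<in> P \<Longrightarrow> y \<in> P \<Longrightarrow> x + y \<in> P" "\<And>x y. x \<in> P \<Longrightarrow> y \<in> M \<Longrightarrow> y * x \<in> P"
    "1 \<notin> P" "\<And>x y. x \<in> M \<Longrightarrow> y \<in> M \<Longrightarrow> x * y \<in> P \<Longrightarrow> x \<in> P \<or> y \<in> P"
proof -
  interpret primeideal P "CC_on M" by fact
  show sub: "P \<subseteq> M" using a_subset by simp
  show "\<And>x y. x \<in> P \<Longrightarrow> y \<in> P \<Longrightarrow> x + y \<in> P" using additive_subgroup.a_closed[OF additive_subgroup_axioms] by simp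
  show m: "\<And>x y. x \<in> P \<Longrightarrow> y \<in> M \<Longrightarrow> y * x \<in> P" using I_l_closed by simp
  show "\<And>x y. x \<in> M \<Longrightarrow> y \<in> M \<Longrightarrow> x * y \<in> P \<Longrightarrow> x \<in> P \<or> y \<in> P" using I_prime by simp
  show "1 \<notin> P"
  proof
    assume "1 \<in> P"
    hence "M \<subseteq> P" using m[of 1] by auto
    thus False using I_notcarr sub by auto
  qed
qed

text \<open>Factoring \<open>j\<^sup>2 - k\<^sup>2\<close> and \<open>\<alpha>\<^sup>2 - t\<^sup>2\<close> modulo \<open>P\<close> shows that \<open>j\<close> and \<open>\<alpha>\<close> are congruent to integers. Which square root of
\<open>-1\<close> occurs depends on \<open>P\<close>, so the residue condition is needed for both.\<close>

lemma prime_above_cases: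
  assumes P: "primeideal P (CC_on M)" and pP: "of_nat p \<in> P" and p: "prime p"
    and k: "[k\<^sup>2 = -1] (mod int p)" and L: "Legendre (1 + k) p = 1" "Legendre (1 - k) p = 1"
  obtains k' s where "[k'\<^sup>2 = -1] (mod int p)" "Legendre (1 + k') p = 1" "[s\<^sup>2 = 1 + k'] (mod int p)"
    "\<forall>x\<in>M. x - of_int (ev k' s x) \<in> P" "\<forall>n. of_int n \<in> P \<longleftrightarrow> int p dvd n"
proof -
  note P = primeideal_M[OF P]
  have int: "of_int n \<in> P" if n: "int p dvd n" for n
  proof -
    obtain m where "n = int p * m" using n by (elim dvdE)
    thus ?thesis using P(3)[OF pP M_of_int[of m]] by (simp add: mult.commute)
  qed
  have neg: "- x \<in> P" if "x \<in> P" for x using P(3)[OF that M_minus[OF M_1]] by simp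
  have diff: "x - y \<in> P" if "x \<in> P" "y \<in> P" for x y using P(2)[OF that(1) neg[OF that(2)]] by simp
  have iff: "of_int n \<in> P \<longleftrightarrow> int p dvd n" for n
  proof
    assume n: "of_int n \<in> P"
    show "int p dvd n"
    proof (rule ccontr)
      assume "\<not> int p dvd n"
      hence "coprime n (int p)" using p prime_imp_coprime[of "int p" n] by (simp add: coprime_commute)
      then obtain e where "[n * e = 1] (mod int p)" using cong_solve_coprime_int by blast
      hence "int p dvd n * e - 1" by (simp add: cong_iff_dvd_diff)
      hence "of_int (n * e - 1) \<in> P" by (rule int)
      moreover have "of_int e * of_int n \<in> P" using P(3)[OF n] by simp
      ultimately have "of_int e * of_int n - of_int (n * e - 1) \<in> P" by (intro diff)
      thus False using P(4) by (simp add: mult.commute)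
    qed
  qed (rule int)
  have "(j - of_int k) * (j + of_int k) = of_int (- (k\<^sup>2 + 1))"
    by (simp add: algebra_simps j_sq power2_eq_square)
  also have "\<dots> \<in> P" using k by (intro int) (simp only: cong_iff_dvd_diff dvd_minus_iff diff_minus_eq_add)
  finally have "j - of_int k \<in> P \<or> j + of_int k \<in> P" by (rule P(5)[rotated 2]) (auto intro: M_diff M_add)
  then obtain k' where k': "k' = k \<or> k' = - k" "j - of_int k' \<in> P"
  proof
    assume "j - of_int k \<in> P"
    thus ?thesis using that by blast
  next
    assume "j + of_int k \<in> P"
    thus ?thesis using that[of "- k"] by simp
  qed
  have k'r: "[k'\<^sup>2 = -1] (mod int p)" using k'(1) k by auto
  have k'L: "Legendre (1 + k') p = 1" using k'(1) L by auto
  then obtain t where t: "[t\<^sup>2 = 1 + k'] (mod int p)" by (rule Legendre_eq_1D)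
  have "(\<alpha> - of_int t) * (\<alpha> + of_int t) = (j - of_int k') - of_int (t\<^sup>2 - (1 + k'))"
    by (simp add: algebra_simps alpha_sq power2_eq_square)
  also have "\<dots> \<in> P" using t by (intro diff k' int) (simp add: cong_iff_dvd_diff)
  finally have "\<alpha> - of_int t \<in> P \<or> \<alpha> + of_int t \<in> P" by (rule P(5)[rotated 2]) (auto intro: M_diff M_add)
  then obtain s where s: "s = t \<or> s = - t" "\<alpha> - of_int s \<in> P"
  proof
    assume "\<alpha> - of_int t \<in> P"
    thus ?thesis using that by blast
  next
    assume "\<alpha> + of_int t \<in> P"
    thus ?thesis using that[of "- t"] by simp
  qed
  have s2: "[s\<^sup>2 = 1 + k'] (mod int p)" using s(1) t by auto
  have red: "x - of_int (ev k' s x) \<in> P" if xM: "x \<in> M" for x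
  proof -
    obtain a1 a2 b1 b2 where x: "x = elt a1 a2 b1 b2" using xM by (rule M_eltE)
    have "x - of_int (ev k' s x) = of_int (a2 + b2 * s) * (j - of_int k') + (of_int b1 + of_int b2 * j) * (\<alpha> - of_int s)"
      unfolding x ev_elt by (simp add: elt_def algebra_simps)
    also have "\<dots> \<in> P" by (intro P(2) P(3)[OF k'(2)] P(3)[OF s(2)] M_add M_mult M_of_int M_j)
    finally show ?thesis .
  qed
  show ?thesis using that[OF k'r k'L s2] red iff by blast
qed

text \<open>The residue ring is \<open>\<int>/p\<close>, and squares of cosets correspond to squares of integers.\<close>

lemma quadratic_character_eq_Legendre:
  assumes P: "primeideal P (CC_on M)"
    and red: "\<And>x. x \<in> M \<Longrightarrow> x - of_int (f x) \<in> P" and iff: "\<And>n. of_int n \<in> P \<longleftrightarrow> int p dvd n"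
    and a: "a \<in> M"
  shows "quadratic_character (CC_on M) a P = 1 \<longleftrightarrow> Legendre (f a) p = 1"
proof -
  interpret primeideal P "CC_on M" by fact
  note P = primeideal_M[OF P]
  have neg: "- x \<in> P" if "x \<in> P" for x using P(3)[OF that M_minus[OF M_1]] by simp
  have diff: "x - y \<in> P" if "x \<in> P" "y \<in> P" for x y using P(2)[OF that(1) neg[OF that(2)]] by simp
  have aP: "a \<in> P \<longleftrightarrow> int p dvd f a"
  proof
    assume "a \<in> P"
    from diff[OF this red[OF a]] show "int p dvd f a" by (simp add: iff)
  next
    assume "int p dvd f a"
    hence "of_int (f a) \<in> P" by (simp add: iff)
    from P(2)[OF red[OF a] this] show "a \<in> P" by simp
  qed
  have coset: "(P +>\<^bsub>CC_on M\<^esub> z) \<otimes>\<^bsub>CC_on M Quot P\<^esub> (P +>\<^bsub>CC_on M\<^esub> z) = P +>\<^bsub>CC_on M\<^esub> a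
      \<longleftrightarrow> z * z - a \<in> P" if z: "z \<in> M" for z
  proof -
    have "(P +>\<^bsub>CC_on M\<^esub> z) \<otimes>\<^bsub>CC_on M Quot P\<^esub> (P +>\<^bsub>CC_on M\<^esub> z) = P +>\<^bsub>CC_on M\<^esub> (z * z)"
      using rcoset_mult_add[of z z] z by (simp add: FactRing_def)
    thus ?thesis
      using quotient_eq_iff_same_a_r_cos[OF is_ideal, of "z * z" a] z a M_mult[OF z z] by (simp add: minus_M)
  qed
  have "(\<exists>y\<in>carrier (CC_on M Quot P). y \<otimes>\<^bsub>CC_on M Quot P\<^esub> y = P +>\<^bsub>CC_on M\<^esub> a) \<longleftrightarrow>
      (\<exists>z\<in>M. z * z - a \<in> P)"
  proof -
    have "carrier (CC_on M Quot P) = (\<lambda>z. P +>\<^bsub>CC_on M\<^esub> z) ` M"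
      by (auto simp: FactRing_def A_RCOSETS_def')
    thus ?thesis using coset by auto
  qed
  also have "\<dots> \<longleftrightarrow> (\<exists>n. [n\<^sup>2 = f a] (mod int p))"
  proof
    assume "\<exists>z\<in>M. z * z - a \<in> P"
    then obtain z where z: "z \<in> M" "z * z - a \<in> P" by blast
    have "of_int ((f z)\<^sup>2 - f a) =
        ((z * z - a) + (a - of_int (f a))) - (z + of_int (f z)) * (z - of_int (f z))"
      by (simp add: algebra_simps power2_eq_square)
    also have "\<dots> \<in> P" by (intro diff P(2,3) z red a M_add M_of_int)
    finally have "[(f z)\<^sup>2 = f a] (mod int p)" unfolding iff cong_iff_dvd_diff .
    thus "\<exists>n. [n\<^sup>2 = f a] (mod int p)" by blast
  next
    assume "\<exists>n. [n\<^sup>2 = f a] (mod int p)"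
    then obtain n where "of_int (n\<^sup>2 - f a) \<in> P" unfolding iff cong_iff_dvd_diff by blast
    from diff[OF this red[OF a]] have "of_int n * of_int n - a \<in> P" by (simp add: power2_eq_square)
    thus "\<exists>z\<in>M. z * z - a \<in> P" using M_of_int by blast
  qed
  finally have *: "(\<exists>y\<in>carrier (CC_on M Quot P). y \<otimes>\<^bsub>CC_on M Quot P\<^esub> y = P +>\<^bsub>CC_on M\<^esub> a) \<longleftrightarrow>
      (\<exists>n. [n\<^sup>2 = f a] (mod int p))" .
  show ?thesis
  proof (cases "a \<in> P")
    case True
    hence "Legendre (f a) p = 0" using aP by (simp add: Legendre_eq_0_iff)
    thus ?thesis using True by (simp add: quadratic_character_def)
  next
    case False
    hence "Legendre (f a) p = 1 \<longleftrightarrow> (\<exists>n. [n\<^sup>2 = f a] (mod int p))"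
      using aP by (auto intro: Legendre_eq_1I elim: Legendre_eq_1D)
    thus ?thesis using False * by (simp add: quadratic_character_def)
  qed
qed

end

locale quartic_field_prime = quartic_field \<alpha> + prime_1_mod_4 p for \<alpha> p +
  fixes k :: int
  assumes mod8: "p mod 8 = 1" and root_k: "[k\<^sup>2 = -1] (mod int p)" and residue: "Legendre (1 + k) p = 1"
begin

text \<open>The product \<open>(1 + k) (1 - k)\<close> is \<open>2\<close> modulo \<open>p\<close>.\<close>

lemma residue_conj: "Legendre (1 - k) p = 1"
proof -
  have "(1 + k) * (1 - k) - 2 = - (k\<^sup>2 + 1)" by (simp add: algebra_simps power2_eq_square)
  moreover have "int p dvd k\<^sup>2 + 1" using root_k by (simp add: cong_iff_dvd_diff)
  ultimately have "[(1 + k) * (1 - k) = 2] (mod int p)" by (simp only: cong_iff_dvd_diff dvd_minus_iff)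
  hence "Legendre ((1 + k) * (1 - k)) p = Legendre 2 p" by (rule Legendre_cong)
  thus ?thesis using Legendre_two mod8 residue by (simp add: Legendre_mult)
qed

text \<open>Write \<open>\<delta> = a + b\<alpha>\<close> and let \<open>\<alpha>\<close> map to \<open>s\<close>. As \<open>(a - sb) (a + sb) \<equiv> p \<equiv> 0\<close> and \<open>a + sb\<close> is the nonzero image of
\<open>\<delta>\<close>, one has \<open>a \<equiv> sb\<close>; so \<open>\<alpha>\<delta>\<close> maps to \<open>s (a + sb) \<equiv> 2s\<^sup>2b = 2 (1 + k') b\<close>.\<close>

lemma admissible_criterion:
  assumes "admissible \<alpha> p \<delta> P"
  obtains k' a1 a2 b1 b2 where "[k'\<^sup>2 = -1] (mod int p)" "Legendre (1 + k') p = 1"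
    "a1\<^sup>2 - a2\<^sup>2 - b1\<^sup>2 + b2\<^sup>2 + 2 * b1 * b2 = int p" "2 * a1 * a2 - b1\<^sup>2 + b2\<^sup>2 - 2 * b1 * b2 = 0"
    "quadratic_character (ring_of_integers (K1 \<alpha>)) (\<alpha> * \<delta>) P = 1 \<longleftrightarrow> Legendre (b1 + b2 * k') p = 1"
proof -
  have P: "primeideal P (CC_on M)" "of_nat p \<in> P" "\<delta> \<notin> P"
    and norm: "field_norm (K1 \<alpha>) (Qi \<alpha>) \<delta> = of_nat p"
    using assms unfolding admissible_def ring_of_integers_K1 by auto
  have dM: "\<delta> \<in> M" using assms almost_integral_imp_M algebraic_int_almost_integral
    unfolding admissible_def K1_eq by blast
  then obtain a1 a2 b1 b2 where d: "\<delta> = elt a1 a2 b1 b2" by (rule M_eltE)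
  have eqs: "a1\<^sup>2 - a2\<^sup>2 - b1\<^sup>2 + b2\<^sup>2 + 2 * b1 * b2 = int p" "2 * a1 * a2 - b1\<^sup>2 + b2\<^sup>2 - 2 * b1 * b2 = 0"
    using norm unfolding d field_norm_elt by blast+
  obtain k' s where k': "[k'\<^sup>2 = -1] (mod int p)" "Legendre (1 + k') p = 1" and s: "[s\<^sup>2 = 1 + k'] (mod int p)"
    and red': "\<forall>x\<in>M. x - of_int (ev k' s x) \<in> P" and iff': "\<forall>n. of_int n \<in> P \<longleftrightarrow> int p dvd n"
    by (rule prime_above_cases[OF P(1,2) prime_p root_k residue residue_conj])
  have red: "x - of_int (ev k' s x) \<in> P" if "x \<in> M" for x using red' that by blast
  have iff: "of_int n \<in> P \<longleftrightarrow> int p dvd n" for n using iff' by blast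
  define a where "a = a1 + a2 * k'"
  define b where "b = b1 + b2 * k'"
  have p1: "int p dvd k'\<^sup>2 + 1" using k'(1) by (simp add: cong_iff_dvd_diff)
  have p2: "int p dvd s\<^sup>2 - (1 + k')" using s by (simp add: cong_iff_dvd_diff)
  have "int p = a\<^sup>2 - (1 + k') * b\<^sup>2 - (k'\<^sup>2 + 1) * (a2\<^sup>2 - (1 + k') * b2\<^sup>2 - 2 * b1 * b2)"
    using relative_norm_identity[of a1 a2 b1 b2 k'] unfolding eqs a_def b_def by simp
  hence "(a - s * b) * (a + b * s) = int p + (k'\<^sup>2 + 1) * (a2\<^sup>2 - (1 + k') * b2\<^sup>2 - 2 * b1 * b2)
      - (s\<^sup>2 - (1 + k')) * b\<^sup>2" by (simp add: algebra_simps power2_eq_square)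
  moreover have "int p dvd int p + (k'\<^sup>2 + 1) * (a2\<^sup>2 - (1 + k') * b2\<^sup>2 - 2 * b1 * b2) - (s\<^sup>2 - (1 + k')) * b\<^sup>2"
    by (rule dvd_diff[OF dvd_add[OF dvd_refl dvd_mult2[OF p1]] dvd_mult2[OF p2]])
  ultimately have "int p dvd (a - s * b) * (a + b * s)" by simp
  moreover have "\<not> int p dvd a + b * s"
  proof
    assume "int p dvd a + b * s"
    hence "of_int (ev k' s \<delta>) \<in> P" unfolding iff d ev_elt a_def b_def .
    from primeideal_M(2)[OF P(1) red[OF dM] this] show False using P(3) by simp
  qed
  ultimately have ab: "int p dvd a - s * b" using prime_dvd_mult_iff[OF prime_int] by blast
  have ad: "\<alpha> * \<delta> = elt (b1 - b2) (b1 + b2) a1 a2" unfolding d by (subst elt_alpha) (simp add: elt_mult)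
  have "ev k' s (\<alpha> * \<delta>) - 2 * (1 + k') * b = s * (a - s * b) + (s\<^sup>2 - (1 + k')) * b - b2 * (k'\<^sup>2 + 1)"
    unfolding ad ev_elt a_def b_def by (simp add: algebra_simps power2_eq_square)
  moreover have "int p dvd s * (a - s * b) + (s\<^sup>2 - (1 + k')) * b - b2 * (k'\<^sup>2 + 1)"
    by (rule dvd_diff[OF dvd_add[OF dvd_mult[OF ab] dvd_mult2[OF p2]] dvd_mult[OF p1]])
  ultimately have "[ev k' s (\<alpha> * \<delta>) = 2 * (1 + k') * b] (mod int p)" by (simp add: cong_iff_dvd_diff)
  hence "Legendre (ev k' s (\<alpha> * \<delta>)) p = Legendre (2 * (1 + k') * b) p" by (rule Legendre_cong)
  also have "\<dots> = Legendre b p" unfolding Legendre_mult k'(2) using Legendre_two mod8 by simp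
  finally have "quadratic_character (CC_on M) (\<alpha> * \<delta>) P = 1 \<longleftrightarrow> Legendre b p = 1"
    using quadratic_character_eq_Legendre[OF P(1) red iff M_mult[OF M_alpha dM]] by simp
  thus ?thesis using that[OF k' eqs] unfolding b_def ring_of_integers_K1 by blast
qed

text \<open>The two roots \<open>s\<close> and \<open>-s\<close> give two primes above \<open>p\<close>. If \<open>\<delta>\<close> were in both, the Gaussian prime below would divide
\<open>a\<close> and \<open>b\<close>, so its square would divide the norm \<open>p\<close>.\<close>

lemma ex_admissible_prime:
  assumes eqs: "a1\<^sup>2 - a2\<^sup>2 - b1\<^sup>2 + b2\<^sup>2 + 2 * b1 * b2 = int p" "2 * a1 * a2 - b1\<^sup>2 + b2\<^sup>2 - 2 * b1 * b2 = 0"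
  shows "\<exists>P. admissible \<alpha> p (elt a1 a2 b1 b2) P"
proof -
  obtain t where t: "[t\<^sup>2 = 1 + k] (mod int p)" "\<not> int p dvd 1 + k" using residue by (rule Legendre_eq_1D)
  have odd_p: "odd (int p)" using gt2 prime_p prime_odd_nat by simp
  \<comment> \<open>One of the two square roots of \<open>1 + k\<close> gives a prime that does not contain \<open>\<delta>\<close>.\<close>
  have "\<exists>s. [s\<^sup>2 = 1 + k] (mod int p) \<and> \<not> int p dvd (a1 + a2 * k) + (b1 + b2 * k) * s"
  proof (rule ccontr)
    assume "\<not> ?thesis"
    hence *: "int p dvd (a1 + a2 * k) + (b1 + b2 * k) * t" "int p dvd (a1 + a2 * k) + (b1 + b2 * k) * (- t)"
      using t(1) by (metis, metis power2_minus)
    have "int p dvd 2 * (a1 + a2 * k)" using dvd_add[OF *] by (simp add: algebra_simps)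
    moreover have p2: "\<not> int p dvd 2" using gt2 zdvd_imp_le by fastforce
    ultimately have a: "int p dvd a1 + a2 * k" using prime_dvd_mult_iff[OF prime_int] by blast
    have "int p dvd (b1 + b2 * k) * t" using *(1) a by (simp add: dvd_add_right_iff)
    moreover have "\<not> int p dvd t"
    proof
      assume "int p dvd t"
      hence "int p dvd t\<^sup>2" by (simp add: power2_eq_square)
      thus False using t cong_dvd_iff[OF t(1)] by blast
    qed
    ultimately have b: "int p dvd b1 + b2 * k" using prime_dvd_mult_iff[OF prime_int] by blast
    obtain k' where "(int p)\<^sup>2 dvd (a1\<^sup>2 - a2\<^sup>2 - b1\<^sup>2 + b2\<^sup>2 + 2 * b1 * b2) + (2 * a1 * a2 - b1\<^sup>2 + b2\<^sup>2 - 2 * b1 * b2) * k'"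
      by (rule relative_norm_primitive[OF prime_int odd_p root_k a b])
    hence "(int p)\<^sup>2 dvd int p" unfolding eqs by simp
    hence "(int p)\<^sup>2 \<le> int p" using gt2 by (intro zdvd_imp_le) auto
    thus False using gt2 by (simp add: power2_eq_square)
  qed
  then obtain s where s: "[s\<^sup>2 = 1 + k] (mod int p)" "\<not> int p dvd ev k s (elt a1 a2 b1 b2)" unfolding ev_elt by blast
  have "ev k s (of_nat p) = int p" using ev_of_int[of k s "int p"] by simp
  moreover have "of_nat p \<in> M" using M_of_int[of "int p"] by simp
  moreover have "elt a1 a2 b1 b2 \<in> L" "algebraic_int (elt a1 a2 b1 b2)"
    using elt_M M_subset_L M_algebraic_int by blast+
  moreover have "field_norm (K1 \<alpha>) (Qi \<alpha>) (elt a1 a2 b1 b2) = of_nat p" using eqs by (simp add: field_norm_elt)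
  ultimately have "admissible \<alpha> p (elt a1 a2 b1 b2) {x \<in> M. int p dvd ev k s x}"
    unfolding admissible_def ring_of_integers_K1 using primeideal_ev[OF prime_p root_k s(1)] s(2)
    by (simp add: K1_eq)
  thus ?thesis by blast
qed

end

section \<open>Elements of relative norm p\<close>

definition norm_re :: "int \<Rightarrow> int \<Rightarrow> int \<Rightarrow> int \<Rightarrow> int" where
  "norm_re a1 a2 b1 b2 = a1\<^sup>2 - a2\<^sup>2 - b1\<^sup>2 + b2\<^sup>2 + 2 * b1 * b2"

definition norm_im :: "int \<Rightarrow> int \<Rightarrow> int \<Rightarrow> int \<Rightarrow> int" where
  "norm_im a1 a2 b1 b2 = 2 * a1 * a2 - b1\<^sup>2 + b2\<^sup>2 - 2 * b1 * b2"

text \<open>The Gaussian integer \<open>p (m1 + m2 i)\<close> is the norm of some \<open>a + b\<alpha>\<close>.\<close>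

definition scaled_norm :: "int \<Rightarrow> int \<Rightarrow> int \<Rightarrow> bool" where
  "scaled_norm p m1 m2 \<longleftrightarrow> (\<exists>a1 a2 b1 b2. norm_re a1 a2 b1 b2 = p * m1 \<and> norm_im a1 a2 b1 b2 = p * m2)"

lemmas nrm_defs = norm_re_def norm_im_def power2_eq_square algebra_simps

lemma norm_identity: "norm_re a1 a2 b1 b2 + norm_im a1 a2 b1 b2 * k =
    (a1 + a2 * k)\<^sup>2 - (1 + k) * (b1 + b2 * k)\<^sup>2 - (k\<^sup>2 + 1) * (a2\<^sup>2 - (1 + k) * b2\<^sup>2 - 2 * b1 * b2)"
  unfolding norm_re_def norm_im_def by (rule relative_norm_identity)

lemma norm_uminus: "norm_re a1 a2 (- b1) (- b2) = norm_re a1 a2 b1 b2" "norm_im a1 a2 (- b1) (- b2) = norm_im a1 a2 b1 b2"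
  by (simp_all add: norm_re_def norm_im_def)

text \<open>Multiply by the unit \<open>1 + \<alpha>\<close>, whose norm is \<open>-i\<close>.\<close>

lemma scaled_norm_rotate: "scaled_norm p m1 m2 \<Longrightarrow> scaled_norm p m2 (- m1)"
proof -
  assume "scaled_norm p m1 m2"
  then obtain a1 a2 b1 b2 where *: "norm_re a1 a2 b1 b2 = p * m1" "norm_im a1 a2 b1 b2 = p * m2"
    unfolding scaled_norm_def by blast
  have "norm_re (a1 + b1 - b2) (a2 + b1 + b2) (a1 + b1) (a2 + b2) = norm_im a1 a2 b1 b2"
    by (simp add: nrm_defs)
  moreover have "norm_im (a1 + b1 - b2) (a2 + b1 + b2) (a1 + b1) (a2 + b2) = - norm_re a1 a2 b1 b2"
    by (simp add: nrm_defs)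
  ultimately show ?thesis unfolding scaled_norm_def using *
    by (intro exI[of _ "a1 + b1 - b2"] exI[of _ "a2 + b1 + b2"] exI[of _ "a1 + b1"] exI[of _ "a2 + b2"]) simp
qed

text \<open>This and the next two lemmas have a common pattern. Let \<open>\<pi> = g\<^sup>2 - (1 + i)\<close>, the norm of \<open>g + \<alpha>\<close>. If
\<open>a = gb + \<pi>c\<close>, then the norm of \<open>a + b\<alpha>\<close> is \<open>\<pi>\<close> times that of \<open>(gc + b) + c\<alpha>\<close>. When a prime \<open>\<pi>\<close>
divides the norm, it divides \<open>a - gb\<close> or \<open>a + gb\<close>, and the two cases are exchanged by \<open>b \<mapsto> -b\<close>. Here \<open>g = 0\<close>
and \<open>\<pi> = -(1 + i)\<close>.\<close>

lemma scaled_norm_div_1_plus_i: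
  assumes "scaled_norm p (v - u) (- (u + v))" shows "scaled_norm p u v"
proof -
  obtain a1 a2 b1 b2 where *: "norm_re a1 a2 b1 b2 = p * (v - u)" "norm_im a1 a2 b1 b2 = p * - (u + v)"
    using assms unfolding scaled_norm_def by blast
  have "norm_re a1 a2 b1 b2 + norm_im a1 a2 b1 b2 = a1\<^sup>2 - a2\<^sup>2 + 2 * (b2\<^sup>2 - b1\<^sup>2 + a1 * a2)"
    by (simp add: nrm_defs)
  moreover have "norm_re a1 a2 b1 b2 + norm_im a1 a2 b1 b2 = 2 * (- (p * u))" unfolding * by (simp add: algebra_simps)
  ultimately have "a1\<^sup>2 - a2\<^sup>2 = 2 * (- (p * u) - (b2\<^sup>2 - b1\<^sup>2 + a1 * a2))" by simp
  hence "even (a1\<^sup>2 - a2\<^sup>2)" by simp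
  hence "even (a1 + a2)" by simp
  then obtain t where "a1 + a2 = 2 * t" by (elim evenE)
  hence t: "a1 = 2 * t - a2" by simp
  have "2 * norm_re b1 b2 t (a2 - t) = - (norm_re a1 a2 b1 b2 + norm_im a1 a2 b1 b2)" unfolding t by (simp add: nrm_defs)
  hence "norm_re b1 b2 t (a2 - t) = p * u" unfolding * by (simp add: algebra_simps)
  moreover have "2 * norm_im b1 b2 t (a2 - t) = norm_re a1 a2 b1 b2 - norm_im a1 a2 b1 b2" unfolding t by (simp add: nrm_defs)
  hence "norm_im b1 b2 t (a2 - t) = p * v" unfolding * by (simp add: algebra_simps)
  ultimately show ?thesis unfolding scaled_norm_def by blast
qed

text \<open>Here \<open>g = i\<close> and \<open>\<pi> = -(2 + i)\<close>; divisibility by \<open>2 + i\<close> is tested by \<open>i \<mapsto> -2\<close> modulo \<open>5\<close>.\<close>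

lemma scaled_norm_div_2_plus_i:
  assumes "scaled_norm p (v - 2 * u) (- (u + 2 * v))" shows "scaled_norm p u v"
proof -
  have main: "scaled_norm p u v" if n: "norm_re a1 a2 b1 b2 = p * (v - 2 * u)" "norm_im a1 a2 b1 b2 = p * - (u + 2 * v)"
    and d: "5 dvd (a1 - 2 * a2) + 2 * (b1 - 2 * b2)" for a1 a2 b1 b2
  proof -
    obtain c where "(a1 - 2 * a2) + 2 * (b1 - 2 * b2) = 5 * c" using d by (elim dvdE)
    hence a1: "a1 = 2 * a2 - 2 * b1 - b2 + 5 * (c + b2)" by simp
    define e where "e = c + b2"
    note a1 = a1[folded e_def]
    let ?re = "norm_re (b1 - e) (b1 + b2 - a2 - 2 * e) (b1 - a2 - 2 * e) e"
    let ?im = "norm_im (b1 - e) (b1 + b2 - a2 - 2 * e) (b1 - a2 - 2 * e) e"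
    have 1: "norm_re a1 a2 b1 b2 = ?im - 2 * ?re" unfolding a1 by (simp add: nrm_defs)
    have 2: "norm_im a1 a2 b1 b2 = - ?re - 2 * ?im" unfolding a1 by (simp add: nrm_defs)
    have "5 * ?re = 5 * (p * u)" using 1 2 unfolding n by (simp add: algebra_simps)
    moreover have "5 * ?im = 5 * (p * v)" using 1 2 unfolding n by (simp add: algebra_simps)
    ultimately show ?thesis unfolding scaled_norm_def by (intro exI conjI) simp_all
  qed
  obtain a1 a2 b1 b2 where *: "norm_re a1 a2 b1 b2 = p * (v - 2 * u)" "norm_im a1 a2 b1 b2 = p * - (u + 2 * v)"
    using assms unfolding scaled_norm_def by blast
  define A where "A = a1 - 2 * a2"
  define B where "B = b1 - 2 * b2"
  have "A\<^sup>2 + B\<^sup>2 = norm_re a1 a2 b1 b2 - 2 * norm_im a1 a2 b1 b2 + 5 * (a2\<^sup>2 + b2\<^sup>2 - 2 * b1 * b2)"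
    unfolding A_def B_def by (simp add: nrm_defs)
  hence "(A + 2 * B) * (A - 2 * B) = 5 * (p * v + (a2\<^sup>2 + b2\<^sup>2 - 2 * b1 * b2) - B\<^sup>2)"
    unfolding * by (simp add: power2_eq_square algebra_simps)
  hence "5 dvd (A + 2 * B) * (A - 2 * B)" by simp
  moreover have "prime (5::int)" by simp
  ultimately have "5 dvd A + 2 * B \<or> 5 dvd A - 2 * B" using prime_dvd_mult_iff by blast
  thus ?thesis
  proof
    assume "5 dvd A + 2 * B"
    thus ?thesis using main[OF *] unfolding A_def B_def by blast
  next
    assume "5 dvd A - 2 * B"
    thus ?thesis using main[of a1 a2 "- b1" "- b2"] * unfolding A_def B_def norm_uminus by (simp add: algebra_simps)
  qed
qed

text \<open>Here \<open>g = 2 + i\<close> and \<open>\<pi> = 2 + 3i\<close>; divisibility by \<open>2 + 3i\<close> is tested by \<open>i \<mapsto> 8\<close> modulo \<open>13\<close>.\<close>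

lemma scaled_norm_div_2_plus_3i:
  assumes "scaled_norm p (2 * u - 3 * v) (3 * u + 2 * v)" shows "scaled_norm p u v"
proof -
  have main: "scaled_norm p u v" if n: "norm_re a1 a2 b1 b2 = p * (2 * u - 3 * v)" "norm_im a1 a2 b1 b2 = p * (3 * u + 2 * v)"
    and d: "13 dvd (a1 + 8 * a2) + 3 * (b1 + 8 * b2)" for a1 a2 b1 b2
  proof -
    obtain c where "(a1 + 8 * a2) + 3 * (b1 + 8 * b2) = 13 * c" using d by (elim dvdE)
    hence a1: "a1 = 2 * b1 - b2 - 8 * (a2 - 2 * b2 - b1) + 13 * (c - b1 - 3 * b2)" by simp
    define e where "e = c - b1 - 3 * b2"
    define z where "z = a2 - 2 * b2 - b1"
    note a1 = a1[folded e_def z_def]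
    have a2: "a2 = z + 2 * b2 + b1" unfolding z_def by simp
    let ?re = "norm_re (2 * (2 * e - z) - (2 * z - 3 * e) + b1) ((2 * e - z) + 2 * (2 * z - 3 * e) + b2) (2 * e - z) (2 * z - 3 * e)"
    let ?im = "norm_im (2 * (2 * e - z) - (2 * z - 3 * e) + b1) ((2 * e - z) + 2 * (2 * z - 3 * e) + b2) (2 * e - z) (2 * z - 3 * e)"
    have 1: "norm_re a1 a2 b1 b2 = 2 * ?re - 3 * ?im" unfolding a1 a2 by (simp add: nrm_defs)
    have 2: "norm_im a1 a2 b1 b2 = 3 * ?re + 2 * ?im" unfolding a1 a2 by (simp add: nrm_defs)
    have "13 * ?re = 13 * (p * u)" using 1 2 unfolding n by (simp add: algebra_simps)
    moreover have "13 * ?im = 13 * (p * v)" using 1 2 unfolding n by (simp add: algebra_simps)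
    ultimately show ?thesis unfolding scaled_norm_def by (intro exI conjI) simp_all
  qed
  obtain a1 a2 b1 b2 where *: "norm_re a1 a2 b1 b2 = p * (2 * u - 3 * v)" "norm_im a1 a2 b1 b2 = p * (3 * u + 2 * v)"
    using assms unfolding scaled_norm_def by blast
  define A where "A = a1 + 8 * a2"
  define B where "B = b1 + 8 * b2"
  have "A\<^sup>2 - 9 * B\<^sup>2 = norm_re a1 a2 b1 b2 + 8 * norm_im a1 a2 b1 b2 + 65 * (a2\<^sup>2 - 9 * b2\<^sup>2 - 2 * b1 * b2)"
    unfolding A_def B_def by (simp add: nrm_defs)
  hence "(A + 3 * B) * (A - 3 * B) = 13 * (p * (2 * u + v) + 5 * (a2\<^sup>2 - 9 * b2\<^sup>2 - 2 * b1 * b2))"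
    unfolding * by (simp add: power2_eq_square algebra_simps)
  hence "13 dvd (A + 3 * B) * (A - 3 * B)" by simp
  moreover have "prime (13::int)" by simp
  ultimately have "13 dvd A + 3 * B \<or> 13 dvd A - 3 * B" using prime_dvd_mult_iff by blast
  thus ?thesis
  proof
    assume "13 dvd A + 3 * B"
    thus ?thesis using main[OF *] unfolding A_def B_def by blast
  next
    assume "13 dvd A - 3 * B"
    thus ?thesis using main[of a1 a2 "- b1" "- b2"] * unfolding A_def B_def norm_uminus by (simp add: algebra_simps)
  qed
qed

text \<open>Otherwise \<open>A/B\<close> would be a square root of \<open>c\<close> modulo \<open>q\<close>.\<close>

lemma dvd_square_minus_nonresidue:
  fixes A B c q :: int
  assumes q: "prime q" and nr: "\<not> QuadRes q c" and d: "q dvd A\<^sup>2 - c * B\<^sup>2"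
  shows "q dvd A \<and> q dvd B"
proof -
  have B: "q dvd B"
  proof (rule ccontr)
    assume "\<not> q dvd B"
    hence "coprime q B" by (rule prime_imp_coprime[OF q])
    hence "coprime B q" by (rule coprime_commute[THEN iffD1])
    then obtain e where "[B * e = 1] (mod q)" using cong_solve_coprime_int by blast
    hence "q dvd 1 - B * e" by (simp add: cong_iff_dvd_diff dvd_diff_commute)
    moreover have "(A * e)\<^sup>2 - c = (A\<^sup>2 - c * B\<^sup>2) * e\<^sup>2 - c * (1 + B * e) * (1 - B * e)"
      by (simp add: power2_eq_square algebra_simps)
    ultimately have "q dvd (A * e)\<^sup>2 - c" using d by simp
    hence "[(A * e)\<^sup>2 = c] (mod q)" by (simp add: cong_iff_dvd_diff)
    thus False using nr unfolding QuadRes_def by blast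
  qed
  hence "q dvd B\<^sup>2" by (simp add: power2_eq_square)
  hence "q dvd (A\<^sup>2 - c * B\<^sup>2) + c * B\<^sup>2" using d by (intro dvd_add) auto
  hence "q dvd A\<^sup>2" by simp
  thus ?thesis using B q prime_dvd_power by blast
qed

lemma not_QuadRes_small: "\<not> QuadRes 5 (8::int)" "\<not> QuadRes 13 (71::int)" "\<not> QuadRes 3 (-1::int)"
proof -
  have *: "\<not> QuadRes m c" if "\<forall>y\<in>{0..<m}. y\<^sup>2 mod m \<noteq> c mod m" "m > 0" for m c :: int
  proof
    assume "QuadRes m c"
    then obtain y where "y\<^sup>2 mod m = c mod m" unfolding QuadRes_def cong_def by blast
    hence "(y mod m)\<^sup>2 mod m = c mod m" by (simp add: power_mod)
    thus False using that by auto
  qed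
  have "{0..<5::int} = {0,1,2,3,4}" "{0..<13::int} = {0,1,2,3,4,5,6,7,8,9,10,11,12}" "{0..<3::int} = {0,1,2}"
    by (simp_all add: set_eq_iff; presburger)+
  thus "\<not> QuadRes 5 (8::int)" "\<not> QuadRes 13 (71::int)" "\<not> QuadRes 3 (-1::int)"
    by (intro *; simp)+
qed

text \<open>A Gaussian prime modulo which \<open>1 + i\<close> is not a square divides norms \<open>a\<^sup>2 - (1 + i) b\<^sup>2\<close> to an even power.\<close>

lemma scaled_norm_nonresidue:
  assumes r: "scaled_norm p m1 m2" and q: "prime q" and k: "q\<^sup>2 dvd k\<^sup>2 + 1" and nr: "\<not> QuadRes q (1 + k)"
    and m: "q dvd m1 + m2 * k" and p: "prime p" "p \<noteq> q"
  shows "q\<^sup>2 dvd m1 + m2 * k"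
proof -
  obtain a1 a2 b1 b2 where *: "norm_re a1 a2 b1 b2 = p * m1" "norm_im a1 a2 b1 b2 = p * m2"
    using r unfolding scaled_norm_def by blast
  define R where "R = a2\<^sup>2 - (1 + k) * b2\<^sup>2 - 2 * b1 * b2"
  have id: "p * (m1 + m2 * k) = (a1 + a2 * k)\<^sup>2 - (1 + k) * (b1 + b2 * k)\<^sup>2 - (k\<^sup>2 + 1) * R"
    using norm_identity[of a1 a2 b1 b2 k] unfolding * R_def by (simp add: algebra_simps)
  have "q dvd q\<^sup>2" by simp
  hence qk: "q dvd k\<^sup>2 + 1" using k by (rule dvd_trans)
  have "q dvd p * (m1 + m2 * k) + (k\<^sup>2 + 1) * R" by (rule dvd_add[OF dvd_mult[OF m] dvd_mult2[OF qk]])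
  hence "q dvd (a1 + a2 * k)\<^sup>2 - (1 + k) * (b1 + b2 * k)\<^sup>2" unfolding id by simp
  hence "q dvd a1 + a2 * k" "q dvd b1 + b2 * k" using dvd_square_minus_nonresidue[OF q nr] by blast+
  hence sq: "q\<^sup>2 dvd (a1 + a2 * k)\<^sup>2" "q\<^sup>2 dvd (b1 + b2 * k)\<^sup>2" by (simp_all add: dvd_power_same)
  have "q\<^sup>2 dvd p * (m1 + m2 * k)" unfolding id
    by (rule dvd_diff[OF dvd_diff[OF sq(1) dvd_mult[OF sq(2)]] dvd_mult2[OF k]])
  moreover have "coprime (q\<^sup>2) p" using primes_coprime[of q p] q p by (metis coprime_power_left_iff)
  ultimately show ?thesis by (simp add: coprime_dvd_mult_right_iff)
qed

lemma dvd_3_sum_squares: "3 dvd x\<^sup>2 + y\<^sup>2 \<Longrightarrow> 3 dvd x \<and> 3 dvd (y::int)"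
  using dvd_square_minus_nonresidue[of 3 "-1" x y] not_QuadRes_small(3) by simp

text \<open>Absolute norms: \<open>\<bar>a\<^sup>2\<bar>\<^sup>2 - \<bar>(1 + i) b\<^sup>2\<bar>\<^sup>2\<close> as a combination of the two coordinates of the relative norm.\<close>

lemma norm_norm_identity:
  "(a1\<^sup>2 + a2\<^sup>2)\<^sup>2 - 2 * (b1\<^sup>2 + b2\<^sup>2)\<^sup>2 =
    norm_re a1 a2 b1 b2 * (a1\<^sup>2 - a2\<^sup>2 + b1\<^sup>2 - b2\<^sup>2 - 2 * b1 * b2) + norm_im a1 a2 b1 b2 * (2 * a1 * a2 + b1\<^sup>2 - b2\<^sup>2 + 2 * b1 * b2)"
  by (simp add: nrm_defs)

text \<open>The inert prime \<open>3\<close>: here \<open>1 + i\<close> is not a square because its norm \<open>2\<close> is not a square modulo \<open>3\<close>.\<close>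

lemma scaled_norm_three:
  assumes r: "scaled_norm p m1 m2" and m: "3 dvd m1" "3 dvd m2" and p: "prime p" "p \<noteq> 3"
  shows "9 dvd m1 \<and> 9 dvd m2"
proof -
  obtain a1 a2 b1 b2 where *: "norm_re a1 a2 b1 b2 = p * m1" "norm_im a1 a2 b1 b2 = p * m2"
    using r unfolding scaled_norm_def by blast
  have "3 dvd (a1\<^sup>2 + a2\<^sup>2)\<^sup>2 - 2 * (b1\<^sup>2 + b2\<^sup>2)\<^sup>2" unfolding norm_norm_identity *
    by (rule dvd_add[OF dvd_mult2[OF dvd_mult[OF m(1)]] dvd_mult2[OF dvd_mult[OF m(2)]]])
  hence "3 dvd ((a1\<^sup>2 + a2\<^sup>2)\<^sup>2 - 2 * (b1\<^sup>2 + b2\<^sup>2)\<^sup>2) + 3 * (b1\<^sup>2 + b2\<^sup>2)\<^sup>2" by (intro dvd_add) auto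
  hence "3 dvd (a1\<^sup>2 + a2\<^sup>2)\<^sup>2 + (b1\<^sup>2 + b2\<^sup>2)\<^sup>2" by (simp add: add.commute)
  hence "3 dvd a1\<^sup>2 + a2\<^sup>2" "3 dvd b1\<^sup>2 + b2\<^sup>2" using dvd_3_sum_squares by blast+
  hence "3 dvd a1" "3 dvd a2" "3 dvd b1" "3 dvd b2" using dvd_3_sum_squares by blast+
  then obtain x y z w where "a1 = 3 * x" "a2 = 3 * y" "b1 = 3 * z" "b2 = 3 * w" by (elim dvdE)
  hence "norm_re a1 a2 b1 b2 = 9 * norm_re x y z w" "norm_im a1 a2 b1 b2 = 9 * norm_im x y z w"
    by (simp_all add: nrm_defs)
  hence "9 dvd p * m1" "9 dvd p * m2" using * by (metis dvd_triv_left)+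
  moreover have "coprime 3 p" using primes_coprime[OF _ p(1) p(2)[symmetric]] by simp
  hence "coprime 9 p" using coprime_power_left_iff[of 3 2 p] by simp
  ultimately show ?thesis by (simp add: coprime_dvd_mult_right_iff)
qed

lemma square_eq_2_square: "U\<^sup>2 = 2 * V\<^sup>2 \<Longrightarrow> V = (0::int)"
proof (rule ccontr)
  assume *: "U\<^sup>2 = 2 * V\<^sup>2" "V \<noteq> 0"
  hence U: "U \<noteq> 0" by auto
  have "prime_elem (2::int)" by simp
  hence "2 * multiplicity 2 U = 1 + 2 * multiplicity 2 V"
    using arg_cong[OF *(1), of "multiplicity 2"] *(2) U
    by (simp add: prime_elem_multiplicity_power_distrib prime_elem_multiplicity_mult_distrib)
  thus False by presburger
qed

lemma norm_eq_0:
  assumes "norm_re a1 a2 b1 b2 = 0" "norm_im a1 a2 b1 b2 = 0" shows "a1 = 0 \<and> a2 = 0 \<and> b1 = 0 \<and> b2 = 0"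
proof -
  have "(a1\<^sup>2 + a2\<^sup>2)\<^sup>2 = 2 * (b1\<^sup>2 + b2\<^sup>2)\<^sup>2" using norm_norm_identity[of a1 a2 b1 b2] assms by simp
  moreover from square_eq_2_square[OF this] have "b1\<^sup>2 + b2\<^sup>2 = 0" .
  ultimately show ?thesis by (simp add: sum_power2_eq_zero_iff)
qed

text \<open>Up to units, the small \<open>m\<close> are products of \<open>1 + i\<close>, \<open>2 + i\<close> and \<open>2 + 3i\<close>, which can be divided away, or are divisible by
exactly one factor \<open>2 - i\<close>, \<open>3 + 2i\<close> or \<open>3\<close>. The last three are primes modulo which \<open>1 + i\<close> is not a square, so they cannot
divide a norm to the first power; for the two of degree one the test uses the roots \<open>7\<close> and \<open>70\<close> of \<open>-1\<close> modulo
\<open>25\<close> and \<open>169\<close>.\<close>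

lemma scaled_norm_small_imp_one:
  assumes p: "prime p" "p \<noteq> 3" "p \<noteq> 5" "p \<noteq> 13"
    and r: "scaled_norm p m1 m2" "\<bar>m1\<bar> \<le> 2" "\<bar>m2\<bar> \<le> 3" "m1 \<noteq> 0 \<or> m2 \<noteq> 0"
  shows "scaled_norm p 1 0"
proof -
  have rot: "scaled_norm p m1 m2" if "scaled_norm p m2 (- m1)" for m1 m2
    using scaled_norm_rotate[OF scaled_norm_rotate[OF scaled_norm_rotate[OF that]]] by simp
  \<comment> \<open>Each rule below derives the claim for one Gaussian integer from the claim for a quotient of it.\<close>
  define T where "T m1 m2 \<longleftrightarrow> (scaled_norm p m1 m2 \<longrightarrow> scaled_norm p 1 0)" for m1 m2
  have D1: "T x y" if "T u v" "x = v - u" "y = - (u + v)" for u v x y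
    using that scaled_norm_div_1_plus_i unfolding T_def by blast
  have D2: "T x y" if "T u v" "x = v - 2 * u" "y = - (u + 2 * v)" for u v x y
    using that scaled_norm_div_2_plus_i unfolding T_def by blast
  have D3: "T x y" if "T u v" "x = 2 * u - 3 * v" "y = 3 * u + 2 * v" for u v x y
    using that scaled_norm_div_2_plus_3i unfolding T_def by blast
  have R: "T x y" if "T u v" "u = y" "v = - x" for u v x y
    using that scaled_norm_rotate unfolding T_def by blast
  have X5: "T x y" if "5 dvd x + y * 7" "\<not> 25 dvd x + y * 7" for x y
    using scaled_norm_nonresidue[of p x y 5 7] that p not_QuadRes_small unfolding T_def by auto
  have X13: "T x y" if "13 dvd x + y * 70" "\<not> 169 dvd x + y * 70" for x y
    using scaled_norm_nonresidue[of p x y 13 70] that p not_QuadRes_small unfolding T_def by auto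
  have X3: "T x y" if "3 dvd x" "3 dvd y" "\<not> (9 dvd x \<and> 9 dvd y)" for x y
    using scaled_norm_three[of p x y] that p unfolding T_def by auto
  have u: "T 1 0" by (simp add: T_def)
  have i: "T 0 1" by (rule R[OF u]) simp_all
  have m: "T (-1) 0" by (rule R[OF i]) simp_all
  have mi: "T 0 (-1)" by (rule R[OF m]) simp_all
  note units = u m i mi
  have n2: "T 1 1" "T 1 (-1)" "T (-1) 1" "T (-1) (-1)"
    using units[THEN D1] by simp_all
  have n4: "T 2 0" "T (-2) 0" "T 0 2" "T 0 (-2)" using n2[THEN D1] by simp_all
  have n8: "T 2 2" "T 2 (-2)" "T (-2) 2" "T (-2) (-2)" using n4[THEN D1] by simp_all
  have n5: "T (-2) (-1)" "T 2 1" "T 1 (-2)" "T (-1) 2" using units[THEN D2] by simp_all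
  have n10: "T 1 3" "T (-1) (-3)" using n5[THEN D1] by simp_all
  have n13: "T 2 3" "T (-2) (-3)" using units[THEN D3] by simp_all
  have x5: "T 2 (-1)" "T (-2) 1" "T 1 2" "T (-1) (-2)" "T (-1) 3" "T 1 (-3)" by (rule X5; simp)+
  have x13: "T 2 (-3)" "T (-2) 3" by (rule X13; simp)+
  have x3: "T 0 3" "T 0 (-3)" by (rule X3; simp)+
  have "m1 \<in> {-2,-1,0,1,2}" "m2 \<in> {-3,-2,-1,0,1,2,3}" using r(2,3) by auto
  hence "T m1 m2" using r(4) units n2 n4 n8 n5 n10 n13 x5 x13 x3 by auto
  thus ?thesis using r(1) unfolding T_def by blast
qed

lemma quadratic_form_bounds:
  fixes x y P :: int
  assumes "x\<^sup>2 < P" "y\<^sup>2 < P"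
  shows "\<bar>y\<^sup>2 - x\<^sup>2 + 2 * x * y\<bar> < 2 * P" "\<bar>2 * x * y\<bar> < 2 * P"  "\<bar>x\<^sup>2 - y\<^sup>2\<bar> < P"
proof -
  have "0 \<le> (x - y)\<^sup>2" "0 \<le> (x + y)\<^sup>2" "0 \<le> x\<^sup>2" "0 \<le> y\<^sup>2" by simp_all
  hence "2 * x * y \<le> x\<^sup>2 + y\<^sup>2" "- (2 * x * y) \<le> x\<^sup>2 + y\<^sup>2" "0 \<le> x\<^sup>2" "0 \<le> y\<^sup>2"
    by (simp_all add: power2_eq_square algebra_simps)
  thus "\<bar>y\<^sup>2 - x\<^sup>2 + 2 * x * y\<bar> < 2 * P" "\<bar>2 * x * y\<bar> < 2 * P" "\<bar>x\<^sup>2 - y\<^sup>2\<bar> < P"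
    using assms by linarith+
qed

context quartic_field_prime
begin

text \<open>There are more than \<open>p\<^sup>2\<close> quadruples in the box, and \<open>p\<^sup>2\<close> pairs of residues.\<close>

lemma thue_quadruple:
  fixes s s' :: int
  obtains a1 a2 b1 b2 :: int where "a1\<^sup>2 < p" "a2\<^sup>2 < p" "b1\<^sup>2 < p" "b2\<^sup>2 < p"
    "\<not> (a1 = 0 \<and> a2 = 0 \<and> b1 = 0 \<and> b2 = 0)"
    "int p dvd (a1 + a2 * k) - s * (b1 + b2 * k)" "int p dvd (a1 - a2 * k) - s' * (b1 - b2 * k)"
proof -
  obtain l where l: "l \<ge> 0" "l\<^sup>2 \<le> int p" "int p < (l + 1)\<^sup>2" using ex_floor_sqrt by blast
  have "l\<^sup>2 \<noteq> int p" using not_square by simp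
  hence lp: "l\<^sup>2 < int p" using l(2) by simp
  define D where "D = {0..l} \<times> {0..l} \<times> {0..l} \<times> {0..l}"
  define f where "f = (\<lambda>(a1, a2, b1, b2). (((a1 + a2 * k) - s * (b1 + b2 * k)) mod int p,
    ((a1 - a2 * k) - s' * (b1 - b2 * k)) mod int p))"
  have finD: "finite D" unfolding D_def by simp
  have p0: "int p > 0" using gt2 by simp
  have cD: "int (card D) = ((l + 1)\<^sup>2)\<^sup>2" unfolding D_def using l(1)
    by (simp add: card_cartesian_product power2_eq_square algebra_simps)
  have sub: "f ` D \<subseteq> {0..<int p} \<times> {0..<int p}" unfolding f_def using p0 by auto
  have "card (f ` D) \<le> card ({0..<int p} \<times> {0..<int p})" by (rule card_mono[OF _ sub]) simp
  hence "int (card (f ` D)) \<le> (int p)\<^sup>2" by (simp add: card_cartesian_product power2_eq_square flip: of_nat_mult)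
  also have "(int p)\<^sup>2 < ((l + 1)\<^sup>2)\<^sup>2" using l(3) p0 by (intro power_strict_mono) auto
  finally have "card (f ` D) < card D" using cD by simp
  hence "\<not> inj_on f D" using pigeonhole by blast
  then obtain u v where uv: "u \<in> D" "v \<in> D" "u \<noteq> v" "f u = f v" unfolding inj_on_def by blast
  obtain x1 x2 x3 x4 where u: "u = (x1, x2, x3, x4)" by (metis surj_pair)
  obtain y1 y2 y3 y4 where v: "v = (y1, y2, y3, y4)" by (metis surj_pair)
  have bound: "(x - y)\<^sup>2 < int p" if "0 \<le> x" "x \<le> l" "0 \<le> y" "y \<le> l" for x y
  proof -
    have "(x - y)\<^sup>2 \<le> l\<^sup>2" using that by (intro abs_le_square_iff[THEN iffD1]) auto
    thus ?thesis using lp by simp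
  qed
  have b: "(x1 - y1)\<^sup>2 < int p" "(x2 - y2)\<^sup>2 < int p" "(x3 - y3)\<^sup>2 < int p" "(x4 - y4)\<^sup>2 < int p"
    using uv(1,2) unfolding u v D_def by (auto intro!: bound)
  have nz: "\<not> (x1 - y1 = 0 \<and> x2 - y2 = 0 \<and> x3 - y3 = 0 \<and> x4 - y4 = 0)" using uv(3) unfolding u v by auto
  have "int p dvd ((x1 + x2 * k) - s * (x3 + x4 * k)) - ((y1 + y2 * k) - s * (y3 + y4 * k))"
    "int p dvd ((x1 - x2 * k) - s' * (x3 - x4 * k)) - ((y1 - y2 * k) - s' * (y3 - y4 * k))"
    using uv(4) unfolding u v f_def by (simp_all add: mod_eq_dvd_iff)
  hence d: "int p dvd ((x1 - y1) + (x2 - y2) * k) - s * ((x3 - y3) + (x4 - y4) * k)"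
    "int p dvd ((x1 - y1) - (x2 - y2) * k) - s' * ((x3 - y3) - (x4 - y4) * k)"
    by (simp_all add: algebra_simps)
  show ?thesis by (rule that[OF b nz d])
qed

text \<open>The two congruences say that \<open>a - s b\<close> vanishes at both Gaussian primes above \<open>p\<close>, for square roots \<open>s\<close> of \<open>1 + i\<close> there; so
\<open>p\<close> divides the norm of \<open>a + b\<alpha>\<close>, and the size of the box bounds the quotient.\<close>

lemma scaled_norm_one: "scaled_norm p 1 0"
proof -
  obtain s where s: "[s\<^sup>2 = 1 + k] (mod int p)" using residue by (rule Legendre_eq_1D)
  obtain s' where s': "[s'\<^sup>2 = 1 - k] (mod int p)" using residue_conj by (rule Legendre_eq_1D)
  obtain a1 a2 b1 b2 :: int where b: "a1\<^sup>2 < p" "a2\<^sup>2 < p" "b1\<^sup>2 < p" "b2\<^sup>2 < p"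
    and nz: "\<not> (a1 = 0 \<and> a2 = 0 \<and> b1 = 0 \<and> b2 = 0)"
    and d: "int p dvd (a1 + a2 * k) - s * (b1 + b2 * k)" "int p dvd (a1 - a2 * k) - s' * (b1 - b2 * k)"
    by (rule thue_quadruple)
  have root: "int p dvd c\<^sup>2 + 1" if "c = k \<or> c = - k" for c
    using that root_k by (auto simp: cong_iff_dvd_diff)
  have norm: "int p dvd norm_re a1 a2 b1 b2 + norm_im a1 a2 b1 b2 * c"
    if c: "c = k \<or> c = - k" and t: "[t\<^sup>2 = 1 + c] (mod int p)" and dt: "int p dvd (a1 + a2 * c) - t * (b1 + b2 * c)" for c t
  proof -
    have td: "int p dvd t\<^sup>2 - (1 + c)" using t by (simp add: cong_iff_dvd_diff)
    have "norm_re a1 a2 b1 b2 + norm_im a1 a2 b1 b2 * c =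
      ((a1 + a2 * c) - t * (b1 + b2 * c)) * ((a1 + a2 * c) + t * (b1 + b2 * c)) + (t\<^sup>2 - (1 + c)) * (b1 + b2 * c)\<^sup>2
      - (c\<^sup>2 + 1) * (a2\<^sup>2 - (1 + c) * b2\<^sup>2 - 2 * b1 * b2)"
      unfolding norm_identity by (simp add: power2_eq_square algebra_simps)
    thus ?thesis using dvd_diff[OF dvd_add[OF dvd_mult2[OF dt] dvd_mult2[OF td]] dvd_mult2[OF root[OF c]]] by simp
  qed
  have n1: "int p dvd norm_re a1 a2 b1 b2 + norm_im a1 a2 b1 b2 * k" using norm[OF _ s d(1)] by simp
  have n2: "int p dvd norm_re a1 a2 b1 b2 - norm_im a1 a2 b1 b2 * k" using norm[of "- k" s'] s' d(2) by simp
  have p2: "\<not> int p dvd 2" using gt2 zdvd_imp_le by fastforce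
  have "int p dvd 2 * norm_re a1 a2 b1 b2" using dvd_add[OF n1 n2] by simp
  hence re: "int p dvd norm_re a1 a2 b1 b2" using p2 prime_dvd_mult_iff[OF prime_int] by blast
  have "int p dvd 2 * (norm_im a1 a2 b1 b2 * k)" using dvd_diff[OF n1 n2] by (simp add: mult.commute)
  hence "int p dvd norm_im a1 a2 b1 b2 * k" using p2 prime_dvd_mult_iff[OF prime_int] by blast
  moreover have "\<not> int p dvd k"
  proof
    assume "int p dvd k"
    hence "int p dvd k\<^sup>2" by (simp add: power2_eq_square)
    hence "int p dvd (k\<^sup>2 + 1) - k\<^sup>2" using root[of k] by (intro dvd_diff) auto
    thus False using gt2 by auto
  qed
  ultimately have im: "int p dvd norm_im a1 a2 b1 b2" using prime_dvd_mult_iff[OF prime_int] by blast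
  obtain m1 m2 where m: "norm_re a1 a2 b1 b2 = int p * m1" "norm_im a1 a2 b1 b2 = int p * m2" using re im by (elim dvdE)
  have p0: "int p > 0" using gt2 by simp
  have "\<bar>norm_re a1 a2 b1 b2\<bar> < 3 * int p"
    using quadratic_form_bounds(3)[OF b(1,2)] quadratic_form_bounds(1)[OF b(3,4)] unfolding norm_re_def by linarith
  hence "int p * \<bar>m1\<bar> < int p * 3" unfolding m using p0 by (simp add: abs_mult mult.commute)
  hence m1: "\<bar>m1\<bar> \<le> 2" using p0 by simp
  have "\<bar>b2\<^sup>2 - b1\<^sup>2 + 2 * (- b1) * b2\<bar> < 2 * int p" using quadratic_form_bounds(1)[of "- b1" "int p" b2] b(3,4) by simp
  hence "\<bar>norm_im a1 a2 b1 b2\<bar> < 4 * int p"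
    using quadratic_form_bounds(2)[OF b(1,2)] unfolding norm_im_def by linarith
  hence "int p * \<bar>m2\<bar> < int p * 4" unfolding m using p0 by (simp add: abs_mult mult.commute)
  hence m2: "\<bar>m2\<bar> \<le> 3" using p0 by simp
  have "m1 \<noteq> 0 \<or> m2 \<noteq> 0" using norm_eq_0 nz m by (metis mult_zero_right)
  moreover have "scaled_norm p m1 m2" unfolding scaled_norm_def using m by blast
  moreover have "int p \<noteq> 3" "int p \<noteq> 5" "int p \<noteq> 13" using mod8 by auto
  ultimately show ?thesis using scaled_norm_small_imp_one[OF prime_int] m1 m2 by blast
qed

lemma ex_admissible: "\<exists>\<delta> P. admissible \<alpha> p \<delta> P"
proof -
  obtain a1 a2 b1 b2 where "norm_re a1 a2 b1 b2 = int p * 1" "norm_im a1 a2 b1 b2 = int p * 0"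
    using scaled_norm_one unfolding scaled_norm_def by blast
  thus ?thesis using ex_admissible_prime unfolding norm_re_def norm_im_def by (metis mult.right_neutral mult_zero_right)
qed

end

section \<open>The classification\<close>

context prime_1_mod_4
begin

lemma h_minus_4_eq: "h_minus_4 p = Coset.order G"
  unfolding h_minus_4_def generate_ring_A[unfolded om_def] ..

end

theorem theoremA:
  fixes \<alpha> :: complex and r :: "nat \<Rightarrow> int"
  assumes "\<alpha> ^ 4 - 2 * \<alpha>\<^sup>2 + 2 = 0"
    and "\<And>p. prime p \<Longrightarrow> [p = 1] (mod 8) \<Longrightarrow> [(r p)\<^sup>2 = - 1] (mod int p)"
  shows "(\<forall>p. prime p \<and> [p = 1] (mod 8) \<and> Legendre (1 + r p) (int p) = 1 \<longrightarrow>
            (\<exists>\<delta> P. admissible \<alpha> p \<delta> P)) \<and>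
         (\<forall>\<delta> P. (\<forall>p. prime p \<and> [p = 1] (mod 8) \<and> Legendre (1 + r p) (int p) = 1 \<longrightarrow>
                   admissible \<alpha> p (\<delta> p) (P p)) \<longrightarrow>
            V4 = {p. prime p \<and> [p = 1] (mod 8) \<and> Legendre (1 + r p) (int p) = 1 \<and>
                     quadratic_character (ring_of_integers (K1 \<alpha>)) (\<alpha> * \<delta> p) (P p) = 1})"
proof -
  have qfp: "quartic_field_prime \<alpha> p (r p)"
    if p: "prime p" "[p = 1] (mod 8)" "Legendre (1 + r p) (int p) = 1" for p
  proof -
    have m8: "p mod 8 = 1" using p(2) by (simp add: cong_def)
    hence "p mod 4 = 1" by presburger
    moreover have "p > 2" using m8 prime_gt_1_nat[OF p(1)] by (cases "p = 2") auto
    ultimately show ?thesis using p m8 assms by unfold_locales auto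
  qed
  show ?thesis
  proof (intro conjI allI impI)
    fix p assume "prime p \<and> [p = 1] (mod 8) \<and> Legendre (1 + r p) (int p) = 1"
    then interpret quartic_field_prime \<alpha> p "r p" using qfp by blast
    show "\<exists>\<delta> P. admissible \<alpha> p \<delta> P" by (rule ex_admissible)
  next
    fix \<delta> :: "nat \<Rightarrow> complex" and P :: "nat \<Rightarrow> complex set"
    assume adm: "\<forall>p. prime p \<and> [p = 1] (mod 8) \<and> Legendre (1 + r p) (int p) = 1 \<longrightarrow> admissible \<alpha> p (\<delta> p) (P p)"
    have split: "[p = 1] (mod 8) \<and> Legendre (1 + r p) (int p) = 1"
      if p: "prime p" "[p = 1] (mod 4)" "16 dvd h_minus_4 p" for p
    proof -
      have m4: "p mod 4 = 1" using p(2) by (simp add: cong_def)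
      hence "p > 2" using prime_gt_1_nat[OF p(1)] by (cases "p = 2") auto
      then interpret prime_1_mod_4 p using p(1) m4 by unfold_locales auto
      have h: "16 dvd Coset.order G" using p(3) by (simp only: h_minus_4_eq)
      have m8: "[p = 1] (mod 8)" using eighth_power_imp_residues(1)[OF h] by (simp add: cong_def)
      show ?thesis using eighth_power_imp_residues(2)[OF h assms(2)[OF p(1) m8]] m8 by simp
    qed
    have iff: "16 dvd h_minus_4 p \<longleftrightarrow> quadratic_character (ring_of_integers (K1 \<alpha>)) (\<alpha> * \<delta> p) (P p) = 1"
      if p: "prime p" "[p = 1] (mod 8)" "Legendre (1 + r p) (int p) = 1" for p
    proof -
      interpret quartic_field_prime \<alpha> p "r p" using qfp p by blast
      have "admissible \<alpha> p (\<delta> p) (P p)" using adm p by blast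
      then obtain k a1 a2 b1 b2 where k: "[k\<^sup>2 = -1] (mod int p)" "Legendre (1 + k) p = 1"
        and eqs: "a1\<^sup>2 - a2\<^sup>2 - b1\<^sup>2 + b2\<^sup>2 + 2 * b1 * b2 = int p" "2 * a1 * a2 - b1\<^sup>2 + b2\<^sup>2 - 2 * b1 * b2 = 0"
        and qc: "quadratic_character (ring_of_integers (K1 \<alpha>)) (\<alpha> * \<delta> p) (P p) = 1 \<longleftrightarrow> Legendre (b1 + b2 * k) p = 1"
        by (rule admissible_criterion)
      show ?thesis unfolding h_minus_4_eq qc by (rule sixteen_dvd_iff_Legendre[OF mod8 k(2,1) eqs])
    qed
    have mod4: "[p = 1] (mod 4)" if "[p = 1] (mod 8)" for p :: nat
      using that unfolding cong_def by presburger
    show "V4 = {p. prime p \<and> [p = 1] (mod 8) \<and> Legendre (1 + r p) (int p) = 1 \<and>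
                     quadratic_character (ring_of_integers (K1 \<alpha>)) (\<alpha> * \<delta> p) (P p) = 1}"
      unfolding V4_def using split iff mod4 by blast
  qed
qed

end
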